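(* Let $(\beta_p)_{p\ge 2}$ be real numbers with $\sum_{p\ge2}2^p\beta_p^2<\infty$, and let $\xi(u)=\sum_{p\ge 2}\beta_p^2u^p$. Suppose that $\frac1{\sqrt2}<\beta_2\le\frac{3}{2\sqrt2}$ and $$\frac{\xi'''(1)}6+\frac23\sqrt{\xi''(1)}\le1.$$ Let $\mu_P$ be a Parisi measure for $\xi$ (a minimizer over $M[0,1]$ of the Parisi functional $\mathcal P$), and let $q_M=\max\operatorname{supp}\mu_P$. Then $\mu_P$ has a jump discontinuity at $q_M$, i.e. $\mu_P(\{q_M\})>0$.
   Context: $M[0,1]$ is the set of Borel probability measures on $[0,1]$ with the metric $d(\mu,\mu')=\int_0^1|\mu([0,u])-\mu'([0,u])|\,du$; $M_d[0,1]\subset M[0,1]$ is the subset of measures with finitely many atoms (and nothing else). Parisi PDE solution. For $\mu\in M_d[0,1]$ with atoms $0\le q_1<\dots<q_{k+1}\le 1$ ($k\ge0$), put $m_p=\mu([0,q_p])$ for $1\le p\le k+1$, $m_0=0$, $q_0=0$, $q_{k+2}=1$. Define $\Phi_\mu:\mathbb R\times[0,1]\to\mathbb R$ by $\Phi_\mu(x,u)=\log\cosh x+\frac12(\xi'(1)-\xi'(u))$ for $q_{k+1}\le u\le1$ and recursively, for $p=k,k-1,\dots,0$ and $q_p\le u<q_{p+1}$, $$\Phi_\mu(x,u)=\frac1{m_p}\log\mathbb E\exp m_p\Phi_\mu\big(x+z\sqrt{\xi'(q_{p+1})-\xi'(u)},\,q_{p+1}\big),$$ $z$ a standard Gaussian,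 where for $m_p=0$ the right side means $\mathbb E\,\Phi_\mu(x+z\sqrt{\xi'(q_{p+1})-\xi'(u)},q_{p+1})$. (This solves $\partial_u\Phi_\mu=-\frac{\xi''(u)}2(\partial_x^2\Phi_\mu+\mu([0,u])(\partial_x\Phi_\mu)^2)$ with $\Phi_\mu(x,1)=\log\cosh x$.) The map $\mu\mapsto\Phi_\mu$ is known to be Lipschitz from $(M_d[0,1],d)$ to $C(\mathbb R\times[0,1])$ with the uniform distance, and $\Phi_\mu$ for general $\mu\in M[0,1]$ is defined by continuous extension. Parisi functional: $\mathcal P(\mu)=\Phi_\mu(0,0)-\frac12\int_0^1u\,\xi''(u)\,\mu([0,u])\,du$ for $\mu\in M[0,1]$. A Parisi measure is any minimizer of $\mathcal P$ on $M[0,1]$. *)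

theory Defs
  imports "HOL-Probability.Probability"
begin

text \<open>Throughout, elements of \<open>M[0,1]\<close> are measures whose space is the interval \<open>{0..1}\<close>
  itself, so \<open>measure \<mu> {0..u}\<close> is only meaningful for \<open>u \<le> 1\<close>.\<close>

definition prob_measures01 :: "real measure set" where
  "prob_measures01 = {\<mu>. prob_space \<mu> \<and> sets \<mu> = sets (restrict_space borel {0..1})}"

definition atoms :: "real measure \<Rightarrow> real set" where
  "atoms \<mu> = {q. measure \<mu> {q} > 0}"

definition discrete_measures01 :: "real measure set" where
  "discrete_measures01 =
     {\<mu> \<in> prob_measures01. finite (atoms \<mu>) \<and> measure \<mu> (atoms \<mu>) = 1}"

definition cdf_dist :: "real measure \<Rightarrow> real measure \<Rightarrow> real" where
  "cdf_dist \<mu> \<nu> = (LINT u:{0..1}|lborel. \<bar>measure \<mu> {0..u} - measure \<nu> {0..u}\<bar>)"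

definition gauss_step :: "real \<Rightarrow> real \<Rightarrow> (real \<Rightarrow> real) \<Rightarrow> real \<Rightarrow> real" where
  "gauss_step m v f x =
     (if m = 0 then (LINT z|std_normal_distribution. f (x + z * sqrt v))
      else 1 / m * ln (LINT z|std_normal_distribution. exp (m * f (x + z * sqrt v))))"

text \<open>\<open>Phi_above \<xi> \<mu> m qs x u\<close> is the value \<open>\<Phi>\<^sub>\<mu>(x,u)\<close> for \<open>u \<ge> q\<^sub>p\<close>, where
  \<open>qs = [q\<^bsub>p+1\<^esub>, \<dots>, q\<^bsub>k+1\<^esub>]\<close> lists in increasing order the atoms of \<open>\<mu>\<close> that lie strictly above
  \<open>q\<^sub>p\<close>, and \<open>m = m\<^sub>p\<close>. If \<open>u < q\<^bsub>p+1\<^esub>\<close>, one backward Gaussian step from \<open>q\<^bsub>p+1\<^esub>\<close> is taken;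
  otherwise the index is raised to \<open>p + 1\<close>, with \<open>m\<^bsub>p+1\<^esub> = \<mu>([0,q\<^bsub>p+1\<^esub>])\<close>. The recursion starts
  with \<open>p = 0\<close>, \<open>m\<^sub>0 = 0\<close> and the list of all atoms (if \<open>q\<^sub>1 = 0\<close>, the range of \<open>p = 0\<close> is empty).\<close>

fun Phi_above ::
  "(real \<Rightarrow> real) \<Rightarrow> real measure \<Rightarrow> real \<Rightarrow> real list \<Rightarrow> real \<Rightarrow> real \<Rightarrow> real" where
  "Phi_above \<xi> \<mu> m [] x u = ln (cosh x) + (deriv \<xi> 1 - deriv \<xi> u) / 2"
| "Phi_above \<xi> \<mu> m (q # qs) x u =
     (if u < q
      then gauss_step m (deriv \<xi> q - deriv \<xi> u) (\<lambda>y. Phi_above \<xi> \<mu> (measure \<mu> {0..q}) qs y q) x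
      else Phi_above \<xi> \<mu> (measure \<mu> {0..q}) qs x u)"

definition Phi_discrete :: "(real \<Rightarrow> real) \<Rightarrow> real measure \<Rightarrow> real \<Rightarrow> real \<Rightarrow> real" where
  "Phi_discrete \<xi> \<mu> x u = Phi_above \<xi> \<mu> 0 (sorted_list_of_set (atoms \<mu>)) x u"

text \<open>Continuous extension from \<^const>\<open>discrete_measures01\<close>: the limit of \<open>\<Phi>\<^sub>\<nu>(x,u)\<close> as
  \<open>\<nu>\<close> tends to \<open>\<mu>\<close> in \<^const>\<open>cdf_dist\<close> through discrete measures. The neighbourhoods of \<open>\<mu>\<close> are
  not punctured.\<close>

definition Phi :: "(real \<Rightarrow> real) \<Rightarrow> real measure \<Rightarrow> real \<Rightarrow> real \<Rightarrow> real" where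
  "Phi \<xi> \<mu> x u =
     Lim (inf (filtercomap (\<lambda>\<nu>. cdf_dist \<nu> \<mu>) (nhds 0)) (principal discrete_measures01))
       (\<lambda>\<nu>. Phi_discrete \<xi> \<nu> x u)"

definition parisi_functional :: "(real \<Rightarrow> real) \<Rightarrow> real measure \<Rightarrow> real" where
  "parisi_functional \<xi> \<mu> =
     Phi \<xi> \<mu> 0 0 - 1 / 2 * (LINT u:{0..1}|lborel. u * (deriv ^^ 2) \<xi> u * measure \<mu> {0..u})"

definition parisi_measure :: "(real \<Rightarrow> real) \<Rightarrow> real measure \<Rightarrow> bool" where
  "parisi_measure \<xi> \<mu> \<longleftrightarrow> is_arg_min (parisi_functional \<xi>) (\<lambda>\<nu>. \<nu> \<in> prob_measures01) \<mu>"

definition measure_support :: "real measure \<Rightarrow> real set" where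
  "measure_support \<mu> = {x \<in> space \<mu>. \<forall>U. open U \<and> x \<in> U \<longrightarrow> measure \<mu> (U \<inter> space \<mu>) > 0}"

text \<open>The sum over \<open>p \<ge> 2\<close>, reindexed to start at \<open>0\<close>.\<close>

definition mixture :: "(nat \<Rightarrow> real) \<Rightarrow> real \<Rightarrow> real" where
  "mixture \<beta> u = (\<Sum>p. (\<beta> (p + 2))\<^sup>2 * u ^ (p + 2))"

end

theory Submission
  imports Defs
begin

text \<open>Suppose that \<open>\<mu>\<close> had no atom at \<open>q = q\<^sub>M\<close>. Then \<open>1 - \<mu>([0,u])\<close> is positive for \<open>u < q\<close> and tends to \<open>0\<close> as
  \<open>u\<close> increases to \<open>q\<close>, so the distribution function can be perturbed just below \<open>q\<close> in both directions.
  The first variation of the Parisi functional is governed by \<open>\<Gamma>(u) - u\<close>, where \<open>\<Gamma>(u)\<close> is the Gibbs average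
  of the squared slope of \<open>\<Phi>\<^sub>\<mu>(\<cdot>,u)\<close>; by minimality it can be neither eventually positive nor eventually
  negative to the left of \<open>q\<close>. Near \<open>q\<close> the slope is close to \<open>tanh\<close>, and with \<open>T = \<xi>'(q) - \<xi>'(u)\<close> one finds
  \<open>\<Gamma>(u) = A - B T + (4 B - 6 C) T\<^sup>2 / 2 + o(T\<^sup>2)\<close>, where \<open>A\<close>, \<open>B\<close>, \<open>C\<close> are the averages of \<open>tanh\<^sup>2\<close>,
  \<open>sech\<^sup>4\<close>, \<open>sech\<^sup>6\<close> at \<open>q\<close>. Hence \<open>A = q\<close> and \<open>B = 1 / \<xi>''(q)\<close>, and the second-order condition is incompatible with the
  inequality \<open>3 r B \<le> 2 C + r\<^sup>3\<close> (the mean of \<open>(y - r)\<^sup>2 (2 y + r) \<ge> 0\<close>) at \<open>r = 1 / sqrt (\<xi>''(q))\<close> and the hypothesis on \<open>\<xi>\<close>.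
  All of this is done for the backward recursion on the uniform grid with \<open>N\<close> nodes, with errors
  uniform in \<open>N\<close>; only the three averages pass to the limit, by compactness, so that neither the Parisi
  PDE nor a stochastic differential equation is needed.\<close>

section \<open>Gaussian integrals\<close>

text \<open>The step with parameter 1 is exactly solvable: it maps \<open>ln (cosh x)\<close> to
  itself plus a constant, so \<open>tanh\<close> is fixed by its tilted average. Above
  \<open>q\<close> the parameter is 1, and just below it is at least \<open>1 - \<eta>\<close> with
  \<open>\<eta>\<close> small when \<open>q\<close> carries no atom. At clock distance
  \<open>\<tau>\<close> below the top the slope therefore differs from \<open>tanh\<close> by
  \<open>O(\<eta> * \<tau>)\<close> and not merely by \<open>O(\<eta>)\<close>. This extra factor
  brings the error in the expansion of \<open>\<Gamma>\<close> down to \<open>o(\<tau>^2)\<close>.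
  The slope is a martingale for the tilted averages, so an increment of \<open>\<Gamma>\<close> is
  an averaged conditional variance; this produces \<open>B\<close>, and the drift of
  \<open>sech^4\<close> along the chain produces \<open>4 * B - 6 * C\<close>. In the first
  variation an upper bound for the perturbed value suffices, since minimality supplies the lower
  one. It comes from Jensen's inequality for the exponential of the deviation, which is linear in
  averages of the unperturbed chain. The perturbation has size \<open>\<epsilon>\<close> with
  \<open>\<epsilon>^4 = K / N\<close>: the gain is linear in \<open>\<epsilon>\<close>, while the
  quadratic error and the mesh error are both of order \<open>\<epsilon>^2\<close>.\<close>

lemma prob_space_std_normal: "prob_space std_normal_distribution"
  by (rule prob_space_normal_density) simp

interpretation std_normal: prob_space std_normal_distribution
  by (rule prob_space_std_normal)

text \<open>Completing the square turns the exponential weight into \<open>exp (t^2 / 2)\<close>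
  times the normal density with mean \<open>t\<close>.\<close>

lemma has_bochner_integral_std_normal_exp:
  "has_bochner_integral std_normal_distribution (\<lambda>z. exp (t * z)) (exp (t\<^sup>2 / 2))"
proof -
  have eq: "std_normal_density z *\<^sub>R exp (t * z) = exp (t\<^sup>2 / 2) * normal_density t 1 z" for z
    by (simp add: normal_density_def mult_exp_exp power2_eq_square field_simps flip: exp_add)
  have "has_bochner_integral lborel (\<lambda>z. exp (t\<^sup>2 / 2) * normal_density t 1 z) (exp (t\<^sup>2 / 2) * 1)"
    by (intro has_bochner_integral_mult_right)
      (auto simp: has_bochner_integral_iff)
  then have "has_bochner_integral lborel (\<lambda>z. std_normal_density z *\<^sub>R exp (t * z)) (exp (t\<^sup>2 / 2))"
    by (simp only: eq mult_1_right)
  then show ?thesis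
    by (intro has_bochner_integral_density) auto
qed

lemma integrable_std_normal_exp_abs [simp]:
  "integrable std_normal_distribution (\<lambda>z. exp (c * \<bar>z\<bar>))"
proof (rule Bochner_Integration.integrable_bound)
  show "integrable std_normal_distribution (\<lambda>z. exp (c * z) + exp ((-c) * z))"
    by (intro Bochner_Integration.integrable_add integrable.intros[OF has_bochner_integral_std_normal_exp])
  have "exp (c * \<bar>z\<bar>) \<le> exp (c * z) + exp ((-c) * z)" for z :: real
    by (simp add: abs_if)
  then show "AE z in std_normal_distribution. norm (exp (c * \<bar>z\<bar>)) \<le> norm (exp (c * z) + exp ((-c) * z))"
    by (intro AE_I2) (simp add: add_nonneg_nonneg)
qed auto

lemma integrable_std_normal_exp_bound:
  fixes g :: "real \<Rightarrow> real"
  assumes "g \<in> borel_measurable borel" "\<And>z. \<bar>g z\<bar> \<le> A * exp (c * \<bar>z\<bar>)"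
  shows "integrable std_normal_distribution g"
proof (rule Bochner_Integration.integrable_bound)
  show "integrable std_normal_distribution (\<lambda>z. A * exp (c * \<bar>z\<bar>))"
    by simp
  have "\<bar>g z\<bar> \<le> \<bar>A * exp (c * \<bar>z\<bar>)\<bar>" for z
    using assms(2)[of z] by linarith
  then show "AE z in std_normal_distribution. norm (g z) \<le> norm (A * exp (c * \<bar>z\<bar>))"
    by simp
qed (use assms in simp)

text \<open>The universal constants of the development. Integrands are bounded by
  \<open>A * exp (c * \<bar>z\<bar>)\<close> with all dependence on functions, base points and step
  sizes in \<open>A\<close>, so errors stay uniform.\<close>

definition gauss_abs_mgf :: "real \<Rightarrow> real" where
  "gauss_abs_mgf c = (LINT z|std_normal_distribution. exp (c * \<bar>z\<bar>))"

lemma gauss_abs_mgf_ge_1: "0 \<le> c \<Longrightarrow> 1 \<le> gauss_abs_mgf c"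
  unfolding gauss_abs_mgf_def
  by (subst std_normal.prob_space[symmetric], intro integral_mono[where f="\<lambda>_. 1", simplified])
    (auto simp: std_normal.prob_space)

lemma std_normal_integral_bound:
  assumes "\<And>z. \<bar>g z\<bar> \<le> A * exp (c * \<bar>z\<bar>)"
  shows "\<bar>LINT z|std_normal_distribution. g z\<bar> \<le> A * gauss_abs_mgf c"
proof -
  have "0 \<le> A"
    using assms[of 0] by simp
  have "\<bar>LINT z|std_normal_distribution. g z\<bar> \<le> (LINT z|std_normal_distribution. A * exp (c * \<bar>z\<bar>))"
  proof (cases "integrable std_normal_distribution g")
    case True
    then have "\<bar>LINT z|std_normal_distribution. g z\<bar> \<le> (LINT z|std_normal_distribution. \<bar>g z\<bar>)"
      using integral_norm_bound[of std_normal_distribution g] by simp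
    also have "\<dots> \<le> (LINT z|std_normal_distribution. A * exp (c * \<bar>z\<bar>))"
      by (rule integral_mono) (use True assms in auto)
    finally show ?thesis .
  next
    \<comment> \<open>A non-integrable \<open>g\<close> has integral 0 by convention.\<close>
    case False
    then show ?thesis
      using \<open>0 \<le> A\<close> by (auto simp: not_integrable_integral_eq intro!: Bochner_Integration.integral_nonneg)
  qed
  then show ?thesis
    by (simp add: gauss_abs_mgf_def)
qed

lemma power_le_fact_exp: "0 \<le> (x::real) \<Longrightarrow> x ^ n \<le> fact n * exp x"
proof -
  assume x: "0 \<le> x"
  have "(\<Sum>k\<in>{n}. x ^ k /\<^sub>R fact k) \<le> (\<Sum>k. x ^ k /\<^sub>R fact k)"
    by (intro sum_le_suminf summable_exp_generic) (use x in auto)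
  then have "x ^ n / fact n \<le> exp x"
    by (simp add: exp_def divide_inverse mult.commute)
  then show ?thesis
    by (simp add: field_simps)
qed

lemma std_normal_integral_id: "(LINT z|std_normal_distribution. z) = 0"
  using integral_std_normal_distribution_moment_odd[of 1] by simp

lemma std_normal_integral_square: "(LINT z|std_normal_distribution. z\<^sup>2) = 1"
  using std_normal_distribution_even_moments(1)[of 1] by simp

lemma std_normal_integrable_id: "integrable std_normal_distribution (\<lambda>z. z)"
  using integrable_std_normal_distribution_moment[of 1] by simp

lemma std_normal_integrable_square: "integrable std_normal_distribution (\<lambda>z. z\<^sup>2)"
  by (rule integrable_std_normal_distribution_moment)

lemma distr_std_normal_scale:
  assumes "0 < a"
  shows "distr std_normal_distribution borel (\<lambda>z. a * z) = density lborel (normal_density 0 a)"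
proof -
  have "distributed std_normal_distribution lborel (\<lambda>z. z) std_normal_density"
    by (auto simp: distributed_def intro!: distr_id2)
  from std_normal.normal_density_affine[OF this, of a 0] assms
  have "distributed std_normal_distribution lborel (\<lambda>z. a * z) (normal_density 0 a)"
    by simp
  then show ?thesis
    by (subst distributed_distr_eq_density[symmetric]) (auto intro!: distr_cong)
qed

text \<open>Variances of independent centred normals add. The exponential bound provides
  integrability on the product for Fubini; the semigroup law of Gaussian steps rests on
  this.\<close>

lemma std_normal_convolution:
  fixes h :: "real \<Rightarrow> real"
  assumes [measurable]: "h \<in> borel_measurable borel"
    and bound: "\<And>y. \<bar>h y\<bar> \<le> A * exp (c * \<bar>y\<bar>)" "0 \<le> c" and ab: "0 < a" "0 < b"
  shows "(LINT z|std_normal_distribution. LINT w|std_normal_distribution. h (a * z + b * w))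
    = (LINT z|std_normal_distribution. h (sqrt (a\<^sup>2 + b\<^sup>2) * z))"
proof -
  let ?n = "\<lambda>a. density lborel (normal_density 0 a)"
  let ?s = "sqrt (a\<^sup>2 + b\<^sup>2)"
  have s: "0 < ?s"
    using ab by (simp add: pos_add_strict)
  interpret A: prob_space "?n a" by (rule prob_space_normal_density) fact
  interpret B: prob_space "?n b" by (rule prob_space_normal_density) fact
  interpret AB: pair_prob_space "?n a" "?n b" ..
  have scale: "(LINT z|std_normal_distribution. f (t * z)) = (LINT z|?n t. f z)"
    if "0 < t" "f \<in> borel_measurable borel" for t and f :: "real \<Rightarrow> real"
    using that by (subst distr_std_normal_scale[symmetric]) (auto simp: integral_distr)
  have int: "integrable (?n t) (\<lambda>z. exp (c * \<bar>z\<bar>))" if "0 < t" for t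
  proof -
    have "integrable (distr std_normal_distribution borel (\<lambda>z. t * z)) (\<lambda>z. exp (c * \<bar>z\<bar>))"
      using integrable_std_normal_exp_abs[of "c * t"] that
      by (subst integrable_distr_eq) (auto simp: abs_mult mult.assoc)
    then show ?thesis
      by (simp add: distr_std_normal_scale[OF that])
  qed
  have conv: "convolution (?n a) (?n b) = ?n ?s"
  proof -
    have "convolution (?n a) (?n b) = density lborel (\<lambda>x. (\<integral>\<^sup>+y. ennreal (normal_density 0 a (x - y)) * ennreal (normal_density 0 b y) \<partial>lborel))"
      by (rule convolution_density) (auto intro: A.finite_measure B.finite_measure)
    also have "(\<lambda>x. (\<integral>\<^sup>+y. ennreal (normal_density 0 a (x - y)) * ennreal (normal_density 0 b y) \<partial>lborel)) = normal_density 0 ?s"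
      using conv_normal_density_zero_mean[OF ab] by (simp add: ennreal_mult'')
    finally show ?thesis .
  qed
  have meas [measurable]: "(\<lambda>(x, y). h (x + y)) \<in> borel_measurable (?n a \<Otimes>\<^sub>M ?n b)"
    by measurable
  have int2: "integrable (?n a \<Otimes>\<^sub>M ?n b) (\<lambda>(x, y). h (x + y))"
  proof (rule Bochner_Integration.integrable_bound)
    show "integrable (?n a \<Otimes>\<^sub>M ?n b) (\<lambda>(x, y). A * (exp (c * \<bar>x\<bar>) * exp (c * \<bar>y\<bar>)))"
    proof -
      have "integrable (?n a \<Otimes>\<^sub>M ?n b) (\<lambda>(x, y). exp (c * \<bar>x\<bar>) * exp (c * \<bar>y\<bar>))"
        by (rule AB.Fubini_integrable) (auto intro!: integrable_mult_left int ab simp: abs_mult)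
      then show ?thesis
        by (simp add: case_prod_unfold)
    qed
    have "0 \<le> A"
      using bound(1)[of 0] by simp
    have "\<bar>h (x + y)\<bar> \<le> A * (exp (c * \<bar>x\<bar>) * exp (c * \<bar>y\<bar>))" for x y
    proof -
      have "\<bar>h (x + y)\<bar> \<le> A * exp (c * \<bar>x + y\<bar>)"
        by (rule bound)
      also have "\<dots> \<le> A * exp (c * (\<bar>x\<bar> + \<bar>y\<bar>))"
        using \<open>0 \<le> A\<close> \<open>0 \<le> c\<close> by (intro mult_left_mono) (auto intro!: mult_left_mono)
      finally show ?thesis
        by (simp add: exp_add algebra_simps)
    qed
    then show "AE x in ?n a \<Otimes>\<^sub>M ?n b. norm (case x of (x, y) \<Rightarrow> h (x + y))
        \<le> norm (case x of (x, y) \<Rightarrow> A * (exp (c * \<bar>x\<bar>) * exp (c * \<bar>y\<bar>)))"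
      by (auto simp: abs_mult intro!: AE_I2 order_trans[OF _ abs_ge_self])
  qed fact
  have "(LINT z|std_normal_distribution. LINT w|std_normal_distribution. h (a * z + b * w))
    = (LINT z|std_normal_distribution. LINT y|?n b. h (a * z + y))"
    by (subst scale[OF ab(2)]) auto
  also have "\<dots> = (LINT x|?n a. LINT y|?n b. h (x + y))"
    by (rule scale[OF ab(1)]) measurable
  also have "\<dots> = (LINT x|(?n a \<Otimes>\<^sub>M ?n b). (\<lambda>(x, y). h (x + y)) x)"
    using AB.integral_fst'[OF int2] by simp
  also have "\<dots> = (LINT x|(convolution (?n a) (?n b)). h x)"
    unfolding convolution_def by (subst integral_distr) (auto simp: case_prod_unfold)
  also have "\<dots> = (LINT z|std_normal_distribution. h (?s * z))"
    unfolding conv by (rule scale[OF s, symmetric]) measurable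
  finally show ?thesis .
qed

section \<open>Gaussian steps of Lipschitz functions\<close>

lemma std_normal_prob_UNIV [simp]: "measure std_normal_distribution UNIV = 1"
  using std_normal.prob_space by simp

lemma abs_le_exp_abs: "\<bar>z\<bar> \<le> exp \<bar>z::real\<bar>"
  using exp_ge_add_one_self[of "\<bar>z\<bar>"] by linarith

text \<open>The class in which the recursion lives: \<open>ln (cosh x)\<close> belongs to it,
  Gaussian steps preserve it, and it yields exponential moments with constants that do not
  deteriorate along the recursion.\<close>

definition lip1 :: "(real \<Rightarrow> real) \<Rightarrow> bool" where
  "lip1 f \<longleftrightarrow> (\<forall>x y. \<bar>f x - f y\<bar> \<le> \<bar>x - y\<bar>)"

lemma lip1D: "lip1 f \<Longrightarrow> \<bar>f x - f y\<bar> \<le> \<bar>x - y\<bar>"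
  by (simp add: lip1_def)

lemma lip1_add_const: "lip1 f \<Longrightarrow> lip1 (\<lambda>y. f y + c)"
  by (simp add: lip1_def)

lemma lip1_shift: "lip1 f \<Longrightarrow> lip1 (\<lambda>y. f (y + c))"
  unfolding lip1_def by (smt (verit))

lemma lip1_continuous: "lip1 f \<Longrightarrow> continuous_on UNIV f"
  unfolding continuous_on_iff dist_real_def by (metis lip1D order_le_less_trans)

lemma lip1_measurable: "lip1 f \<Longrightarrow> f \<in> borel_measurable borel"
  by (intro borel_measurable_continuous_onI lip1_continuous)

lemma lip1_bound: "lip1 f \<Longrightarrow> \<bar>f y\<bar> \<le> \<bar>f x\<bar> + \<bar>y - x\<bar>"
  using lip1D[of f y x] by linarith

lemma lip1_of_deriv:
  assumes "\<And>x. (f has_real_derivative f' x) (at x)" "\<And>x. \<bar>f' x\<bar> \<le> 1"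
  shows "lip1 f"
proof -
  have "norm (f x - f y) \<le> 1 * norm (x - y)" for x y
    by (rule field_differentiable_bound[of UNIV f f']) (use assms in auto)
  then show ?thesis
    by (simp add: lip1_def)
qed

lemma lip1_integrable:
  assumes "lip1 f"
  shows "integrable std_normal_distribution (\<lambda>z. f (x + z * s))"
proof (rule integrable_std_normal_exp_bound)
  show "(\<lambda>z. f (x + z * s)) \<in> borel_measurable borel"
    using lip1_measurable[OF assms] by measurable
  fix z :: real
  have "\<bar>f (x + z * s)\<bar> \<le> \<bar>f x\<bar> + \<bar>s\<bar> * \<bar>z\<bar>"
    using lip1_bound[OF assms, of "x + z * s" x] by (simp add: abs_mult mult.commute)
  also have "\<dots> \<le> \<bar>f x\<bar> * exp \<bar>z\<bar> + \<bar>s\<bar> * exp \<bar>z\<bar>"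
    using abs_le_exp_abs[of z] mult_left_mono[of 1 "exp \<bar>z\<bar>" "\<bar>f x\<bar>"]
    by (intro add_mono mult_left_mono) auto
  finally show "\<bar>f (x + z * s)\<bar> \<le> (\<bar>f x\<bar> + \<bar>s\<bar>) * exp (1 * \<bar>z\<bar>)"
    by (simp add: algebra_simps)
qed

lemma lip1_exp_integrable:
  assumes "lip1 f"
  shows "integrable std_normal_distribution (\<lambda>z. exp (m * f (x + z * s)))"
proof (rule integrable_std_normal_exp_bound)
  show "(\<lambda>z. exp (m * f (x + z * s))) \<in> borel_measurable borel"
    using lip1_measurable[OF assms] by measurable
  fix z :: real
  have "m * f (x + z * s) \<le> \<bar>m\<bar> * \<bar>f (x + z * s)\<bar>"
    by (metis abs_ge_self abs_mult)
  also have "\<dots> \<le> \<bar>m\<bar> * (\<bar>f x\<bar> + \<bar>s\<bar> * \<bar>z\<bar>)"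
    using lip1_bound[OF assms, of "x + z * s" x]
    by (intro mult_left_mono) (auto simp: abs_mult mult.commute)
  finally show "\<bar>exp (m * f (x + z * s))\<bar> \<le> exp (\<bar>m\<bar> * \<bar>f x\<bar>) * exp ((\<bar>m\<bar> * \<bar>s\<bar>) * \<bar>z\<bar>)"
    by (simp add: algebra_simps flip: exp_add)
qed

lemma lip1_exp_integral_pos:
  assumes "lip1 f"
  shows "0 < (LINT z|std_normal_distribution. exp (m * f (x + z * s)))"
  by (rule std_normal.expectation_greater) (use lip1_exp_integrable[OF assms] in auto)

section \<open>Gaussian steps as monotone contractions\<close>

lemma gauss_step_shift: "gauss_step m v f (x + a) = gauss_step m v (\<lambda>y. f (y + a)) x"
  by (simp add: gauss_step_def algebra_simps)

lemma gauss_step_mono: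
  assumes "lip1 f" "lip1 g" "\<And>y. f y \<le> g y" "0 \<le> m"
  shows "gauss_step m v f x \<le> gauss_step m v g x"
proof (cases "m = 0")
  case True
  then show ?thesis
    using assms by (auto simp: gauss_step_def intro!: integral_mono lip1_integrable)
next
  case False
  then have "m > 0"
    using assms by simp
  have "(LINT z|std_normal_distribution. exp (m * f (x + z * sqrt v)))
      \<le> (LINT z|std_normal_distribution. exp (m * g (x + z * sqrt v)))"
    using assms by (intro integral_mono lip1_exp_integrable) (auto intro!: mult_left_mono)
  then show ?thesis
    using \<open>m > 0\<close> lip1_exp_integral_pos[OF assms(1)] lip1_exp_integral_pos[OF assms(2)]
    by (simp add: gauss_step_def divide_right_mono)
qed

lemma gauss_step_add_const:
  assumes "lip1 f"
  shows "gauss_step m v (\<lambda>y. f y + c) x = gauss_step m v f x + c"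
proof (cases "m = 0")
  case True
  then show ?thesis
    using lip1_integrable[OF assms] by (simp add: gauss_step_def std_normal.prob_space)
next
  case False
  have "(LINT z|std_normal_distribution. exp (m * (f (x + z * sqrt v) + c)))
      = exp (m * c) * (LINT z|std_normal_distribution. exp (m * f (x + z * sqrt v)))"
    by (simp add: distrib_left exp_add mult.commute)
  then show ?thesis
    using False lip1_exp_integral_pos[OF assms, of m x "sqrt v"]
    by (simp add: gauss_step_def ln_mult field_simps)
qed

text \<open>A monotone operator that commutes with the addition of constants contracts the uniform
  distance. Hence an error made at one node is not amplified by the following steps.\<close>

lemma gauss_step_contraction:
  assumes "lip1 f" "lip1 g" "\<And>y. \<bar>f y - g y\<bar> \<le> c" "0 \<le> m"
  shows "\<bar>gauss_step m v f x - gauss_step m v g x\<bar> \<le> c"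
proof -
  have "f y \<le> g y + c" "g y \<le> f y + c" for y
    using assms(3)[of y] by linarith+
  then have "gauss_step m v f x \<le> gauss_step m v g x + c"
    and "gauss_step m v g x \<le> gauss_step m v f x + c"
    using gauss_step_mono[OF assms(1) lip1_add_const[OF assms(2)], of c m v x]
      gauss_step_mono[OF assms(2) lip1_add_const[OF assms(1)], of c m v x] assms
    by (simp_all add: gauss_step_add_const)
  then show ?thesis
    by linarith
qed

text \<open>The step commutes with translations, so this is the contraction property applied to
  \<open>f\<close> and a translate of \<open>f\<close>.\<close>

lemma lip1_gauss_step:
  assumes "lip1 f" "0 \<le> m"
  shows "lip1 (gauss_step m v f)"
  unfolding lip1_def
proof (intro allI)
  fix x y
  have "\<bar>gauss_step m v (\<lambda>w. f (w + (x - y))) y - gauss_step m v f y\<bar> \<le> \<bar>x - y\<bar>"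
    by (rule gauss_step_contraction)
      (use assms lip1D[OF assms(1), of "w + (x - y)" w for w] in \<open>auto intro: lip1_shift\<close>)
  then show "\<bar>gauss_step m v f x - gauss_step m v f y\<bar> \<le> \<bar>x - y\<bar>"
    using gauss_step_shift[of m v f y "x - y"] by simp
qed

lemma gauss_step_0: "gauss_step m 0 f = f"
  by (rule ext) (simp add: gauss_step_def std_normal.prob_space)

text \<open>For fixed \<open>m\<close>, the function \<open>exp (m * f)\<close> (or \<open>f\<close>
  itself if \<open>m = 0\<close>) evolves by the heat semigroup. An additional node at which the
  parameter does not change is therefore harmless.\<close>

lemma gauss_step_semigroup:
  assumes f: "lip1 f" and "0 \<le> v" "0 \<le> w"
  shows "gauss_step m v (gauss_step m w f) x = gauss_step m (v + w) f x"
proof (cases "v = 0 \<or> w = 0")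
  case True
  then show ?thesis
    by (auto simp: gauss_step_0)
next
  case False
  then have vw: "0 < v" "0 < w"
    using assms by auto
  have meas [measurable]: "f \<in> borel_measurable borel"
    by (rule lip1_measurable[OF f])
  show ?thesis
  proof (cases "m = 0")
    case True
    have "\<bar>f (x + y)\<bar> \<le> (\<bar>f x\<bar> + 1) * exp (1 * \<bar>y\<bar>)" for y
    proof -
      have "\<bar>f (x + y)\<bar> \<le> \<bar>f x\<bar> + \<bar>y\<bar>"
        using lip1_bound[OF f, of "x + y" x] by simp
      also have "\<dots> \<le> \<bar>f x\<bar> * exp \<bar>y\<bar> + exp \<bar>y\<bar>"
        using abs_le_exp_abs[of y] mult_left_mono[of 1 "exp \<bar>y\<bar>" "\<bar>f x\<bar>"]
        by (intro add_mono) auto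
      finally show ?thesis
        by (simp add: algebra_simps)
    qed
    from std_normal_convolution[of "\<lambda>y. f (x + y)", OF _ this, of "sqrt v" "sqrt w"] vw True
    show ?thesis
      by (simp add: gauss_step_def algebra_simps)
  next
    case False
    have "\<bar>exp (m * f (x + y))\<bar> \<le> exp (\<bar>m\<bar> * \<bar>f x\<bar>) * exp (\<bar>m\<bar> * \<bar>y\<bar>)" for y
    proof -
      have "m * f (x + y) \<le> \<bar>m\<bar> * \<bar>f (x + y)\<bar>"
        by (metis abs_ge_self abs_mult)
      also have "\<dots> \<le> \<bar>m\<bar> * (\<bar>f x\<bar> + \<bar>y\<bar>)"
        using lip1_bound[OF f, of "x + y" x] by (intro mult_left_mono) auto
      finally show ?thesis
        by (simp add: algebra_simps flip: exp_add)
    qed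
    note conv = std_normal_convolution[of "\<lambda>y. exp (m * f (x + y))", OF _ this, of "sqrt v" "sqrt w"]
    have inner: "exp (m * gauss_step m w f y) = (LINT z|std_normal_distribution. exp (m * f (y + z * sqrt w)))" for y
      using False lip1_exp_integral_pos[OF f] by (simp add: gauss_step_def)
    have "(LINT z|std_normal_distribution. exp (m * gauss_step m w f (x + z * sqrt v)))
       = (LINT z|std_normal_distribution. exp (m * f (x + z * sqrt (v + w))))"
      using conv vw by (simp add: inner add.assoc mult.commute)
    then show ?thesis
      using False by (simp add: gauss_step_def[of m v "gauss_step m w f"] gauss_step_def[of m "v + w" f])
  qed
qed

lemma lip1_ln_cosh: "lip1 (\<lambda>y. ln (cosh y))"
proof (rule lip1_of_deriv)
  fix x :: real
  show "((\<lambda>y. ln (cosh y)) has_real_derivative tanh x) (at x)"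
    by (auto intro!: derivative_eq_intros simp: tanh_def)
  show "\<bar>tanh x\<bar> \<le> 1"
    using tanh_real_bounds[of x] by auto
qed

lemma std_normal_cosh:
  "(LINT z|std_normal_distribution. cosh (x + z * s)) = cosh x * exp (s\<^sup>2 / 2)"
proof -
  have e: "has_bochner_integral std_normal_distribution (\<lambda>z. (exp x * exp (s * z) + exp (-x) * exp ((-s) * z)) / 2)
     ((exp x * exp (s\<^sup>2 / 2) + exp (-x) * exp ((-s)\<^sup>2 / 2)) / 2)"
    by (intro has_bochner_integral_divide_zero has_bochner_integral_add has_bochner_integral_mult_right
        has_bochner_integral_std_normal_exp)
  have "(\<lambda>z. (exp x * exp (s * z) + exp (-x) * exp ((-s) * z)) / 2) = (\<lambda>z. cosh (x + z * s))"
    by (rule ext) (simp add: cosh_def mult.commute flip: exp_add)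
  from has_bochner_integral_integral_eq[OF e[unfolded this]]
  show ?thesis
    by (simp add: cosh_def field_simps)
qed

text \<open>The solvable case: \<open>cosh\<close> is an eigenfunction of the heat semigroup. It is
  the reason for the closed formula of \<open>Phi_above\<close> on the empty list.\<close>

lemma gauss_step_ln_cosh:
  assumes "0 \<le> v"
  shows "gauss_step 1 v (\<lambda>y. ln (cosh y) + c) x = ln (cosh x) + v / 2 + c"
proof -
  have "gauss_step 1 v (\<lambda>y. ln (cosh y)) x = ln (cosh x) + v / 2"
    using assms by (simp add: gauss_step_def std_normal_cosh ln_mult)
  then show ?thesis
    by (simp add: gauss_step_add_const[OF lip1_ln_cosh])
qed

section \<open>Expansion of a Gaussian step in its parameter\<close>

lemma exp_taylor2_bound: "\<bar>exp y - 1 - y - y\<^sup>2 / 2\<bar> \<le> \<bar>y\<bar> ^ 3 * exp \<bar>y::real\<bar>"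
proof -
  obtain t where t: "\<bar>t\<bar> \<le> \<bar>y\<bar>" "exp y = (\<Sum>m<3. y ^ m / fact m) + exp t / fact 3 * y ^ 3"
    using Maclaurin_exp_le[of y 3] by blast
  have "(\<Sum>m<3. y ^ m / fact m) = 1 + y + y\<^sup>2 / 2"
    by (simp add: eval_nat_numeral)
  with t(2) have e: "exp y - 1 - y - y\<^sup>2 / 2 = exp t / 6 * y ^ 3"
    by (simp add: fact_numeral)
  have "\<bar>exp y - 1 - y - y\<^sup>2 / 2\<bar> = exp t / 6 * \<bar>y\<bar> ^ 3"
    unfolding e by (simp add: abs_mult power_abs)
  also have "\<dots> \<le> exp \<bar>y\<bar> * \<bar>y\<bar> ^ 3"
  proof (intro mult_right_mono)
    have "exp t / 6 \<le> exp t"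
      by simp
    also have "\<dots> \<le> exp \<bar>y\<bar>"
      using t(1) by simp
    finally show "exp t / 6 \<le> exp \<bar>y\<bar>" .
  qed simp
  finally show ?thesis
    by (simp add: mult.commute)
qed

lemma abs_ln_add1_diff_le: "0 \<le> a \<Longrightarrow> \<bar>ln (1 + a) - a\<bar> \<le> (a::real)\<^sup>2"
proof -
  assume a: "0 \<le> a"
  have "- ln (1 + a) \<le> 1 / (1 + a) - 1"
    using ln_le_minus_one[of "1 / (1 + a)"] a by (simp add: ln_div)
  also have "\<dots> \<le> a\<^sup>2 - a"
    using a by (simp add: field_simps power2_eq_square)
  finally show ?thesis
    using ln_add_one_self_le_self[OF a] by (simp add: abs_le_iff)
qed

lemma abs_add1_le_exp: "\<bar>z\<bar> + 1 \<le> exp \<bar>z::real\<bar>"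
  using exp_ge_add_one_self[of "\<bar>z\<bar>"] by linarith

definition gauss_var :: "real \<Rightarrow> (real \<Rightarrow> real) \<Rightarrow> real \<Rightarrow> real" where
  "gauss_var v f x = (LINT z|std_normal_distribution. (f (x + z * sqrt v) - gauss_step 0 v f x)\<^sup>2)"

lemma gauss_step_0_diff:
  assumes "lip1 f" "0 \<le> v"
  shows "\<bar>gauss_step 0 v f x - f x\<bar> \<le> sqrt v"
proof -
  \<comment> \<open>The first absolute moment is at most 1 because the variance of
    \<open>\<bar>z\<bar>\<close> is nonnegative and the second moment is 1.\<close>
  have "(LINT z|std_normal_distribution. \<bar>z\<bar>)\<^sup>2 \<le> (LINT z|std_normal_distribution. \<bar>z\<bar>\<^sup>2)"
  proof -
    have "0 \<le> (LINT z|std_normal_distribution. (\<bar>z\<bar> - (LINT z|std_normal_distribution. \<bar>z\<bar>))\<^sup>2)"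
      by (rule Bochner_Integration.integral_nonneg) auto
    also have "\<dots> = (LINT z|std_normal_distribution. \<bar>z\<bar>\<^sup>2) - (LINT z|std_normal_distribution. \<bar>z\<bar>)\<^sup>2"
      using std_normal_integrable_square std_normal_integrable_id
      by (intro std_normal.variance_eq) auto
    finally show ?thesis
      by simp
  qed
  then have E: "(LINT z|std_normal_distribution. \<bar>z\<bar>) \<le> 1"
    by (simp add: std_normal_integral_square power_le_one_iff)
  have int: "integrable std_normal_distribution (\<lambda>z. f (x + z * sqrt v))"
    by (rule lip1_integrable) fact
  have "gauss_step 0 v f x - f x = (LINT z|std_normal_distribution. f (x + z * sqrt v) - f x)"
    using int by (simp add: gauss_step_def)
  also have "\<bar>\<dots>\<bar> \<le> (LINT z|std_normal_distribution. \<bar>f (x + z * sqrt v) - f x\<bar>)"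
    using integral_norm_bound[of std_normal_distribution "\<lambda>z. f (x + z * sqrt v) - f x"] by simp
  also have "\<dots> \<le> (LINT z|std_normal_distribution. \<bar>z\<bar> * sqrt v)"
    by (intro integral_mono)
      (use int std_normal_integrable_id lip1D[OF assms(1), of "x + z * sqrt v" x for z] assms(2) in \<open>auto simp: abs_mult\<close>)
  also have "\<dots> \<le> 1 * sqrt v"
    using mult_right_mono[OF E, of "sqrt v"] assms(2) by simp
  finally show ?thesis
    by simp
qed

text \<open>Cumulant expansion in \<open>m\<close>. The constant depends neither on \<open>f\<close>
  and \<open>x\<close> nor on \<open>m\<close>: every remainder keeps a factor \<open>m\<close>
  before the division by \<open>m\<close>. The power \<open>v * sqrt v\<close> is what makes the
  errors of a fine mesh sum to something small.\<close>

lemma gauss_step_expansion: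
  obtains C where "0 \<le> C"
    and "\<And>f m v x. lip1 f \<Longrightarrow> 0 \<le> m \<Longrightarrow> m \<le> 1 \<Longrightarrow> 0 \<le> v \<Longrightarrow> v \<le> 1 \<Longrightarrow>
      \<bar>gauss_step m v f x - gauss_step 0 v f x - m / 2 * gauss_var v f x\<bar> \<le> C * (v * sqrt v)"
proof -
  define G where "G = exp 1 * gauss_abs_mgf 4"
  define K where "K = gauss_abs_mgf 2 + G"
  have "0 \<le> G" "0 \<le> K"
    using gauss_abs_mgf_ge_1[of 4] gauss_abs_mgf_ge_1[of 2] by (auto simp: G_def K_def)
  have "\<bar>gauss_step m v f x - gauss_step 0 v f x - m / 2 * gauss_var v f x\<bar> \<le> (K\<^sup>2 + G) * (v * sqrt v)"
    if f: "lip1 f" and m: "0 \<le> m" "m \<le> 1" and v: "0 \<le> v" "v \<le> 1" for f m v x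
  proof (cases "m = 0")
    case True
    then show ?thesis
      using v \<open>0 \<le> G\<close> by simp
  next
    case False
    then have "m > 0"
      using m by simp
    define s where "s = sqrt v"
    have s: "0 \<le> s" "s \<le> 1" "s\<^sup>2 = v"
      using v by (auto simp: s_def)
    define M where "M = gauss_step 0 v f x"
    define Z where "Z z = f (x + z * s) - M" for z
    have meas [measurable]: "Z \<in> borel_measurable borel"
      using lip1_measurable[OF f] unfolding Z_def by measurable
    have Z1: "\<bar>Z z\<bar> \<le> s * (\<bar>z\<bar> + 1)" for z
      using lip1D[OF f, of "x + z * s" x] gauss_step_0_diff[OF f v(1), of x] s
      by (simp add: Z_def M_def s_def abs_mult algebra_simps)
    have Z2: "\<bar>Z z\<bar> \<le> s * exp \<bar>z\<bar>" for z
      by (rule order_trans[OF Z1 mult_left_mono[OF abs_add1_le_exp s(1)]])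
    have Z3: "\<bar>Z z\<bar> \<le> \<bar>z\<bar> + 1" for z
      using Z1[of z] s mult_right_mono[of s 1 "\<bar>z\<bar> + 1"] by auto
    have expZ: "exp \<bar>m * Z z\<bar> \<le> exp 1 * exp \<bar>z\<bar>" for z
      using Z3[of z] m mult_right_mono[of m 1 "\<bar>Z z\<bar>"] by (simp add: abs_mult flip: exp_add)
    have Zint: "integrable std_normal_distribution Z"
      using lip1_integrable[OF f, of x s] unfolding Z_def by simp
    have EZ: "(LINT z|std_normal_distribution. Z z) = 0"
      using lip1_integrable[OF f, of x s] unfolding Z_def M_def by (simp add: gauss_step_def s_def)
    have ZZ: "\<bar>(Z z)\<^sup>2\<bar> \<le> v * exp (2 * \<bar>z\<bar>)" for z
    proof -
      have "\<bar>Z z\<bar>\<^sup>2 \<le> (s * exp \<bar>z\<bar>)\<^sup>2"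
        using Z2 by (intro power_mono) auto
      then show ?thesis
        by (simp add: power_mult_distrib s exp_double)
    qed
    have ZZint: "integrable std_normal_distribution (\<lambda>z. (Z z)\<^sup>2)"
      by (rule integrable_std_normal_exp_bound[OF _ ZZ]) measurable
    define V where "V = (LINT z|std_normal_distribution. (Z z)\<^sup>2)"
    have V: "0 \<le> V" "V \<le> v * gauss_abs_mgf 2"
      using std_normal_integral_bound[of "\<lambda>z. (Z z)\<^sup>2", OF ZZ]
      by (auto simp: V_def intro!: Bochner_Integration.integral_nonneg)
    have Eint: "integrable std_normal_distribution (\<lambda>z. exp (m * Z z))"
    proof (rule integrable_std_normal_exp_bound)
      show "\<bar>exp (m * Z z)\<bar> \<le> exp 1 * exp (1 * \<bar>z\<bar>)" for z
        using order_trans[OF _ expZ[of z], of "exp (m * Z z)"] by simp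
    qed measurable
    define a where "a = (LINT z|std_normal_distribution. exp (m * Z z)) - 1"
    have rem: "\<bar>exp (m * Z z) - 1 - m * Z z - (m * Z z)\<^sup>2 / 2\<bar> \<le> (m ^ 3 * (v * s) * exp 1) * exp (4 * \<bar>z\<bar>)" for z
    proof -
      have "\<bar>exp (m * Z z) - 1 - m * Z z - (m * Z z)\<^sup>2 / 2\<bar> \<le> \<bar>m * Z z\<bar> ^ 3 * exp \<bar>m * Z z\<bar>"
        by (rule exp_taylor2_bound)
      also have "\<dots> \<le> (m * (s * exp \<bar>z\<bar>)) ^ 3 * (exp 1 * exp \<bar>z\<bar>)"
        using Z2[of z] m expZ s by (intro mult_mono power_mono) (auto simp: abs_mult intro!: mult_left_mono)
      also have "\<dots> = (m ^ 3 * (v * s) * exp 1) * (exp \<bar>z\<bar>) ^ 4"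
        by (simp add: power_mult_distrib eval_nat_numeral flip: s(3))
      also have "(exp \<bar>z\<bar>) ^ 4 = exp (4 * \<bar>z\<bar>)"
        by (simp flip: exp_of_nat_mult)
      finally show ?thesis .
    qed
    have a1: "\<bar>a - m\<^sup>2 / 2 * V\<bar> \<le> m ^ 3 * (v * s) * G"
    proof -
      have "a - m\<^sup>2 / 2 * V = (LINT z|std_normal_distribution. exp (m * Z z) - 1 - m * Z z - (m * Z z)\<^sup>2 / 2)"
        using Eint Zint ZZint EZ by (simp add: a_def V_def power_mult_distrib)
      also have "\<bar>\<dots>\<bar> \<le> (m ^ 3 * (v * s) * exp 1) * gauss_abs_mgf 4"
        by (rule std_normal_integral_bound[OF rem])
      finally show ?thesis
        by (simp add: G_def)
    qed
    \<comment> \<open>Since \<open>Z\<close> is centred, \<open>exp y \<ge> 1 + y\<close> gives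
      \<open>0 \<le> a\<close>, under which \<open>ln (1 + a)\<close> is within \<open>a^2\<close>
      of \<open>a\<close>.\<close>
    have "0 \<le> (LINT z|std_normal_distribution. exp (m * Z z) - 1 - m * Z z)"
    proof (rule Bochner_Integration.integral_nonneg)
      show "0 \<le> exp (m * Z z) - 1 - m * Z z" for z
        using exp_ge_add_one_self[of "m * Z z"] by linarith
    qed
    then have "0 \<le> a"
      using Eint Zint EZ by (simp add: a_def)
    have a2: "a \<le> m\<^sup>2 * v * K"
    proof -
      have "m ^ 3 * (v * s) \<le> m\<^sup>2 * v"
        using mult_left_mono[of "m * s" 1 "m\<^sup>2 * v"] m s v
        by (simp add: mult_le_one power3_eq_cube power2_eq_square mult_ac)
      then have "m ^ 3 * (v * s) * G \<le> m\<^sup>2 * v * G"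
        using \<open>0 \<le> G\<close> by (rule mult_right_mono)
      moreover have "m\<^sup>2 / 2 * V \<le> m\<^sup>2 * (v * gauss_abs_mgf 2)"
        using V by (intro mult_mono) auto
      ultimately show ?thesis
        using a1 by (simp add: K_def algebra_simps)
    qed
    \<comment> \<open>Here \<open>a\<close> is of order \<open>m^2 * v\<close>. Its square and the
      third-order remainder both retain one factor \<open>m\<close>, which cancels the
      \<open>1 / m\<close> of the step.\<close>
    have "a\<^sup>2 \<le> (m\<^sup>2 * v * K)\<^sup>2"
      using a2 \<open>0 \<le> a\<close> by (rule power_mono)
    also have "\<dots> = m * (m ^ 3 * (v * s) * K\<^sup>2 * s)"
      by (simp add: power2_eq_square power3_eq_cube flip: s(3))
    also have "\<dots> \<le> m * (1 * (v * s) * K\<^sup>2 * 1)"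
      using m v s by (intro mult_mono) (auto simp: power_le_one)
    finally have a3: "a\<^sup>2 \<le> m * (v * s * K\<^sup>2)"
      by simp
    have "m ^ 3 * (v * s) * G \<le> m * (v * s) * G"
      using m v s \<open>0 \<le> G\<close> power_decreasing[of 1 3 m] by (intro mult_right_mono) auto
    with a1 have a4: "\<bar>a - m\<^sup>2 / 2 * V\<bar> \<le> m * (v * s * G)"
      by (simp add: mult.assoc)
    have "exp (m * f (x + z * s)) = exp (m * M) * exp (m * Z z)" for z
      by (simp add: Z_def right_diff_distrib flip: exp_add)
    then have "(LINT z|std_normal_distribution. exp (m * f (x + z * s))) = exp (m * M) * (1 + a)"
      by (simp add: a_def)
    moreover have "ln (exp (m * M) * (1 + a)) = m * M + ln (1 + a)"
      using \<open>0 \<le> a\<close> by (simp add: ln_mult del: distrib_left)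
    ultimately have "gauss_step m v f x = M + 1 / m * ln (1 + a)"
      using \<open>m > 0\<close> by (simp add: gauss_step_def s_def distrib_left del: ln_mult)
    moreover have "gauss_var v f x = V"
      by (simp add: gauss_var_def V_def Z_def M_def s_def)
    ultimately have "gauss_step m v f x - gauss_step 0 v f x - m / 2 * gauss_var v f x
        = 1 / m * (ln (1 + a) - m\<^sup>2 / 2 * V)"
      using \<open>m > 0\<close> by (simp add: M_def field_simps power2_eq_square)
    also have "\<bar>\<dots>\<bar> = 1 / m * \<bar>ln (1 + a) - m\<^sup>2 / 2 * V\<bar>"
      using \<open>m > 0\<close> by (simp add: abs_mult)
    also have "\<dots> \<le> 1 / m * (m * (v * s * K\<^sup>2) + m * (v * s * G))"
      using abs_ln_add1_diff_le[OF \<open>0 \<le> a\<close>] a3 a4 \<open>m > 0\<close> by (intro mult_left_mono) auto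
    also have "\<dots> = (K\<^sup>2 + G) * (v * sqrt v)"
      using \<open>m > 0\<close> by (simp add: s_def field_simps)
    finally show ?thesis .
  qed
  then show ?thesis
    using that[of "K\<^sup>2 + G"] \<open>0 \<le> G\<close> by auto
qed

text \<open>For the upper bound, the variance is at most the second moment about any point, in
  particular about \<open>f x\<close>.\<close>

lemma gauss_var_bounds:
  assumes "lip1 f" "0 \<le> v"
  shows "0 \<le> gauss_var v f x" "gauss_var v f x \<le> v"
proof -
  show "0 \<le> gauss_var v f x"
    by (simp add: gauss_var_def Bochner_Integration.integral_nonneg)
  define Y where "Y z = f (x + z * sqrt v) - f x" for z
  have Y: "\<bar>Y z\<bar> \<le> \<bar>z\<bar> * sqrt v" for z
    using lip1D[OF assms(1), of "x + z * sqrt v" x] assms(2) by (simp add: Y_def abs_mult)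
  have YY: "(Y z)\<^sup>2 \<le> z\<^sup>2 * v" for z
    using power_mono[OF Y[of z], of 2] assms(2) by (simp add: power_mult_distrib)
  have [measurable]: "Y \<in> borel_measurable borel"
    using lip1_measurable[OF assms(1)] unfolding Y_def by measurable
  have Yi: "integrable std_normal_distribution Y"
    unfolding Y_def using lip1_integrable[OF assms(1)] by simp
  have YYi: "integrable std_normal_distribution (\<lambda>z. (Y z)\<^sup>2)"
    by (rule Bochner_Integration.integrable_bound[of _ "\<lambda>z. z\<^sup>2 * v"])
      (use std_normal_integrable_square YY assms(2) in \<open>auto intro!: AE_I2\<close>)
  have "gauss_var v f x = (LINT z|std_normal_distribution. (Y z - (LINT z|std_normal_distribution. Y z))\<^sup>2)"
    using lip1_integrable[OF assms(1)] by (simp add: gauss_var_def Y_def gauss_step_def)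
  also have "\<dots> = (LINT z|std_normal_distribution. (Y z)\<^sup>2) - (LINT z|std_normal_distribution. Y z)\<^sup>2"
    by (rule std_normal.variance_eq) fact+
  also have "\<dots> \<le> (LINT z|std_normal_distribution. (Y z)\<^sup>2)"
    by simp
  also have "\<dots> \<le> (LINT z|std_normal_distribution. z\<^sup>2 * v)"
    by (intro integral_mono YYi YY) (use std_normal_integrable_square in auto)
  also have "\<dots> = v"
    by (simp add: std_normal_integral_square)
  finally show "gauss_var v f x \<le> v" .
qed

section \<open>Backward recursion on finite node sets\<close>

lemma prob_measures01D:
  assumes "\<mu> \<in> prob_measures01"
  shows "prob_space \<mu>" "space \<mu> = {0..1}" "A \<in> sets \<mu> \<longleftrightarrow> A \<in> sets borel \<and> A \<subseteq> {0..1}"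
proof -
  show "prob_space \<mu>"
    using assms by (simp add: prob_measures01_def)
  have "sets \<mu> = sets (restrict_space borel {0..1})"
    using assms by (simp add: prob_measures01_def)
  from sets_eq_imp_space_eq[OF this] this
  show "space \<mu> = {0..1}" "A \<in> sets \<mu> \<longleftrightarrow> A \<in> sets borel \<and> A \<subseteq> {0..1}"
    by (auto simp: space_restrict_space sets_restrict_space_iff)
qed

lemma cdf01_diff:
  assumes "\<mu> \<in> prob_measures01" "0 \<le> a" "a \<le> b" "b \<le> 1"
  shows "measure \<mu> {0..b} = measure \<mu> {0..a} + measure \<mu> {a<..b}"
proof -
  interpret prob_space \<mu>
    by (rule prob_measures01D) fact
  have "{0..b} = {0..a} \<union> {a<..b}"
    using assms by auto
  moreover have "measure \<mu> ({0..a} \<union> {a<..b}) = measure \<mu> {0..a} + measure \<mu> {a<..b}"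
    by (rule finite_measure_Union) (use assms in \<open>auto simp: prob_measures01D(3)\<close>)
  ultimately show ?thesis
    by simp
qed

lemma cdf01_mono:
  "\<mu> \<in> prob_measures01 \<Longrightarrow> 0 \<le> a \<Longrightarrow> a \<le> b \<Longrightarrow> b \<le> 1 \<Longrightarrow> measure \<mu> {0..a} \<le> measure \<mu> {0..b}"
  by (subst cdf01_diff[of \<mu> a b]) auto

lemma cdf01_le_1: "\<mu> \<in> prob_measures01 \<Longrightarrow> measure \<mu> {0..a} \<le> 1"
  using prob_measures01D(1) prob_space.prob_le_1 by blast

lemma cdf01_1: "\<mu> \<in> prob_measures01 \<Longrightarrow> measure \<mu> {0..1} = 1"
  using prob_measures01D(1,2) prob_space.prob_space by metis

lemma mono_on_set_integrable:
  fixes F :: "real \<Rightarrow> real"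
  assumes "mono_on {a..b} F"
  shows "set_integrable lborel {a..b} F"
proof -
  have meas: "(\<lambda>x. indicator {a..b} x *\<^sub>R F x) \<in> borel_measurable borel"
    using borel_measurable_mono_on_fnc[OF assms]
    by (subst (asm) borel_measurable_restrict_space_iff) auto
  define B where "B = \<bar>F a\<bar> + \<bar>F b\<bar>"
  have "\<bar>F x\<bar> \<le> \<bar>B\<bar>" if "a \<le> x" "x \<le> b" for x
    using monotone_onD[OF assms, of a x] monotone_onD[OF assms, of x b] that by (auto simp: B_def)
  then have "norm (indicator {a..b} x *\<^sub>R F x) \<le> norm (B * indicator {a..b} x)" for x
    by (auto simp: indicator_def)
  note bound = this
  show ?thesis
    unfolding set_integrable_def
  proof (rule Bochner_Integration.integrable_bound)
    show "integrable lborel (\<lambda>x. B * indicator {a..b} x :: real)"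
      by (intro integrable_mult_right integrable_real_indicator) (use emeasure_bounded_finite[OF bounded_closed_interval[of a b]] in auto)
    show "AE x in lborel. norm (indicator {a..b} x *\<^sub>R F x) \<le> norm (B * indicator {a..b} x)"
      by (rule AE_I2) (rule bound)
  qed (use meas in simp)
qed

lemma cdf01_set_integrable:
  "\<mu> \<in> prob_measures01 \<Longrightarrow> set_integrable lborel {0..1} (\<lambda>u. measure \<mu> {0..u})"
  by (intro mono_on_set_integrable) (auto simp: monotone_on_def cdf01_mono)

lemma cdf_dist_integrable:
  assumes "\<mu> \<in> prob_measures01" "\<nu> \<in> prob_measures01"
  shows "set_integrable lborel {0..1} (\<lambda>u. \<bar>measure \<mu> {0..u} - measure \<nu> {0..u}\<bar>)"
  using assms by (intro set_integrable_abs set_integral_diff cdf01_set_integrable)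

lemma cdf_dist_commute: "cdf_dist \<mu> \<nu> = cdf_dist \<nu> \<mu>"
  by (simp add: cdf_dist_def abs_minus_commute)

lemma cdf_dist_nonneg: "0 \<le> cdf_dist \<mu> \<nu>"
  unfolding cdf_dist_def set_lebesgue_integral_def
  by (rule Bochner_Integration.integral_nonneg) auto

lemma cdf_dist_triangle:
  assumes "\<mu> \<in> prob_measures01" "\<nu> \<in> prob_measures01" "\<kappa> \<in> prob_measures01"
  shows "cdf_dist \<mu> \<kappa> \<le> cdf_dist \<mu> \<nu> + cdf_dist \<nu> \<kappa>"
proof -
  note int = cdf_dist_integrable[OF assms(1,2)] cdf_dist_integrable[OF assms(2,3)]
  have "cdf_dist \<mu> \<kappa> \<le> (LINT u:{0..1}|lborel. \<bar>measure \<mu> {0..u} - measure \<nu> {0..u}\<bar> + \<bar>measure \<nu> {0..u} - measure \<kappa> {0..u}\<bar>)"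
    unfolding cdf_dist_def
    by (rule set_integral_mono) (use cdf_dist_integrable[OF assms(1,3)] int in auto)
  also have "\<dots> = cdf_dist \<mu> \<nu> + cdf_dist \<nu> \<kappa>"
    unfolding cdf_dist_def using int by (rule set_integral_add)
  finally show ?thesis .
qed

lemma atoms_subset: "\<mu> \<in> prob_measures01 \<Longrightarrow> atoms \<mu> \<subseteq> {0..1}"
proof
  fix q assume \<mu>: "\<mu> \<in> prob_measures01" and "q \<in> atoms \<mu>"
  then have "{q} \<in> sets \<mu>"
    using measure_notin_sets[of "{q}" \<mu>] by (cases "{q} \<in> sets \<mu>") (auto simp: atoms_def)
  then show "q \<in> {0..1}"
    using prob_measures01D(3)[OF \<mu>] by auto
qed

text \<open>The atoms carry the whole mass, so an interval free of atoms is a null set.\<close>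

lemma discrete_cdf_const:
  assumes "\<mu> \<in> discrete_measures01" "0 \<le> a" "a \<le> b" "b \<le> 1" "{a<..b} \<inter> atoms \<mu> = {}"
  shows "measure \<mu> {0..a} = measure \<mu> {0..b}"
proof -
  have \<mu>: "\<mu> \<in> prob_measures01" and fin: "finite (atoms \<mu>)" and one: "measure \<mu> (atoms \<mu>) = 1"
    using assms(1) by (auto simp: discrete_measures01_def)
  interpret prob_space \<mu>
    by (rule prob_measures01D) fact
  have sets: "atoms \<mu> \<in> sets \<mu>" "{a<..b} \<in> sets \<mu>"
    using fin atoms_subset[OF \<mu>] assms by (auto simp: prob_measures01D(3)[OF \<mu>] finite_imp_closed)
  have "measure \<mu> ({a<..b} \<union> atoms \<mu>) = measure \<mu> {a<..b} + measure \<mu> (atoms \<mu>)"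
    by (rule finite_measure_Union) fact+
  then have "measure \<mu> {a<..b} = 0"
    using one prob_le_1[of "{a<..b} \<union> atoms \<mu>"] measure_nonneg[of \<mu> "{a<..b}"] by linarith
  then show ?thesis
    using cdf01_diff[OF \<mu> assms(2-4)] by simp
qed

text \<open>\<open>Psi D F qs u x\<close> is the backward recursion from \<open>1\<close> to \<open>u\<close> along the increasing list \<open>qs\<close> of
  nodes, for an arbitrary step function \<open>F\<close> in place of the distribution function; \<open>D\<close> is the
  derivative of the mixture. In contrast to \<^const>\<open>Phi_above\<close> the nodes need not be atoms, so that two
  measures can be compared on a common refinement.\<close>

fun Psi :: "(real \<Rightarrow> real) \<Rightarrow> (real \<Rightarrow> real) \<Rightarrow> real list \<Rightarrow> real \<Rightarrow> real \<Rightarrow> real" where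
  "Psi D F [] u = (\<lambda>x. ln (cosh x) + (D 1 - D u) / 2)"
| "Psi D F (q # qs) u = gauss_step (F u) (D q - D u) (Psi D F qs q)"

lemma Phi_above_eq_Psi:
  assumes "sorted_wrt (<) qs" "\<forall>q\<in>set qs. u < q" "m = measure \<mu> {0..u}"
  shows "Phi_above \<xi> \<mu> m qs x u = Psi (deriv \<xi>) (\<lambda>u. measure \<mu> {0..u}) qs u x"
  using assms by (induction qs arbitrary: u m x) auto

lemma Phi_discrete_eq_Psi:
  assumes "\<mu> \<in> discrete_measures01"
  shows "Phi_discrete \<xi> \<mu> x 0 = Psi (deriv \<xi>) (\<lambda>u. measure \<mu> {0..u}) (sorted_list_of_set (atoms \<mu> - {0})) 0 x"
proof -
  have \<mu>: "\<mu> \<in> prob_measures01" and fin: "finite (atoms \<mu>)"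
    using assms by (auto simp: discrete_measures01_def)
  note sub = atoms_subset[OF \<mu>]
  let ?qs = "sorted_list_of_set (atoms \<mu> - {0})"
  have qs: "sorted_wrt (<) ?qs" "\<forall>q\<in>set ?qs. 0 < q"
    using fin sub by (auto simp: order_le_less)
  show ?thesis
  proof (cases "0 \<in> atoms \<mu>")
    case True
    have "sorted_list_of_set (atoms \<mu>) = sorted_list_of_set (insert 0 (atoms \<mu> - {0}))"
      using True by (simp add: insert_absorb)
    also have "\<dots> = insort 0 ?qs"
      using fin by (subst sorted_list_of_set_insert) auto
    also have "\<dots> = 0 # ?qs"
      using qs(2) by (intro insort_is_Cons) auto
    finally show ?thesis
      using Phi_above_eq_Psi[OF qs refl] by (simp add: Phi_discrete_def)
  next
    case False
    then have "measure \<mu> {0..0} = 0"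
      by (simp add: atoms_def zero_less_measure_iff)
    then show ?thesis
      using False Phi_above_eq_Psi[OF qs, of 0 \<mu>] by (simp add: Phi_discrete_def)
  qed
qed

text \<open>\<open>D\<close> stands for the derivative of \<open>\<xi>\<close>, whose increments are
  the variances of the steps; \<open>K\<close> will be \<open>\<xi>''(1)\<close>.\<close>

definition clock :: "(real \<Rightarrow> real) \<Rightarrow> real \<Rightarrow> bool" where
  "clock D K \<longleftrightarrow> (\<forall>a b. 0 \<le> a \<longrightarrow> a \<le> b \<longrightarrow> b \<le> 1 \<longrightarrow> 0 \<le> D b - D a \<and> D b - D a \<le> K * (b - a))"

lemma clockD: "clock D K \<Longrightarrow> 0 \<le> a \<Longrightarrow> a \<le> b \<Longrightarrow> b \<le> 1 \<Longrightarrow> 0 \<le> D b - D a"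
  "clock D K \<Longrightarrow> 0 \<le> a \<Longrightarrow> a \<le> b \<Longrightarrow> b \<le> 1 \<Longrightarrow> D b - D a \<le> K * (b - a)"
  by (auto simp: clock_def)

lemma clock_nonneg: "clock D K \<Longrightarrow> 0 \<le> K"
  using clockD[of D K 0 1] by auto

lemma lip1_Psi:
  assumes "\<And>u. 0 \<le> F u"
  shows "lip1 (Psi D F qs u)"
  by (induction qs arbitrary: u) (auto intro!: lip1_gauss_step lip1_add_const lip1_ln_cosh assms)

text \<open>A node inside an interval of constancy of \<open>F\<close> is invisible. Before an
  existing node, the semigroup law merges the two steps with equal parameter; beyond the last node
  the parameter is 1 and the closed formula for \<open>ln (cosh x)\<close> applies.\<close>

lemma Psi_insort:
  assumes F: "\<And>u. 0 \<le> F u" "F 1 = 1" and D: "clock D K"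
    and "sorted_wrt (<) qs" "\<forall>q\<in>set qs. u < q \<and> q \<le> 1" "r \<notin> set qs" "u < r" "r \<le> 1" "0 \<le> u"
    and "\<And>a b. u \<le> a \<Longrightarrow> a \<le> b \<Longrightarrow> b \<le> 1 \<Longrightarrow> {a<..b} \<inter> set qs = {} \<Longrightarrow> F a = F b"
  shows "Psi D F (insort r qs) u = Psi D F qs u"
  using assms(4-)
proof (induction qs arbitrary: u)
  case Nil
  have "F u = 1"
    using Nil(7)[of u 1] Nil F by simp
  then show ?case
    using gauss_step_ln_cosh[of "D r - D u" "(D 1 - D r) / 2"] clockD(1)[OF D, of u r] Nil
    by (simp add: fun_eq_iff diff_divide_distrib)
next
  case (Cons q qs)
  show ?case
  proof (cases "r \<le> q")
    case True
    then have "r < q"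
      using Cons.prems by auto
    have "F u = F r"
      using Cons.prems(7)[of u r] Cons.prems \<open>r < q\<close> by fastforce
    then show ?thesis
      using True gauss_step_semigroup[OF lip1_Psi[where F = F and D = D and qs = qs and u = q, OF F(1)], of "D r - D u" "D q - D r" "F r"]
        clockD(1)[OF D, of u r] clockD(1)[OF D, of r q] Cons.prems
      by (auto simp: fun_eq_iff)
  next
    case False
    have "Psi D F (insort r qs) q = Psi D F qs q"
    proof (rule Cons.IH)
      fix a b assume ab: "q \<le> a" "a \<le> b" "b \<le> 1" "{a<..b} \<inter> set qs = {}"
      show "F a = F b"
        by (rule Cons.prems(7)) (use ab Cons.prems in auto)
    qed (use Cons.prems False in auto)
    then show ?thesis
      using False by simp
  qed
qed

text \<open>Permits two measures to be compared on a common refinement of their atoms whose mesh is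
  as fine as desired.\<close>

lemma Psi_superset:
  assumes F: "\<And>u. 0 \<le> F u" "F 1 = 1" and D: "clock D K" and "finite B" "finite A" "A \<union> B \<subseteq> {0<..1}"
    and const: "\<And>a b. 0 \<le> a \<Longrightarrow> a \<le> b \<Longrightarrow> b \<le> 1 \<Longrightarrow> {a<..b} \<inter> A = {} \<Longrightarrow> F a = F b"
  shows "Psi D F (sorted_list_of_set (A \<union> B)) 0 = Psi D F (sorted_list_of_set A) 0"
  using \<open>finite B\<close> \<open>A \<union> B \<subseteq> {0<..1}\<close>
proof (induction B)
  case (insert r B)
  show ?case
  proof (cases "r \<in> A")
    case False
    then have "sorted_list_of_set (A \<union> insert r B) = insort r (sorted_list_of_set (A \<union> B))"
      using insert.hyps \<open>finite A\<close> by (simp add: sorted_list_of_set_insert)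
    moreover have "Psi D F (insort r (sorted_list_of_set (A \<union> B))) 0 = Psi D F (sorted_list_of_set (A \<union> B)) 0"
      by (rule Psi_insort[where F=F, OF F D]) (use False insert \<open>finite A\<close> in \<open>auto intro!: const\<close>)
    ultimately show ?thesis
      using insert by simp
  qed (use insert in \<open>simp add: insert_absorb\<close>)
qed simp

text \<open>Discrete form of the integral of \<open>\<bar>w\<bar>\<close>, leaving out the piece
  beyond the last node. With \<open>w\<close> the difference of two distribution functions it is
  bounded by \<open>cdf_dist\<close>.\<close>

fun node_sum :: "(real \<Rightarrow> real) \<Rightarrow> real list \<Rightarrow> real \<Rightarrow> real" where
  "node_sum w [] u = 0"
| "node_sum w (q # qs) u = \<bar>w u\<bar> * (q - u) + node_sum w qs q"

fun mesh_le :: "real \<Rightarrow> real list \<Rightarrow> real \<Rightarrow> bool" where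
  "mesh_le h [] u = True"
| "mesh_le h (q # qs) u \<longleftrightarrow> q - u \<le> h \<and> mesh_le h qs q"

lemma mesh_le_grid:
  fixes N :: nat
  assumes "0 < N" "sorted_wrt (<) qs" "\<forall>q\<in>set qs. u < q \<and> q \<le> 1" "0 \<le> u"
    and "\<And>j. u < real j / N \<Longrightarrow> real j / N \<le> 1 \<Longrightarrow> real j / N \<in> set qs"
  shows "mesh_le (1 / N) qs u"
  using assms(2-)
proof (induction qs arbitrary: u)
  case (Cons q qs)
  \<comment> \<open>The first grid point strictly to the right of \<open>u\<close>. It is within
    \<open>1 / N\<close> of \<open>u\<close> and belongs to the list unless it exceeds 1.\<close>
  define j where "j = nat \<lfloor>u * N\<rfloor> + 1"
  have fl: "0 \<le> \<lfloor>u * N\<rfloor>"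
    using Cons.prems by simp
  then have "real j = of_int \<lfloor>u * N\<rfloor> + 1"
    by (simp add: j_def)
  then have "u * N < j" "j \<le> u * N + 1"
    by linarith+
  then have j: "u < real j / N" "real j / N \<le> u + 1 / N"
    using assms(1) by (simp_all add: field_simps)
  have "q \<le> real j / N"
  proof (cases "real j / N \<le> 1")
    case True
    then show ?thesis
      using Cons.prems(4)[OF j(1)] Cons.prems(1) by auto
  next
    case False
    then show ?thesis
      using Cons.prems(2) by auto
  qed
  then have "q - u \<le> 1 / N"
    using j by simp
  moreover have "mesh_le (1 / N) qs q"
  proof (rule Cons.IH)
    fix j assume j: "q < real j / N" "real j / N \<le> 1"
    have "real j / N \<in> set (q # qs)"
      by (rule Cons.prems(4)) (use j Cons.prems in auto)
    then show "real j / N \<in> set qs"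
      using j by auto
  qed (use Cons.prems in auto)
  ultimately show ?case
    by simp
qed simp

lemma node_sum_le_integral:
  assumes "set_integrable lborel {0..1} w"
    "sorted_wrt (<) qs" "\<forall>q\<in>set qs. u < q \<and> q \<le> 1" "0 \<le> u"
    and "\<And>a b. u \<le> a \<Longrightarrow> a \<le> b \<Longrightarrow> b \<le> 1 \<Longrightarrow> {a<..b} \<inter> set qs = {} \<Longrightarrow> w a = w b"
  shows "node_sum w qs u \<le> (LINT t:{u..1}|lborel. \<bar>w t\<bar>)"
  using assms(2-)
proof (induction qs arbitrary: u)
  case Nil
  show ?case
    unfolding set_lebesgue_integral_def by (auto intro!: Bochner_Integration.integral_nonneg)
next
  case (Cons q qs)
  have uq: "u < q" "q \<le> 1"
    using Cons.prems by auto
  have int: "set_integrable lborel A (\<lambda>t. \<bar>w t\<bar>)" if "A \<in> sets borel" "A \<subseteq> {0..1}" for A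
    using set_integrable_subset[OF set_integrable_abs[OF assms(1)], of A] that by simp
  have "node_sum w qs q \<le> (LINT t:{q..1}|lborel. \<bar>w t\<bar>)"
  proof (rule Cons.IH)
    fix a b assume ab: "q \<le> a" "a \<le> b" "b \<le> 1" "{a<..b} \<inter> set qs = {}"
    show "w a = w b"
      by (rule Cons.prems(4)) (use ab Cons.prems in auto)
  qed (use Cons.prems in auto)
  moreover have "(LINT t:{u..1}|lborel. \<bar>w t\<bar>) = (LINT t:{u..<q}|lborel. \<bar>w t\<bar>) + (LINT t:{q..1}|lborel. \<bar>w t\<bar>)"
  proof -
    have "{u..1} = {u..<q} \<union> {q..1}" "{u..<q} \<inter> {q..1} = {}"
      using uq by auto
    then show ?thesis
      using set_integral_Un[of "{u..<q}" "{q..1}" lborel, OF _ int int] uq Cons.prems(3) by (simp add: subset_iff)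
  qed
  moreover have "(LINT t:{u..<q}|lborel. \<bar>w t\<bar>) = (LINT t:{u..<q}|lborel. \<bar>w u\<bar>)"
  proof (rule set_lebesgue_integral_cong)
    show "\<forall>t. t \<in> {u..<q} \<longrightarrow> \<bar>w t\<bar> = \<bar>w u\<bar>"
    proof (intro allI impI)
      fix t assume t: "t \<in> {u..<q}"
      have "w u = w t"
        by (rule Cons.prems(4)) (use t uq Cons.prems in auto)
      then show "\<bar>w t\<bar> = \<bar>w u\<bar>"
        by simp
    qed
  qed simp
  moreover have "(LINT t:{u..<q}|lborel. \<bar>w u\<bar>) = \<bar>w u\<bar> * (q - u)"
    using uq by (simp add: set_integral_const)
  ultimately show ?case
    by simp
qed

text \<open>Replace \<open>F\<close> by \<open>G\<close> node by node. The contraction transports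
  the difference from the nodes on the right; the new contribution is \<open>(F u - G u) / 2\<close>
  times a variance of at most \<open>K * (q - u)\<close>, plus two remainders of the parameter
  expansion. Those remainders sum to a multiple of the square root of the mesh.\<close>

lemma Psi_diff_le:
  assumes C: "0 \<le> C" "\<And>f m v x. lip1 f \<Longrightarrow> 0 \<le> m \<Longrightarrow> m \<le> 1 \<Longrightarrow> 0 \<le> v \<Longrightarrow> v \<le> 1 \<Longrightarrow>
      \<bar>gauss_step m v f x - gauss_step 0 v f x - m / 2 * gauss_var v f x\<bar> \<le> C * (v * sqrt v)"
    and D: "clock D K" and h: "0 \<le> h" "K * h \<le> 1"
    and F: "\<And>u. 0 \<le> F u" "\<And>u. F u \<le> 1" and G: "\<And>u. 0 \<le> G u" "\<And>u. G u \<le> 1"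
    and "sorted_wrt (<) qs" "\<forall>q\<in>set qs. u < q \<and> q \<le> 1" "0 \<le> u" "u \<le> 1" "mesh_le h qs u"
  shows "\<bar>Psi D F qs u x - Psi D G qs u x\<bar> \<le> K / 2 * node_sum (\<lambda>u. F u - G u) qs u + 2 * C * K * sqrt (K * h) * (1 - u)"
  using assms(10-)
proof (induction qs arbitrary: u x)
  case Nil
  then show ?case
    using C clock_nonneg[OF D] h by simp
next
  case (Cons q qs)
  define v where "v = D q - D u"
  have uq: "u < q" "q \<le> 1" "q - u \<le> h"
    using Cons.prems by auto
  have "0 \<le> v" and vK: "v \<le> K * (q - u)"
    using clockD[OF D, of u q] uq Cons.prems by (auto simp: v_def)
  moreover have "K * (q - u) \<le> K * h"
    using uq clock_nonneg[OF D] by (intro mult_left_mono) auto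
  ultimately have v: "0 \<le> v" "v \<le> 1" "v \<le> K * h"
    using h by linarith+
  let ?f = "Psi D F qs q" and ?g = "Psi D G qs q"
  note lip = lip1_Psi[where F = F and D = D and qs = qs and u = q, OF F(1)] lip1_Psi[where F = G and D = D and qs = qs and u = q, OF G(1)]
  let ?R = "K / 2 * node_sum (\<lambda>u. F u - G u) qs q + 2 * C * K * sqrt (K * h) * (1 - q)"
  have "\<bar>gauss_step (F u) v ?f x - gauss_step (F u) v ?g x\<bar> \<le> ?R"
    by (rule gauss_step_contraction[OF lip Cons.IH F(1)]) (use Cons.prems in auto)
  moreover have "\<bar>gauss_step (F u) v ?g x - gauss_step (G u) v ?g x\<bar> \<le> K / 2 * (\<bar>F u - G u\<bar> * (q - u)) + 2 * C * K * sqrt (K * h) * (q - u)"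
  proof -
    have 1: "\<bar>gauss_step (F u) v ?g x - gauss_step (G u) v ?g x\<bar> \<le> \<bar>(F u - G u) / 2 * gauss_var v ?g x\<bar> + 2 * (C * (v * sqrt v))"
      using C(2)[OF lip(2), of "F u" v x] C(2)[OF lip(2), of "G u" v x] F G v
      by (simp add: diff_divide_distrib left_diff_distrib)
    have 2: "\<bar>(F u - G u) / 2 * gauss_var v ?g x\<bar> \<le> \<bar>F u - G u\<bar> / 2 * (K * (q - u))"
      using gauss_var_bounds[OF lip(2) v(1), of x] vK by (auto simp: abs_mult intro!: mult_mono)
    have "v * sqrt v \<le> K * (q - u) * sqrt (K * h)"
      using v vK by (intro mult_mono) auto
    then have 3: "C * (v * sqrt v) \<le> C * (K * (q - u) * sqrt (K * h))"
      using C(1) by (rule mult_left_mono)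
    show ?thesis
      using 1 2 3 by (simp add: mult_ac)
  qed
  ultimately show ?case
    by (simp add: v_def algebra_simps)
qed

text \<open>Refining the nodes leaves both values unchanged while the mesh tends to 0, so only the
  main term with constant \<open>K / 2\<close> survives. This is the Lipschitz property on which the
  continuous extension \<open>Phi\<close> rests.\<close>

lemma Phi_discrete_lipschitz:
  assumes D: "clock (deriv \<xi>) K" and \<mu>: "\<mu> \<in> discrete_measures01" and \<nu>: "\<nu> \<in> discrete_measures01"
  shows "\<bar>Phi_discrete \<xi> \<mu> x 0 - Phi_discrete \<xi> \<nu> x 0\<bar> \<le> K / 2 * cdf_dist \<mu> \<nu>"
proof -
  obtain C where C: "0 \<le> C" "\<And>f m v x. lip1 f \<Longrightarrow> 0 \<le> m \<Longrightarrow> m \<le> 1 \<Longrightarrow> 0 \<le> v \<Longrightarrow> v \<le> 1 \<Longrightarrow>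
      \<bar>gauss_step m v f x - gauss_step 0 v f x - m / 2 * gauss_var v f x\<bar> \<le> C * (v * sqrt v)"
    using gauss_step_expansion by metis
  note K = clock_nonneg[OF D]
  let ?F = "\<lambda>u. measure \<mu> {0..u}" and ?G = "\<lambda>u. measure \<nu> {0..u}"
  have p: "\<mu> \<in> prob_measures01" "\<nu> \<in> prob_measures01" "finite (atoms \<mu>)" "finite (atoms \<nu>)"
    using \<mu> \<nu> by (auto simp: discrete_measures01_def)
  note sub = atoms_subset[OF p(1)] atoms_subset[OF p(2)]
  have "\<bar>Phi_discrete \<xi> \<mu> x 0 - Phi_discrete \<xi> \<nu> x 0\<bar> \<le> K / 2 * cdf_dist \<mu> \<nu> + 2 * C * K * sqrt (K * (1 / n))"
    if n: "0 < n" "K \<le> real n" for n :: nat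
  proof -
    define gr where "gr = (\<lambda>j. real j / n) ` {1..n}"
    define A where "A = (atoms \<mu> \<union> atoms \<nu> \<union> gr) - {0}"
    define qs where "qs = sorted_list_of_set A"
    have gr: "finite gr" "gr \<subseteq> {0<..1}"
      using n by (auto simp: gr_def divide_simps)
    have A: "finite A" "A \<subseteq> {0<..1}"
      using gr p sub by (auto simp: A_def less_le subset_iff)
    have qs: "sorted_wrt (<) qs" "set qs = A"
      using A by (auto simp: qs_def)
    have un: "(atoms \<mu> - {0}) \<union> A = A" "(atoms \<nu> - {0}) \<union> A = A"
      by (auto simp: A_def)
    have eqF: "Psi (deriv \<xi>) (\<lambda>u. measure \<mu> {0..u}) (sorted_list_of_set ((atoms \<mu> - {0}) \<union> A)) 0 = Psi (deriv \<xi>) (\<lambda>u. measure \<mu> {0..u}) (sorted_list_of_set (atoms \<mu> - {0})) 0"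
    proof (rule Psi_superset[where F = "\<lambda>u. measure \<mu> {0..u}" and A = "atoms \<mu> - {0}" and B = A and D = "deriv \<xi>" and K = K])
      show "measure \<mu> {0..a} = measure \<mu> {0..b}"
        if "0 \<le> a" "a \<le> b" "b \<le> 1" "{a<..b} \<inter> (atoms \<mu> - {0}) = {}" for a b
        by (rule discrete_cdf_const[OF \<mu>]) (use that in auto)
      show "atoms \<mu> - {0} \<union> A \<subseteq> {0<..1}"
        using A(2) by (simp add: un)
    qed (use A(1) p D in \<open>simp_all add: cdf01_1\<close>)
    have eqG: "Psi (deriv \<xi>) (\<lambda>u. measure \<nu> {0..u}) (sorted_list_of_set ((atoms \<nu> - {0}) \<union> A)) 0 = Psi (deriv \<xi>) (\<lambda>u. measure \<nu> {0..u}) (sorted_list_of_set (atoms \<nu> - {0})) 0"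
    proof (rule Psi_superset[where F = "\<lambda>u. measure \<nu> {0..u}" and A = "atoms \<nu> - {0}" and B = A and D = "deriv \<xi>" and K = K])
      show "measure \<nu> {0..a} = measure \<nu> {0..b}"
        if "0 \<le> a" "a \<le> b" "b \<le> 1" "{a<..b} \<inter> (atoms \<nu> - {0}) = {}" for a b
        by (rule discrete_cdf_const[OF \<nu>]) (use that in auto)
      show "atoms \<nu> - {0} \<union> A \<subseteq> {0<..1}"
        using A(2) by (simp add: un)
    qed (use A(1) p D in \<open>simp_all add: cdf01_1\<close>)
    have eq: "Phi_discrete \<xi> \<mu> x 0 = Psi (deriv \<xi>) ?F qs 0 x" "Phi_discrete \<xi> \<nu> x 0 = Psi (deriv \<xi>) ?G qs 0 x"
      unfolding Phi_discrete_eq_Psi[OF \<mu>] Phi_discrete_eq_Psi[OF \<nu>] qs_def eqF[symmetric] eqG[symmetric] un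
      by (rule refl)+
    have "mesh_le (1 / n) qs 0"
    proof (rule mesh_le_grid)
      fix j :: nat assume j: "0 < real j / n" "real j / n \<le> 1"
      then have "j \<in> {1..n}"
        using n by (auto simp: divide_simps split: if_splits)
      then show "real j / n \<in> set qs"
        using j by (auto simp: qs A_def gr_def)
    qed (use n qs A in auto)
    then have "\<bar>Psi (deriv \<xi>) ?F qs 0 x - Psi (deriv \<xi>) ?G qs 0 x\<bar>
       \<le> K / 2 * node_sum (\<lambda>u. ?F u - ?G u) qs 0 + 2 * C * K * sqrt (K * (1 / n)) * (1 - 0)"
      by (intro Psi_diff_le[OF C D]) (use n qs A p in \<open>auto simp: cdf01_le_1\<close>)
    also have "node_sum (\<lambda>u. ?F u - ?G u) qs 0 \<le> (LINT t:{0..1}|lborel. \<bar>?F t - ?G t\<bar>)"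
    proof (rule node_sum_le_integral)
      show "set_integrable lborel {0..1} (\<lambda>u. ?F u - ?G u)"
        using p by (intro set_integral_diff cdf01_set_integrable)
      show "?F a - ?G a = ?F b - ?G b" if ab: "0 \<le> a" "a \<le> b" "b \<le> 1" "{a<..b} \<inter> set qs = {}" for a b
      proof -
        have "0 \<notin> {a<..b}"
          using ab by auto
        then have "{a<..b} \<inter> atoms \<mu> = {}" "{a<..b} \<inter> atoms \<nu> = {}"
          using ab(4) unfolding qs(2) A_def by blast+
        then show ?thesis
          using discrete_cdf_const[OF \<mu> ab(1-3)] discrete_cdf_const[OF \<nu> ab(1-3)] by simp
      qed
    qed (use qs A in auto)
    finally have "\<bar>Psi (deriv \<xi>) ?F qs 0 x - Psi (deriv \<xi>) ?G qs 0 x\<bar> \<le> K / 2 * cdf_dist \<mu> \<nu> + 2 * C * K * sqrt (K * (1 / n)) * (1 - 0)"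
      using K by (simp add: cdf_dist_def mult_left_mono)
    then show ?thesis
      unfolding eq by simp
  qed
  note bound = this
  have "eventually (\<lambda>n. \<bar>Phi_discrete \<xi> \<mu> x 0 - Phi_discrete \<xi> \<nu> x 0\<bar> \<le> K / 2 * cdf_dist \<mu> \<nu> + 2 * C * K * sqrt (K * (1 / real n))) sequentially"
    using eventually_gt_at_top[of 0] eventually_ge_at_top[of "nat \<lceil>K\<rceil>"]
    by eventually_elim (rule bound, auto simp: nat_ceiling_le_eq)
  moreover have "(\<lambda>n. K / 2 * cdf_dist \<mu> \<nu> + 2 * C * K * sqrt (K * (1 / real n))) \<longlonglongrightarrow> K / 2 * cdf_dist \<mu> \<nu> + 2 * C * K * sqrt (K * 0)"
    by (intro tendsto_intros lim_1_over_n)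
  ultimately show ?thesis
    by (intro tendsto_lowerbound[where F = sequentially]) auto
qed

text \<open>Turns a nondecreasing sequence of parameters into an admissible measure, so that
  perturbed sequences become competitors in the minimisation.\<close>

lemma exists_grid_measure:
  fixes M :: "nat \<Rightarrow> real" and N :: nat
  assumes "0 < N" "0 \<le> M 0" "\<And>i j. i \<le> j \<Longrightarrow> j \<le> N \<Longrightarrow> M i \<le> M j" "M N = 1"
  obtains \<nu> where "\<nu> \<in> discrete_measures01" "atoms \<nu> \<subseteq> (\<lambda>j. real j / N) ` {..N}"
    "\<And>j u. j \<le> N \<Longrightarrow> real j / N \<le> u \<Longrightarrow> u < (real j + 1) / N \<Longrightarrow> u \<le> 1 \<Longrightarrow> measure \<nu> {0..u} = M j"
proof -
  define w where "w i = (if i = 0 then M 0 else if i \<le> N then M i - M (i - 1) else 0)" for i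
  have w0: "0 \<le> w i" for i
    using assms(2) assms(3)[of "i - 1" i] by (auto simp: w_def)
  have sumw: "(\<Sum>i\<le>j. w i) = M j" if "j \<le> N" for j
    using that by (induction j) (auto simp: w_def)
  have "(\<integral>\<^sup>+ i. ennreal (w i) \<partial>count_space UNIV) = (\<integral>\<^sup>+ i. ennreal (w i) \<partial>count_space {..N})"
    by (rule nn_integral_count_space_eq) (auto simp: w_def)
  also have "\<dots> = 1"
    by (simp add: nn_integral_count_space_finite sum_ennreal w0 sumw assms(4))
  finally have "(\<integral>\<^sup>+ i. ennreal (w i) \<partial>count_space UNIV) = 1" .
  note pmf = pmf_embed_pmf[OF w0 this]
  define P where "P = embed_pmf w"
  \<comment> \<open>The minimum puts the image into \<open>{0..1}\<close> for every natural number;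
    indices above \<open>N\<close> carry no mass.\<close>
  define g where "g i = min 1 (real i / N)" for i
  have g: "g i \<in> {0..1}" for i
    by (auto simp: g_def)
  define \<nu> where "\<nu> = distr (measure_pmf P) (restrict_space borel {0..1}) g"
  have gm [measurable]: "g \<in> measurable (measure_pmf P) (restrict_space borel {0..1})"
    by (auto simp: space_restrict_space g_def)
  have pr: "\<nu> \<in> prob_measures01"
    unfolding prob_measures01_def \<nu>_def
    using measure_pmf.prob_space_distr[OF gm] by simp
  have meas: "measure \<nu> A = (\<Sum>i\<in>{i. i \<le> N \<and> real i / N \<in> A}. w i)" if "A \<in> sets borel" "A \<subseteq> {0..1}" for A
  proof -
    have "measure \<nu> A = measure (measure_pmf P) (g -` A)"
      unfolding \<nu>_def using that by (subst measure_distr[OF gm]) (simp_all add: sets_restrict_space_iff)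
    also have "\<dots> = measure (measure_pmf P) (g -` A \<inter> {..N})"
    proof -
      have "set_pmf P \<subseteq> {..N}"
        by (auto simp: set_pmf_eq P_def pmf w_def split: if_splits)
      then show ?thesis
        by (intro measure_pmf.finite_measure_eq_AE) (auto simp: AE_measure_pmf_iff)
    qed
    also have "\<dots> = (\<Sum>i\<in>g -` A \<inter> {..N}. w i)"
      by (simp add: measure_measure_pmf_finite P_def pmf)
    also have "g -` A \<inter> {..N} = {i. i \<le> N \<and> real i / N \<in> A}"
      using assms(1) by (auto simp: g_def min_def divide_simps split: if_splits)
    finally show ?thesis .
  qed
  have at: "atoms \<nu> \<subseteq> (\<lambda>j. real j / N) ` {..N}"
  proof
    fix q assume q: "q \<in> atoms \<nu>"
    then have "q \<in> {0..1}"
      using atoms_subset[OF pr] by auto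
    then have "measure \<nu> {q} = (\<Sum>i\<in>{i. i \<le> N \<and> real i / N \<in> {q}}. w i)"
      by (intro meas) auto
    moreover have "measure \<nu> {q} \<noteq> 0"
      using q by (auto simp: atoms_def)
    ultimately have "{i. i \<le> N \<and> real i / N \<in> {q}} \<noteq> {}"
      by (metis (no_types, lifting) sum.empty)
    then show "q \<in> (\<lambda>j. real j / N) ` {..N}"
      by auto
  qed
  then have fin: "finite (atoms \<nu>)"
    by (rule finite_subset) auto
  have "measure \<nu> (atoms \<nu>) = 1"
  proof -
    have as: "atoms \<nu> \<in> sets borel" "atoms \<nu> \<subseteq> {0..1}"
      using fin atoms_subset[OF pr] by (auto intro: borel_closed finite_imp_closed)
    have "(\<Sum>i\<in>{i. i \<le> N \<and> real i / N \<in> atoms \<nu>}. w i) = (\<Sum>i\<le>N. w i)"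
    proof (rule sum.mono_neutral_left)
      show "\<forall>i\<in>{..N} - {i. i \<le> N \<and> real i / N \<in> atoms \<nu>}. w i = 0"
      proof
        fix i assume i: "i \<in> {..N} - {i. i \<le> N \<and> real i / N \<in> atoms \<nu>}"
        then have "measure \<nu> {real i / N} = 0"
          by (auto simp: atoms_def zero_less_measure_iff)
        moreover have "measure \<nu> {real i / N} = (\<Sum>k\<in>{k. k \<le> N \<and> real k / N \<in> {real i / N}}. w k)"
          by (rule meas) (use i assms(1) in \<open>auto simp: divide_simps\<close>)
        moreover have "{k. k \<le> N \<and> real k / N \<in> {real i / N}} = {i}"
          using i assms(1) by auto
        ultimately show "w i = 0"
          by simp
      qed
    qed auto
    then show ?thesis
      using meas[OF as] sumw[of N] assms(4) by simp
  qed
  then have disc: "\<nu> \<in> discrete_measures01"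
    using pr fin by (simp add: discrete_measures01_def)
  have cdf: "measure \<nu> {0..u} = M j"
    if "j \<le> N" "real j / N \<le> u" "u < (real j + 1) / N" "u \<le> 1" for j u
  proof -
    have "measure \<nu> {0..u} = (\<Sum>i\<in>{i. i \<le> N \<and> real i / N \<in> {0..u}}. w i)"
      by (rule meas) (use that in auto)
    also have "{i. i \<le> N \<and> real i / N \<in> {0..u}} = {..j}"
    proof (intro equalityI subsetI)
      fix i assume "i \<in> {i. i \<le> N \<and> real i / N \<in> {0..u}}"
      then have "real i / N < (real j + 1) / N"
        using that by auto
      then have "real i < real j + 1"
        using assms(1) by (simp add: divide_less_cancel)
      then show "i \<in> {..j}"
        by simp
    next
      fix i assume "i \<in> {..j}"
      then have "real i / N \<le> real j / N"
        using assms(1) by (simp add: divide_right_mono)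
      then show "i \<in> {i. i \<le> N \<and> real i / N \<in> {0..u}}"
        using that \<open>i \<in> {..j}\<close> by auto
    qed
    finally show ?thesis
      using sumw[OF that(1)] by simp
  qed
  show ?thesis
    by (rule that[OF disc at cdf])
qed

section \<open>Uniform grids\<close>

lemma grid_cell_subset:
  fixes N :: nat
  assumes "j < N"
  shows "{real j / N..<(real j + 1) / N} \<subseteq> {0..1}"
proof
  fix x assume x: "x \<in> {real j / N..<(real j + 1) / N}"
  have "0 \<le> real j / N" "(real j + 1) / N \<le> 1"
    using assms by (auto simp: divide_simps)
  with x show "x \<in> {0..1}"
    unfolding atLeastAtMost_iff atLeastLessThan_iff by linarith
qed

lemma set_integral_grid:
  fixes h :: "real \<Rightarrow> real" and N :: nat
  assumes "0 < N" and h: "set_integrable lborel {0..1} h"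
  shows "(LINT u:{0..1}|lborel. h u) = (\<Sum>j<N. LINT u:{real j / N..<(real j + 1) / N}|lborel. h u)"
proof -
  have int: "set_integrable lborel A h" if "A \<in> sets borel" "A \<subseteq> {0..1}" for A
    using set_integrable_subset[OF h] that by simp
  have partial: "(LINT u:{0..<real k / N}|lborel. h u) = (\<Sum>j<k. LINT u:{real j / N..<(real j + 1) / N}|lborel. h u)"
    if "k \<le> N" for k
    using that
  proof (induction k)
    case (Suc k)
    have le: "real k / N \<le> (real k + 1) / N" "(real k + 1) / N \<le> 1"
      using Suc.prems assms(1) by (auto simp: divide_simps)
    have eq: "{0..<real (Suc k) / N} = {0..<real k / N} \<union> {real k / N..<(real k + 1) / N}"
      "{0..<real k / N} \<inter> {real k / N..<(real k + 1) / N} = {}"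
      using ivl_disj_un_two(3)[of 0 "real k / N" "(real k + 1) / N"] le by (auto simp: add.commute)
    have "set_integrable lborel {0..<real k / N} h"
      using le by (intro int) auto
    moreover have "set_integrable lborel {real k / N..<(real k + 1) / N} h"
      using Suc.prems by (intro int grid_cell_subset) auto
    ultimately have this: "set_integrable lborel {0..<real k / N} h" "set_integrable lborel {real k / N..<(real k + 1) / N} h"
      by simp_all
    from set_integral_Un[OF eq(2) this(1,2)] show ?case
      using Suc by (simp only: eq(1)) simp
  qed (simp add: set_lebesgue_integral_def)
  have "(LINT u:{0..1}|lborel. h u) = (LINT u:{0..<1}|lborel. h u) + (LINT u:{1}|lborel. h u)"
  proof -
    have e: "{0..<1} \<union> {1::real} = {0..1}" "{0..<1} \<inter> {1::real} = {}"
      by auto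
    have "set_integrable lborel {0..<1} h" "set_integrable lborel {1} h"
      by (rule int; force)+
    from set_integral_Un[OF e(2) this] show ?thesis
      by (simp only: e(1))
  qed
  also have "(LINT u:{1}|lborel. h u) = 0"
    by (simp add: set_integral_at_point)
  finally show ?thesis
    using partial[of N] assms(1) by simp
qed

lemma set_integral_Ico_const:
  fixes a b c :: real
  assumes "a \<le> b" "\<And>t. a \<le> t \<Longrightarrow> t < b \<Longrightarrow> g t = c * h t"
  shows "(LINT t:{a..<b}|lborel. g t) = c * (LINT t:{a..<b}|lborel. h t)"
proof -
  have "(LINT t:{a..<b}|lborel. g t) = (LINT t:{a..<b}|lborel. c * h t)"
    by (rule set_lebesgue_integral_cong) (use assms in auto)
  then show ?thesis
    by simp
qed

text \<open>\<open>\<nu>\<close> moves the mass of each cell to its right end. Inside a cell the two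
  distribution functions differ by at most the increment over the cell, and the increments telescope
  to at most 1.\<close>

lemma exists_discrete_approx:
  fixes N :: nat
  assumes \<mu>: "\<mu> \<in> prob_measures01" and N: "0 < N"
  obtains \<nu> where "\<nu> \<in> discrete_measures01" "cdf_dist \<nu> \<mu> \<le> 1 / N"
    "atoms \<nu> \<subseteq> (\<lambda>j. real j / N) ` {..N}"
    "\<And>j u. j \<le> N \<Longrightarrow> real j / N \<le> u \<Longrightarrow> u < (real j + 1) / N \<Longrightarrow> u \<le> 1 \<Longrightarrow> measure \<nu> {0..u} = measure \<mu> {0..real j / N}"
proof -
  define M where "M j = measure \<mu> {0..real j / N}" for j :: nat
  have mono: "M i \<le> M j" if "i \<le> j" "j \<le> N" for i j
    unfolding M_def using that N by (intro cdf01_mono \<mu>) (auto simp: divide_simps)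
  have "M N = 1"
    using N cdf01_1[OF \<mu>] by (simp add: M_def)
  then obtain \<nu> where \<nu>: "\<nu> \<in> discrete_measures01" "atoms \<nu> \<subseteq> (\<lambda>j. real j / N) ` {..N}"
    "\<And>j u. j \<le> N \<Longrightarrow> real j / N \<le> u \<Longrightarrow> u < (real j + 1) / N \<Longrightarrow> u \<le> 1 \<Longrightarrow> measure \<nu> {0..u} = M j"
    using exists_grid_measure[of N M] N mono by (auto simp: M_def)
  have p: "\<nu> \<in> prob_measures01"
    using \<nu>(1) by (simp add: discrete_measures01_def)
  have "cdf_dist \<nu> \<mu> = (\<Sum>j<N. LINT u:{real j / N..<(real j + 1) / N}|lborel. \<bar>measure \<nu> {0..u} - measure \<mu> {0..u}\<bar>)"
    unfolding cdf_dist_def by (rule set_integral_grid[OF N cdf_dist_integrable[OF p \<mu>]])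
  also have "\<dots> \<le> (\<Sum>j<N. (M (Suc j) - M j) * (1 / N))"
  proof (rule sum_mono)
    fix j assume "j \<in> {..<N}"
    then have j: "j < N" by simp
    then have le: "(real j + 1) / N \<le> 1" "0 \<le> real j / N" "real j / N \<le> (real j + 1) / N"
      using N by (auto simp: divide_simps)
    let ?I = "{real j / N..<(real j + 1) / N}"
    have "(LINT u:?I|lborel. \<bar>measure \<nu> {0..u} - measure \<mu> {0..u}\<bar>) \<le> (LINT u:?I|lborel. M (Suc j) - M j)"
    proof (rule set_integral_mono)
      show "set_integrable lborel ?I (\<lambda>u. \<bar>measure \<nu> {0..u} - measure \<mu> {0..u}\<bar>)"
        by (rule set_integrable_subset[OF cdf_dist_integrable[OF p \<mu>]]) (use grid_cell_subset[OF j] in auto)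
      show "set_integrable lborel ?I (\<lambda>u. M (Suc j) - M j)"
        unfolding set_integrable_def using le by (intro integrable_scaleR_left integrable_real_indicator) auto
      fix u assume u: "u \<in> ?I"
      have u01: "0 \<le> u" "u \<le> 1"
        using subsetD[OF grid_cell_subset[OF j]] u unfolding atLeastAtMost_iff by blast+
      have "M j \<le> measure \<mu> {0..u}"
        unfolding M_def by (rule cdf01_mono[OF \<mu>]) (use u u01 le in auto)
      moreover have "measure \<mu> {0..u} \<le> M (Suc j)"
        unfolding M_def by (rule cdf01_mono[OF \<mu> u01(1)]) (use u le in \<open>auto simp: add.commute\<close>)
      moreover have "measure \<nu> {0..u} = M j"
        by (rule \<nu>(3)[OF _ _ _ u01(2)]) (use u j in auto)
      ultimately show "\<bar>measure \<nu> {0..u} - measure \<mu> {0..u}\<bar> \<le> M (Suc j) - M j"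
        by simp
    qed
    also have "\<dots> = (M (Suc j) - M j) * (1 / N)"
      using le by (simp add: set_integral_const diff_divide_distrib[symmetric])
    finally show "(LINT u:?I|lborel. \<bar>measure \<nu> {0..u} - measure \<mu> {0..u}\<bar>) \<le> (M (Suc j) - M j) * (1 / N)" .
  qed
  also have "\<dots> = (M N - M 0) * (1 / N)"
    by (simp only: sum_lessThan_telescope sum_distrib_right[symmetric])
  also have "\<dots> \<le> 1 * (1 / N)"
    using \<open>M N = 1\<close> by (intro mult_right_mono) (auto simp: M_def)
  finally have "cdf_dist \<nu> \<mu> \<le> 1 / N"
    by simp
  then show ?thesis
    using that[OF \<nu>(1) _ \<nu>(2)] \<nu>(3) by (simp add: M_def)
qed

text \<open>Makes the \<open>Lim\<close> in \<open>Phi\<close> usable: the Lipschitz bound gives a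
  Cauchy sequence and thus a limit, and the existence of discrete approximations makes the filter
  proper, so that the limit is unique.\<close>

lemma Phi_discrete_approx:
  assumes D: "clock (deriv \<xi>) K" and \<mu>: "\<mu> \<in> prob_measures01" and \<nu>: "\<nu> \<in> discrete_measures01"
  shows "\<bar>Phi_discrete \<xi> \<nu> x 0 - Phi \<xi> \<mu> x 0\<bar> \<le> K / 2 * cdf_dist \<nu> \<mu>"
proof -
  note K = clock_nonneg[OF D]
  let ?V = "\<lambda>\<nu>. Phi_discrete \<xi> \<nu> x 0"
  let ?Fil = "inf (filtercomap (\<lambda>\<nu>. cdf_dist \<nu> \<mu>) (nhds 0)) (principal discrete_measures01)"
  have "\<forall>n. \<exists>\<kappa>\<in>discrete_measures01. cdf_dist \<kappa> \<mu> \<le> 1 / real (Suc n)"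
    using exists_discrete_approx[OF \<mu>, of "Suc n" for n] by (metis zero_less_Suc)
  then obtain \<kappa> where \<kappa>: "\<And>n. \<kappa> n \<in> discrete_measures01" "\<And>n. cdf_dist (\<kappa> n) \<mu> \<le> 1 / real (Suc n)"
    by metis
  have lip: "\<bar>?V \<alpha> - ?V \<gamma>\<bar> \<le> K / 2 * (cdf_dist \<alpha> \<mu> + cdf_dist \<gamma> \<mu>)"
    if "\<alpha> \<in> discrete_measures01" "\<gamma> \<in> discrete_measures01" for \<alpha> \<gamma>
  proof -
    have "\<alpha> \<in> prob_measures01" "\<gamma> \<in> prob_measures01"
      using that by (auto simp: discrete_measures01_def)
    then have "cdf_dist \<alpha> \<gamma> \<le> cdf_dist \<alpha> \<mu> + cdf_dist \<gamma> \<mu>"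
      using cdf_dist_triangle[of \<alpha> \<mu> \<gamma>] \<mu> by (simp add: cdf_dist_commute[of \<gamma>])
    then show ?thesis
      using Phi_discrete_lipschitz[OF D that, of x] K by (smt (verit, best) mult_left_mono divide_nonneg_pos)
  qed
  have conv0: "(\<lambda>n. 1 / real (Suc n)) \<longlonglongrightarrow> 0"
    using LIMSEQ_Suc[OF lim_1_over_n] by simp
  have "Cauchy (\<lambda>n. ?V (\<kappa> n))"
  proof (rule metric_CauchyI)
    fix e :: real assume "0 < e"
    define d where "d = e / (K + 1)"
    have d: "0 < d" "e = d * (K + 1)"
      using K \<open>0 < e\<close> by (auto simp: d_def)
    from order_tendstoD(2)[OF conv0 d(1)] obtain n0 where n0: "\<And>n. n \<ge> n0 \<Longrightarrow> 1 / real (Suc n) < d"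
      unfolding eventually_sequentially by blast
    show "\<exists>n0. \<forall>m\<ge>n0. \<forall>n\<ge>n0. dist (?V (\<kappa> m)) (?V (\<kappa> n)) < e"
    proof (intro exI allI impI)
      fix m n assume mn: "m \<ge> n0" "n \<ge> n0"
      have "\<bar>?V (\<kappa> m) - ?V (\<kappa> n)\<bar> \<le> K / 2 * (cdf_dist (\<kappa> m) \<mu> + cdf_dist (\<kappa> n) \<mu>)"
        by (intro lip \<kappa>)
      also have "\<dots> \<le> K / 2 * (d + d)"
        using K order_trans[OF \<kappa>(2)[of m] less_imp_le[OF n0[OF mn(1)]]] order_trans[OF \<kappa>(2)[of n] less_imp_le[OF n0[OF mn(2)]]]
        by (intro mult_left_mono add_mono) auto
      also have "\<dots> < e"
        using d by (simp add: algebra_simps)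
      finally show "dist (?V (\<kappa> m)) (?V (\<kappa> n)) < e"
        by (simp add: dist_real_def)
    qed
  qed
  then obtain L where L: "(\<lambda>n. ?V (\<kappa> n)) \<longlonglongrightarrow> L"
    using Cauchy_convergent convergent_def by blast
  have VL: "\<bar>?V \<alpha> - L\<bar> \<le> K / 2 * cdf_dist \<alpha> \<mu>" if "\<alpha> \<in> discrete_measures01" for \<alpha>
  proof (rule LIMSEQ_le)
    show "(\<lambda>n. \<bar>?V \<alpha> - ?V (\<kappa> n)\<bar>) \<longlonglongrightarrow> \<bar>?V \<alpha> - L\<bar>"
      by (intro tendsto_intros L)
    show "(\<lambda>n. K / 2 * (cdf_dist \<alpha> \<mu> + 1 / real (Suc n))) \<longlonglongrightarrow> K / 2 * cdf_dist \<alpha> \<mu>"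
      using tendsto_mult[OF tendsto_const tendsto_add[OF tendsto_const conv0], of "K / 2" "cdf_dist \<alpha> \<mu>"] by simp
    show "\<exists>N. \<forall>n\<ge>N. \<bar>?V \<alpha> - ?V (\<kappa> n)\<bar> \<le> K / 2 * (cdf_dist \<alpha> \<mu> + 1 / real (Suc n))"
      using lip[OF that \<kappa>(1)] \<kappa>(2) K
      by (intro exI[of _ 0] allI impI order_trans[OF lip[OF that \<kappa>(1)]] mult_left_mono add_left_mono) auto
  qed
  have "?Fil \<noteq> bot"
  proof
    assume "?Fil = bot"
    then have "eventually (\<lambda>_. False) ?Fil"
      by simp
    then have "eventually (\<lambda>\<nu>. \<nu> \<in> discrete_measures01 \<longrightarrow> False) (filtercomap (\<lambda>\<nu>. cdf_dist \<nu> \<mu>) (nhds 0))"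
      by (simp add: eventually_inf_principal)
    then obtain Q where Q: "eventually Q (nhds 0)" "\<And>\<nu>. Q (cdf_dist \<nu> \<mu>) \<Longrightarrow> \<nu> \<notin> discrete_measures01"
      by (auto simp: eventually_filtercomap)
    have "(\<lambda>n. cdf_dist (\<kappa> n) \<mu>) \<longlonglongrightarrow> 0"
      by (rule tendsto_sandwich[OF _ _ tendsto_const conv0]) (use \<kappa>(2) in \<open>auto simp: cdf_dist_nonneg\<close>)
    then have "eventually (\<lambda>n. Q (cdf_dist (\<kappa> n) \<mu>)) sequentially"
      using Q(1) by (rule eventually_compose_filterlim[rotated])
    then obtain n where "Q (cdf_dist (\<kappa> n) \<mu>)"
      by (auto simp: eventually_sequentially)
    with Q(2) \<kappa>(1) show False
      by blast
  qed
  moreover have "(?V \<longlongrightarrow> L) ?Fil"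
  proof (rule tendstoI)
    fix e :: real assume "0 < e"
    then have "0 < e / (K + 1)"
      using K by simp
    then have "eventually (\<lambda>d. d < e / (K + 1)) (nhds 0)"
      by (rule order_tendstoD(2)[OF filterlim_ident])
    then have "eventually (\<lambda>\<nu>. cdf_dist \<nu> \<mu> < e / (K + 1)) (filtercomap (\<lambda>\<nu>. cdf_dist \<nu> \<mu>) (nhds 0))"
      by (rule eventually_filtercomapI)
    then show "eventually (\<lambda>\<nu>. dist (?V \<nu>) L < e) ?Fil"
      unfolding eventually_inf_principal
    proof eventually_elim
      case (elim \<alpha>)
      show ?case
      proof
        assume a: "\<alpha> \<in> discrete_measures01"
        have "\<bar>?V \<alpha> - L\<bar> \<le> K / 2 * (e / (K + 1))"
          by (rule order_trans[OF VL[OF a]], rule mult_left_mono) (use elim K in auto)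
        also have "\<dots> = e * (K / (2 * (K + 1)))"
          by simp
        also have "\<dots> < e * 1"
          using K \<open>0 < e\<close> by (intro mult_strict_left_mono) (auto simp: divide_simps)
        finally have "\<bar>?V \<alpha> - L\<bar> < e"
          by simp
        then show "dist (?V \<alpha>) L < e"
          by (simp add: dist_real_def)
      qed
    qed
  qed
  ultimately have "Phi \<xi> \<mu> x 0 = L"
    unfolding Phi_def by (rule tendsto_Lim)
  then show ?thesis
    using VL[OF \<nu>] by simp
qed

text \<open>The recursion on the uniform grid with parameters \<open>m\<close> and variances
  \<open>v\<close> detached from any measure. The last node is 1, which is why the start has no
  additive constant.\<close>

definition chain :: "(nat \<Rightarrow> real) \<Rightarrow> (nat \<Rightarrow> real) \<Rightarrow> nat \<Rightarrow> nat \<Rightarrow> real \<Rightarrow> real" where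
  "chain m v N i = foldr (\<lambda>j. gauss_step (m j) (v j)) [i..<N] (\<lambda>x. ln (cosh x))"

lemma chain_N: "chain m v N N = (\<lambda>x. ln (cosh x))"
  by (simp add: chain_def)

lemma chain_step: "i < N \<Longrightarrow> chain m v N i = gauss_step (m i) (v i) (chain m v N (Suc i))"
  by (simp add: chain_def upt_conv_Cons)

lemma Phi_discrete_grid:
  fixes N :: nat
  assumes D: "clock (deriv \<xi>) K" and N: "0 < N" and \<nu>: "\<nu> \<in> discrete_measures01"
    "atoms \<nu> \<subseteq> (\<lambda>j. real j / N) ` {..N}" "\<And>j. j < N \<Longrightarrow> measure \<nu> {0..real j / N} = m j"
  shows "Phi_discrete \<xi> \<nu> x 0 = chain m (\<lambda>j. deriv \<xi> ((real j + 1) / N) - deriv \<xi> (real j / N)) N 0 x"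
proof -
  let ?F = "\<lambda>u. measure \<nu> {0..u}" and ?D = "deriv \<xi>"
  let ?v = "\<lambda>j. ?D ((real j + 1) / N) - ?D (real j / N)"
  have p: "\<nu> \<in> prob_measures01" "finite (atoms \<nu>)"
    using \<nu>(1) by (auto simp: discrete_measures01_def)
  define gr where "gr = (\<lambda>j. real j / N) ` {1..N}"
  define xs where "xs i = map (\<lambda>j. real j / N) [Suc i..<Suc N]" for i
  have gr: "finite gr" "gr \<subseteq> {0<..1}"
    using N by (auto simp: gr_def divide_simps)
  have un: "(atoms \<nu> - {0}) \<union> gr = gr"
    using \<nu>(2) by (force simp: gr_def image_iff)
  have "sorted_list_of_set gr = xs 0"
  proof -
    have "set (xs 0) = gr"
      by (auto simp: xs_def gr_def simp del: upt_Suc)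
    moreover have "sorted_wrt (<) (xs 0)"
      using N by (auto simp: xs_def sorted_wrt_map divide_strict_right_mono simp del: upt_Suc
          intro!: sorted_wrt_mono_rel[OF _ sorted_wrt_upt])
    ultimately show ?thesis
      using sorted_list_of_set.idem_if_sorted_distinct[of "xs 0"] by (simp add: strict_sorted_iff)
  qed
  moreover have "Psi ?D ?F (sorted_list_of_set ((atoms \<nu> - {0}) \<union> gr)) 0 = Psi ?D ?F (sorted_list_of_set (atoms \<nu> - {0})) 0"
  proof (rule Psi_superset[where F = "?F" and A = "atoms \<nu> - {0}" and B = gr and D = "?D" and K = K])
    show "measure \<nu> {0..a} = measure \<nu> {0..b}"
      if "0 \<le> a" "a \<le> b" "b \<le> 1" "{a<..b} \<inter> (atoms \<nu> - {0}) = {}" for a b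
      by (rule discrete_cdf_const[OF \<nu>(1)]) (use that in auto)
    show "atoms \<nu> - {0} \<union> gr \<subseteq> {0<..1}"
      using gr(2) by (simp add: un)
  qed (use gr(1) p D in \<open>simp_all add: cdf01_1\<close>)
  ultimately have "Phi_discrete \<xi> \<nu> x 0 = Psi ?D ?F (xs 0) 0 x"
    by (simp only: Phi_discrete_eq_Psi[OF \<nu>(1)] un)
  moreover have ch: "Psi ?D ?F (xs i) (real i / N) = chain m ?v N i" if "i \<le> N" for i
    using that
  proof (induction i rule: inc_induct)
    case base
    then show ?case
      using N by (simp add: xs_def chain_N)
  next
    case (step i)
    have "xs i = (real i + 1) / N # xs (Suc i)"
      using step by (simp add: xs_def upt_conv_Cons add.commute del: upt_Suc)
    then show ?case
      using step \<nu>(3)[of i] by (simp add: chain_step add.commute)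
  qed
  ultimately show ?thesis
    using ch[of 0] by simp
qed

section \<open>Minimality on the uniform grid\<close>

lemma set_integrable_mult_mono_on:
  fixes g F :: "real \<Rightarrow> real"
  assumes "continuous_on {0..1} g" "mono_on {0..1} F" "\<And>u. \<bar>F u\<bar> \<le> 1"
  shows "set_integrable lborel {0..1} (\<lambda>u. g u * F u)"
proof -
  have g: "integrable lborel (\<lambda>u. indicator {0..1} u *\<^sub>R g u)"
    using borel_integrable_atLeastAtMost'[OF assms(1)] by (simp add: set_integrable_def)
  have F: "integrable lborel (\<lambda>u. indicator {0..1} u *\<^sub>R F u)"
    using mono_on_set_integrable[OF assms(2)] by (simp add: set_integrable_def)
  have "integrable lborel (\<lambda>u. (indicator {0..1} u *\<^sub>R g u) * (indicator {0..1} u *\<^sub>R F u))"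
  proof (rule Bochner_Integration.integrable_bound[OF g])
    show "AE u in lborel. norm (indicator {0..1} u *\<^sub>R g u * indicator {0..1} u *\<^sub>R F u) \<le> norm (indicator {0..1} u *\<^sub>R g u)"
      using assms(3) by (intro AE_I2) (auto simp: indicator_def abs_mult intro: mult_left_le)
  qed (intro borel_measurable_times borel_measurable_integrable g F)
  also have "(\<lambda>u. (indicator {0..1} u *\<^sub>R g u) * (indicator {0..1} u *\<^sub>R F u)) = (\<lambda>u. indicator {0..1} u *\<^sub>R (g u * F u))"
    by (auto simp: indicator_def fun_eq_iff)
  finally show ?thesis
    by (simp add: set_integrable_def)
qed

text \<open>On a cell the factor \<open>u\<close> lies between the end points, and the integral of
  \<open>D'\<close> is the increment of \<open>D\<close>. This compares the linear term of the
  functional with a sum over nodes.\<close>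

lemma weighted_increment_bounds:
  fixes a b :: real
  assumes ab: "0 \<le> a" "a \<le> b" "b \<le> 1"
    and D: "\<And>u. 0 \<le> u \<Longrightarrow> u \<le> 1 \<Longrightarrow> (D has_real_derivative D' u) (at u)"
    and c: "\<And>u. 0 \<le> u \<Longrightarrow> u \<le> 1 \<Longrightarrow> isCont D' u" "\<And>u. 0 \<le> u \<Longrightarrow> u \<le> 1 \<Longrightarrow> 0 \<le> D' u"
  shows "a * (D b - D a) \<le> (LINT u:{a..<b}|lborel. u * D' u)"
    "(LINT u:{a..<b}|lborel. u * D' u) \<le> b * (D b - D a)"
proof -
  have cont: "continuous_on {0..1} D'"
    using c by (auto intro!: continuous_at_imp_continuous_on)
  have contg: "continuous_on {0..1} (\<lambda>u. u * D' u)"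
    by (intro continuous_intros cont)
  have sub: "{a..<b} \<subseteq> {0..1}"
    using ab by auto
  have i: "set_integrable lborel {a..<b} D'" "set_integrable lborel {a..<b} (\<lambda>u. u * D' u)"
    using set_integrable_subset[OF borel_integrable_atLeastAtMost'[OF cont], of "{a..<b}"]
      set_integrable_subset[OF borel_integrable_atLeastAtMost', of 0 1 "\<lambda>u. u * D' u" "{a..<b}"] cont sub
    using contg by auto
  have "(LINT u:{a..<b}|lborel. D' u) = (LINT u:{a..b}|lborel. D' u)"
    by (rule set_integral_discrete_difference[of "{b}"]) auto
  also have "\<dots> = D b - D a"
    using integral_FTC_Icc_real[of a b D D'] D c ab by (simp add: set_lebesgue_integral_def mult.commute)
  finally have I: "(LINT u:{a..<b}|lborel. D' u) = D b - D a" .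
  have "(LINT u:{a..<b}|lborel. a * D' u) \<le> (LINT u:{a..<b}|lborel. u * D' u)"
    by (rule set_integral_mono) (use i c ab in \<open>auto intro!: mult_right_mono\<close>)
  then show "a * (D b - D a) \<le> (LINT u:{a..<b}|lborel. u * D' u)"
    by (simp add: I)
  have "(LINT u:{a..<b}|lborel. u * D' u) \<le> (LINT u:{a..<b}|lborel. b * D' u)"
    by (rule set_integral_mono) (use i c ab in \<open>auto intro!: mult_right_mono\<close>)
  then show "(LINT u:{a..<b}|lborel. u * D' u) \<le> b * (D b - D a)"
    by (simp add: I)
qed

text \<open>Three errors, each at most half of \<open>K / N\<close>: discretising
  \<open>\<mu>\<close> inside \<open>Phi\<close>, discretising it in the linear term, and replacing
  \<open>u\<close> by the left node of its cell. The resulting \<open>3 / 2\<close> is rounded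
  up.\<close>

lemma parisi_grid_variation:
  fixes \<xi> :: "real \<Rightarrow> real" and N :: nat and m :: "nat \<Rightarrow> real"
  defines "D \<equiv> deriv \<xi>" and "D' \<equiv> (deriv ^^ 2) \<xi>"
  assumes clock: "clock D K"
    and D: "\<And>u. 0 \<le> u \<Longrightarrow> u \<le> 1 \<Longrightarrow> (D has_real_derivative D' u) (at u)"
    and c: "\<And>u. 0 \<le> u \<Longrightarrow> u \<le> 1 \<Longrightarrow> isCont D' u" "\<And>u. 0 \<le> u \<Longrightarrow> u \<le> 1 \<Longrightarrow> 0 \<le> D' u"
      "\<And>u. 0 \<le> u \<Longrightarrow> u \<le> 1 \<Longrightarrow> D' u \<le> K"
    and min: "parisi_measure \<xi> \<mu>"
    and N: "0 < N" and m: "0 \<le> m 0" "\<And>i j. i \<le> j \<Longrightarrow> j \<le> N \<Longrightarrow> m i \<le> m j" "m N = 1"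
  defines "F \<equiv> (\<lambda>j::nat. measure \<mu> {0..real j / N})"
    and "v \<equiv> (\<lambda>j::nat. D ((real j + 1) / N) - D (real j / N))"
  shows "chain F v N 0 0 + (\<Sum>j<N. (m j - F j) * (real j / N) * v j) / 2 - 3 * (K / N) \<le> chain m v N 0 0"
proof -
  note K = clock_nonneg[OF clock]
  have opt: "\<not> parisi_functional \<xi> \<nu> < parisi_functional \<xi> \<mu>" if "\<nu> \<in> prob_measures01" for \<nu>
    using min that by (auto simp: parisi_measure_def is_arg_min_def)
  have \<mu>: "\<mu> \<in> prob_measures01"
    using min by (auto simp: parisi_measure_def is_arg_min_def)
  obtain \<nu> where \<nu>: "\<nu> \<in> discrete_measures01" "cdf_dist \<nu> \<mu> \<le> 1 / N"
    "atoms \<nu> \<subseteq> (\<lambda>j. real j / N) ` {..N}"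
    "\<And>j u. j \<le> N \<Longrightarrow> real j / N \<le> u \<Longrightarrow> u < (real j + 1) / N \<Longrightarrow> u \<le> 1 \<Longrightarrow> measure \<nu> {0..u} = measure \<mu> {0..real j / N}"
    using exists_discrete_approx[OF \<mu> N] by metis
  obtain \<kappa> where \<kappa>: "\<kappa> \<in> discrete_measures01" "atoms \<kappa> \<subseteq> (\<lambda>j. real j / N) ` {..N}"
    "\<And>j u. j \<le> N \<Longrightarrow> real j / N \<le> u \<Longrightarrow> u < (real j + 1) / N \<Longrightarrow> u \<le> 1 \<Longrightarrow> measure \<kappa> {0..u} = m j"
    using exists_grid_measure[OF N m(1) m(2) m(3)] by metis
  have p: "\<nu> \<in> prob_measures01" "\<kappa> \<in> prob_measures01"
    using \<nu>(1) \<kappa>(1) by (auto simp: discrete_measures01_def)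
  have node: "real j / N \<le> 1" "real j / N < (real j + 1) / N" "(real j + 1) / N \<le> 1" "0 \<le> real j / N" if "j < N" for j
    using that N by (auto simp: divide_simps)
  \<comment> \<open>No error arises here: \<open>\<kappa>\<close> is itself discrete and has
    distance 0 from itself.\<close>
  have ph\<kappa>: "Phi \<xi> \<kappa> 0 0 = chain m v N 0 0"
  proof -
    have "Phi_discrete \<xi> \<kappa> 0 0 = chain m (\<lambda>j. deriv \<xi> ((real j + 1) / N) - deriv \<xi> (real j / N)) N 0 0"
      by (rule Phi_discrete_grid[OF clock[unfolded D_def] N \<kappa>(1,2)]) (use node in \<open>auto intro!: \<kappa>(3)\<close>)
    then show ?thesis
      using Phi_discrete_approx[OF clock[unfolded D_def] p(2) \<kappa>(1), of 0]
      by (simp add: v_def D_def cdf_dist_def)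
  qed
  have ph\<nu>: "\<bar>chain F v N 0 0 - Phi \<xi> \<mu> 0 0\<bar> \<le> K / 2 * (1 / N)"
  proof -
    have "Phi_discrete \<xi> \<nu> 0 0 = chain F (\<lambda>j. deriv \<xi> ((real j + 1) / N) - deriv \<xi> (real j / N)) N 0 0"
      by (rule Phi_discrete_grid[OF clock[unfolded D_def] N \<nu>(1,3)])
        (use node in \<open>auto simp: F_def intro!: \<nu>(4)\<close>)
    then have "\<bar>chain F v N 0 0 - Phi \<xi> \<mu> 0 0\<bar> \<le> K / 2 * cdf_dist \<nu> \<mu>"
      using Phi_discrete_approx[OF clock[unfolded D_def] \<mu> \<nu>(1), of 0] by (simp add: v_def D_def)
    also have "\<dots> \<le> K / 2 * (1 / N)"
      using \<nu>(2) K by (intro mult_left_mono) auto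
    finally show ?thesis .
  qed
  define T where "T \<alpha> = (LINT u:{0..1}|lborel. u * D' u * measure \<alpha> {0..u})" for \<alpha>
  have P: "parisi_functional \<xi> \<alpha> = Phi \<xi> \<alpha> 0 0 - T \<alpha> / 2" for \<alpha>
    by (simp add: parisi_functional_def T_def D'_def)
  have contg: "continuous_on {0..1} (\<lambda>u. u * D' u)"
    using c by (auto intro!: continuous_intros continuous_at_imp_continuous_on)
  have Ti: "set_integrable lborel {0..1} (\<lambda>u. u * D' u * measure \<alpha> {0..u})" if "\<alpha> \<in> prob_measures01" for \<alpha>
    using that by (intro set_integrable_mult_mono_on contg) (auto simp: monotone_on_def cdf01_mono cdf01_le_1)
  have T1: "\<bar>T \<nu> - T \<mu>\<bar> \<le> K * (1 / N)"
  proof -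
    have "T \<nu> - T \<mu> = (LINT u:{0..1}|lborel. u * D' u * measure \<nu> {0..u} - u * D' u * measure \<mu> {0..u})"
      unfolding T_def by (rule set_integral_diff(2)[symmetric]) (intro Ti p \<mu>)+
    also have "\<bar>\<dots>\<bar> \<le> (LINT u:{0..1}|lborel. \<bar>u * D' u * measure \<nu> {0..u} - u * D' u * measure \<mu> {0..u}\<bar>)"
      using set_integral_norm_bound[OF set_integral_diff(1)[OF Ti[OF p(1)] Ti[OF \<mu>]]] by simp
    also have "\<dots> \<le> (LINT u:{0..1}|lborel. K * \<bar>measure \<nu> {0..u} - measure \<mu> {0..u}\<bar>)"
    proof (rule set_integral_mono)
      show "set_integrable lborel {0..1} (\<lambda>u. \<bar>u * D' u * measure \<nu> {0..u} - u * D' u * measure \<mu> {0..u}\<bar>)"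
        by (intro set_integrable_abs set_integral_diff(1) Ti p \<mu>)
      show "set_integrable lborel {0..1} (\<lambda>u. K * \<bar>measure \<nu> {0..u} - measure \<mu> {0..u}\<bar>)"
        using cdf_dist_integrable[OF p(1) \<mu>] by simp
      fix u :: real assume u: "u \<in> {0..1}"
      have "\<bar>u * D' u * measure \<nu> {0..u} - u * D' u * measure \<mu> {0..u}\<bar> = (u * D' u) * \<bar>measure \<nu> {0..u} - measure \<mu> {0..u}\<bar>"
        using u c(2) by (simp add: abs_mult flip: right_diff_distrib)
      also have "\<dots> \<le> (1 * K) * \<bar>measure \<nu> {0..u} - measure \<mu> {0..u}\<bar>"
        using u c K by (intro mult_right_mono mult_mono) auto
      finally show "\<bar>u * D' u * measure \<nu> {0..u} - u * D' u * measure \<mu> {0..u}\<bar> \<le> K * \<bar>measure \<nu> {0..u} - measure \<mu> {0..u}\<bar>"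
        by simp
    qed
    also have "\<dots> = K * cdf_dist \<nu> \<mu>"
      by (simp add: cdf_dist_def)
    also have "\<dots> \<le> K * (1 / N)"
      using \<nu>(2) K by (intro mult_left_mono) auto
    finally show ?thesis .
  qed
  define I where "I j = (LINT u:{real j / N..<(real j + 1) / N}|lborel. u * D' u)" for j :: nat
  have T2: "T \<alpha> = (\<Sum>j<N. M j * I j)"
    if \<alpha>: "\<alpha> \<in> prob_measures01" and M: "\<And>j u. j \<le> N \<Longrightarrow> real j / N \<le> u \<Longrightarrow> u < (real j + 1) / N \<Longrightarrow> u \<le> 1 \<Longrightarrow> measure \<alpha> {0..u} = M j" for \<alpha> M
    unfolding T_def set_integral_grid[OF N Ti[OF \<alpha>]] I_def
  proof (intro sum.cong refl set_integral_Ico_const)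
    fix j u assume j: "j \<in> {..<N}" and u: "real j / N \<le> u" "u < (real j + 1) / N"
    have "measure \<alpha> {0..u} = M j"
      by (rule M[OF _ u]) (use j u subsetD[OF grid_cell_subset[of j N], of u] in auto)
    then show "u * D' u * measure \<alpha> {0..u} = M j * (u * D' u)"
      by simp
  qed (use node in \<open>auto intro: less_imp_le\<close>)
  have T\<nu>: "T \<nu> = (\<Sum>j<N. F j * I j)"
    unfolding F_def by (rule T2[OF p(1)]) (rule \<nu>(4))
  have T\<kappa>: "T \<kappa> = (\<Sum>j<N. m j * I j)"
    by (rule T2[OF p(2)]) (rule \<kappa>(3))
  have "(\<Sum>j<N. (m j - F j) * (real j / N) * v j) - (\<Sum>j<N. K / N * (1 / N)) \<le> (\<Sum>j<N. (m j - F j) * I j)"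
    unfolding sum_subtractf[symmetric]
  proof (rule sum_mono)
    fix j assume "j \<in> {..<N}"
    then have j: "j < N" by simp
    have v: "0 \<le> v j" "v j \<le> K / N"
      using clockD[OF clock node(4)[OF j] less_imp_le[OF node(2)[OF j]] node(3)[OF j]]
      by (simp_all add: v_def diff_divide_distrib[symmetric])
    have I: "(real j / N) * v j \<le> I j" "I j \<le> ((real j + 1) / N) * v j"
      unfolding I_def v_def
      using weighted_increment_bounds[OF node(4)[OF j] less_imp_le[OF node(2)[OF j]] node(3)[OF j] D c(1,2)]
      by auto
    have mF: "\<bar>m j - F j\<bar> \<le> 1"
      using m(2)[of 0 j] m(2)[of j N] m j cdf01_le_1[OF \<mu>, of "real j / N"] measure_nonneg[of \<mu> "{0..real j / N}"]
      unfolding F_def by linarith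
    have "\<bar>(m j - F j) * (I j - (real j / N) * v j)\<bar> \<le> 1 * (1 / N * v j)"
      unfolding abs_mult using I mF by (intro mult_mono) (auto simp: add_divide_distrib distrib_right)
    also have "\<dots> \<le> K / N * (1 / N)"
      using mult_right_mono[OF v(2), of "1 / N"] N by simp
    finally show "(m j - F j) * (real j / N) * v j - K / N * (1 / N) \<le> (m j - F j) * I j"
      by (simp add: algebra_simps abs_le_iff)
  qed
  then have "(\<Sum>j<N. (m j - F j) * (real j / N) * v j) - K / N \<le> T \<kappa> - T \<nu>"
    using N by (simp add: T\<nu> T\<kappa> left_diff_distrib sum_subtractf)
  moreover have "Phi \<xi> \<mu> 0 0 - T \<mu> / 2 \<le> Phi \<xi> \<kappa> 0 0 - T \<kappa> / 2"
    using opt[OF p(2)] by (simp add: P)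
  ultimately have "chain F v N 0 0 + (\<Sum>j<N. (m j - F j) * (real j / N) * v j) / 2 - 3 / 2 * (K / N) \<le> chain m v N 0 0"
    using ph\<nu> T1 unfolding ph\<kappa> by (simp add: abs_le_iff field_simps)
  moreover have "0 \<le> K / N"
    using K by simp
  ultimately show ?thesis
    by linarith
qed

section \<open>Gibbs weights and tilted averages\<close>

text \<open>A class closed under sums and products whose members are integrable against the
  Gaussian, also after multiplication by a Gibbs weight.\<close>

definition exp_bounded :: "(real \<Rightarrow> real) \<Rightarrow> bool" where
  "exp_bounded \<psi> \<longleftrightarrow> \<psi> \<in> borel_measurable borel \<and> (\<exists>R c. \<forall>z. \<bar>\<psi> z\<bar> \<le> R * exp (c * \<bar>z\<bar>))"

lemma exp_boundedI:
  "\<psi> \<in> borel_measurable borel \<Longrightarrow> (\<And>z. \<bar>\<psi> z\<bar> \<le> R * exp (c * \<bar>z\<bar>)) \<Longrightarrow> exp_bounded \<psi>"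
  by (auto simp: exp_bounded_def)

lemma exp_bounded_measurable [measurable_dest]: "exp_bounded \<psi> \<Longrightarrow> \<psi> \<in> borel_measurable borel"
  by (simp add: exp_bounded_def)

lemma exp_bounded_integrable: "exp_bounded \<psi> \<Longrightarrow> integrable std_normal_distribution \<psi>"
  by (auto simp: exp_bounded_def intro: integrable_std_normal_exp_bound)

lemma exp_bounded_const [simp, intro]: "exp_bounded (\<lambda>_. a)"
  by (rule exp_boundedI[where R = "\<bar>a\<bar>" and c = 0]) auto

lemma exp_bounded_mult [intro]:
  assumes "exp_bounded \<psi>" "exp_bounded \<phi>"
  shows "exp_bounded (\<lambda>z. \<psi> z * \<phi> z)"
proof -
  obtain R c S d where "\<And>z. \<bar>\<psi> z\<bar> \<le> R * exp (c * \<bar>z\<bar>)" "\<And>z. \<bar>\<phi> z\<bar> \<le> S * exp (d * \<bar>z\<bar>)"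
    using assms by (auto simp: exp_bounded_def)
  then have "\<bar>\<psi> z * \<phi> z\<bar> \<le> (R * exp (c * \<bar>z\<bar>)) * (S * exp (d * \<bar>z\<bar>))" for z
    unfolding abs_mult by (intro mult_mono) (auto intro: order_trans[OF abs_ge_zero])
  then show ?thesis
    using assms by (intro exp_boundedI[where R = "R * S" and c = "c + d"])
      (auto simp: exp_add algebra_simps intro!: borel_measurable_times exp_bounded_measurable)
qed

lemma exp_bounded_add [intro]:
  assumes "exp_bounded \<psi>" "exp_bounded \<phi>"
  shows "exp_bounded (\<lambda>z. \<psi> z + \<phi> z)"
proof -
  obtain R c S d where b: "\<And>z. \<bar>\<psi> z\<bar> \<le> R * exp (c * \<bar>z\<bar>)" "\<And>z. \<bar>\<phi> z\<bar> \<le> S * exp (d * \<bar>z\<bar>)"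
    using assms by (auto simp: exp_bounded_def)
  have RS: "0 \<le> R" "0 \<le> S"
    using b[of 0] by auto
  have "\<bar>\<psi> z + \<phi> z\<bar> \<le> (R + S) * exp (max c d * \<bar>z\<bar>)" for z
  proof -
    have "\<bar>\<psi> z + \<phi> z\<bar> \<le> R * exp (c * \<bar>z\<bar>) + S * exp (d * \<bar>z\<bar>)"
      using b[of z] by linarith
    also have "\<dots> \<le> R * exp (max c d * \<bar>z\<bar>) + S * exp (max c d * \<bar>z\<bar>)"
      using RS by (intro add_mono mult_left_mono) (auto intro!: mult_right_mono)
    finally show ?thesis
      by (simp add: algebra_simps)
  qed
  then show ?thesis
    using assms by (intro exp_boundedI[where R = "R + S" and c = "max c d"])
      (auto intro!: borel_measurable_add exp_bounded_measurable)
qed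

lemma exp_bounded_diff [intro]:
  assumes "exp_bounded \<psi>" "exp_bounded \<phi>"
  shows "exp_bounded (\<lambda>z. \<psi> z - \<phi> z)"
  using exp_bounded_add[OF assms(1) exp_bounded_mult[OF exp_bounded_const[of "-1"] assms(2)]] by simp

text \<open>The Gibbs weight is normalised to \<open>1\<close> at \<open>z = 0\<close>, which makes it bounded above and below by
  \<open>exp (\<plusminus>\<bar>z\<bar>)\<close> uniformly in \<open>f\<close> and \<open>x\<close>.\<close>

definition gibbs_weight :: "real \<Rightarrow> real \<Rightarrow> (real \<Rightarrow> real) \<Rightarrow> real \<Rightarrow> real \<Rightarrow> real" where
  "gibbs_weight m v f x z = exp (m * (f (x + z * sqrt v) - f x))"

definition gibbs :: "real \<Rightarrow> real \<Rightarrow> (real \<Rightarrow> real) \<Rightarrow> real \<Rightarrow> (real \<Rightarrow> real) \<Rightarrow> real" where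
  "gibbs m v f x \<psi> = (LINT z|std_normal_distribution. \<psi> z * gibbs_weight m v f x z)
     / (LINT z|std_normal_distribution. gibbs_weight m v f x z)"

text \<open>Uniform bound for the Gibbs average of \<open>exp (c * \<bar>z\<bar>)\<close>: the
  weight is at most \<open>exp \<bar>z\<bar>\<close> in the numerator and at least
  \<open>exp (- \<bar>z\<bar>)\<close> in the denominator.\<close>

definition gibbs_mgf :: "real \<Rightarrow> real" where
  "gibbs_mgf c = gauss_abs_mgf (c + 1) / gauss_abs_mgf (-1)"

lemma gauss_abs_mgf_pos: "0 < gauss_abs_mgf c"
  unfolding gauss_abs_mgf_def by (rule std_normal.expectation_greater) auto

lemma gibbs_mgf_pos: "0 < gibbs_mgf c"
  by (simp add: gibbs_mgf_def gauss_abs_mgf_pos)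

locale gibbs_measure =
  fixes m v :: real and f :: "real \<Rightarrow> real" and x :: real
  assumes lip: "lip1 f" and m: "0 \<le> m" "m \<le> 1" and v: "0 \<le> v" "v \<le> 1"
begin

abbreviation "w \<equiv> gibbs_weight m v f x"
abbreviation "E \<equiv> gibbs m v f x"

lemma weight_exponent: "\<bar>m * (f (x + z * sqrt v) - f x)\<bar> \<le> \<bar>z\<bar>"
proof -
  have "\<bar>f (x + z * sqrt v) - f x\<bar> \<le> \<bar>z\<bar> * sqrt v"
    using lip1D[OF lip, of "x + z * sqrt v" x] v by (simp add: abs_mult)
  also have "\<dots> \<le> \<bar>z\<bar> * 1"
    using v by (intro mult_left_mono) auto
  finally have "\<bar>m * (f (x + z * sqrt v) - f x)\<bar> \<le> 1 * (\<bar>z\<bar> * 1)"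
    unfolding abs_mult using m by (intro mult_mono) auto
  then show ?thesis
    by simp
qed

lemma weight_bounds: "0 < w z" "w z \<le> exp \<bar>z\<bar>" "exp (- \<bar>z\<bar>) \<le> w z"
  using weight_exponent[of z] by (auto simp: gibbs_weight_def)

lemma weight_exp_bounded: "exp_bounded w"
proof (rule exp_boundedI[where R = 1 and c = 1])
  show "w \<in> borel_measurable borel"
    unfolding gibbs_weight_def using lip1_measurable[OF lip] by measurable
qed (use weight_bounds in \<open>auto simp: abs_of_pos\<close>)

lemma norm_bounds:
  "gauss_abs_mgf (-1) \<le> (LINT z|std_normal_distribution. w z)"
  "(LINT z|std_normal_distribution. w z) \<le> gauss_abs_mgf 1"
  unfolding gauss_abs_mgf_def
  by (intro integral_mono exp_bounded_integrable[OF weight_exp_bounded] integrable_std_normal_exp_abs;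
      use weight_bounds in simp)+

lemma norm_pos: "0 < (LINT z|std_normal_distribution. w z)"
  using norm_bounds(1) gauss_abs_mgf_pos[of "-1"] by linarith

lemma E_integrable: "exp_bounded \<psi> \<Longrightarrow> integrable std_normal_distribution (\<lambda>z. \<psi> z * w z)"
  by (intro exp_bounded_integrable exp_bounded_mult weight_exp_bounded)

lemma E_const [simp]: "E (\<lambda>_. a) = a"
  using norm_pos by (simp add: gibbs_def)

lemma E_add: "exp_bounded \<psi> \<Longrightarrow> exp_bounded \<phi> \<Longrightarrow> E (\<lambda>z. \<psi> z + \<phi> z) = E \<psi> + E \<phi>"
  using E_integrable[of \<psi>] E_integrable[of \<phi>] by (simp add: gibbs_def distrib_right add_divide_distrib)

lemma E_diff: "exp_bounded \<psi> \<Longrightarrow> exp_bounded \<phi> \<Longrightarrow> E (\<lambda>z. \<psi> z - \<phi> z) = E \<psi> - E \<phi>"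
  using E_integrable[of \<psi>] E_integrable[of \<phi>] by (simp add: gibbs_def left_diff_distrib diff_divide_distrib)

lemma E_cmult: "E (\<lambda>z. a * \<psi> z) = a * E \<psi>"
  by (simp add: gibbs_def mult.assoc)

lemma E_mono: "exp_bounded \<psi> \<Longrightarrow> exp_bounded \<phi> \<Longrightarrow> (\<And>z. \<psi> z \<le> \<phi> z) \<Longrightarrow> E \<psi> \<le> E \<phi>"
  unfolding gibbs_def using norm_pos
  by (intro divide_right_mono integral_mono E_integrable)
    (auto intro!: mult_right_mono less_imp_le[OF weight_bounds(1)])

lemma E_bound:
  assumes "\<And>z. \<bar>\<psi> z\<bar> \<le> R * exp (c * \<bar>z\<bar>)"
  shows "\<bar>E \<psi>\<bar> \<le> R * gibbs_mgf c"
proof -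
  have "\<bar>\<psi> z * w z\<bar> \<le> R * exp ((c + 1) * \<bar>z\<bar>)" for z
  proof -
    have "\<bar>\<psi> z * w z\<bar> \<le> (R * exp (c * \<bar>z\<bar>)) * exp \<bar>z\<bar>"
      unfolding abs_mult using assms[of z] weight_bounds[of z]
      by (intro mult_mono) (auto intro: order_trans[OF abs_ge_zero])
    then show ?thesis
      by (simp add: distrib_right exp_add)
  qed
  then have "\<bar>LINT z|std_normal_distribution. \<psi> z * w z\<bar> \<le> R * gauss_abs_mgf (c + 1)"
    by (rule std_normal_integral_bound)
  moreover have "0 \<le> R"
    using assms[of 0] by simp
  ultimately show ?thesis
    unfolding gibbs_def gibbs_mgf_def abs_divide times_divide_eq_right
    using norm_bounds(1) norm_pos gauss_abs_mgf_pos[of "-1"] gauss_abs_mgf_pos[of "c + 1"]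
    by (intro frac_le) auto
qed

definition cov :: "(real \<Rightarrow> real) \<Rightarrow> (real \<Rightarrow> real) \<Rightarrow> real" where
  "cov \<psi> \<phi> = E (\<lambda>z. \<psi> z * \<phi> z) - E \<psi> * E \<phi>"

lemma cov_shift:
  assumes "exp_bounded \<psi>" "exp_bounded \<phi>"
  shows "cov \<psi> \<phi> = cov (\<lambda>z. \<psi> z - a) (\<lambda>z. \<phi> z - b)"
proof -
  have "E (\<lambda>z. (\<psi> z - a) * (\<phi> z - b)) = E (\<lambda>z. (\<psi> z * \<phi> z - a * \<phi> z) - (b * \<psi> z - a * b))"
    by (simp add: algebra_simps)
  also have "\<dots> = (E (\<lambda>z. \<psi> z * \<phi> z) - a * E \<phi>) - (b * E \<psi> - a * b)"
    using assms by (simp add: E_diff E_cmult exp_bounded_mult exp_bounded_diff)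
  finally show ?thesis
    using assms by (simp add: cov_def E_diff algebra_simps)
qed

text \<open>A covariance does not see constants, so each factor may be recentred separately, and the
  smallness of the two deviations multiplies.\<close>

lemma cov_bound:
  assumes "exp_bounded \<psi>" "exp_bounded \<phi>"
    and \<psi>: "\<And>z. \<bar>\<psi> z - a\<bar> \<le> R * exp (c * \<bar>z\<bar>)" and \<phi>: "\<And>z. \<bar>\<phi> z - b\<bar> \<le> S * exp (d * \<bar>z\<bar>)"
  shows "\<bar>cov \<psi> \<phi>\<bar> \<le> R * S * (gibbs_mgf (c + d) + gibbs_mgf c * gibbs_mgf d)"
proof -
  have RS: "0 \<le> R" "0 \<le> S"
    using \<psi>[of 0] \<phi>[of 0] by auto
  have "\<bar>(\<psi> z - a) * (\<phi> z - b)\<bar> \<le> (R * S) * exp ((c + d) * \<bar>z\<bar>)" for z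
  proof -
    have "\<bar>(\<psi> z - a) * (\<phi> z - b)\<bar> \<le> (R * exp (c * \<bar>z\<bar>)) * (S * exp (d * \<bar>z\<bar>))"
      unfolding abs_mult using \<psi>[of z] \<phi>[of z] RS by (intro mult_mono) auto
    then show ?thesis
      using exp_add[of "c * \<bar>z\<bar>" "d * \<bar>z\<bar>"] by (simp add: distrib_right mult.assoc mult.left_commute)
  qed
  then have 1: "\<bar>E (\<lambda>z. (\<psi> z - a) * (\<phi> z - b))\<bar> \<le> R * S * gibbs_mgf (c + d)"
    by (rule E_bound)
  have 2: "\<bar>E (\<lambda>z. \<psi> z - a) * E (\<lambda>z. \<phi> z - b)\<bar> \<le> (R * gibbs_mgf c) * (S * gibbs_mgf d)"
    unfolding abs_mult using RS less_imp_le[OF gibbs_mgf_pos] by (intro mult_mono E_bound \<psi> \<phi>) auto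
  have "\<bar>cov \<psi> \<phi>\<bar> \<le> \<bar>E (\<lambda>z. (\<psi> z - a) * (\<phi> z - b))\<bar> + \<bar>E (\<lambda>z. \<psi> z - a) * E (\<lambda>z. \<phi> z - b)\<bar>"
    unfolding cov_shift[OF assms(1,2), of a b] cov_def[of "\<lambda>z. \<psi> z - a"] by (rule abs_triangle_ineq4)
  also have "\<dots> \<le> R * S * gibbs_mgf (c + d) + (R * gibbs_mgf c) * (S * gibbs_mgf d)"
    using 1 2 by linarith
  also have "\<dots> = R * S * (gibbs_mgf (c + d) + gibbs_mgf c * gibbs_mgf d)"
    by (simp add: distrib_left)
  finally show ?thesis .
qed

end

text \<open>\<open>cov_bound\<close> with exponents 1 and 3, times a bound for the reciprocal of the
  average of the density ratio \<open>e\<close> in \<open>gibbs_diff\<close>.\<close>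

definition gibbs_diff_const :: real where
  "gibbs_diff_const = (gibbs_mgf 4 + gibbs_mgf 1 * gibbs_mgf 3) * (gauss_abs_mgf 1 / gauss_abs_mgf (-1))"

text \<open>Change of measure. With \<open>e\<close> the ratio of the two weights, the difference of
  the averages is the covariance of \<open>\<psi>\<close> and \<open>e\<close> divided by the
  average of \<open>e\<close>. As \<open>e - 1\<close> is of order \<open>\<kappa> * sqrt v\<close>,
  the result is small in \<open>R\<close> and in \<open>\<kappa>\<close> at once.\<close>

lemma gibbs_diff:
  assumes 1: "gibbs_measure m1 v f1" and 2: "gibbs_measure m2 v f2"
    and \<psi>: "exp_bounded \<psi>" "\<And>z. \<bar>\<psi> z - a\<bar> \<le> R * exp \<bar>z\<bar>"
    and \<kappa>: "\<And>y. \<bar>(m1 * f1 y - m2 * f2 y) - (m1 * f1 x - m2 * f2 x)\<bar> \<le> \<kappa> * \<bar>y - x\<bar>" "\<kappa> \<le> 2"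
  shows "\<bar>gibbs m1 v f1 x \<psi> - gibbs m2 v f2 x \<psi>\<bar> \<le> gibbs_diff_const * (R * \<kappa> * sqrt v)"
proof -
  interpret A: gibbs_measure m1 v f1 x by fact
  interpret B: gibbs_measure m2 v f2 x by fact
  have "0 \<le> \<kappa>"
    using order_trans[OF abs_ge_zero \<kappa>(1)[of "x + 1"]] by simp
  define e where "e z = exp ((m1 * f1 (x + z * sqrt v) - m2 * f2 (x + z * sqrt v)) - (m1 * f1 x - m2 * f2 x))" for z
  have eb: "\<bar>e z - 1\<bar> \<le> (\<kappa> * sqrt v) * exp (3 * \<bar>z\<bar>)" for z
  proof -
    define k where "k = (m1 * f1 (x + z * sqrt v) - m2 * f2 (x + z * sqrt v)) - (m1 * f1 x - m2 * f2 x)"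
    have k1: "\<bar>k\<bar> \<le> \<kappa> * sqrt v * \<bar>z\<bar>"
      using \<kappa>(1)[of "x + z * sqrt v"] A.v by (simp add: k_def abs_mult mult_ac)
    also have "\<dots> \<le> 2 * 1 * \<bar>z\<bar>"
      using \<kappa>(2) A.v by (intro mult_mono) auto
    finally have k2: "\<bar>k\<bar> \<le> 2 * \<bar>z\<bar>"
      by simp
    have "\<bar>exp k - 1\<bar> \<le> \<bar>k\<bar> * exp \<bar>k\<bar>"
    proof -
      obtain t where "\<bar>t\<bar> \<le> \<bar>k\<bar>" "exp k = (\<Sum>i<1. k ^ i / fact i) + exp t / fact 1 * k ^ 1"
        using Maclaurin_exp_le[of k 1] by blast
      then show ?thesis
        by (simp add: abs_mult mult_left_mono mult.commute)
    qed
    \<comment> \<open>One exponential absorbs the factor \<open>\<bar>z\<bar>\<close>, and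
      \<open>\<kappa> \<le> 2\<close> bounds the exponent by \<open>2 * \<bar>z\<bar>\<close>;
      together they give the exponent 3.\<close>
    also have "\<dots> \<le> (\<kappa> * sqrt v * exp \<bar>z\<bar>) * exp (2 * \<bar>z\<bar>)"
    proof (rule mult_mono)
      have "\<kappa> * sqrt v * \<bar>z\<bar> \<le> \<kappa> * sqrt v * exp \<bar>z\<bar>"
        using \<open>0 \<le> \<kappa>\<close> A.v abs_le_exp_abs[of z] by (intro mult_left_mono) auto
      with k1 show "\<bar>k\<bar> \<le> \<kappa> * sqrt v * exp \<bar>z\<bar>"
        by linarith
    qed (use k2 \<open>0 \<le> \<kappa>\<close> A.v in auto)
    also have "\<dots> = (\<kappa> * sqrt v) * exp (3 * \<bar>z\<bar>)"
      by (simp add: mult.assoc flip: exp_add)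
    finally show ?thesis
      by (simp add: e_def k_def)
  qed
  have em: "e \<in> borel_measurable borel"
    unfolding e_def using lip1_measurable[OF A.lip] lip1_measurable[OF B.lip] by measurable
  have "exp_bounded (\<lambda>z. e z - 1)"
    by (intro exp_boundedI[OF _ eb] borel_measurable_diff em borel_measurable_const)
  from exp_bounded_add[OF this exp_bounded_const[of 1]] have ee: "exp_bounded e"
    by simp
  have we: "A.w = (\<lambda>z. e z * B.w z)"
    by (rule ext) (simp add: gibbs_weight_def e_def algebra_simps flip: exp_add)
  have Ee: "B.E e = (LINT z|std_normal_distribution. A.w z) / (LINT z|std_normal_distribution. B.w z)"
    by (simp add: gibbs_def we)
  have "A.E \<psi> = B.E (\<lambda>z. \<psi> z * e z) / B.E e"
    unfolding Ee using B.norm_pos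
    by (simp add: gibbs_def[of m1 v f1 x \<psi>] gibbs_def[of m2 v f2 x "\<lambda>z. \<psi> z * e z"] we mult.assoc)
  moreover have pos: "gauss_abs_mgf (-1) / gauss_abs_mgf 1 \<le> B.E e"
    unfolding Ee using A.norm_bounds B.norm_bounds A.norm_pos B.norm_pos gauss_abs_mgf_pos by (intro frac_le) (auto intro: less_imp_le)
  moreover have "0 < gauss_abs_mgf (-1) / gauss_abs_mgf 1"
    by (simp add: gauss_abs_mgf_pos)
  ultimately have "A.E \<psi> - B.E \<psi> = B.cov \<psi> e / B.E e"
    by (simp add: B.cov_def diff_divide_distrib)
  also have "\<bar>\<dots>\<bar> = \<bar>B.cov \<psi> e\<bar> * (1 / B.E e)"
    using pos \<open>0 < gauss_abs_mgf (-1) / gauss_abs_mgf 1\<close> by (simp add: abs_divide)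
  also have "\<dots> \<le> (R * (\<kappa> * sqrt v) * (gibbs_mgf (1 + 3) + gibbs_mgf 1 * gibbs_mgf 3)) * (1 / (gauss_abs_mgf (-1) / gauss_abs_mgf 1))"
  proof (rule mult_mono)
    show "\<bar>B.cov \<psi> e\<bar> \<le> R * (\<kappa> * sqrt v) * (gibbs_mgf (1 + 3) + gibbs_mgf 1 * gibbs_mgf 3)"
      using B.cov_bound[of \<psi> e a R 1 1 "\<kappa> * sqrt v" 3] \<psi> ee eb by simp
    then show "0 \<le> R * (\<kappa> * sqrt v) * (gibbs_mgf (1 + 3) + gibbs_mgf 1 * gibbs_mgf 3)"
      by linarith
    show "1 / B.E e \<le> 1 / (gauss_abs_mgf (-1) / gauss_abs_mgf 1)"
      using pos \<open>0 < gauss_abs_mgf (-1) / gauss_abs_mgf 1\<close> by (rule frac_le[OF zero_le_one order_refl, rotated])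
    show "0 \<le> 1 / B.E e"
      using pos \<open>0 < gauss_abs_mgf (-1) / gauss_abs_mgf 1\<close> by simp
  qed
  also have "\<dots> = gibbs_diff_const * (R * \<kappa> * sqrt v)"
    by (simp add: gibbs_diff_const_def)
  finally show ?thesis .
qed

section \<open>Tilted averages as operators on bounded functions\<close>

definition bdd_borel :: "(real \<Rightarrow> real) \<Rightarrow> bool" where
  "bdd_borel g \<longleftrightarrow> g \<in> borel_measurable borel \<and> (\<exists>B. \<forall>x. \<bar>g x\<bar> \<le> B)"

lemma bdd_borelI: "g \<in> borel_measurable borel \<Longrightarrow> (\<And>x. \<bar>g x\<bar> \<le> B) \<Longrightarrow> bdd_borel g"
  by (auto simp: bdd_borel_def)

lemma bdd_borel_measurable: "bdd_borel g \<Longrightarrow> g \<in> borel_measurable borel"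
  by (simp add: bdd_borel_def)

lemma bdd_borel_const [simp]: "bdd_borel (\<lambda>_. c)"
  by (auto simp: bdd_borel_def)

lemma bdd_borel_mult:
  assumes "bdd_borel g" "bdd_borel h"
  shows "bdd_borel (\<lambda>x. g x * h x)"
proof -
  obtain A B where AB: "\<And>x. \<bar>g x\<bar> \<le> A" "\<And>x. \<bar>h x\<bar> \<le> B"
    using assms by (auto simp: bdd_borel_def)
  have "0 \<le> A"
    using AB(1)[of 0] by linarith
  then have "\<bar>g x * h x\<bar> \<le> A * B" for x
    unfolding abs_mult by (rule mult_mono[OF AB(1) AB(2) _ abs_ge_zero])
  then show ?thesis
    by (rule bdd_borelI[OF borel_measurable_times[OF assms[THEN bdd_borel_measurable]]])
qed

lemma bdd_borel_add:
  assumes "bdd_borel g" "bdd_borel h"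
  shows "bdd_borel (\<lambda>x. g x + h x)"
proof -
  obtain A B where AB: "\<And>x. \<bar>g x\<bar> \<le> A" "\<And>x. \<bar>h x\<bar> \<le> B"
    using assms by (auto simp: bdd_borel_def)
  have "\<bar>g x + h x\<bar> \<le> A + B" for x
    using AB[of x] by linarith
  then show ?thesis
    by (rule bdd_borelI[OF borel_measurable_add[OF assms[THEN bdd_borel_measurable]]])
qed

lemma bdd_borel_diff: "bdd_borel g \<Longrightarrow> bdd_borel h \<Longrightarrow> bdd_borel (\<lambda>x. g x - h x)"
  using bdd_borel_add[of g "\<lambda>x. - 1 * h x"] bdd_borel_mult[of "\<lambda>_. - 1" h] by simp

lemma bdd_borel_exp_bounded:
  assumes "bdd_borel g"
  shows "exp_bounded (\<lambda>z. g (x + z * s))"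
proof -
  obtain B where "\<And>x. \<bar>g x\<bar> \<le> B"
    using assms by (auto simp: bdd_borel_def)
  moreover have "(\<lambda>z. g (x + z * s)) \<in> borel_measurable borel"
    using bdd_borel_measurable[OF assms] by measurable
  ultimately show ?thesis
    by (intro exp_boundedI[where R = B and c = 0]) auto
qed

text \<open>A Markov operator: Gaussian transition from \<open>x\<close>, reweighted by
  \<open>exp (m * f)\<close>. It is the discrete counterpart of the diffusion whose drift is given
  by the slope of the Parisi solution.\<close>

definition tilt :: "real \<Rightarrow> real \<Rightarrow> (real \<Rightarrow> real) \<Rightarrow> (real \<Rightarrow> real) \<Rightarrow> real \<Rightarrow> real" where
  "tilt m v f g x = gibbs m v f x (\<lambda>z. g (x + z * sqrt v))"

definition admissible :: "real \<Rightarrow> real \<Rightarrow> (real \<Rightarrow> real) \<Rightarrow> bool" where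
  "admissible m v f \<longleftrightarrow> lip1 f \<and> 0 \<le> m \<and> m \<le> 1 \<and> 0 \<le> v \<and> v \<le> 1"

lemma admissible_gibbs: "admissible m v f \<Longrightarrow> gibbs_measure m v f"
  by (auto simp: admissible_def gibbs_measure_def)

lemma tilt_const: "admissible m v f \<Longrightarrow> tilt m v f (\<lambda>_. c) x = c"
  unfolding tilt_def by (rule gibbs_measure.E_const[OF admissible_gibbs])

lemma tilt_add:
  "admissible m v f \<Longrightarrow> bdd_borel g \<Longrightarrow> bdd_borel h \<Longrightarrow> tilt m v f (\<lambda>x. g x + h x) x = tilt m v f g x + tilt m v f h x"
  unfolding tilt_def by (intro gibbs_measure.E_add admissible_gibbs bdd_borel_exp_bounded)

lemma tilt_diff:
  "admissible m v f \<Longrightarrow> bdd_borel g \<Longrightarrow> bdd_borel h \<Longrightarrow> tilt m v f (\<lambda>x. g x - h x) x = tilt m v f g x - tilt m v f h x"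
  unfolding tilt_def by (intro gibbs_measure.E_diff admissible_gibbs bdd_borel_exp_bounded)

lemma tilt_cmult: "admissible m v f \<Longrightarrow> tilt m v f (\<lambda>x. c * g x) x = c * tilt m v f g x"
  unfolding tilt_def by (intro gibbs_measure.E_cmult admissible_gibbs)

lemma tilt_mono:
  "admissible m v f \<Longrightarrow> bdd_borel g \<Longrightarrow> bdd_borel h \<Longrightarrow> (\<And>x. g x \<le> h x) \<Longrightarrow> tilt m v f g x \<le> tilt m v f h x"
  unfolding tilt_def by (intro gibbs_measure.E_mono admissible_gibbs bdd_borel_exp_bounded)

lemma tilt_bound:
  assumes "admissible m v f" "bdd_borel g" "\<And>x. \<bar>g x\<bar> \<le> B"
  shows "\<bar>tilt m v f g x\<bar> \<le> B"
proof -
  have "g x \<le> B" "- B \<le> g x" for x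
    using assms(3)[of x] by linarith+
  then show ?thesis
    using tilt_mono[OF assms(1,2) bdd_borel_const, of B x] tilt_mono[OF assms(1) bdd_borel_const assms(2), of "- B" x]
      tilt_const[OF assms(1)] by (simp add: abs_le_iff)
qed

lemma tilt_eq_ratio:
  "tilt m v f g x = (LINT z|std_normal_distribution. g (x + z * sqrt v) * exp (m * f (x + z * sqrt v)))
     / (LINT z|std_normal_distribution. exp (m * f (x + z * sqrt v)))"
proof -
  have "gibbs_weight m v f x z = exp (- (m * f x)) * exp (m * f (x + z * sqrt v))" for z
    by (simp add: gibbs_weight_def algebra_simps flip: exp_add)
  then show ?thesis
    by (simp add: tilt_def gibbs_def mult.left_commute[of _ "exp (- (m * f x))"])
qed

lemma bdd_borel_tilt:
  assumes a: "admissible m v f" and g: "bdd_borel g"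
  shows "bdd_borel (tilt m v f g)"
proof -
  obtain B where B: "\<And>x. \<bar>g x\<bar> \<le> B"
    using g by (auto simp: bdd_borel_def)
  have [measurable]: "g \<in> borel_measurable borel" "f \<in> borel_measurable borel"
    using bdd_borel_measurable[OF g] lip1_measurable a by (auto simp: admissible_def)
  have "tilt m v f g \<in> borel_measurable borel"
    unfolding tilt_eq_ratio[abs_def] by measurable
  then show ?thesis
    using tilt_bound[OF a g B] by (intro bdd_borelI)
qed

section \<open>Derivatives of tilted averages\<close>

lemma std_normal_integral_DERIV:
  fixes h h' :: "real \<Rightarrow> real"
  assumes h: "\<And>y. (h has_real_derivative h' y) (at y)"
    and b: "\<And>y. \<bar>h' y\<bar> \<le> A * exp (c * \<bar>y\<bar>)" "0 \<le> c"
    and hi: "\<And>x. integrable std_normal_distribution (\<lambda>z. h (x + z * s))"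
    and [measurable]: "h' \<in> borel_measurable borel"
  shows "((\<lambda>x. LINT z|std_normal_distribution. h (x + z * s)) has_real_derivative
     (LINT z|std_normal_distribution. h' (x + z * s))) (at x)"
proof -
  have "0 \<le> A"
    using b(1)[of 0] by simp
  have [measurable]: "h \<in> borel_measurable borel"
    by (intro borel_measurable_continuous_onI continuous_at_imp_continuous_on)
      (use h DERIV_isCont in blast)
  let ?U = "\<lambda>x. LINT z|std_normal_distribution. h (x + z * s)"
  let ?U' = "LINT z|std_normal_distribution. h' (x + z * s)"
  have "((\<lambda>y. (?U y - ?U x) / (y - x)) \<longlongrightarrow> ?U') (at x)"
    unfolding tendsto_at_iff_sequentially
  proof (intro allI impI)
    fix X :: "nat \<Rightarrow> real" assume X: "\<forall>i. X i \<in> UNIV - {x}" "X \<longlonglongrightarrow> x"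
    obtain B where B: "\<And>n. \<bar>X n\<bar> \<le> B"
      using convergent_imp_Bseq[OF convergentI[OF X(2)]] by (auto simp: Bseq_def)
    \<comment> \<open>A convergent sequence is bounded, so all points involved lie in
      \<open>{- r z..r z}\<close>. The mean value theorem there dominates the difference quotients
      by an exponential in \<open>\<bar>z\<bar>\<close>, independently of \<open>n\<close>.\<close>
    define r where "r z = B + \<bar>x\<bar> + \<bar>z\<bar> * \<bar>s\<bar>" for z
    have Q: "\<bar>(h (X n + z * s) - h (x + z * s)) / (X n - x)\<bar> \<le> A * exp (c * r z)" for n z
    proof -
      have "norm (h (X n + z * s) - h (x + z * s)) \<le> (A * exp (c * r z)) * norm ((X n + z * s) - (x + z * s))"
      proof (rule field_differentiable_bound[of "{- r z..r z}" h h'])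
        fix y assume "y \<in> {- r z..r z}"
        then have "c * \<bar>y\<bar> \<le> c * r z"
          using b(2) by (intro mult_left_mono) auto
        then have "A * exp (c * \<bar>y\<bar>) \<le> A * exp (c * r z)"
          using \<open>0 \<le> A\<close> by (intro mult_left_mono) auto
        then show "norm (h' y) \<le> A * exp (c * r z)"
          using b(1)[of y] by simp
      next
        have zs: "\<bar>z * s\<bar> = \<bar>z\<bar> * \<bar>s\<bar>"
          by (rule abs_mult)
        show "X n + z * s \<in> {- r z..r z}" "x + z * s \<in> {- r z..r z}"
          using B[of n] zs unfolding r_def atLeastAtMost_iff by linarith+
      qed (use h in \<open>auto intro: has_field_derivative_at_within\<close>)
      then show ?thesis
        using X(1) by (simp add: divide_simps)
    qed
    have lim: "(\<lambda>n. LINT z|std_normal_distribution. (h (X n + z * s) - h (x + z * s)) / (X n - x)) \<longlonglongrightarrow> ?U'"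
    proof (rule integral_dominated_convergence)
      show "integrable std_normal_distribution (\<lambda>z. A * exp (c * r z))"
      proof -
        have "c * r z = c * (B + \<bar>x\<bar>) + (c * \<bar>s\<bar>) * \<bar>z\<bar>" for z
          by (simp add: r_def algebra_simps)
        then have eq: "(\<lambda>z. A * exp (c * r z)) = (\<lambda>z. A * exp (c * (B + \<bar>x\<bar>)) * exp ((c * \<bar>s\<bar>) * \<bar>z\<bar>))"
          by (simp add: exp_add mult.assoc)
        show ?thesis
          unfolding eq by simp
      qed
      show "AE z in std_normal_distribution. (\<lambda>n. (h (X n + z * s) - h (x + z * s)) / (X n - x)) \<longlonglongrightarrow> h' (x + z * s)"
      proof (rule AE_I2)
        fix z
        have "((\<lambda>y. h (y + z * s)) has_real_derivative h' (x + z * s)) (at x)"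
          using DERIV_shift[of h "h' (x + z * s)" x "z * s"] h by simp
        then have "((\<lambda>y. (h (y + z * s) - h (x + z * s)) / (y - x)) \<longlongrightarrow> h' (x + z * s)) (at x)"
          by (simp add: has_field_derivative_iff)
        then show "(\<lambda>n. (h (X n + z * s) - h (x + z * s)) / (X n - x)) \<longlonglongrightarrow> h' (x + z * s)"
          using X unfolding tendsto_at_iff_sequentially by (auto simp: o_def)
      qed
      show "AE z in std_normal_distribution. norm ((h (X n + z * s) - h (x + z * s)) / (X n - x)) \<le> A * exp (c * r z)" for n
        using Q by simp
    qed measurable
    have "(\<lambda>y. (?U y - ?U x) / (y - x)) \<circ> X = (\<lambda>n. LINT z|std_normal_distribution. (h (X n + z * s) - h (x + z * s)) / (X n - x))"
      using hi by (simp add: fun_eq_iff)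
    with lim show "((\<lambda>y. (?U y - ?U x) / (y - x)) \<circ> X) \<longlonglongrightarrow> ?U'"
      by simp
  qed
  then show ?thesis
    by (simp only: has_field_derivative_iff)
qed

lemma exp_lip1_bound: "lip1 f \<Longrightarrow> 0 \<le> m \<Longrightarrow> exp (m * f y) \<le> exp (m * \<bar>f 0\<bar>) * exp (m * \<bar>y\<bar>)"
  using lip1_bound[of f y 0] mult_left_mono[of "f y" "\<bar>f 0\<bar> + \<bar>y\<bar>" m] by (simp add: distrib_left flip: exp_add)

lemma exp_weighted_DERIV:
  assumes f: "lip1 f" "\<And>y. (f has_real_derivative f' y) (at y)" "bdd_borel f'" and m: "0 \<le> m"
    and g: "\<And>y. (g has_real_derivative g' y) (at y)" "bdd_borel g" "bdd_borel g'"
  shows "((\<lambda>x. LINT z|std_normal_distribution. g (x + z * s) * exp (m * f (x + z * s))) has_real_derivative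
     (LINT z|std_normal_distribution. (g' (x + z * s) + m * (g (x + z * s) * f' (x + z * s))) * exp (m * f (x + z * s)))) (at x)"
proof -
  have gg: "bdd_borel (\<lambda>y. g' y + m * (g y * f' y))"
    by (intro bdd_borel_add bdd_borel_mult bdd_borel_const f g)
  then obtain B where B: "\<And>y. \<bar>g' y + m * (g y * f' y)\<bar> \<le> B"
    by (auto simp: bdd_borel_def)
  obtain A where A: "\<And>y. \<bar>g y\<bar> \<le> A"
    using g(2) by (auto simp: bdd_borel_def)
  show ?thesis
  proof (rule std_normal_integral_DERIV[where h = "\<lambda>y. g y * exp (m * f y)" and h' = "\<lambda>y. (g' y + m * (g y * f' y)) * exp (m * f y)"])
  show "((\<lambda>y. g y * exp (m * f y)) has_real_derivative (g' y + m * (g y * f' y)) * exp (m * f y)) (at y)" for y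
    by (auto intro!: derivative_eq_intros f g simp: algebra_simps)
  have "0 \<le> B"
    using B[of 0] by linarith
  then show "\<bar>(g' y + m * (g y * f' y)) * exp (m * f y)\<bar> \<le> (B * exp (m * \<bar>f 0\<bar>)) * exp (m * \<bar>y\<bar>)" for y
    unfolding abs_mult mult.assoc[of B] abs_exp_cancel
    by (rule mult_mono[OF B exp_lip1_bound[OF f(1) m] _ exp_ge_zero])
  show "(\<lambda>y. (g' y + m * (g y * f' y)) * exp (m * f y)) \<in> borel_measurable borel"
    using bdd_borel_measurable[OF gg] lip1_measurable[OF f(1)] by measurable
  show "integrable std_normal_distribution (\<lambda>z. g (x + z * s) * exp (m * f (x + z * s)))" for x
  proof (rule Bochner_Integration.integrable_bound)
    show "integrable std_normal_distribution (\<lambda>z. A * exp (m * f (x + z * s)))"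
      using lip1_exp_integrable[OF f(1)] by simp
    show "(\<lambda>z. g (x + z * s) * exp (m * f (x + z * s))) \<in> borel_measurable std_normal_distribution"
      using bdd_borel_measurable[OF g(2)] lip1_measurable[OF f(1)] by simp
    have "\<bar>g (x + z * s)\<bar> \<le> \<bar>A\<bar>" for z
      using A[of "x + z * s"] by linarith
    then show "AE z in std_normal_distribution. norm (g (x + z * s) * exp (m * f (x + z * s))) \<le> norm (A * exp (m * f (x + z * s)))"
      by (simp add: abs_mult mult_right_mono)
  qed
  qed (rule m)
qed

text \<open>Differentiating the weight and its normalisation contributes \<open>m\<close> times the
  covariance of \<open>g\<close> and \<open>f'\<close>.\<close>

lemma tilt_DERIV:
  assumes a: "admissible m v f" and f: "\<And>y. (f has_real_derivative f' y) (at y)" "bdd_borel f'"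
    and g: "\<And>y. (g has_real_derivative g' y) (at y)" "bdd_borel g" "bdd_borel g'"
  shows "(tilt m v f g has_real_derivative
     tilt m v f g' x + m * (tilt m v f (\<lambda>y. g y * f' y) x - tilt m v f g x * tilt m v f f' x)) (at x)"
proof -
  have am: "lip1 f" "0 \<le> m"
    using a by (auto simp: admissible_def)
  let ?U = "\<lambda>g x. LINT z|std_normal_distribution. g (x + z * sqrt v) * exp (m * f (x + z * sqrt v))"
  let ?W = "\<lambda>x. LINT z|std_normal_distribution. exp (m * f (x + z * sqrt v))"
  have W: "0 < ?W x"
    by (rule lip1_exp_integral_pos[OF am(1)])
  have dU: "(?U g has_real_derivative ?U (\<lambda>y. g' y + m * (g y * f' y)) x) (at x)"
    by (rule exp_weighted_DERIV) fact+
  have dW: "(?W has_real_derivative m * ?U f' x) (at x)"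
    using exp_weighted_DERIV[OF am(1) f am(2), of "\<lambda>_. 1" "\<lambda>_. 0" "sqrt v" x] by (simp add: mult.assoc)
  have t: "tilt m v f h x = ?U h x / ?W x" for h x
    by (rule tilt_eq_ratio)
  have E1: "?U (\<lambda>y. g' y + m * (g y * f' y)) x / ?W x = tilt m v f g' x + m * tilt m v f (\<lambda>y. g y * f' y) x"
    using t[of "\<lambda>y. g' y + m * (g y * f' y)" x]
      tilt_add[OF a g(3) bdd_borel_mult[OF bdd_borel_const bdd_borel_mult[OF g(2) f(2)]], of m x] tilt_cmult[OF a, of m "\<lambda>y. g y * f' y" x]
    by linarith
  have D: "((\<lambda>x. ?U g x / ?W x) has_real_derivative
      (?U (\<lambda>y. g' y + m * (g y * f' y)) x * ?W x - ?U g x * (m * ?U f' x)) / (?W x * ?W x)) (at x)"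
    using W by (intro DERIV_divide dU dW) auto
  have E2: "(?U (\<lambda>y. g' y + m * (g y * f' y)) x * ?W x - ?U g x * (m * ?U f' x)) / (?W x * ?W x)
      = ?U (\<lambda>y. g' y + m * (g y * f' y)) x / ?W x - m * ((?U g x / ?W x) * (?U f' x / ?W x))"
    using W by (simp add: diff_divide_distrib)
  have fe: "(\<lambda>x. ?U g x / ?W x) = tilt m v f g"
    by (rule ext) (rule t[symmetric])
  from D show ?thesis
    unfolding E2 E1 t[of g x, symmetric] t[of f' x, symmetric] fe
    by (simp only: right_diff_distrib add_diff_eq)
qed

text \<open>The logarithm makes the derivative of a step the tilted average of the slope. Slopes are
  thus martingales for the tilted averages.\<close>

lemma gauss_step_DERIV:
  assumes a: "admissible m v f" and f: "\<And>y. (f has_real_derivative f' y) (at y)" "bdd_borel f'" and m: "0 < m"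
  shows "(gauss_step m v f has_real_derivative tilt m v f f' x) (at x)"
proof -
  have am: "lip1 f" "0 \<le> m"
    using a by (auto simp: admissible_def)
  let ?W = "\<lambda>x. LINT z|std_normal_distribution. exp (m * f (x + z * sqrt v))"
  have W: "0 < ?W x"
    by (rule lip1_exp_integral_pos[OF am(1)])
  have dW: "(?W has_real_derivative m * (LINT z|std_normal_distribution. f' (x + z * sqrt v) * exp (m * f (x + z * sqrt v)))) (at x)"
    using exp_weighted_DERIV[OF am(1) f am(2), of "\<lambda>_. 1" "\<lambda>_. 0" "sqrt v" x] by (simp add: mult.assoc)
  have "((\<lambda>x. 1 / m * ln (?W x)) has_real_derivative tilt m v f f' x) (at x)"
    by (rule DERIV_cong[OF DERIV_cmult[OF DERIV_chain2[OF DERIV_ln[OF W] dW]]])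
      (use m W in \<open>simp add: tilt_eq_ratio field_simps\<close>)
  moreover have "gauss_step m v f = (\<lambda>x. 1 / m * ln (?W x))"
    using m by (simp add: gauss_step_def fun_eq_iff)
  ultimately show ?thesis
    by simp
qed

text \<open>One constant dominating those of the three estimates below (covariance, change of a
  mean, change of a variance).\<close>

definition tilt_const_bound :: real where
  "tilt_const_bound = gibbs_mgf 2 + (gibbs_mgf 1)\<^sup>2 + 2 * gibbs_diff_const * (1 + gibbs_mgf 1)"

lemma gibbs_diff_const_nonneg: "0 \<le> gibbs_diff_const"
  unfolding gibbs_diff_const_def
  using gibbs_mgf_pos[of 1] gibbs_mgf_pos[of 3] gibbs_mgf_pos[of 4] gauss_abs_mgf_pos[of 1] gauss_abs_mgf_pos[of "-1"]
  by simp

lemma tilt_const_bound_ge: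
  "gibbs_mgf 2 + (gibbs_mgf 1)\<^sup>2 \<le> tilt_const_bound" "gibbs_diff_const \<le> tilt_const_bound"
  "2 * gibbs_diff_const * (1 + gibbs_mgf 1) \<le> tilt_const_bound" "0 \<le> tilt_const_bound"
proof -
  have "0 \<le> gibbs_diff_const * gibbs_mgf 1"
    using gibbs_diff_const_nonneg gibbs_mgf_pos[of 1] by simp
  then show "gibbs_mgf 2 + (gibbs_mgf 1)\<^sup>2 \<le> tilt_const_bound" "gibbs_diff_const \<le> tilt_const_bound"
    "2 * gibbs_diff_const * (1 + gibbs_mgf 1) \<le> tilt_const_bound" "0 \<le> tilt_const_bound"
    using gibbs_diff_const_nonneg gibbs_mgf_pos[of 1] gibbs_mgf_pos[of 2] zero_le_power2[of "gibbs_mgf 1"]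
    unfolding tilt_const_bound_def distrib_left by linarith+
qed

definition lip_with :: "real \<Rightarrow> (real \<Rightarrow> real) \<Rightarrow> bool" where
  "lip_with G g \<longleftrightarrow> bdd_borel g \<and> 0 \<le> G \<and> (\<forall>x y. \<bar>g x - g y\<bar> \<le> G * \<bar>x - y\<bar>)"

lemma lip_withD: "lip_with G g \<Longrightarrow> bdd_borel g" "lip_with G g \<Longrightarrow> 0 \<le> G"
  "lip_with G g \<Longrightarrow> \<bar>g x - g y\<bar> \<le> G * \<bar>x - y\<bar>"
  by (auto simp: lip_with_def)

lemma lip_with_of_deriv:
  assumes "bdd_borel g" "\<And>x. (g has_real_derivative g' x) (at x)" "\<And>x. \<bar>g' x\<bar> \<le> G"
  shows "lip_with G g"
proof -
  have "norm (g x - g y) \<le> G * norm (x - y)" for x y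
    by (rule field_differentiable_bound[of UNIV g g']) (use assms in auto)
  moreover have "0 \<le> G"
    using assms(3)[of 0] by linarith
  ultimately show ?thesis
    using assms(1) by (simp add: lip_with_def)
qed

lemma lip_with_gauss:
  assumes "lip_with G g" "0 \<le> v"
  shows "\<bar>g (x + z * sqrt v) - g x\<bar> \<le> (G * sqrt v) * exp (1 * \<bar>z\<bar>)"
proof -
  have "\<bar>g (x + z * sqrt v) - g x\<bar> \<le> G * (\<bar>z\<bar> * sqrt v)"
    using lip_withD(3)[OF assms(1), of "x + z * sqrt v" x] assms(2) by (simp add: abs_mult)
  also have "\<dots> \<le> G * (exp \<bar>z\<bar> * sqrt v)"
    using lip_withD(2)[OF assms(1)] assms(2) abs_le_exp_abs[of z] by (intro mult_left_mono mult_right_mono) auto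
  finally show ?thesis
    by (simp add: mult_ac)
qed

text \<open>Over a step of variance \<open>v\<close> each function moves by its Lipschitz constant
  times \<open>sqrt v\<close>, after recentring at its value in \<open>x\<close>.\<close>

lemma tilt_cov_bound:
  assumes a: "admissible m v f" and g: "lip_with G g" and h: "lip_with H h"
  shows "\<bar>tilt m v f (\<lambda>y. g y * h y) x - tilt m v f g x * tilt m v f h x\<bar> \<le> tilt_const_bound * (G * H * v)"
proof -
  interpret gibbs_measure m v f x
    using a by (rule admissible_gibbs)
  have "\<bar>cov (\<lambda>z. g (x + z * sqrt v)) (\<lambda>z. h (x + z * sqrt v))\<bar>
      \<le> (G * sqrt v) * (H * sqrt v) * (gibbs_mgf (1 + 1) + gibbs_mgf 1 * gibbs_mgf 1)"
    by (rule cov_bound[where a = "g x" and b = "h x"])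
      (intro bdd_borel_exp_bounded lip_withD(1)[OF g] lip_withD(1)[OF h] lip_with_gauss g h v)+
  also have "\<dots> = (gibbs_mgf 2 + (gibbs_mgf 1)\<^sup>2) * (G * H * v)"
    using v by (simp add: power2_eq_square)
  also have "\<dots> \<le> tilt_const_bound * (G * H * v)"
    using v lip_withD(2)[OF g] lip_withD(2)[OF h] by (intro mult_right_mono tilt_const_bound_ge) auto
  finally show ?thesis
    by (simp add: cov_def tilt_def)
qed

text \<open>A change of the exponent by a function with Lipschitz constant \<open>\<kappa>\<close>
  costs one factor \<open>\<kappa> * sqrt v\<close> beyond the natural size of the quantity, which
  is \<open>G * sqrt v\<close> for a recentred mean and \<open>G^2 * v\<close> for a
  variance.\<close>

lemma tilt_change_bound:
  assumes a: "admissible m1 v f1" "admissible m2 v f2" and g: "lip_with G g"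
    and \<kappa>: "\<And>y. \<bar>(m1 * f1 y - m2 * f2 y) - (m1 * f1 x - m2 * f2 x)\<bar> \<le> \<kappa> * \<bar>y - x\<bar>" "\<kappa> \<le> 2"
  shows "\<bar>tilt m1 v f1 g x - tilt m2 v f2 g x\<bar> \<le> tilt_const_bound * (G * \<kappa> * v)"
    and "\<bar>(tilt m1 v f1 (\<lambda>y. g y * g y) x - (tilt m1 v f1 g x)\<^sup>2) - (tilt m2 v f2 (\<lambda>y. g y * g y) x - (tilt m2 v f2 g x)\<^sup>2)\<bar>
      \<le> tilt_const_bound * (G\<^sup>2 * \<kappa> * (v * sqrt v))"
proof -
  interpret A: gibbs_measure m1 v f1 x
    using a(1) by (rule admissible_gibbs)
  interpret B: gibbs_measure m2 v f2 x
    using a(2) by (rule admissible_gibbs)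
  note gm = admissible_gibbs[OF a(1)] admissible_gibbs[OF a(2)]
  have v: "0 \<le> v"
    using A.v by simp
  have "0 \<le> \<kappa>"
    using order_trans[OF abs_ge_zero \<kappa>(1)[of "x + 1"]] by simp
  have G: "0 \<le> G"
    by (rule lip_withD(2)[OF g])
  let ?g = "\<lambda>z. g (x + z * sqrt v)"
  let ?d = "\<lambda>z. ?g z - g x"
  have eb: "exp_bounded ?g"
    by (rule bdd_borel_exp_bounded[OF lip_withD(1)[OF g]])
  have "exp_bounded (\<lambda>z. ?g z - (\<lambda>_. g x) z)"
    by (rule exp_bounded_diff) (rule eb, rule exp_bounded_const)
  then have eb0: "exp_bounded ?d"
    by simp
  have vv: "sqrt v * sqrt v = v"
    using v by simp
  have "\<bar>A.E ?g - B.E ?g\<bar> \<le> gibbs_diff_const * (G * sqrt v * \<kappa> * sqrt v)"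
    by (rule gibbs_diff[OF gm eb _ \<kappa>]) (use lip_with_gauss[OF g v] in simp)
  also have "G * sqrt v * \<kappa> * sqrt v = G * \<kappa> * (sqrt v * sqrt v)"
    by (simp only: mult_ac)
  finally have d1: "\<bar>A.E ?g - B.E ?g\<bar> \<le> gibbs_diff_const * (G * \<kappa> * v)"
    unfolding vv .
  also have "\<dots> \<le> tilt_const_bound * (G * \<kappa> * v)"
    using v G \<open>0 \<le> \<kappa>\<close> by (intro mult_right_mono tilt_const_bound_ge) auto
  finally show "\<bar>tilt m1 v f1 g x - tilt m2 v f2 g x\<bar> \<le> tilt_const_bound * (G * \<kappa> * v)"
    by (simp add: tilt_def)
  \<comment> \<open>The variance of \<open>g\<close> is that of \<open>?d\<close>, and the square of
    \<open>?d\<close> is already of order \<open>v\<close>; \<open>gibbs_diff\<close> then adds the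
    factor \<open>\<kappa> * sqrt v\<close>.\<close>
  have sq: "\<bar>?d z * ?d z - 0\<bar> \<le> (2 * G\<^sup>2 * v) * exp \<bar>z\<bar>" for z
  proof -
    have "\<bar>?d z\<bar> \<le> G * (\<bar>z\<bar> * sqrt v)"
      using lip_withD(3)[OF g, of "x + z * sqrt v" x] v by (simp add: abs_mult)
    then have "\<bar>?d z\<bar> * \<bar>?d z\<bar> \<le> (G * (\<bar>z\<bar> * sqrt v)) * (G * (\<bar>z\<bar> * sqrt v))"
      using G v by (intro mult_mono) auto
    also have "\<dots> = (G\<^sup>2 * v) * \<bar>z\<bar>\<^sup>2"
      using v by (simp add: power2_eq_square mult_ac)
    also have "\<dots> \<le> (G\<^sup>2 * v) * (2 * exp \<bar>z\<bar>)"
      using power_le_fact_exp[of "\<bar>z\<bar>" 2] v by (intro mult_left_mono) auto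
    finally show ?thesis
      by (simp add: abs_mult)
  qed
  have d2: "\<bar>A.E (\<lambda>z. ?d z * ?d z) - B.E (\<lambda>z. ?d z * ?d z)\<bar> \<le> gibbs_diff_const * (2 * G\<^sup>2 * v * \<kappa> * sqrt v)"
    by (rule gibbs_diff[OF gm exp_bounded_mult[OF eb0 eb0] sq \<kappa>])
  have d3: "\<bar>A.E ?d - B.E ?d\<bar> \<le> gibbs_diff_const * (G * \<kappa> * v)"
    using d1 eb by (simp add: A.E_diff B.E_diff)
  have b0: "\<bar>A.E ?d\<bar> \<le> (G * sqrt v) * gibbs_mgf 1" "\<bar>B.E ?d\<bar> \<le> (G * sqrt v) * gibbs_mgf 1"
    using A.E_bound[OF lip_with_gauss[OF g v]] B.E_bound[OF lip_with_gauss[OF g v]] by auto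
  have "\<bar>(A.E ?d)\<^sup>2 - (B.E ?d)\<^sup>2\<bar> = \<bar>A.E ?d - B.E ?d\<bar> * \<bar>A.E ?d + B.E ?d\<bar>"
    by (simp add: power2_eq_square square_diff_square_factored abs_mult mult.commute)
  also have "\<dots> \<le> (gibbs_diff_const * (G * \<kappa> * v)) * (2 * ((G * sqrt v) * gibbs_mgf 1))"
    using d3 b0 gibbs_diff_const_nonneg G \<open>0 \<le> \<kappa>\<close> v by (intro mult_mono) auto
  finally have d4: "\<bar>(A.E ?d)\<^sup>2 - (B.E ?d)\<^sup>2\<bar> \<le> 2 * gibbs_diff_const * gibbs_mgf 1 * (G\<^sup>2 * \<kappa> * (v * sqrt v))"
    by (simp add: power2_eq_square mult_ac)
  have A0: "tilt m1 v f1 (\<lambda>y. g y * g y) x - (tilt m1 v f1 g x)\<^sup>2 = A.E (\<lambda>z. ?d z * ?d z) - (A.E ?d)\<^sup>2"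
    using A.cov_shift[OF eb eb, of "g x" "g x"] by (simp add: A.cov_def tilt_def power2_eq_square)
  have B0: "tilt m2 v f2 (\<lambda>y. g y * g y) x - (tilt m2 v f2 g x)\<^sup>2 = B.E (\<lambda>z. ?d z * ?d z) - (B.E ?d)\<^sup>2"
    using B.cov_shift[OF eb eb, of "g x" "g x"] by (simp add: B.cov_def tilt_def power2_eq_square)
  have "\<bar>(A.E (\<lambda>z. ?d z * ?d z) - (A.E ?d)\<^sup>2) - (B.E (\<lambda>z. ?d z * ?d z) - (B.E ?d)\<^sup>2)\<bar>
      \<le> 2 * gibbs_diff_const * (G\<^sup>2 * \<kappa> * (v * sqrt v)) + 2 * gibbs_diff_const * gibbs_mgf 1 * (G\<^sup>2 * \<kappa> * (v * sqrt v))"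
  proof -
    have "gibbs_diff_const * (2 * G\<^sup>2 * v * \<kappa> * sqrt v) = 2 * gibbs_diff_const * (G\<^sup>2 * \<kappa> * (v * sqrt v))"
      by (simp add: mult_ac)
    with d2 d4 show ?thesis
      by linarith
  qed
  also have "\<dots> = (2 * gibbs_diff_const * (1 + gibbs_mgf 1)) * (G\<^sup>2 * \<kappa> * (v * sqrt v))"
    by (simp add: algebra_simps)
  also have "\<dots> \<le> tilt_const_bound * (G\<^sup>2 * \<kappa> * (v * sqrt v))"
    using v \<open>0 \<le> \<kappa>\<close> by (intro mult_right_mono tilt_const_bound_ge) auto
  finally show "\<bar>(tilt m1 v f1 (\<lambda>y. g y * g y) x - (tilt m1 v f1 g x)\<^sup>2) - (tilt m2 v f2 (\<lambda>y. g y * g y) x - (tilt m2 v f2 g x)\<^sup>2)\<bar>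
      \<le> tilt_const_bound * (G\<^sup>2 * \<kappa> * (v * sqrt v))"
    unfolding A0 B0 .
qed

section \<open>Tilts of powers of the hyperbolic secant\<close>

text \<open>The first-order term vanishes by symmetry. The bound on \<open>\<psi>3\<close> is
  relative to the base point \<open>x\<close>, which later permits division by \<open>cosh x\<close>
  with constants uniform in \<open>x\<close>.\<close>

lemma std_normal_taylor:
  assumes d: "\<And>y. (\<psi> has_real_derivative \<psi>1 y) (at y)" "\<And>y. (\<psi>1 has_real_derivative \<psi>2 y) (at y)"
      "\<And>y. (\<psi>2 has_real_derivative \<psi>3 y) (at y)"
    and b: "\<And>y. \<bar>\<psi>3 y\<bar> \<le> M * exp (k * \<bar>y - x\<bar>)" "0 \<le> k" and v: "0 \<le> v" "v \<le> 1"
  shows "\<bar>(LINT z|std_normal_distribution. \<psi> (x + z * sqrt v)) - \<psi> x - v / 2 * \<psi>2 x\<bar> \<le> M * (v * sqrt v) * gauss_abs_mgf (k + 1)"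
proof -
  have "0 \<le> M"
    using b(1)[of x] by simp
  have T: "\<bar>\<psi> (x + y) - \<psi> x - \<psi>1 x * y - \<psi>2 x / 2 * y\<^sup>2\<bar> \<le> M * exp (k * \<bar>y\<bar>) * (\<bar>y\<bar> ^ 3 / 6)" for y
  proof (cases "y = 0")
    case False
    define diff where "diff i = (if i = 0 then \<psi> else if i = 1 then \<psi>1 else if i = 2 then \<psi>2 else \<psi>3)" for i :: nat
    have dd: "\<forall>m t. m < 3 \<and> min x (x + y) \<le> t \<and> t \<le> max x (x + y) \<longrightarrow> (diff m has_real_derivative diff (Suc m) t) (at t)"
      using d by (auto simp: diff_def less_Suc_eq numeral_3_eq_3)
    obtain t where t: "if x + y < x then x + y < t \<and> t < x else x < t \<and> t < x + y"
      and eq: "\<psi> (x + y) = (\<Sum>m<3. diff m x / fact m * (x + y - x) ^ m) + diff 3 t / fact 3 * (x + y - x) ^ 3"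
      using Taylor[of 3 diff \<psi>, OF _ _ dd, of x "x + y"] False by (auto simp: diff_def)
    have r: "\<psi> (x + y) - \<psi> x - \<psi>1 x * y - \<psi>2 x / 2 * y\<^sup>2 = \<psi>3 t * (y ^ 3 / 6)"
      using eq by (simp add: diff_def eval_nat_numeral)
    have "\<bar>\<psi> (x + y) - \<psi> x - \<psi>1 x * y - \<psi>2 x / 2 * y\<^sup>2\<bar> = \<bar>\<psi>3 t\<bar> * (\<bar>y\<bar> ^ 3 / 6)"
      unfolding r by (simp add: abs_mult power_abs)
    also have "\<dots> \<le> (M * exp (k * \<bar>y\<bar>)) * (\<bar>y\<bar> ^ 3 / 6)"
    proof (rule mult_right_mono)
      have "\<bar>t - x\<bar> \<le> \<bar>y\<bar>"
        using t by (auto split: if_splits)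
      then have "M * exp (k * \<bar>t - x\<bar>) \<le> M * exp (k * \<bar>y\<bar>)"
        using \<open>0 \<le> M\<close> b(2) by (intro mult_left_mono) (auto intro: mult_left_mono)
      then show "\<bar>\<psi>3 t\<bar> \<le> M * exp (k * \<bar>y\<bar>)"
        using b(1)[of t] by linarith
    qed simp
    finally show ?thesis .
  qed simp
  let ?R = "\<lambda>z. \<psi> (x + z * sqrt v) - \<psi> x - \<psi>1 x * (z * sqrt v) - \<psi>2 x / 2 * (z * sqrt v)\<^sup>2"
  have R: "\<bar>?R z\<bar> \<le> (M * (v * sqrt v)) * exp ((k + 1) * \<bar>z\<bar>)" for z
  proof -
    have zs: "\<bar>z * sqrt v\<bar> \<le> \<bar>z\<bar>"
      using v by (simp add: abs_mult mult_left_le)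
    have "\<bar>z * sqrt v\<bar> ^ 3 = (v * sqrt v) * \<bar>z\<bar> ^ 3"
    proof -
      have "sqrt v ^ 3 = v * sqrt v"
        using v by (simp add: power3_eq_cube)
      then show ?thesis
        using v by (simp add: abs_mult power_mult_distrib)
    qed
    also have "\<dots> \<le> (v * sqrt v) * (6 * exp \<bar>z\<bar>)"
      using power_le_fact_exp[of "\<bar>z\<bar>" 3] v by (intro mult_left_mono) (auto simp: fact_numeral)
    finally have c: "\<bar>z * sqrt v\<bar> ^ 3 / 6 \<le> (v * sqrt v) * exp \<bar>z\<bar>"
      by simp
    have "\<bar>?R z\<bar> \<le> M * exp (k * \<bar>z * sqrt v\<bar>) * (\<bar>z * sqrt v\<bar> ^ 3 / 6)"
      by (rule T)
    also have "\<dots> \<le> M * exp (k * \<bar>z\<bar>) * ((v * sqrt v) * exp \<bar>z\<bar>)"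
      using \<open>0 \<le> M\<close> b(2) zs by (intro mult_mono c) (auto intro!: mult_left_mono)
    also have "\<dots> = (M * (v * sqrt v)) * (exp (k * \<bar>z\<bar>) * exp \<bar>z\<bar>)"
      by (simp only: mult_ac)
    also have "exp (k * \<bar>z\<bar>) * exp \<bar>z\<bar> = exp ((k + 1) * \<bar>z\<bar>)"
      by (simp add: distrib_right exp_add)
    finally show ?thesis .
  qed
  have "\<psi> \<in> borel_measurable borel"
    by (intro borel_measurable_continuous_onI continuous_at_imp_continuous_on) (use d DERIV_isCont in blast)
  then have "?R \<in> borel_measurable borel"
    by measurable
  then have iR: "integrable std_normal_distribution ?R"
    by (rule integrable_std_normal_exp_bound[OF _ R])
  have i1: "integrable std_normal_distribution (\<lambda>z. \<psi>1 x * (z * sqrt v))"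
    using std_normal_integrable_id by simp
  have i2: "integrable std_normal_distribution (\<lambda>z. \<psi>2 x / 2 * (z * sqrt v)\<^sup>2)"
    using std_normal_integrable_square by (simp add: power_mult_distrib)
  define Rf where "Rf = ?R"
  have iRf: "integrable std_normal_distribution Rf"
    unfolding Rf_def by (rule iR)
  have "(LINT z|std_normal_distribution. \<psi> (x + z * sqrt v))
      = (LINT z|std_normal_distribution. ((Rf z + \<psi> x) + \<psi>1 x * (z * sqrt v)) + \<psi>2 x / 2 * (z * sqrt v)\<^sup>2)"
    by (simp add: Rf_def)
  also have "\<dots> = (LINT z|std_normal_distribution. Rf z) + \<psi> x + \<psi>2 x / 2 * v"
    using iRf i1 i2 v by (simp add: Bochner_Integration.integral_add std_normal_integral_id std_normal_integral_square power_mult_distrib)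
  finally have "(LINT z|std_normal_distribution. \<psi> (x + z * sqrt v)) - \<psi> x - v / 2 * \<psi>2 x = (LINT z|std_normal_distribution. Rf z)"
    by simp
  then show ?thesis
    using std_normal_integral_bound[OF R] by (simp add: Rf_def)
qed

definition sech2 :: "real \<Rightarrow> real" where
  "sech2 x = 1 - (tanh x)\<^sup>2"

lemma sech2_eq: "sech2 x = 1 / (cosh x)\<^sup>2"
proof -
  have "cosh x \<noteq> 0"
    using cosh_real_pos[of x] by simp
  then have "sech2 x = ((cosh x)\<^sup>2 - (sinh x)\<^sup>2) / (cosh x)\<^sup>2"
    by (simp add: sech2_def tanh_def power_divide diff_divide_distrib)
  then show ?thesis
    by (simp add: hyperbolic_pythagoras)
qed

lemma sech2_bounds: "0 < sech2 x" "sech2 x \<le> 1"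
proof -
  show "0 < sech2 x"
    using cosh_real_pos[of x] by (simp add: sech2_eq)
  show "sech2 x \<le> 1"
    by (simp add: sech2_def)
qed

lemma abs_tanh_le_1: "\<bar>tanh x\<bar> \<le> (1::real)"
  using tanh_real_bounds[of x] by auto

lemma DERIV_tanh_sech2: "(tanh has_real_derivative sech2 x) (at x)"
proof -
  have "cosh x \<noteq> 0"
    using cosh_real_pos[of x] by simp
  then show ?thesis
    unfolding sech2_def by (auto intro!: derivative_eq_intros)
qed

lemma DERIV_sech2: "(sech2 has_real_derivative - 2 * tanh x * sech2 x) (at x)"
  unfolding sech2_def[abs_def] by (auto intro!: derivative_eq_intros DERIV_tanh_sech2 simp: sech2_def)

lemma DERIV_ln_cosh: "((\<lambda>y. ln (cosh y)) has_real_derivative tanh x) (at x)"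
  by (auto intro!: derivative_eq_intros simp: tanh_def)

lemma bdd_borel_tanh: "bdd_borel tanh"
proof (rule bdd_borelI)
  show "tanh \<in> borel_measurable (borel :: real measure)"
    by (intro borel_measurable_continuous_onI continuous_at_imp_continuous_on) (use DERIV_tanh_sech2 DERIV_isCont in blast)
qed (rule abs_tanh_le_1)

lemma bdd_borel_sech2: "bdd_borel sech2"
  unfolding sech2_def[abs_def] power2_eq_square
  by (intro bdd_borel_diff bdd_borel_mult bdd_borel_const bdd_borel_tanh)

lemma bdd_borel_power: "bdd_borel g \<Longrightarrow> bdd_borel (\<lambda>x. g x ^ n)"
  by (induction n) (auto intro: bdd_borel_mult)

lemma lip_with_tanh: "lip_with 1 tanh"
  by (rule lip_with_of_deriv[OF bdd_borel_tanh DERIV_tanh_sech2])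
    (use sech2_bounds in \<open>auto simp: abs_of_pos\<close>)

lemma abs_sech2_le_1: "\<bar>sech2 x\<bar> \<le> 1"
  using sech2_bounds[of x] by simp

lemma lip_with_sech2_power: "lip_with (2 * real n) (\<lambda>x. sech2 x ^ n)"
proof (rule lip_with_of_deriv[OF bdd_borel_power[OF bdd_borel_sech2]])
  fix x
  show "((\<lambda>x. sech2 x ^ n) has_real_derivative real n * sech2 x ^ (n - 1) * (- 2 * tanh x * sech2 x)) (at x)"
    by (auto intro!: derivative_eq_intros DERIV_sech2)
  have "\<bar>real n * sech2 x ^ (n - 1) * (- 2 * tanh x * sech2 x)\<bar> \<le> real n * 1 * (2 * 1 * 1)"
    unfolding abs_mult power_abs using abs_sech2_le_1[of x] abs_tanh_le_1[of x]
    by (intro mult_mono power_le_one) auto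
  then show "\<bar>real n * sech2 x ^ (n - 1) * (- 2 * tanh x * sech2 x)\<bar> \<le> 2 * real n"
    by simp
qed

text \<open>The logarithm of \<open>cosh\<close> has Lipschitz constant 1. This bounds a power of
  \<open>1 / cosh\<close> at \<open>y\<close> by its value at \<open>x\<close>, as the hypothesis of
  \<open>std_normal_taylor\<close> demands.\<close>

lemma inverse_cosh_shift: "1 / cosh y \<le> 1 / cosh x * exp \<bar>y - x\<bar>" for x y :: real
proof -
  have "ln (cosh x) - ln (cosh y) \<le> \<bar>y - x\<bar>"
    using lip1D[OF lip1_ln_cosh, of x y] by (simp add: abs_minus_commute)
  then have "exp (ln (cosh x)) \<le> exp (ln (cosh y) + \<bar>y - x\<bar>)"
    by (subst exp_le_cancel_iff) linarith
  then show ?thesis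
    by (simp add: exp_add field_simps)
qed

text \<open>The Doob transform of the heat semigroup by \<open>cosh\<close>: the solvable tilt with
  parameter 1, of which all tilts near the top are perturbations.\<close>

abbreviation "free_tilt v \<equiv> tilt 1 v (\<lambda>y. ln (cosh y))"

lemma free_tilt_eq:
  assumes "0 \<le> v"
  shows "free_tilt v g x = (LINT z|std_normal_distribution. g (x + z * sqrt v) * cosh (x + z * sqrt v)) / (cosh x * exp (v / 2))"
  using assms by (simp add: tilt_eq_ratio std_normal_cosh)

text \<open>\<open>sech2 y ^ n * cosh y\<close> is the odd power \<open>k = 2 * n - 1\<close> of
  \<open>1 / cosh y\<close>, and the second derivative of this power is
  \<open>k^2 - k * (k + 1) * sech2 y\<close> times the power itself. The \<open>- 1\<close> in the
  coefficient stems from the normalisation \<open>exp (v / 2)\<close>.\<close>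

lemma free_tilt_sech2_power:
  fixes n :: nat
  assumes "1 \<le> n"
  defines "k \<equiv> 2 * real n - 1"
  obtains C where "0 \<le> C" "\<And>v x. 0 \<le> v \<Longrightarrow> v \<le> 1 \<Longrightarrow>
    \<bar>free_tilt v (\<lambda>y. sech2 y ^ n) x - sech2 x ^ n * (1 + v / 2 * (k\<^sup>2 - 1 - k * (k + 1) * sech2 x))\<bar> \<le> C * (v * sqrt v)"
proof -
  define K where "K = 2 * n - 1"
  have K: "real K = k"
    using assms(1) by (simp add: K_def k_def of_nat_diff)
  have "1 \<le> k"
    using assms(1) by (simp add: k_def)
  define \<psi> where "\<psi> y = (1 / cosh y) ^ K" for y :: real
  have cp: "0 < cosh y" for y :: real
    by (rule cosh_real_pos)
  have \<psi>0: "0 < \<psi> y" for y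
    using cp by (simp add: \<psi>_def)
  define \<psi>1 where "\<psi>1 y = - k * tanh y * \<psi> y" for y
  define \<psi>2 where "\<psi>2 y = (k\<^sup>2 - k * (k + 1) * sech2 y) * \<psi> y" for y
  define \<psi>3 where "\<psi>3 y = (2 * (k * (k + 1)) * tanh y * sech2 y) * \<psi> y + (k\<^sup>2 - k * (k + 1) * sech2 y) * (- k * tanh y * \<psi> y)" for y
  have d0: "(\<psi> has_real_derivative \<psi>1 y) (at y)" for y
  proof -
    have "((\<lambda>y. 1 / cosh y) has_real_derivative - (tanh y * (1 / cosh y))) (at y)"
      using cp[of y] by (auto intro!: derivative_eq_intros simp: tanh_def field_simps)
    then have "(\<psi> has_real_derivative (real K * (- (tanh y * (1 / cosh y)) * (1 / cosh y) ^ (K - Suc 0)))) (at y)"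
      unfolding \<psi>_def[abs_def] by (rule DERIV_power)
    moreover have "(1 / cosh y) ^ K = (1 / cosh y) ^ (K - 1) * (1 / cosh y)"
      using assms(1) by (cases K) (auto simp: K_def)
    ultimately show ?thesis
      by (simp add: \<psi>1_def \<psi>_def K mult.assoc)
  qed
  have d1: "(\<psi>1 has_real_derivative \<psi>2 y) (at y)" for y
    unfolding \<psi>1_def[abs_def]
    by (rule DERIV_cong[OF DERIV_mult[OF DERIV_cmult[OF DERIV_tanh_sech2] d0]])
      (simp add: \<psi>1_def \<psi>2_def sech2_def power2_eq_square algebra_simps)
  have d2: "(\<psi>2 has_real_derivative \<psi>3 y) (at y)" for y
    unfolding \<psi>2_def[abs_def]
    by (rule DERIV_cong[OF DERIV_mult[OF DERIV_diff[OF DERIV_const DERIV_cmult[OF DERIV_sech2]] d0]])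
      (simp add: \<psi>1_def \<psi>3_def algebra_simps)
  define a where "a y = k\<^sup>2 - k * (k + 1) * sech2 y" for y
  define A where "A = k\<^sup>2 + k * (k + 1)"
  have aA: "\<bar>a y\<bar> \<le> A" for y
  proof -
    have "\<bar>k * (k + 1) * sech2 y\<bar> \<le> k * (k + 1) * 1"
      unfolding abs_mult using \<open>1 \<le> k\<close> abs_sech2_le_1[of y] by (intro mult_mono) auto
    then show ?thesis
      using zero_le_power2[of k] unfolding a_def A_def abs_le_iff by linarith
  qed
  define M where "M = 2 * (k * (k + 1)) + A * k"
  have "0 \<le> A"
    using aA[of 0] by linarith
  have "0 \<le> M"
    using \<open>0 \<le> A\<close> \<open>1 \<le> k\<close> by (simp add: M_def)
  have b3: "\<bar>\<psi>3 y\<bar> \<le> M * \<psi> y" for y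
  proof -
    have "\<bar>2 * (k * (k + 1)) * tanh y * sech2 y\<bar> \<le> 2 * (k * (k + 1)) * 1 * 1"
      unfolding abs_mult using \<open>1 \<le> k\<close> abs_sech2_le_1[of y] abs_tanh_le_1[of y] by (intro mult_mono) auto
    moreover have "\<bar>a y * (- k * tanh y)\<bar> \<le> A * (k * 1)"
      unfolding abs_mult using \<open>1 \<le> k\<close> aA[of y] \<open>0 \<le> A\<close> abs_tanh_le_1[of y] by (intro mult_mono) auto
    ultimately have "\<bar>2 * (k * (k + 1)) * tanh y * sech2 y + a y * (- k * tanh y)\<bar> \<le> M"
      unfolding M_def by linarith
    moreover have "\<psi>3 y = (2 * (k * (k + 1)) * tanh y * sech2 y + a y * (- k * tanh y)) * \<psi> y"
      by (simp add: \<psi>3_def a_def algebra_simps)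
    ultimately show ?thesis
      using \<psi>0[of y] by (simp add: abs_mult)
  qed
  have b3': "\<bar>\<psi>3 y\<bar> \<le> (M * \<psi> x) * exp (k * \<bar>y - x\<bar>)" for x y
  proof -
    have "\<psi> y \<le> (1 / cosh x * exp \<bar>y - x\<bar>) ^ K"
      unfolding \<psi>_def using cp[of y] by (intro power_mono inverse_cosh_shift) (auto intro: less_imp_le)
    also have "\<dots> = \<psi> x * exp (k * \<bar>y - x\<bar>)"
      by (simp add: \<psi>_def power_mult_distrib power_divide K flip: exp_of_nat_mult)
    finally have "M * \<psi> y \<le> M * (\<psi> x * exp (k * \<bar>y - x\<bar>))"
      using \<open>0 \<le> M\<close> by (rule mult_left_mono)
    with b3[of y] show ?thesis
      by (simp add: mult.assoc)
  qed
  define G where "G = gauss_abs_mgf (k + 1)"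
  have "0 \<le> G"
    using gauss_abs_mgf_pos[of "k + 1"] by (simp add: G_def)
  show ?thesis
  proof (rule that)
    show "0 \<le> M * G + (1 + A)"
      using \<open>0 \<le> M\<close> \<open>0 \<le> G\<close> \<open>0 \<le> A\<close> by simp
    fix v x :: real assume v: "0 \<le> v" "v \<le> 1"
    have pow: "sech2 y ^ n * cosh y = \<psi> y" for y
    proof -
      have "sech2 y ^ n * cosh y = (1 / cosh y) ^ (2 * n) * cosh y"
        by (simp add: sech2_eq power_mult power_divide)
      also have "2 * n = Suc K"
        using assms(1) by (simp add: K_def)
      finally show ?thesis
        using cp[of y] by (simp add: \<psi>_def)
    qed
    define J where "J = (LINT z|std_normal_distribution. \<psi> (x + z * sqrt v)) / cosh x"
    define S where "S = sech2 x ^ n"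
    have S: "0 \<le> S" "S \<le> 1"
      using sech2_bounds[of x] by (auto simp: S_def power_le_one)
    have \<psi>S: "\<psi> x = S * cosh x"
      using pow[of x] by (simp add: S_def)
    have a2: "\<psi>2 x = a x * \<psi> x"
      by (simp add: \<psi>2_def a_def)
    define h where "h = v / 2"
    \<comment> \<open>The Taylor error is proportional to \<open>\<psi> x = S * cosh x\<close>, so
      after division by \<open>cosh x\<close> it is bounded uniformly in \<open>x\<close>.\<close>
    have "\<bar>(LINT z|std_normal_distribution. \<psi> (x + z * sqrt v)) - \<psi> x - v / 2 * \<psi>2 x\<bar> \<le> (M * \<psi> x) * (v * sqrt v) * G"
      unfolding G_def by (rule std_normal_taylor[OF d0 d1 d2 b3' _ v]) (use \<open>1 \<le> k\<close> in simp)
    moreover have "(LINT z|std_normal_distribution. \<psi> (x + z * sqrt v)) - \<psi> x - v / 2 * \<psi>2 x = (J - S * (1 + h * a x)) * cosh x"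
      using cp[of x] by (simp add: J_def h_def a2 \<psi>S algebra_simps)
    ultimately have "\<bar>J - S * (1 + h * a x)\<bar> * cosh x \<le> (M * S * (v * sqrt v) * G) * cosh x"
      using cp[of x] by (simp add: abs_mult \<psi>S mult_ac)
    then have 1: "\<bar>J - S * (1 + h * a x)\<bar> \<le> M * S * (v * sqrt v) * G"
      using cp[of x] by simp
    also have "\<dots> \<le> M * 1 * (v * sqrt v) * G"
      using S v \<open>0 \<le> M\<close> \<open>0 \<le> G\<close> by (intro mult_right_mono mult_left_mono) auto
    finally have 1: "\<bar>J - S * (1 + h * a x)\<bar> \<le> M * G * (v * sqrt v)"
      by (simp add: mult_ac)
    have h: "0 \<le> h" "h \<le> 1"
      using v by (auto simp: h_def)
    have e1: "\<bar>exp (- h) - 1 + h\<bar> \<le> h\<^sup>2"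
    proof -
      have "exp (- h) = 1 / exp h"
        by (simp add: exp_minus divide_inverse)
      also have "\<dots> \<le> 1 / (1 + h)"
        using exp_ge_add_one_self[of h] h by (intro divide_left_mono) (auto simp: add.commute)
      also have "\<dots> \<le> 1 - h + h\<^sup>2"
        using h by (simp add: divide_simps) (simp add: algebra_simps power2_eq_square)
      finally show ?thesis
        using exp_ge_add_one_self[of "-h"] by (simp add: abs_le_iff)
    qed
    have e2: "\<bar>exp (- h) - 1\<bar> \<le> h"
      using exp_ge_add_one_self[of "-h"] h by (simp add: abs_le_iff)
    have "\<bar>exp (- h) * (1 + h * a x) - (1 + h * (a x - 1))\<bar> = \<bar>(exp (- h) - 1 + h) + h * a x * (exp (- h) - 1)\<bar>"
      by (simp add: algebra_simps)
    also have "\<dots> \<le> h\<^sup>2 + h * A * h"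
      using e1 e2 h aA[of x] \<open>0 \<le> A\<close>
      by (intro order_trans[OF abs_triangle_ineq add_mono]) (auto simp: abs_mult intro!: mult_mono)
    also have "\<dots> = (1 + A) * h\<^sup>2"
      by (simp add: power2_eq_square algebra_simps)
    also have "\<dots> \<le> (1 + A) * (v * sqrt v)"
    proof (rule mult_left_mono)
      have "h\<^sup>2 \<le> v * v"
        using h v unfolding power2_eq_square h_def by (intro mult_mono) auto
      also have "\<dots> \<le> v * sqrt v"
      proof (rule mult_left_mono)
        show "v \<le> sqrt v"
          using v real_le_rsqrt[of v v] by (simp add: power2_eq_square mult_left_le)
      qed (rule v)
      finally show "h\<^sup>2 \<le> v * sqrt v" .
    qed (use \<open>0 \<le> A\<close> in simp)
    finally have 2: "\<bar>exp (- h) * (1 + h * a x) - (1 + h * (a x - 1))\<bar> \<le> (1 + A) * (v * sqrt v)" .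
    have "free_tilt v (\<lambda>y. sech2 y ^ n) x = exp (- h) * J"
      unfolding free_tilt_eq[OF v(1)] J_def h_def pow by (simp add: exp_minus field_simps)
    moreover have "k\<^sup>2 - 1 - k * (k + 1) * sech2 x = a x - 1"
      by (simp add: a_def)
    ultimately have "free_tilt v (\<lambda>y. sech2 y ^ n) x - sech2 x ^ n * (1 + v / 2 * (k\<^sup>2 - 1 - k * (k + 1) * sech2 x))
        = exp (- h) * (J - S * (1 + h * a x)) + S * (exp (- h) * (1 + h * a x) - (1 + h * (a x - 1)))"
      by (simp add: S_def[symmetric] h_def[symmetric] algebra_simps)
    also have "\<bar>\<dots>\<bar> \<le> 1 * (M * G * (v * sqrt v)) + 1 * ((1 + A) * (v * sqrt v))"
    proof (rule order_trans[OF abs_triangle_ineq add_mono])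
      show "\<bar>exp (- h) * (J - S * (1 + h * a x))\<bar> \<le> 1 * (M * G * (v * sqrt v))"
        unfolding abs_mult by (rule mult_mono) (use 1 h in auto)
      show "\<bar>S * (exp (- h) * (1 + h * a x) - (1 + h * (a x - 1)))\<bar> \<le> 1 * ((1 + A) * (v * sqrt v))"
        unfolding abs_mult by (rule mult_mono) (use 2 S in auto)
    qed
    finally show "\<bar>free_tilt v (\<lambda>y. sech2 y ^ n) x - sech2 x ^ n * (1 + v / 2 * (k\<^sup>2 - 1 - k * (k + 1) * sech2 x))\<bar> \<le> (M * G + (1 + A)) * (v * sqrt v)"
      by (simp add: algebra_simps)
  qed
qed

section \<open>Gibbs chains near the top of the support\<close>

lemma free_admissible: "0 \<le> v \<Longrightarrow> v \<le> 1 \<Longrightarrow> admissible 1 v (\<lambda>y. ln (cosh y))"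
  by (simp add: admissible_def lip1_ln_cosh)

text \<open>Differentiate the solvable step: \<open>ln (cosh x) + v / 2\<close> has slope
  \<open>tanh\<close>, and this slope is also the tilted average of \<open>tanh\<close>.\<close>

lemma free_tilt_tanh:
  assumes v: "0 \<le> v" "v \<le> 1"
  shows "free_tilt v tanh x = tanh x"
proof -
  have "gauss_step 1 v (\<lambda>y. ln (cosh y)) = (\<lambda>x. ln (cosh x) + v / 2)"
    using gauss_step_ln_cosh[OF v(1), of 0] by (simp add: fun_eq_iff)
  moreover have "((\<lambda>x. ln (cosh x) + v / 2) has_real_derivative tanh x) (at x)"
    by (rule DERIV_cong[OF DERIV_add[OF DERIV_ln_cosh DERIV_const]]) simp
  ultimately show ?thesis
    using DERIV_unique[OF gauss_step_DERIV[OF free_admissible[OF v] DERIV_ln_cosh bdd_borel_tanh]] by force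
qed

text \<open>Differentiate the fixed-point identity of \<open>tanh\<close>. The conditional variance
  of \<open>tanh\<close> is exactly the expected decrease of \<open>sech2\<close>, so the expansion
  for \<open>sech2\<close> also yields this variance.\<close>

lemma free_tilt_sech2:
  assumes v: "0 \<le> v" "v \<le> 1"
  shows "sech2 x = free_tilt v sech2 x + (free_tilt v (\<lambda>y. tanh y * tanh y) x - (free_tilt v tanh x)\<^sup>2)"
proof -
  have "free_tilt v tanh = tanh"
    using free_tilt_tanh[OF v] by (simp add: fun_eq_iff)
  then have eq: "free_tilt v tanh = tanh" .
  note d = tilt_DERIV[where g = tanh and g' = sech2 and x = x,
      OF free_admissible[OF v] DERIV_ln_cosh bdd_borel_tanh DERIV_tanh_sech2 bdd_borel_tanh bdd_borel_sech2]
  show ?thesis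
    using DERIV_unique[OF DERIV_tanh_sech2[of x] d[unfolded eq]] by (simp add: eq power2_eq_square)
qed

section \<open>Averages along a chain, its slope and its curvature\<close>

locale gibbs_chain =
  fixes m v :: "nat \<Rightarrow> real" and N :: nat
  assumes m: "\<And>i. 0 \<le> m i" "\<And>i. m i \<le> 1" and v: "\<And>i. 0 \<le> v i" "\<And>i. v i \<le> 1"
begin

abbreviation "f \<equiv> chain m v N"
abbreviation "L i \<equiv> tilt (m i) (v i) (f (Suc i))"

lemma lip1_chain: "lip1 (f i)"
proof -
  have "lip1 (foldr (\<lambda>j. gauss_step (m j) (v j)) js (\<lambda>x. ln (cosh x)))" for js
    by (induction js) (auto simp: lip1_ln_cosh lip1_gauss_step m)
  then show ?thesis
    by (simp add: chain_def)
qed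

lemma adm: "admissible (m i) (v i) (f (Suc i))"
  using m v lip1_chain by (simp add: admissible_def)

text \<open>Expectation of \<open>g\<close> at node \<open>i\<close> for the Markov chain that
  starts at 0 and has transition operators \<open>L\<close>; composing the operators plays the role
  of the path measure.\<close>

primrec path_avg :: "nat \<Rightarrow> (real \<Rightarrow> real) \<Rightarrow> real" where
  "path_avg 0 g = g 0"
| "path_avg (Suc i) g = path_avg i (L i g)"

lemma path_avg_const: "path_avg i (\<lambda>_. c) = c"
proof (induction i)
  case (Suc i)
  have "L i (\<lambda>_. c) = (\<lambda>_. c)"
    by (rule ext) (rule tilt_const[OF adm])
  then show ?case
    using Suc by simp
qed simp

lemma path_avg_add: "bdd_borel g \<Longrightarrow> bdd_borel h \<Longrightarrow> path_avg i (\<lambda>x. g x + h x) = path_avg i g + path_avg i h"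
proof (induction i arbitrary: g h)
  case (Suc i)
  have "L i (\<lambda>x. g x + h x) = (\<lambda>x. L i g x + L i h x)"
    by (rule ext) (rule tilt_add[OF adm Suc.prems])
  then show ?case
    using Suc.IH[OF bdd_borel_tilt[OF adm Suc.prems(1)] bdd_borel_tilt[OF adm Suc.prems(2)]] by simp
qed simp

lemma path_avg_cmult: "path_avg i (\<lambda>x. c * g x) = c * path_avg i g"
proof (induction i arbitrary: g)
  case (Suc i)
  have "L i (\<lambda>x. c * g x) = (\<lambda>x. c * L i g x)"
    by (rule ext) (rule tilt_cmult[OF adm])
  then show ?case
    using Suc.IH by simp
qed simp

lemma path_avg_diff: "bdd_borel g \<Longrightarrow> bdd_borel h \<Longrightarrow> path_avg i (\<lambda>x. g x - h x) = path_avg i g - path_avg i h"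
  using path_avg_add[of g "\<lambda>x. -1 * h x" i] path_avg_cmult[of i "-1" h] bdd_borel_mult[of "\<lambda>_. -1" h] by simp

lemma path_avg_mono: "bdd_borel g \<Longrightarrow> bdd_borel h \<Longrightarrow> (\<And>x. g x \<le> h x) \<Longrightarrow> path_avg i g \<le> path_avg i h"
proof (induction i arbitrary: g h)
  case (Suc i)
  show ?case
    unfolding path_avg.simps
    by (intro Suc.IH bdd_borel_tilt adm Suc.prems tilt_mono)
qed simp

lemma path_avg_le: "bdd_borel g \<Longrightarrow> (\<And>x. g x \<le> c) \<Longrightarrow> path_avg i g \<le> c"
  using path_avg_mono[of g "\<lambda>_. c" i] path_avg_const[of i c] by simp

lemma path_avg_ge: "bdd_borel g \<Longrightarrow> (\<And>x. c \<le> g x) \<Longrightarrow> c \<le> path_avg i g"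
  using path_avg_mono[of "\<lambda>_. c" g i] path_avg_const[of i c] by simp

lemma path_avg_diff_bound:
  assumes "bdd_borel g" "bdd_borel h" "\<And>x. \<bar>g x - h x\<bar> \<le> c"
  shows "\<bar>path_avg i g - path_avg i h\<bar> \<le> c"
proof -
  have b: "g x - h x \<le> c" "- c \<le> g x - h x" for x
    using assms(3)[of x] by linarith+
  show ?thesis
    using path_avg_le[OF bdd_borel_diff[OF assms(1,2)] b(1), of i] path_avg_ge[OF bdd_borel_diff[OF assms(1,2)] b(2), of i]
    by (simp add: path_avg_diff assms abs_le_iff)
qed

text \<open>\<open>slope\<close> and \<open>curv\<close> are defined by the recursions that the
  first and second derivative of \<open>f i\<close> obey. That they are these derivatives is
  \<open>chain_DERIV\<close>, where the parameters are positive.\<close>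

definition slope :: "nat \<Rightarrow> real \<Rightarrow> real" where
  "slope i = foldr L [i..<N] tanh"

definition curv :: "nat \<Rightarrow> real \<Rightarrow> real" where
  "curv i = foldr (\<lambda>j g x. L j g x + m j * (L j (\<lambda>y. slope (Suc j) y * slope (Suc j) y) x - (slope j x)\<^sup>2)) [i..<N] sech2"

lemma slope_N: "slope N = tanh" and curv_N: "curv N = sech2"
  by (simp_all add: slope_def curv_def)

lemma slope_step: "i < N \<Longrightarrow> slope i = L i (slope (Suc i))"
  by (simp add: slope_def upt_conv_Cons)

lemma curv_step: "i < N \<Longrightarrow> curv i x = L i (curv (Suc i)) x + m i * (L i (\<lambda>y. slope (Suc i) y * slope (Suc i) y) x - (slope i x)\<^sup>2)"
  by (simp add: curv_def upt_conv_Cons)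

lemma slope_bdd: "i \<le> N \<Longrightarrow> bdd_borel (slope i) \<and> (\<forall>x. \<bar>slope i x\<bar> \<le> 1)"
proof (induction i rule: inc_induct)
  case base
  then show ?case
    by (simp add: slope_N bdd_borel_tanh abs_tanh_le_1)
next
  case (step i)
  then show ?case
    using bdd_borel_tilt[OF adm] tilt_bound[OF adm] by (simp add: slope_step)
qed

lemmas bdd_borel_slope = slope_bdd[THEN conjunct1]
lemmas slope_le_1 = slope_bdd[THEN conjunct2, rule_format]

lemma bdd_borel_curv: "i \<le> N \<Longrightarrow> bdd_borel (curv i)"
proof (induction i rule: inc_induct)
  case base
  then show ?case
    by (simp add: curv_N bdd_borel_sech2)
next
  case (step i)
  have "curv i = (\<lambda>x. L i (curv (Suc i)) x + m i * (L i (\<lambda>y. slope (Suc i) y * slope (Suc i) y) x - slope i x * slope i x))"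
    using step curv_step by (simp add: fun_eq_iff power2_eq_square)
  moreover have "bdd_borel \<dots>"
    using step by (intro bdd_borel_add bdd_borel_mult bdd_borel_diff bdd_borel_const bdd_borel_tilt adm bdd_borel_slope) auto
  ultimately show ?case
    by simp
qed

lemma chain_DERIV:
  assumes "i \<le> N" "\<And>l. i \<le> l \<Longrightarrow> l < N \<Longrightarrow> 0 < m l"
  shows "(f i has_real_derivative slope i x) (at x) \<and> (slope i has_real_derivative curv i x) (at x)"
  using assms
proof (induction i arbitrary: x rule: inc_induct)
  case base
  then show ?case
    by (simp add: chain_N slope_N curv_N DERIV_ln_cosh DERIV_tanh_sech2)
next
  case (step i)
  have d: "(f (Suc i) has_real_derivative slope (Suc i) y) (at y)" "(slope (Suc i) has_real_derivative curv (Suc i) y) (at y)" for y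
    using step by auto
  have b: "bdd_borel (slope (Suc i))" "bdd_borel (curv (Suc i))"
    using step bdd_borel_slope bdd_borel_curv by auto
  have mi: "0 < m i"
    using step by simp
  have "(f i has_real_derivative slope i x) (at x)"
    using gauss_step_DERIV[OF adm d(1) b(1) mi, of x] step by (simp add: chain_step slope_step)
  moreover have "(slope i has_real_derivative curv i x) (at x)"
    using tilt_DERIV[OF adm d(1) b(1) d(2) b, of x] step by (simp add: slope_step[symmetric] curv_step power2_eq_square)
  ultimately show ?case
    by simp
qed

end

text \<open>The 13 is \<open>7 + 6\<close>, from the one-step error
  \<open>7 * (1 - m i) + 6 * e\<close> in \<open>near_estimates\<close>. The summand 1 ensures
  \<open>1 \<le> near_const\<close>, so that \<open>small\<close> also bounds the clock length of
  the window by 1.\<close>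

definition near_const :: real where
  "near_const = 13 * tilt_const_bound + 1"

lemma near_const_bounds: "1 \<le> near_const" "13 * tilt_const_bound \<le> near_const"
  using tilt_const_bound_ge(4) by (auto simp: near_const_def)

text \<open>Steps from \<open>J\<close> on lie above the top of the support and are free. The window
  \<open>j..<J\<close> below has parameters at least \<open>1 - \<eta>\<close>, and
  \<open>small\<close> makes it so short that the accumulated deviation from the free chain stays
  below \<open>\<eta>\<close>.\<close>

locale near_top = gibbs_chain +
  fixes j J :: nat and \<eta> :: real
  assumes jJ: "j \<le> J" "J \<le> N" and top: "\<And>i. J \<le> i \<Longrightarrow> i < N \<Longrightarrow> m i = 1"
    and near: "\<And>i. j \<le> i \<Longrightarrow> i < J \<Longrightarrow> 1 - \<eta> \<le> m i" and \<eta>: "0 \<le> \<eta>" "\<eta> \<le> 1 / 2"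
    and small: "near_const * (\<Sum>l\<in>{j..<J}. v l) \<le> 1"
begin

definition \<tau> :: "nat \<Rightarrow> real" where
  "\<tau> i = (\<Sum>l\<in>{i..<J}. v l)"

lemma tau_nonneg: "0 \<le> \<tau> i"
  by (simp add: \<tau>_def sum_nonneg v)

lemma tau_step: "i < J \<Longrightarrow> \<tau> i = v i + \<tau> (Suc i)"
  by (simp add: \<tau>_def sum.atLeast_Suc_lessThan)

lemma tau_top: "J \<le> i \<Longrightarrow> \<tau> i = 0"
  by (simp add: \<tau>_def)

lemma tau_le: "j \<le> i \<Longrightarrow> near_const * \<tau> i \<le> 1"
proof -
  assume "j \<le> i"
  then have "\<tau> i \<le> \<tau> j"
    unfolding \<tau>_def by (intro sum_mono2) (auto simp: v)
  then have "near_const * \<tau> i \<le> near_const * \<tau> j"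
    using near_const_bounds by (intro mult_left_mono) auto
  then show ?thesis
    using small by (simp add: \<tau>_def)
qed

lemma m_pos: "j \<le> i \<Longrightarrow> i < N \<Longrightarrow> 0 < m i"
  using near[of i] top[of i] \<eta> by (cases "i < J") auto

lemma near_DERIV:
  assumes "j \<le> i" "i \<le> N"
  shows "(f i has_real_derivative slope i x) (at x)" "(slope i has_real_derivative curv i x) (at x)"
  using chain_DERIV[of i x] m_pos assms by auto

abbreviation "err i \<equiv> near_const * \<eta> * \<tau> i"

lemma err_bounds:
  assumes "j \<le> i"
  shows "0 \<le> err i" "err i \<le> \<eta>" "err i \<le> 1"
proof -
  show "0 \<le> err i"
    using near_const_bounds \<eta> tau_nonneg by simp
  have "err i = \<eta> * (near_const * \<tau> i)"
    by simp
  also have "\<dots> \<le> \<eta> * 1"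
    using tau_le[OF assms] \<eta> by (intro mult_left_mono) auto
  finally show "err i \<le> \<eta>"
    by simp
  then show "err i \<le> 1"
    using \<eta> by simp
qed

text \<open>Closeness of the curvatures turns into Lipschitz bounds for the slope and for its
  distance to \<open>tanh\<close>, the form in which the covariance estimates accept it.\<close>

lemma near_lip:
  assumes i: "j \<le> i" "i \<le> N" and C: "\<And>x. \<bar>slope i x - tanh x\<bar> \<le> e" "\<And>x. \<bar>curv i x - sech2 x\<bar> \<le> e" "e \<le> 1"
  shows "lip_with 2 (slope i)" "lip_with e (\<lambda>x. slope i x - tanh x)" "lip_with 3 (\<lambda>x. slope i x + tanh x)"
proof -
  note d = near_DERIV(2)[OF i]
  have b: "bdd_borel (slope i)"
    using i by (intro bdd_borel_slope)
  have c2: "\<bar>curv i x\<bar> \<le> 2" "\<bar>curv i x + sech2 x\<bar> \<le> 3" for x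
    using C(2)[of x] C(3) abs_sech2_le_1[of x] by linarith+
  show "lip_with 2 (slope i)"
    by (rule lip_with_of_deriv[OF b d c2(1)])
  show "lip_with e (\<lambda>x. slope i x - tanh x)"
    by (rule lip_with_of_deriv[OF bdd_borel_diff[OF b bdd_borel_tanh] DERIV_diff[OF d DERIV_tanh_sech2] C(2)])
  show "lip_with 3 (\<lambda>x. slope i x + tanh x)"
    by (rule lip_with_of_deriv[OF bdd_borel_add[OF b bdd_borel_tanh] DERIV_add[OF d DERIV_tanh_sech2] c2(2)])
qed

text \<open>The tilt of step \<open>i\<close> differs from the free one by an exponent of Lipschitz constant
  \<open>(1 - m i) + err (Suc i)\<close>.\<close>

lemma near_kappa:
  assumes i: "j \<le> i" "i < N" and C: "\<And>x. \<bar>slope (Suc i) x - tanh x\<bar> \<le> e"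
  shows "\<bar>(m i * f (Suc i) y - 1 * ln (cosh y)) - (m i * f (Suc i) x - 1 * ln (cosh x))\<bar> \<le> ((1 - m i) + e) * \<bar>y - x\<bar>"
proof -
  have "\<bar>m i * slope (Suc i) z - 1 * tanh z\<bar> \<le> (1 - m i) + e" for z
  proof -
    have "\<bar>m i * slope (Suc i) z - 1 * tanh z\<bar> = \<bar>(slope (Suc i) z - tanh z) - (1 - m i) * slope (Suc i) z\<bar>"
      by (simp add: algebra_simps)
    also have "\<dots> \<le> e + (1 - m i) * 1"
    proof (rule order_trans[OF abs_triangle_ineq4 add_mono[OF C]])
      show "\<bar>(1 - m i) * slope (Suc i) z\<bar> \<le> (1 - m i) * 1"
        unfolding abs_mult using m[of i] slope_le_1[of "Suc i" z] i by (intro mult_mono) auto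
    qed
    finally show ?thesis
      by simp
  qed
  moreover have "((\<lambda>y. m i * f (Suc i) y - 1 * ln (cosh y)) has_real_derivative m i * slope (Suc i) z - 1 * tanh z) (at z)" for z
    using i by (intro DERIV_diff DERIV_cmult near_DERIV DERIV_ln_cosh) auto
  ultimately have "norm ((\<lambda>y. m i * f (Suc i) y - 1 * ln (cosh y)) y - (\<lambda>y. m i * f (Suc i) y - 1 * ln (cosh y)) x) \<le> ((1 - m i) + e) * norm (y - x)"
    by (intro field_differentiable_bound[of UNIV]) auto
  then show ?thesis
    by simp
qed

text \<open>Polarisation: the difference of two variances becomes a single covariance in which the
  small factor \<open>slope - tanh\<close> is explicit.\<close>

lemma variance_split:
  assumes "i < N"
  shows "(L i (\<lambda>y. slope (Suc i) y * slope (Suc i) y) x - (L i (slope (Suc i)) x)\<^sup>2) - (L i (\<lambda>y. tanh y * tanh y) x - (L i tanh x)\<^sup>2)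
    = L i (\<lambda>y. (slope (Suc i) y - tanh y) * (slope (Suc i) y + tanh y)) x
      - L i (\<lambda>y. slope (Suc i) y - tanh y) x * L i (\<lambda>y. slope (Suc i) y + tanh y) x"
proof -
  have b: "bdd_borel (slope (Suc i))"
    using assms by (intro bdd_borel_slope) auto
  have "(\<lambda>y. (slope (Suc i) y - tanh y) * (slope (Suc i) y + tanh y)) = (\<lambda>y. slope (Suc i) y * slope (Suc i) y - tanh y * tanh y)"
    by (simp add: fun_eq_iff algebra_simps)
  then show ?thesis
    using b bdd_borel_tanh by (simp add: tilt_diff[OF adm] tilt_add[OF adm] bdd_borel_mult power2_eq_square algebra_simps)
qed

text \<open>The one-step comparison with the free chain. Under the free tilt the variance of
  \<open>tanh\<close> equals \<open>sech2 - free_tilt sech2\<close> exactly, so in the estimate for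
  this variance only the change of tilt is paid for.\<close>

lemma near_step:
  assumes i: "j \<le> i" "i < N"
    and IH: "\<And>x. \<bar>slope (Suc i) x - tanh x\<bar> \<le> err (Suc i)" "\<And>x. \<bar>curv (Suc i) x - sech2 x\<bar> \<le> err (Suc i)"
  defines "\<kappa> \<equiv> (1 - m i) + err (Suc i)"
  shows "0 \<le> \<kappa>" "\<kappa> \<le> 2"
    and "lip_with G g \<Longrightarrow> \<bar>L i g x - free_tilt (v i) g x\<bar> \<le> tilt_const_bound * (G * \<kappa> * v i)"
    and "\<bar>(L i (\<lambda>y. slope (Suc i) y * slope (Suc i) y) x - (slope i x)\<^sup>2) - (L i (\<lambda>y. tanh y * tanh y) x - (L i tanh x)\<^sup>2)\<bar>
      \<le> tilt_const_bound * (err (Suc i) * 3 * v i)"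
    and "\<bar>(L i (\<lambda>y. tanh y * tanh y) x - (L i tanh x)\<^sup>2) - (sech2 x - free_tilt (v i) sech2 x)\<bar>
      \<le> tilt_const_bound * (\<kappa> * (v i * sqrt (v i)))"
    and "\<bar>L i (\<lambda>y. slope (Suc i) y * slope (Suc i) y) x - (slope i x)\<^sup>2\<bar> \<le> tilt_const_bound * (2 * 2 * v i)"
proof -
  have iS: "j \<le> Suc i" "Suc i \<le> N"
    using i by auto
  note e = err_bounds[OF iS(1)]
  show \<kappa>0: "0 \<le> \<kappa>"
    using e m[of i] by (simp add: \<kappa>_def)
  show \<kappa>2: "\<kappa> \<le> 2"
    using e m[of i] by (simp add: \<kappa>_def)
  note lips = near_lip[OF iS IH e(3)]
  have k: "\<bar>(m i * f (Suc i) y - 1 * ln (cosh y)) - (m i * f (Suc i) x - 1 * ln (cosh x))\<bar> \<le> \<kappa> * \<bar>y - x\<bar>" for x y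
    unfolding \<kappa>_def by (rule near_kappa[OF i IH(1)])
  note ch = tilt_change_bound[OF adm[of i] free_admissible[OF v(1)[of i] v(2)[of i]] _ k \<kappa>2]
  show "\<bar>L i g x - free_tilt (v i) g x\<bar> \<le> tilt_const_bound * (G * \<kappa> * v i)" if "lip_with G g"
    by (rule ch(1)[OF that])
  show "\<bar>(L i (\<lambda>y. slope (Suc i) y * slope (Suc i) y) x - (slope i x)\<^sup>2) - (L i (\<lambda>y. tanh y * tanh y) x - (L i tanh x)\<^sup>2)\<bar>
      \<le> tilt_const_bound * (err (Suc i) * 3 * v i)"
    unfolding slope_step[OF i(2)] variance_split[OF i(2)]
    by (rule tilt_cov_bound[OF adm lips(2,3)])
  show "\<bar>(L i (\<lambda>y. tanh y * tanh y) x - (L i tanh x)\<^sup>2) - (sech2 x - free_tilt (v i) sech2 x)\<bar>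
      \<le> tilt_const_bound * (\<kappa> * (v i * sqrt (v i)))"
    using ch(2)[OF lip_with_tanh, of x] free_tilt_sech2[OF v(1)[of i] v(2)[of i], of x] by (simp add: algebra_simps)
  show "\<bar>L i (\<lambda>y. slope (Suc i) y * slope (Suc i) y) x - (slope i x)\<^sup>2\<bar> \<le> tilt_const_bound * (2 * 2 * v i)"
    using tilt_cov_bound[OF adm[of i] lips(1,1), of x] by (simp add: slope_step[OF i(2)] power2_eq_square)
qed

text \<open>Downward induction on slope and curvature together: the Lipschitz bounds used for one
  step come from the curvature at the next node. From \<open>J\<close> on there is no loss because
  the parameter is 1; each step of the window costs at most
  \<open>near_const * \<eta> * v i\<close>.\<close>

lemma near_estimates:
  assumes "j \<le> i" "i \<le> N"
  shows "(\<forall>x. \<bar>slope i x - tanh x\<bar> \<le> err i) \<and> (\<forall>x. \<bar>curv i x - sech2 x\<bar> \<le> err i)"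
  using assms(2,1)
proof (induction i rule: inc_induct)
  case base
  then show ?case
    using err_bounds[OF base] by (simp add: slope_N curv_N)
next
  case (step i)
  have i: "j \<le> i" "i < N"
    using step by auto
  have IH: "\<bar>slope (Suc i) x - tanh x\<bar> \<le> err (Suc i)" "\<bar>curv (Suc i) x - sech2 x\<bar> \<le> err (Suc i)" for x
    using step by auto
  define e where "e = err (Suc i)"
  have e0: "0 \<le> e" "e \<le> \<eta>"
    using err_bounds[of "Suc i"] i by (auto simp: e_def)
  define \<kappa> where "\<kappa> = (1 - m i) + e"
  define c where "c = tilt_const_bound"
  have "0 \<le> c"
    using tilt_const_bound_ge(4) by (simp add: c_def)
  note st = near_step[OF i IH, folded e_def \<kappa>_def c_def]
  have bS: "bdd_borel (slope (Suc i))" "bdd_borel (curv (Suc i))"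
    using i by (auto intro: bdd_borel_slope bdd_borel_curv)
  have total: "e + c * v i * (7 * (1 - m i) + 6 * e) \<le> err i"
  proof (cases "i < J")
    case True
    have "c * v i * (7 * (1 - m i) + 6 * e) \<le> c * v i * (13 * \<eta>)"
      using near[OF i(1) True] e0 \<open>0 \<le> c\<close> v[of i] by (intro mult_left_mono) auto
    also have "\<dots> = (13 * c) * (\<eta> * v i)"
      by simp
    also have "\<dots> \<le> near_const * (\<eta> * v i)"
      using near_const_bounds(2) \<eta> v[of i] by (intro mult_right_mono) (auto simp: c_def)
    finally show ?thesis
      by (simp add: tau_step[OF True] e_def algebra_simps)
  next
    case False
    then show ?thesis
      using top[of i] i by (simp add: e_def tau_top)
  qed
  have sl: "\<bar>slope i x - tanh x\<bar> \<le> err i" for x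
  proof -
    have "\<bar>L i (slope (Suc i)) x - L i tanh x\<bar> \<le> e"
      using tilt_bound[OF adm[of i] bdd_borel_diff[OF bS(1) bdd_borel_tanh], of e x] IH(1)
      by (simp add: tilt_diff[OF adm bS(1) bdd_borel_tanh] e_def)
    moreover have "\<bar>L i tanh x - tanh x\<bar> \<le> c * (1 * \<kappa> * v i)"
      using st(3)[OF lip_with_tanh, of x] by (simp add: free_tilt_tanh v)
    moreover have "c * (1 * \<kappa> * v i) = c * v i * \<kappa>"
      by simp
    moreover have "c * v i * \<kappa> \<le> c * v i * (7 * (1 - m i) + 6 * e)"
      using \<open>0 \<le> c\<close> v[of i] e0 m[of i] by (intro mult_left_mono) (auto simp: \<kappa>_def)
    ultimately show ?thesis
      using total unfolding slope_step[OF i(2)] by linarith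
  qed
  have cu: "\<bar>curv i x - sech2 x\<bar> \<le> err i" for x
  proof -
    define V where "V = L i (\<lambda>y. slope (Suc i) y * slope (Suc i) y) x - (slope i x)\<^sup>2"
    define V' where "V' = L i (\<lambda>y. tanh y * tanh y) x - (L i tanh x)\<^sup>2"
    have 1: "\<bar>L i (curv (Suc i)) x - L i sech2 x\<bar> \<le> e"
      using tilt_bound[OF adm[of i] bdd_borel_diff[OF bS(2) bdd_borel_sech2], of e x] IH(2)
      by (simp add: tilt_diff[OF adm bS(2) bdd_borel_sech2] e_def)
    have 2: "\<bar>L i sech2 x - free_tilt (v i) sech2 x\<bar> \<le> c * (2 * \<kappa> * v i)"
      using st(3)[OF lip_with_sech2_power[of 1], of x] by simp
    have 3: "\<bar>V - V'\<bar> \<le> c * (e * 3 * v i)"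
      unfolding V_def V'_def by (rule st(4))
    have 4: "\<bar>V' - (sech2 x - free_tilt (v i) sech2 x)\<bar> \<le> c * (\<kappa> * (v i * sqrt (v i)))"
      unfolding V'_def by (rule st(5))
    have 5: "\<bar>V\<bar> \<le> c * (2 * 2 * v i)"
      unfolding V_def by (rule st(6))
    have 6: "\<bar>(1 - m i) * V\<bar> \<le> (1 - m i) * (c * (2 * 2 * v i))"
      unfolding abs_mult using m[of i] 5 by (intro mult_mono) auto
    have 7: "c * (\<kappa> * (v i * sqrt (v i))) \<le> c * (\<kappa> * (v i * 1))"
      using \<open>0 \<le> c\<close> st(1) v[of i] by (intro mult_left_mono) auto
    \<comment> \<open>By \<open>free_tilt_sech2\<close> the function \<open>sech2\<close> obeys the
      curvature recursion with parameter 1. The summands are, in order: the error at the next node,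
      the change of tilt, the change of slope in the variance, the change of tilt in the variance,
      and the missing weight \<open>1 - m i\<close>.\<close>
    have "curv i x - sech2 x = (L i (curv (Suc i)) x - L i sech2 x) + (L i sech2 x - free_tilt (v i) sech2 x)
        + (V - V') + (V' - (sech2 x - free_tilt (v i) sech2 x)) - (1 - m i) * V"
      using curv_step[OF i(2), of x] by (simp add: V_def algebra_simps)
    then have "\<bar>curv i x - sech2 x\<bar> \<le> e + c * (2 * \<kappa> * v i) + c * (e * 3 * v i) + c * (\<kappa> * (v i * 1)) + (1 - m i) * (c * (2 * 2 * v i))"
      using 1 2 3 4 6 7 by linarith
    also have "\<dots> = e + c * v i * (7 * (1 - m i) + 6 * e)"
      by (simp add: \<kappa>_def algebra_simps)
    finally show ?thesis
      using total by linarith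
  qed
  show ?case
    using sl cu by blast
qed

end

text \<open>A predicate on the constant, so that one value can be fixed as a locale parameter before
  any chain is chosen.\<close>

definition sech_expansion_const :: "real \<Rightarrow> bool" where
  "sech_expansion_const C \<longleftrightarrow> 0 \<le> C \<and> (\<forall>v x. 0 \<le> v \<longrightarrow> v \<le> 1 \<longrightarrow>
     \<bar>free_tilt v sech2 x - (sech2 x - v * sech2 x ^ 2)\<bar> \<le> C * (v * sqrt v) \<and>
     \<bar>free_tilt v (\<lambda>y. sech2 y ^ 2) x - (sech2 x ^ 2 + v * (4 * sech2 x ^ 2 - 6 * sech2 x ^ 3))\<bar> \<le> C * (v * sqrt v) \<and>
     \<bar>free_tilt v (\<lambda>y. sech2 y ^ 3) x - sech2 x ^ 3\<bar> \<le> C * v)"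

text \<open>The powers 1, 2, 3 of \<open>sech2\<close> correspond to \<open>k = 1, 3, 5\<close> in
  \<open>free_tilt_sech2_power\<close>. For the cube the first-order coefficient
  \<open>12 - 15 * sech2\<close> is merely bounded, by 27.\<close>

lemma exists_sech_expansion_const: "\<exists>C. sech_expansion_const C"
proof -
  obtain C1 where C1: "0 \<le> C1" "\<And>v x. 0 \<le> v \<Longrightarrow> v \<le> 1 \<Longrightarrow>
    \<bar>free_tilt v (\<lambda>y. sech2 y ^ 1) x - sech2 x ^ 1 * (1 + v / 2 * ((2 * real 1 - 1)\<^sup>2 - 1 - (2 * real 1 - 1) * (2 * real 1 - 1 + 1) * sech2 x))\<bar> \<le> C1 * (v * sqrt v)"
    using free_tilt_sech2_power[of 1] by (metis order_refl)
  obtain C2 where C2: "0 \<le> C2" "\<And>v x. 0 \<le> v \<Longrightarrow> v \<le> 1 \<Longrightarrow>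
    \<bar>free_tilt v (\<lambda>y. sech2 y ^ 2) x - sech2 x ^ 2 * (1 + v / 2 * ((2 * real 2 - 1)\<^sup>2 - 1 - (2 * real 2 - 1) * (2 * real 2 - 1 + 1) * sech2 x))\<bar> \<le> C2 * (v * sqrt v)"
    using free_tilt_sech2_power[of 2] by (metis one_le_numeral)
  obtain C3 where C3: "0 \<le> C3" "\<And>v x. 0 \<le> v \<Longrightarrow> v \<le> 1 \<Longrightarrow>
    \<bar>free_tilt v (\<lambda>y. sech2 y ^ 3) x - sech2 x ^ 3 * (1 + v / 2 * ((2 * real 3 - 1)\<^sup>2 - 1 - (2 * real 3 - 1) * (2 * real 3 - 1 + 1) * sech2 x))\<bar> \<le> C3 * (v * sqrt v)"
    using free_tilt_sech2_power[of 3] by (metis one_le_numeral)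
  have "sech_expansion_const (C1 + C2 + C3 + 27)"
    unfolding sech_expansion_const_def
  proof (intro conjI allI impI)
    show "0 \<le> C1 + C2 + C3 + 27"
      using C1 C2 C3 by simp
    fix v x :: real assume v: "0 \<le> v" "v \<le> 1"
    have vs: "0 \<le> v * sqrt v" "v * sqrt v \<le> v"
      using v by (auto simp: mult_left_le)
    show "\<bar>free_tilt v sech2 x - (sech2 x - v * sech2 x ^ 2)\<bar> \<le> (C1 + C2 + C3 + 27) * (v * sqrt v)"
    proof (rule order_trans)
      show "\<bar>free_tilt v sech2 x - (sech2 x - v * sech2 x ^ 2)\<bar> \<le> C1 * (v * sqrt v)"
        using C1(2)[OF v, of x] by (simp add: algebra_simps power2_eq_square)
      show "C1 * (v * sqrt v) \<le> (C1 + C2 + C3 + 27) * (v * sqrt v)"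
        using C1 C2 C3 vs by (intro mult_right_mono) auto
    qed
    show "\<bar>free_tilt v (\<lambda>y. sech2 y ^ 2) x - (sech2 x ^ 2 + v * (4 * sech2 x ^ 2 - 6 * sech2 x ^ 3))\<bar> \<le> (C1 + C2 + C3 + 27) * (v * sqrt v)"
    proof (rule order_trans)
      show "\<bar>free_tilt v (\<lambda>y. sech2 y ^ 2) x - (sech2 x ^ 2 + v * (4 * sech2 x ^ 2 - 6 * sech2 x ^ 3))\<bar> \<le> C2 * (v * sqrt v)"
        using C2(2)[OF v, of x] by (simp add: algebra_simps power2_eq_square power3_eq_cube)
      show "C2 * (v * sqrt v) \<le> (C1 + C2 + C3 + 27) * (v * sqrt v)"
        using C1 C2 C3 vs by (intro mult_right_mono) auto
    qed
    have "\<bar>sech2 x ^ 3 * (v * (12 - 15 * sech2 x))\<bar> \<le> 1 * (v * 27)"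
      unfolding abs_mult using v sech2_bounds[of x]
      by (intro mult_mono) (auto simp: power_le_one abs_le_iff)
    moreover have "\<bar>free_tilt v (\<lambda>y. sech2 y ^ 3) x - (sech2 x ^ 3 + sech2 x ^ 3 * (v * (12 - 15 * sech2 x)))\<bar> \<le> C3 * (v * sqrt v)"
      using C3(2)[OF v, of x] by (simp add: algebra_simps)
    moreover have "C3 * (v * sqrt v) \<le> C3 * v"
      using C3 vs by (intro mult_left_mono) auto
    ultimately have "\<bar>free_tilt v (\<lambda>y. sech2 y ^ 3) x - sech2 x ^ 3\<bar> \<le> C3 * v + 27 * v"
      by linarith
    also have "\<dots> \<le> (C1 + C2 + C3 + 27) * v"
      unfolding distrib_right using C1 C2 v by simp
    finally show "\<bar>free_tilt v (\<lambda>y. sech2 y ^ 3) x - sech2 x ^ 3\<bar> \<le> (C1 + C2 + C3 + 27) * v" .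
  qed
  then show ?thesis
    by blast
qed

section \<open>Second-order expansion of the averages\<close>

definition step_const :: "real \<Rightarrow> real" where
  "step_const C = 3 * tilt_const_bound * near_const + 14 * tilt_const_bound + C"

text \<open>\<open>h\<close> controls the square root of the step variances, which is the relative
  error of a single Gaussian step.\<close>

locale near_expansion = near_top +
  fixes C h :: real
  assumes C: "sech_expansion_const C" and h: "h \<le> 1" "\<And>i. sqrt (v i) \<le> h"
begin

abbreviation "S \<equiv> step_const C"

definition "\<Gamma> i = path_avg i (\<lambda>x. slope i x * slope i x)"
definition "avg1 i = path_avg i sech2"
definition "avg2 i = path_avg i (\<lambda>x. sech2 x ^ 2)"
definition "avg3 i = path_avg i (\<lambda>x. sech2 x ^ 3)"

lemma C0: "0 \<le> C"
  using C by (simp add: sech_expansion_const_def)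

lemma h0: "0 \<le> h"
  using h(2)[of 0] v(1)[of 0] by (meson order_trans real_sqrt_ge_zero)

lemma S_bounds: "0 \<le> S" "3 * tilt_const_bound * near_const \<le> S" "2 * tilt_const_bound + C \<le> S"
    "8 * tilt_const_bound \<le> S" "C \<le> S" "12 * tilt_const_bound + C \<le> S"
proof -
  have "0 \<le> tilt_const_bound * near_const"
    using tilt_const_bound_ge(4) near_const_bounds(1) by simp
  then show "0 \<le> S" "3 * tilt_const_bound * near_const \<le> S" "2 * tilt_const_bound + C \<le> S"
    "8 * tilt_const_bound \<le> S" "C \<le> S" "12 * tilt_const_bound + C \<le> S"
    using C0 tilt_const_bound_ge(4) unfolding step_const_def by linarith+
qed

lemmas bdd_sech2_power = bdd_borel_power[OF bdd_borel_sech2]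

context
  fixes i assumes i: "j \<le> i" "i < J"
begin

lemma step_facts:
  "near_const * \<eta> * \<tau> (Suc i) \<le> near_const * \<eta> * \<tau> i"
  "(1 - m i) + err (Suc i) \<le> 2 * \<eta>" "0 \<le> (1 - m i) + err (Suc i)"
  "v i * sqrt (v i) \<le> v i * h"
proof -
  show "near_const * \<eta> * \<tau> (Suc i) \<le> near_const * \<eta> * \<tau> i"
    using tau_step[OF i(2)] v(1)[of i] near_const_bounds(1) \<eta> by (intro mult_left_mono) auto
  show "(1 - m i) + err (Suc i) \<le> 2 * \<eta>" "0 \<le> (1 - m i) + err (Suc i)"
    using near[OF i] err_bounds[of "Suc i"] i m(2)[of i] by auto
  show "v i * sqrt (v i) \<le> v i * h"
    using h(2)[of i] v(1)[of i] by (rule mult_left_mono)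
qed

lemma near_step':
  shows "lip_with G g \<Longrightarrow> \<bar>L i g x - free_tilt (v i) g x\<bar> \<le> tilt_const_bound * (G * (2 * \<eta>) * v i)"
    and "\<bar>(L i (\<lambda>y. slope (Suc i) y * slope (Suc i) y) x - (slope i x)\<^sup>2) - (L i (\<lambda>y. tanh y * tanh y) x - (L i tanh x)\<^sup>2)\<bar>
      \<le> 3 * tilt_const_bound * near_const * (\<eta> * \<tau> i * v i)"
    and "\<bar>(L i (\<lambda>y. tanh y * tanh y) x - (L i tanh x)\<^sup>2) - (sech2 x - free_tilt (v i) sech2 x)\<bar>
      \<le> 2 * tilt_const_bound * (v i * h)"
proof -
  have iN: "i < N" "j \<le> Suc i" "Suc i \<le> N"
    using i jJ by auto
  have IH: "\<bar>slope (Suc i) x - tanh x\<bar> \<le> err (Suc i)" "\<bar>curv (Suc i) x - sech2 x\<bar> \<le> err (Suc i)" for x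
    using near_estimates[OF iN(2,3)] by auto
  note st = near_step[OF i(1) iN(1) IH]
  note c0 = tilt_const_bound_ge(4)
  show "\<bar>L i g x - free_tilt (v i) g x\<bar> \<le> tilt_const_bound * (G * (2 * \<eta>) * v i)" if "lip_with G g"
    by (rule order_trans[OF st(3)[OF that]])
      (use step_facts lip_withD(2)[OF that] v c0 in \<open>intro mult_left_mono mult_right_mono; simp\<close>)
  have "tilt_const_bound * (err (Suc i) * 3 * v i) \<le> tilt_const_bound * (err i * 3 * v i)"
    by (rule mult_left_mono[OF mult_right_mono[OF mult_right_mono[OF step_facts(1)]]]) (use v c0 in auto)
  also have "\<dots> = 3 * tilt_const_bound * near_const * (\<eta> * \<tau> i * v i)"
    by simp
  finally show "\<bar>(L i (\<lambda>y. slope (Suc i) y * slope (Suc i) y) x - (slope i x)\<^sup>2) - (L i (\<lambda>y. tanh y * tanh y) x - (L i tanh x)\<^sup>2)\<bar>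
      \<le> 3 * tilt_const_bound * near_const * (\<eta> * \<tau> i * v i)"
    using st(4)[of x] by linarith
  have "((1 - m i) + err (Suc i)) * (v i * sqrt (v i)) \<le> 2 * (v i * h)"
    by (rule mult_mono[OF st(2) step_facts(4)]) (use v in auto)
  then have "tilt_const_bound * (((1 - m i) + err (Suc i)) * (v i * sqrt (v i))) \<le> tilt_const_bound * (2 * (v i * h))"
    using c0 by (rule mult_left_mono)
  then show "\<bar>(L i (\<lambda>y. tanh y * tanh y) x - (L i tanh x)\<^sup>2) - (sech2 x - free_tilt (v i) sech2 x)\<bar>
      \<le> 2 * tilt_const_bound * (v i * h)"
    using st(5)[of x] by linarith
qed

lemma sech_steps:
  "\<bar>free_tilt (v i) sech2 x - (sech2 x - v i * sech2 x ^ 2)\<bar> \<le> C * (v i * h)"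
  "\<bar>free_tilt (v i) (\<lambda>y. sech2 y ^ 2) x - (sech2 x ^ 2 + v i * (4 * sech2 x ^ 2 - 6 * sech2 x ^ 3))\<bar> \<le> C * (v i * h)"
  "\<bar>free_tilt (v i) (\<lambda>y. sech2 y ^ 3) x - sech2 x ^ 3\<bar> \<le> C * v i"
proof -
  have "C * (v i * sqrt (v i)) \<le> C * (v i * h)"
    using step_facts(4) C0 by (rule mult_left_mono)
  then show "\<bar>free_tilt (v i) sech2 x - (sech2 x - v i * sech2 x ^ 2)\<bar> \<le> C * (v i * h)"
    "\<bar>free_tilt (v i) (\<lambda>y. sech2 y ^ 2) x - (sech2 x ^ 2 + v i * (4 * sech2 x ^ 2 - 6 * sech2 x ^ 3))\<bar> \<le> C * (v i * h)"
    "\<bar>free_tilt (v i) (\<lambda>y. sech2 y ^ 3) x - sech2 x ^ 3\<bar> \<le> C * v i"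
    using C v[of i] unfolding sech_expansion_const_def by (meson order_trans)+
qed

text \<open>The slope is a martingale, so the increment of \<open>\<Gamma>\<close> is the averaged
  conditional variance of the slope, to leading order \<open>v i\<close> times the average of
  \<open>sech^4\<close>. The error carries \<open>\<eta> * \<tau> i\<close>; with
  \<open>\<eta>\<close> alone the sum over the window would only be
  \<open>O(\<eta> * \<tau>)\<close>, too large for a second-order expansion.\<close>

lemma Gamma_step: "\<bar>\<Gamma> (Suc i) - \<Gamma> i - v i * avg2 i\<bar> \<le> v i * (S * (\<eta> * \<tau> i + h))"
proof -
  have iN: "i < N"
    using i jJ by auto
  have bs: "bdd_borel (slope (Suc i))" "bdd_borel (slope i)"
    using iN by (auto intro: bdd_borel_slope)
  have pt: "\<bar>(L i (\<lambda>y. slope (Suc i) y * slope (Suc i) y) x - slope i x * slope i x) - v i * sech2 x ^ 2\<bar> \<le> v i * (S * (\<eta> * \<tau> i + h))" for x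
  proof -
    have "\<bar>(L i (\<lambda>y. slope (Suc i) y * slope (Suc i) y) x - (slope i x)\<^sup>2) - v i * sech2 x ^ 2\<bar>
      \<le> 3 * tilt_const_bound * near_const * (\<eta> * \<tau> i * v i) + 2 * tilt_const_bound * (v i * h) + C * (v i * h)"
      using near_step'(2)[of x] near_step'(3)[of x] sech_steps(1)[of x] by linarith
    also have "\<dots> \<le> S * (\<eta> * \<tau> i * v i) + S * (v i * h)"
      unfolding add.assoc using S_bounds \<eta> tau_nonneg v h0
      by (intro add_mono mult_right_mono order_trans[OF eq_refl[OF distrib_right[symmetric]] mult_right_mono]) auto
    finally show ?thesis
      by (simp add: algebra_simps power2_eq_square)
  qed
  have b1: "bdd_borel (L i (\<lambda>y. slope (Suc i) y * slope (Suc i) y))"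
    by (intro bdd_borel_tilt adm bdd_borel_mult bs)
  have b2: "bdd_borel (\<lambda>x. slope i x * slope i x)" "bdd_borel (\<lambda>x. v i * sech2 x ^ 2)"
    by (intro bdd_borel_mult bs bdd_borel_const bdd_sech2_power)+
  have "\<bar>path_avg i (\<lambda>x. L i (\<lambda>y. slope (Suc i) y * slope (Suc i) y) x - slope i x * slope i x) - path_avg i (\<lambda>x. v i * sech2 x ^ 2)\<bar>
    \<le> v i * (S * (\<eta> * \<tau> i + h))"
    by (rule path_avg_diff_bound[OF bdd_borel_diff[OF b1 b2(1)] b2(2) pt])
  then show ?thesis
    by (simp add: path_avg_diff[OF b1 b2(1)] path_avg_cmult \<Gamma>_def avg2_def)
qed

text \<open>An error of relative size \<open>\<eta>\<close> is affordable here: \<open>avg2\<close>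
  enters \<open>\<Gamma>\<close> through a further sum over steps, which supplies the second factor
  \<open>\<tau>\<close>.\<close>

lemma avg2_step: "\<bar>avg2 (Suc i) - avg2 i - v i * (4 * avg2 i - 6 * avg3 i)\<bar> \<le> v i * (S * (\<eta> + h))"
proof -
  have pt: "\<bar>L i (\<lambda>x. sech2 x ^ 2) x - (sech2 x ^ 2 + v i * (4 * sech2 x ^ 2 - 6 * sech2 x ^ 3))\<bar> \<le> v i * (S * (\<eta> + h))" for x
  proof -
    have "\<bar>L i (\<lambda>x. sech2 x ^ 2) x - (sech2 x ^ 2 + v i * (4 * sech2 x ^ 2 - 6 * sech2 x ^ 3))\<bar>
      \<le> tilt_const_bound * (2 * real 2 * (2 * \<eta>) * v i) + C * (v i * h)"
      using near_step'(1)[OF lip_with_sech2_power[of 2], of x] sech_steps(2)[of x] by linarith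
    also have "\<dots> = (8 * tilt_const_bound) * (\<eta> * v i) + C * (v i * h)"
      by simp
    also have "\<dots> \<le> S * (\<eta> * v i) + S * (v i * h)"
      using S_bounds \<eta> v h0 by (intro add_mono mult_right_mono) auto
    finally show ?thesis
      by (simp add: algebra_simps)
  qed
  have "\<bar>path_avg i (L i (\<lambda>x. sech2 x ^ 2)) - path_avg i (\<lambda>x. sech2 x ^ 2 + v i * (4 * sech2 x ^ 2 - 6 * sech2 x ^ 3))\<bar> \<le> v i * (S * (\<eta> + h))"
    by (rule path_avg_diff_bound[OF _ _ pt])
      (intro bdd_borel_tilt adm bdd_sech2_power bdd_borel_add bdd_borel_diff bdd_borel_mult bdd_borel_const)+
  moreover have "path_avg i (\<lambda>x. sech2 x ^ 2 + v i * (4 * sech2 x ^ 2 - 6 * sech2 x ^ 3)) = avg2 i + v i * (4 * avg2 i - 6 * avg3 i)"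
    by (simp add: avg2_def avg3_def path_avg_add path_avg_diff path_avg_cmult bdd_sech2_power bdd_borel_mult bdd_borel_diff)
  ultimately show ?thesis
    by (simp add: avg2_def)
qed

lemma avg1_step: "\<bar>avg1 (Suc i) - avg1 i + v i * avg2 i\<bar> \<le> v i * (S * (\<eta> + h))"
proof -
  have pt: "\<bar>L i sech2 x - (sech2 x - v i * sech2 x ^ 2)\<bar> \<le> v i * (S * (\<eta> + h))" for x
  proof -
    have "\<bar>L i sech2 x - (sech2 x - v i * sech2 x ^ 2)\<bar> \<le> tilt_const_bound * (2 * real 1 * (2 * \<eta>) * v i) + C * (v i * h)"
      using near_step'(1)[OF lip_with_sech2_power[of 1], of x] sech_steps(1)[of x] by simp
    also have "\<dots> = (4 * tilt_const_bound) * (\<eta> * v i) + C * (v i * h)"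
      by simp
    also have "\<dots> \<le> S * (\<eta> * v i) + S * (v i * h)"
      using S_bounds tilt_const_bound_ge(4) \<eta> v h0 by (intro add_mono mult_right_mono) auto
    finally show ?thesis
      by (simp add: algebra_simps)
  qed
  have "\<bar>path_avg i (L i sech2) - path_avg i (\<lambda>x. sech2 x - v i * sech2 x ^ 2)\<bar> \<le> v i * (S * (\<eta> + h))"
    by (rule path_avg_diff_bound[OF _ _ pt])
      (intro bdd_borel_tilt adm bdd_sech2_power bdd_borel_sech2 bdd_borel_diff bdd_borel_mult bdd_borel_const)+
  moreover have "path_avg i (\<lambda>x. sech2 x - v i * sech2 x ^ 2) = avg1 i - v i * avg2 i"
    by (simp add: avg1_def avg2_def path_avg_diff path_avg_cmult bdd_sech2_power bdd_borel_mult bdd_borel_sech2)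
  ultimately show ?thesis
    by (simp add: avg1_def algebra_simps)
qed

lemma avg3_step: "\<bar>avg3 (Suc i) - avg3 i\<bar> \<le> v i * S"
proof -
  have pt: "\<bar>L i (\<lambda>x. sech2 x ^ 3) x - sech2 x ^ 3\<bar> \<le> v i * S" for x
  proof -
    have "\<bar>L i (\<lambda>x. sech2 x ^ 3) x - sech2 x ^ 3\<bar> \<le> tilt_const_bound * (2 * real 3 * (2 * \<eta>) * v i) + C * v i"
      using near_step'(1)[OF lip_with_sech2_power[of 3], of x] sech_steps(3)[of x] by linarith
    also have "\<dots> = 12 * tilt_const_bound * (\<eta> * v i) + C * v i"
      by simp
    also have "\<dots> \<le> 12 * tilt_const_bound * (1 * v i) + C * v i"
      using \<eta> v tilt_const_bound_ge(4) by (intro add_mono mult_left_mono mult_right_mono) auto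
    also have "\<dots> = (12 * tilt_const_bound + C) * v i"
      by (simp add: algebra_simps)
    also have "\<dots> \<le> S * v i"
      using S_bounds v by (intro mult_right_mono) auto
    finally show ?thesis
      by (simp add: mult.commute)
  qed
  have "\<bar>path_avg i (L i (\<lambda>x. sech2 x ^ 3)) - path_avg i (\<lambda>x. sech2 x ^ 3)\<bar> \<le> v i * S"
    by (rule path_avg_diff_bound[OF _ _ pt]) (intro bdd_borel_tilt adm bdd_sech2_power)+
  then show ?thesis
    by (simp add: avg3_def)
qed

end

lemma telescope_bound:
  fixes a :: "nat \<Rightarrow> real"
  assumes "\<And>i. k \<le> i \<Longrightarrow> i < J \<Longrightarrow> \<bar>a (Suc i) - a i\<bar> \<le> v i * e" "k \<le> J"
  shows "\<bar>a J - a k\<bar> \<le> \<tau> k * e"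
  using assms(2) assms(1)
proof (induction k rule: inc_induct)
  case base
  then show ?case
    by (simp add: tau_top)
next
  case (step k)
  have "\<bar>a J - a (Suc k)\<bar> \<le> \<tau> (Suc k) * e"
    by (rule step.IH) (use step.prems in auto)
  moreover have "\<bar>a (Suc k) - a k\<bar> \<le> v k * e"
    using step by auto
  ultimately show ?case
    using tau_step[OF step.hyps(2)] unfolding distrib_right by (auto simp: distrib_right)
qed

lemma tau_mono: "k \<le> i \<Longrightarrow> \<tau> i \<le> \<tau> k"
  unfolding \<tau>_def by (intro sum_mono2) (auto simp: v)

lemma tau_le_1: "j \<le> i \<Longrightarrow> \<tau> i \<le> 1"
  using tau_le[of i] mult_right_mono[OF near_const_bounds(1) tau_nonneg[of i]] by linarith

lemma avg_bounds: "0 \<le> avg2 i" "avg2 i \<le> 1" "0 \<le> avg3 i" "avg3 i \<le> 1"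
  unfolding avg2_def avg3_def using sech2_bounds
  by (auto intro!: path_avg_ge path_avg_le bdd_sech2_power simp: power_le_one less_imp_le)

abbreviation "A \<equiv> \<Gamma> J"
abbreviation "B \<equiv> avg2 J"
abbreviation "D \<equiv> 4 * avg2 J - 6 * avg3 J"

text \<open>At \<open>J\<close> the error bound of \<open>near_estimates\<close> vanishes, so the
  slope there is exactly \<open>tanh\<close>.\<close>

lemma avg1_J: "avg1 J = 1 - A"
proof -
  have "slope J x = tanh x" for x
    using near_estimates[of J] jJ by (simp add: tau_top)
  then have "(\<lambda>x. slope J x * slope J x) = (\<lambda>x. 1 - sech2 x)"
    by (simp add: sech2_def power2_eq_square)
  then show ?thesis
    by (simp add: \<Gamma>_def avg1_def path_avg_diff bdd_borel_sech2 path_avg_const)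
qed

text \<open>The 10 bounds \<open>\<bar>4 * avg2 - 6 * avg3\<bar>\<close>, and
  \<open>40 + 14 * S\<close> is \<open>4 * (10 + 2 * S) + 6 * S\<close>.\<close>

lemma drift_bound:
  assumes "j \<le> i" "i \<le> J"
  shows "\<bar>avg2 i - B\<bar> \<le> \<tau> i * (10 + 2 * S)" "\<bar>(4 * avg2 i - 6 * avg3 i) - D\<bar> \<le> \<tau> i * (40 + 14 * S)"
proof -
  have "\<bar>avg2 (Suc k) - avg2 k\<bar> \<le> v k * (10 + 2 * S)" if k: "i \<le> k" "k < J" for k
  proof -
    have "\<bar>v k * (4 * avg2 k - 6 * avg3 k)\<bar> \<le> v k * 10"
      unfolding abs_mult using v[of k] avg_bounds[of k] by (intro mult_mono) auto
    moreover have "v k * (S * (\<eta> + h)) \<le> v k * (S * 2)"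
      using v[of k] S_bounds(1) \<eta> h(1) by (intro mult_left_mono) auto
    ultimately show ?thesis
      using avg2_step[of k] k assms unfolding distrib_left by linarith
  qed
  from telescope_bound[of i avg2, OF this] have a2: "\<bar>avg2 J - avg2 i\<bar> \<le> \<tau> i * (10 + 2 * S)"
    using assms by simp
  have "\<bar>avg3 J - avg3 i\<bar> \<le> \<tau> i * S"
    by (rule telescope_bound) (use avg3_step assms in auto)
  with a2 show "\<bar>avg2 i - B\<bar> \<le> \<tau> i * (10 + 2 * S)" "\<bar>(4 * avg2 i - 6 * avg3 i) - D\<bar> \<le> \<tau> i * (40 + 14 * S)"
    unfolding distrib_left by linarith+
qed

text \<open>\<open>avg2 k + \<tau> k * D\<close> is nearly constant in \<open>k\<close>: by
  \<open>drift_bound\<close> the drift of \<open>avg2\<close> differs from its value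
  \<open>D\<close> at the top only by \<open>O(\<tau>)\<close>.\<close>

lemma avg2_expansion:
  assumes "j \<le> i" "i \<le> J"
  shows "\<bar>avg2 i - (B - \<tau> i * D)\<bar> \<le> \<tau> i * (S * (\<eta> + h) + \<tau> i * (40 + 14 * S))"
proof -
  have "\<bar>(avg2 (Suc k) + \<tau> (Suc k) * D) - (avg2 k + \<tau> k * D)\<bar> \<le> v k * (S * (\<eta> + h) + \<tau> i * (40 + 14 * S))"
    if k: "i \<le> k" "k < J" for k
  proof -
    have "\<bar>(4 * avg2 k - 6 * avg3 k) - D\<bar> \<le> \<tau> i * (40 + 14 * S)"
      by (rule order_trans[OF drift_bound(2) mult_right_mono[OF tau_mono[OF k(1)]]]) (use k assms S_bounds(1) in auto)
    then have "\<bar>v k * ((4 * avg2 k - 6 * avg3 k) - D)\<bar> \<le> v k * (\<tau> i * (40 + 14 * S))"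
      using v(1)[of k] by (simp add: abs_mult mult_left_mono)
    moreover have "(avg2 (Suc k) + \<tau> (Suc k) * D) - (avg2 k + \<tau> k * D)
        = (avg2 (Suc k) - avg2 k - v k * (4 * avg2 k - 6 * avg3 k)) + v k * ((4 * avg2 k - 6 * avg3 k) - D)"
      using tau_step[OF k(2)] by (simp add: algebra_simps)
    ultimately show ?thesis
      using avg2_step[of k] k assms unfolding distrib_left[of "v k"] by linarith
  qed
  from telescope_bound[of i "\<lambda>k. avg2 k + \<tau> k * D", OF this] show ?thesis
    using assms by (simp add: tau_top algebra_simps abs_minus_commute)
qed

lemma avg1_expansion:
  "\<bar>avg1 j - (1 - A + \<tau> j * B)\<bar> \<le> \<tau> j * (S * (\<eta> + h) + \<tau> j * (10 + 2 * S))"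
proof -
  have "\<bar>(avg1 (Suc k) - \<tau> (Suc k) * B) - (avg1 k - \<tau> k * B)\<bar> \<le> v k * (S * (\<eta> + h) + \<tau> j * (10 + 2 * S))"
    if k: "j \<le> k" "k < J" for k
  proof -
    have "\<bar>avg2 k - B\<bar> \<le> \<tau> j * (10 + 2 * S)"
      by (rule order_trans[OF drift_bound(1) mult_right_mono[OF tau_mono[OF k(1)]]]) (use k S_bounds(1) in auto)
    then have "\<bar>v k * (avg2 k - B)\<bar> \<le> v k * (\<tau> j * (10 + 2 * S))"
      using v(1)[of k] by (simp add: abs_mult mult_left_mono)
    moreover have "(avg1 (Suc k) - \<tau> (Suc k) * B) - (avg1 k - \<tau> k * B)
        = (avg1 (Suc k) - avg1 k + v k * avg2 k) - v k * (avg2 k - B)"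
      using tau_step[OF k(2)] by (simp add: algebra_simps)
    ultimately show ?thesis
      using avg1_step[of k] k unfolding distrib_left[of "v k"] by linarith
  qed
  from telescope_bound[of j "\<lambda>k. avg1 k - \<tau> k * B", OF this] show ?thesis
    using jJ by (simp add: tau_top avg1_J algebra_simps abs_minus_commute)
qed

text \<open>Discrete integration of \<open>avg2_expansion\<close>: in the clock,
  \<open>\<Gamma>\<close> has derivative \<open>avg2\<close>, and this is
  \<open>B - \<tau> * D\<close> up to small errors.\<close>

lemma Gamma_expansion:
  "\<bar>\<Gamma> j - (A - B * \<tau> j + D * (\<tau> j)\<^sup>2 / 2)\<bar> \<le> \<tau> j * (2 * S * \<eta> * \<tau> j + (40 + 14 * S) * (\<tau> j)\<^sup>2 + (2 * S + 5) * h)"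
proof -
  let ?e = "2 * S * \<eta> * \<tau> j + (40 + 14 * S) * (\<tau> j)\<^sup>2 + (2 * S + 5) * h"
  let ?a = "\<lambda>k. \<Gamma> k + B * \<tau> k - D * (\<tau> k)\<^sup>2 / 2"
  have "\<bar>?a (Suc k) - ?a k\<bar> \<le> v k * ?e" if k: "j \<le> k" "k < J" for k
  proof -
    have t: "0 \<le> \<tau> k" "\<tau> k \<le> \<tau> j" "\<tau> k \<le> 1"
      using tau_nonneg tau_mono[OF k(1)] tau_le_1[OF k(1)] by auto
    have 1: "\<bar>\<Gamma> (Suc k) - \<Gamma> k - v k * avg2 k\<bar> \<le> v k * (S * (\<eta> * \<tau> j) + S * h)"
    proof (rule order_trans[OF Gamma_step[OF k]])
      show "v k * (S * (\<eta> * \<tau> k + h)) \<le> v k * (S * (\<eta> * \<tau> j) + S * h)"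
        unfolding distrib_left[of S] using v[of k] S_bounds(1) \<eta> t by (intro mult_left_mono add_mono) auto
    qed
    have "\<bar>avg2 k - (B - \<tau> k * D)\<bar> \<le> \<tau> k * (S * (\<eta> + h) + \<tau> k * (40 + 14 * S))"
      using avg2_expansion[of k] k by simp
    also have "\<dots> = S * (\<eta> * \<tau> k) + S * (\<tau> k * h) + (40 + 14 * S) * (\<tau> k)\<^sup>2"
      by (simp add: algebra_simps power2_eq_square)
    also have "\<dots> \<le> S * (\<eta> * \<tau> j) + S * (1 * h) + (40 + 14 * S) * (\<tau> j)\<^sup>2"
      using S_bounds(1) \<eta> t h0 by (intro add_mono mult_left_mono mult_right_mono power_mono) auto
    finally have "v k * \<bar>avg2 k - (B - \<tau> k * D)\<bar> \<le> v k * (S * (\<eta> * \<tau> j) + S * (1 * h) + (40 + 14 * S) * (\<tau> j)\<^sup>2)"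
      using v(1) by (rule mult_left_mono)
    then have 2: "\<bar>v k * (avg2 k - (B - \<tau> k * D))\<bar> \<le> v k * (S * (\<eta> * \<tau> j) + S * (1 * h) + (40 + 14 * S) * (\<tau> j)\<^sup>2)"
      using v(1)[of k] by (simp add: abs_mult)
    \<comment> \<open>Differencing \<open>D * \<tau>^2 / 2\<close> leaves
      \<open>D * (v k)^2 / 2\<close> at each step; \<open>\<bar>D\<bar> \<le> 10\<close> and
      \<open>v k \<le> h\<close> turn it into the summand \<open>5 * h\<close>.\<close>
    have "v k \<le> h"
    proof -
      have "v k = sqrt (v k) * sqrt (v k)"
        using v(1)[of k] by simp
      also have "\<dots> \<le> h * 1"
        using h(1) h(2)[of k] h0 v[of k] by (intro mult_mono) auto
      finally show ?thesis by simp
    qed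
    then have "\<bar>D * (v k / 2)\<bar> \<le> 10 * (h / 2)"
      unfolding abs_mult using avg_bounds[of J] v[of k] by (intro mult_mono) auto
    then have "v k * \<bar>D * (v k / 2)\<bar> \<le> v k * (5 * h)"
      using v(1)[of k] by (intro mult_left_mono) auto
    then have 3: "\<bar>v k * (D * (v k / 2))\<bar> \<le> v k * (5 * h)"
      using v(1)[of k] by (simp add: abs_mult)
    have "?a (Suc k) - ?a k = (\<Gamma> (Suc k) - \<Gamma> k - v k * avg2 k) + v k * (avg2 k - (B - \<tau> k * D)) - v k * (D * (v k / 2))"
    proof -
      have "\<tau> (Suc k) = \<tau> k - v k"
        using tau_step[OF k(2)] by simp
      then show ?thesis
        by (simp only:) (simp add: power2_eq_square field_simps)
    qed
    then have "\<bar>?a (Suc k) - ?a k\<bar> \<le> v k * (S * (\<eta> * \<tau> j) + S * h) + v k * (S * (\<eta> * \<tau> j) + S * (1 * h) + (40 + 14 * S) * (\<tau> j)\<^sup>2) + v k * (5 * h)"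
      using 1 2 3 by linarith
    also have "\<dots> = v k * ?e"
      by (simp add: algebra_simps)
    finally show ?thesis .
  qed
  from telescope_bound[of j ?a, OF this] show ?thesis
    using jJ by (simp add: tau_top algebra_simps abs_minus_commute)
qed

end

section \<open>Variation of a Gibbs chain\<close>

lemma exp_interpolate: "0 \<le> m \<Longrightarrow> m \<le> 1 \<Longrightarrow> exp (m * w) \<le> (1 - m) + m * exp (w::real)"
  using convex_onD[OF exp_convex, of m 0 w] by simp

text \<open>Jensen: the difference of the two steps is \<open>1 / m\<close> times the logarithm of
  the tilted average of \<open>exp (m * (g - f))\<close>, and \<open>m \<le> 1\<close>; for
  \<open>m = 0\<close> it is the mean of \<open>g - f\<close>. The bound is linear in
  \<open>exp (g - f)\<close> and involves the tilt of \<open>f\<close> alone, so it can be iterated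
  along the unperturbed chain.\<close>

lemma exp_gauss_step_diff_le:
  assumes a: "admissible m v f" and g: "lip1 g" and b: "\<And>y. \<bar>g y - f y\<bar> \<le> B"
  shows "exp (gauss_step m v g x - gauss_step m v f x) \<le> tilt m v f (\<lambda>y. exp (g y - f y)) x"
proof -
  have f: "lip1 f" "0 \<le> m" "m \<le> 1"
    using a by (auto simp: admissible_def)
  have meas: "(\<lambda>y. g y - f y) \<in> borel_measurable borel"
    by (intro borel_measurable_diff lip1_measurable g f)
  have kb: "bdd_borel (\<lambda>y. g y - f y)"
    by (rule bdd_borelI[OF meas b])
  have eb: "bdd_borel (\<lambda>y. exp (a * (g y - f y)))" for a :: real
  proof (rule bdd_borelI)
    show "(\<lambda>y. exp (a * (g y - f y))) \<in> borel_measurable borel"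
      using meas by measurable
    fix y
    have "a * (g y - f y) \<le> \<bar>a\<bar> * B"
      using mult_left_mono[OF b[of y], of "\<bar>a\<bar>"] by (simp add: abs_mult[symmetric] abs_le_iff)
    then show "\<bar>exp (a * (g y - f y))\<bar> \<le> exp (\<bar>a\<bar> * B)"
      by simp
  qed
  have e1: "bdd_borel (\<lambda>y. exp (g y - f y))"
    using eb[of 1] by simp
  define c where "c = gauss_step m v g x - gauss_step m v f x"
  show ?thesis
  proof (cases "m = 0")
    case True
    have t0: "tilt 0 v f h x = (LINT z|std_normal_distribution. h (x + z * sqrt v))" for h
      by (simp add: tilt_eq_ratio)
    have "tilt m v f (\<lambda>y. g y - f y) x = c"
      using lip1_integrable[OF g] lip1_integrable[OF f(1)] by (simp add: t0 c_def True gauss_step_def)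
    moreover have "tilt m v f (\<lambda>y. exp c * ((g y - f y) + (1 - c))) x = exp c * (tilt m v f (\<lambda>y. g y - f y) x + (1 - c))"
      by (simp add: tilt_cmult[OF a] tilt_add[OF a kb bdd_borel_const] tilt_const[OF a])
    moreover have "tilt m v f (\<lambda>y. exp c * ((g y - f y) + (1 - c))) x \<le> tilt m v f (\<lambda>y. exp (g y - f y)) x"
    proof (rule tilt_mono[OF a _ e1])
      show "bdd_borel (\<lambda>y. exp c * ((g y - f y) + (1 - c)))"
        by (intro bdd_borel_mult bdd_borel_add bdd_borel_const kb)
      fix y
      have "exp c * (1 + (g y - f y - c)) \<le> exp c * exp (g y - f y - c)"
        by (intro mult_left_mono exp_ge_add_one_self) auto
      then show "exp c * ((g y - f y) + (1 - c)) \<le> exp (g y - f y)"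
        by (simp add: algebra_simps flip: exp_add)
    qed
    ultimately show ?thesis
      by (simp add: c_def)
  next
    case False
    then have m: "0 < m"
      using f by simp
    have "exp (m * c) = (LINT z|std_normal_distribution. exp (m * g (x + z * sqrt v))) / (LINT z|std_normal_distribution. exp (m * f (x + z * sqrt v)))"
      using m lip1_exp_integral_pos[OF g] lip1_exp_integral_pos[OF f(1)]
      by (simp add: c_def gauss_step_def right_diff_distrib exp_diff)
    also have "\<dots> = tilt m v f (\<lambda>y. exp (m * (g y - f y))) x"
      by (simp add: tilt_eq_ratio algebra_simps flip: exp_add)
    finally have ec: "tilt m v f (\<lambda>y. exp (m * (g y - f y))) x = exp (m * c)" ..
    \<comment> \<open>Coefficients of \<open>exp_interpolate\<close> at
      \<open>w = g y - f y - c\<close>, solved for \<open>exp w\<close> and scaled by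
      \<open>exp c\<close>. The left side then has tilted average exactly
      \<open>exp c\<close>.\<close>
    define K where "K = exp c * exp (- (m * c)) / m"
    have "tilt m v f (\<lambda>y. K * exp (m * (g y - f y)) + exp c * (1 - 1 / m)) x = K * exp (m * c) + exp c * (1 - 1 / m)"
      using bdd_borel_mult[OF bdd_borel_const eb, of K m]
      by (simp add: tilt_add[OF a _ bdd_borel_const] tilt_cmult[OF a] tilt_const[OF a] ec)
    also have "\<dots> = exp c"
      using m by (simp add: K_def field_simps flip: exp_add)
    finally have E: "tilt m v f (\<lambda>y. K * exp (m * (g y - f y)) + exp c * (1 - 1 / m)) x = exp c" .
    have "tilt m v f (\<lambda>y. K * exp (m * (g y - f y)) + exp c * (1 - 1 / m)) x \<le> tilt m v f (\<lambda>y. exp (g y - f y)) x"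
    proof (rule tilt_mono[OF a _ e1])
      show "bdd_borel (\<lambda>y. K * exp (m * (g y - f y)) + exp c * (1 - 1 / m))"
        by (intro bdd_borel_mult bdd_borel_add bdd_borel_const eb)
      fix y
      have "exp (m * (g y - f y - c)) / m \<le> ((1 - m) + m * exp (g y - f y - c)) / m"
        using m f by (intro divide_right_mono exp_interpolate) auto
      also have "\<dots> = (1 / m - 1) + exp (g y - f y - c)"
        using m by (simp add: add_divide_distrib diff_divide_distrib)
      finally have "exp (m * (g y - f y - c)) / m + (1 - 1 / m) \<le> exp (g y - f y - c)"
        by linarith
      then have "exp c * (exp (m * (g y - f y - c)) / m + (1 - 1 / m)) \<le> exp c * exp (g y - f y - c)"
        by (rule mult_left_mono) simp
      moreover have "exp c * (exp (m * (g y - f y - c)) / m + (1 - 1 / m)) = K * exp (m * (g y - f y)) + exp c * (1 - 1 / m)"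
        by (simp add: K_def right_diff_distrib exp_diff exp_minus field_simps exp_add)
      moreover have "exp c * exp (g y - f y - c) = exp (g y - f y)"
        by (simp flip: exp_add)
      ultimately show "K * exp (m * (g y - f y)) + exp c * (1 - 1 / m) \<le> exp (g y - f y)"
        by simp
    qed
    then show ?thesis
      unfolding E unfolding c_def .
  qed
qed

text \<open>The 24 is \<open>4 * 6\<close>, with 6 from
  \<open>\<bar>z\<bar> ^ 3 \<le> 6 * exp \<bar>z\<bar>\<close>; the 4 comes from the squared mean,
  which is at most \<open>(2 * v)^2\<close>.\<close>

definition var_const :: real where
  "var_const = 24 * gauss_abs_mgf 1 + 4"

lemma var_const_nonneg: "0 \<le> var_const"
  using gauss_abs_mgf_pos[of 1] by (simp add: var_const_def)

text \<open>Linearise \<open>f\<close> at \<open>x\<close>: the linear part has variance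
  \<open>v * (p x)^2\<close>, and the Lipschitz bound on \<open>p\<close> makes the rest smaller by
  a factor \<open>sqrt v\<close>.\<close>

lemma gauss_var_expansion:
  assumes f: "lip1 f" "\<And>y. (f has_real_derivative p y) (at y)" and p: "\<And>y. \<bar>p y\<bar> \<le> 1" "lip_with 2 p"
    and v: "0 \<le> v" "v \<le> 1"
  shows "\<bar>gauss_var v f x - v * (p x)\<^sup>2\<bar> \<le> var_const * (v * sqrt v)"
proof -
  define s where "s = sqrt v"
  have s: "0 \<le> s" "s \<le> 1" "s * s = v"
    using v by (auto simp: s_def)
  define Y where "Y z = f (x + z * s) - f x" for z
  have R: "\<bar>f (x + y) - f x - p x * y\<bar> \<le> 2 * y\<^sup>2" for y
  proof -
    have "norm ((\<lambda>t. f t - p x * t) (x + y) - (\<lambda>t. f t - p x * t) x) \<le> (2 * \<bar>y\<bar>) * norm ((x + y) - x)"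
    proof (rule field_differentiable_bound[of "{x - \<bar>y\<bar>..x + \<bar>y\<bar>}"])
      fix t assume "t \<in> {x - \<bar>y\<bar>..x + \<bar>y\<bar>}"
      then have "\<bar>t - x\<bar> \<le> \<bar>y\<bar>"
        by auto
      then show "norm (p t - p x) \<le> 2 * \<bar>y\<bar>"
        using lip_withD(3)[OF p(2), of t x] by simp
      have "((\<lambda>t. f t - p x * t) has_real_derivative p t - p x) (at t)"
        by (auto intro!: derivative_eq_intros f)
      then show "((\<lambda>t. f t - p x * t) has_real_derivative p t - p x) (at t within {x - \<bar>y\<bar>..x + \<bar>y\<bar>})"
        by (rule has_field_derivative_at_within)
    qed auto
    then show ?thesis
      by (simp add: algebra_simps power2_eq_square abs_mult[symmetric])
  qed
  have Y1: "\<bar>Y z\<bar> \<le> \<bar>z\<bar> * s" for z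
    using lip1D[OF f(1), of "x + z * s" x] s by (simp add: Y_def abs_mult)
  have Y2: "\<bar>Y z - p x * (z * s)\<bar> \<le> 2 * (z\<^sup>2 * v)" for z
  proof -
    have "(z * s)\<^sup>2 = z\<^sup>2 * v"
      using s(3) by (simp add: power_mult_distrib power2_eq_square[of s])
    then show ?thesis
      using R[of "z * s"] by (simp add: Y_def)
  qed
  have Yi: "integrable std_normal_distribution Y"
    unfolding Y_def using lip1_integrable[OF f(1)] by simp
  have [measurable]: "Y \<in> borel_measurable borel"
    using lip1_measurable[OF f(1)] unfolding Y_def by measurable
  have YYi: "integrable std_normal_distribution (\<lambda>z. (Y z)\<^sup>2)"
  proof (rule Bochner_Integration.integrable_bound[of _ "\<lambda>z. z\<^sup>2"])
    have "\<bar>Y z\<bar> \<le> \<bar>z\<bar>" for z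
      using Y1[of z] mult_left_mono[OF s(2), of "\<bar>z\<bar>"] by simp
    then show "AE z in std_normal_distribution. norm ((Y z)\<^sup>2) \<le> norm (z\<^sup>2)"
      by (simp add: abs_le_square_iff[symmetric])
  qed (use std_normal_integrable_square in auto)
  have zi: "integrable std_normal_distribution (\<lambda>z. p x * (z * s))"
    using std_normal_integrable_id by simp
  have zzi: "integrable std_normal_distribution (\<lambda>z. v * (p x)\<^sup>2 * z\<^sup>2)"
    using std_normal_integrable_square by simp
  define a where "a = (LINT z|std_normal_distribution. Y z)"
  have "a = (LINT z|std_normal_distribution. Y z - p x * (z * s))"
    using Yi zi by (simp add: a_def std_normal_integral_id)
  also have "\<bar>\<dots>\<bar> \<le> (LINT z|std_normal_distribution. \<bar>Y z - p x * (z * s)\<bar>)"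
    using integral_norm_bound[of std_normal_distribution "\<lambda>z. Y z - p x * (z * s)"] by simp
  also have "\<dots> \<le> (LINT z|std_normal_distribution. 2 * (z\<^sup>2 * v))"
    by (intro integral_mono Y2 integrable_abs Bochner_Integration.integrable_diff Yi zi)
      (use std_normal_integrable_square in simp)
  also have "\<dots> = 2 * v"
    by (simp add: std_normal_integral_square)
  finally have a: "\<bar>a\<bar> \<le> 2 * v" .
  have "\<bar>(Y z)\<^sup>2 - v * (p x)\<^sup>2 * z\<^sup>2\<bar> \<le> (24 * (v * s)) * exp (1 * \<bar>z\<bar>)" for z
  proof -
    have "(Y z)\<^sup>2 - v * (p x)\<^sup>2 * z\<^sup>2 = (Y z - p x * (z * s)) * (Y z + p x * (z * s))"
      by (simp add: power2_eq_square algebra_simps flip: s(3))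
    moreover have "\<bar>p x * (z * s)\<bar> \<le> 1 * (\<bar>z\<bar> * s)"
      unfolding abs_mult using p(1)[of x] s by (intro mult_mono) auto
    then have "\<bar>Y z + p x * (z * s)\<bar> \<le> 2 * (\<bar>z\<bar> * s)"
      using Y1[of z] by linarith
    ultimately have "\<bar>(Y z)\<^sup>2 - v * (p x)\<^sup>2 * z\<^sup>2\<bar> \<le> (2 * (z\<^sup>2 * v)) * (2 * (\<bar>z\<bar> * s))"
      using Y2[of z] v by (simp only: abs_mult) (intro mult_mono, auto)
    also have "\<dots> = 4 * (v * s) * \<bar>z\<bar> ^ 3"
      by (simp add: power2_eq_square power3_eq_cube)
    also have "\<dots> \<le> 4 * (v * s) * (6 * exp \<bar>z\<bar>)"
      using power_le_fact_exp[of "\<bar>z\<bar>" 3] v s by (intro mult_left_mono) (auto simp: fact_numeral)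
    finally show ?thesis
      by simp
  qed
  then have "\<bar>LINT z|std_normal_distribution. (Y z)\<^sup>2 - v * (p x)\<^sup>2 * z\<^sup>2\<bar> \<le> (24 * (v * s)) * gauss_abs_mgf 1"
    by (rule std_normal_integral_bound)
  moreover have "(LINT z|std_normal_distribution. (Y z)\<^sup>2 - v * (p x)\<^sup>2 * z\<^sup>2) = (LINT z|std_normal_distribution. (Y z)\<^sup>2) - v * (p x)\<^sup>2"
    using YYi zzi by (simp add: std_normal_integral_square)
  moreover have "gauss_var v f x = (LINT z|std_normal_distribution. (Y z)\<^sup>2) - a\<^sup>2"
  proof -
    have "gauss_var v f x = (LINT z|std_normal_distribution. (Y z - a)\<^sup>2)"
      using lip1_integrable[OF f(1)] by (simp add: gauss_var_def Y_def a_def gauss_step_def s_def)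
    also have "\<dots> = (LINT z|std_normal_distribution. (Y z)\<^sup>2) - a\<^sup>2"
      unfolding a_def by (rule std_normal.variance_eq) fact+
    finally show ?thesis .
  qed
  moreover have "a\<^sup>2 \<le> 4 * (v * s)"
  proof -
    have "a\<^sup>2 \<le> (2 * v)\<^sup>2"
      using power_mono[OF a, of 2] by simp
    also have "\<dots> = 4 * (v * (s * s))"
      by (simp add: power2_eq_square s)
    also have "\<dots> \<le> 4 * (v * (s * 1))"
      using v s by (intro mult_left_mono) auto
    finally show ?thesis
      by simp
  qed
  ultimately have "\<bar>gauss_var v f x - v * (p x)\<^sup>2\<bar> \<le> (24 * (v * s)) * gauss_abs_mgf 1 + 4 * (v * s)"
    using zero_le_power2[of a] by linarith
  then show ?thesis
    by (simp add: var_const_def s_def algebra_simps)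
qed

lemma tilt_minus_self:
  assumes "admissible m v f" "lip_with G g"
  shows "\<bar>tilt m v f g x - g x\<bar> \<le> G * sqrt v * gibbs_mgf 1"
proof -
  interpret gibbs_measure m v f x
    using assms(1) by (rule admissible_gibbs)
  have "exp_bounded (\<lambda>z. g (x + z * sqrt v))"
    by (rule bdd_borel_exp_bounded[OF lip_withD(1)[OF assms(2)]])
  from E_diff[OF this exp_bounded_const] have "E (\<lambda>z. g (x + z * sqrt v) - g x) = tilt m v f g x - g x"
    by (simp add: tilt_def)
  moreover have "\<bar>E (\<lambda>z. g (x + z * sqrt v) - g x)\<bar> \<le> (G * sqrt v) * gibbs_mgf 1"
    by (rule E_bound) (rule lip_with_gauss[OF assms(2) v(1)])
  ultimately show ?thesis
    by simp
qed

definition step_expansion_const :: "real \<Rightarrow> bool" where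
  "step_expansion_const C \<longleftrightarrow> 0 \<le> C \<and> (\<forall>f m v x. lip1 f \<longrightarrow> 0 \<le> m \<longrightarrow> m \<le> 1 \<longrightarrow> 0 \<le> v \<longrightarrow> v \<le> 1 \<longrightarrow>
      \<bar>gauss_step m v f x - gauss_step 0 v f x - m / 2 * gauss_var v f x\<bar> \<le> C * (v * sqrt v))"

lemma exists_step_expansion_const: "\<exists>C. step_expansion_const C"
  using gauss_step_expansion unfolding step_expansion_const_def by metis

lemma exp_le_quadratic: "\<bar>r\<bar> \<le> 1 \<Longrightarrow> exp r \<le> 1 + r + (r::real)\<^sup>2"
proof (cases "0 \<le> r")
  case False
  assume r: "\<bar>r\<bar> \<le> 1"
  have "exp r = 1 / exp (- r)"
    by (simp add: exp_minus divide_inverse)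
  also have "\<dots> \<le> 1 / (1 - r)"
    using exp_ge_add_one_self[of "- r"] False by (intro divide_left_mono) auto
  also have "\<dots> \<le> 1 + r + r\<^sup>2"
  proof -
    have "r ^ 3 \<le> 0"
      using False by (simp add: power3_eq_cube mult_nonneg_nonpos)
    then have "1 \<le> (1 + r + r\<^sup>2) * (1 - r)"
      by (simp add: algebra_simps power2_eq_square power3_eq_cube)
    then show ?thesis
      using False by (simp add: pos_divide_le_eq)
  qed
  finally show ?thesis .
qed (auto intro: exp_bound)

definition pert_const :: "real \<Rightarrow> real" where
  "pert_const C = 2 * C + var_const + 2 * gibbs_mgf 1"

text \<open>Two chains with the same variances, the perturbed one under the prefix \<open>T\<close>.
  They differ only on the window \<open>j..<J\<close>: below it by \<open>unpert\<close>, above it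
  because both have parameter 1.\<close>

locale perturbed_chain =
  near_top m v N j J \<eta> + T: near_top m' v N j J \<eta> for m m' v N j J \<eta> +
  fixes \<epsilon> h C :: real
  assumes eps: "0 \<le> \<epsilon>" "\<epsilon> \<le> 1" and pert: "\<And>i. j \<le> i \<Longrightarrow> i < J \<Longrightarrow> \<bar>m' i - m i\<bar> \<le> \<epsilon>"
    and unpert: "\<And>i. i < j \<Longrightarrow> m' i = m i"
    and C: "step_expansion_const C" and h: "h \<le> 1" "\<And>i. sqrt (v i) \<le> h"
begin

lemma h0: "0 \<le> h"
  using h(2)[of 0] v(1)[of 0] by (meson order_trans real_sqrt_ge_zero)

lemma slope_lip: "j \<le> i \<Longrightarrow> i \<le> N \<Longrightarrow> lip_with 2 (slope i)"
  using near_estimates[of i] err_bounds[of i] near_lip(1)[of i "err i"] by blast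

lemma T_slope_lip: "j \<le> i \<Longrightarrow> i \<le> N \<Longrightarrow> lip_with 2 (T.slope i)"
  using T.near_estimates[of i] T.err_bounds[of i] T.near_lip(1)[of i "T.err i"] by blast

lemma slope_diff:
  assumes "j \<le> i" "i \<le> N"
  shows "\<forall>x. \<bar>T.slope i x - slope i x\<bar> \<le> near_const * \<epsilon> * \<tau> i"
  using assms(2,1)
proof (induction i rule: inc_induct)
  case base
  then show ?case
    using near_const_bounds eps tau_nonneg by (simp add: slope_N T.slope_N)
next
  case (step i)
  have i: "j \<le> i" "i < N" "j \<le> Suc i" "Suc i \<le> N"
    using step by auto
  define d where "d = near_const * \<epsilon> * \<tau> (Suc i)"
  define e where "e = (if i < J then \<epsilon> else 0)"
  have IH: "\<bar>T.slope (Suc i) x - slope (Suc i) x\<bar> \<le> d" for x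
    using step.IH i(3) by (auto simp: d_def)
  have d0: "0 \<le> d"
    using near_const_bounds eps tau_nonneg by (simp add: d_def)
  have "\<epsilon> * (near_const * \<tau> (Suc i)) \<le> \<epsilon> * 1"
    using tau_le[OF i(3)] eps by (intro mult_left_mono) auto
  then have d\<epsilon>: "d \<le> \<epsilon>"
    by (simp add: d_def mult_ac)
  have e: "\<bar>m' i - m i\<bar> \<le> e" "0 \<le> e" "e \<le> 1"
    using pert[OF i(1)] top[of i] T.top[of i] i eps by (auto simp: e_def)
  have kd: "\<bar>m' i * T.slope (Suc i) z - m i * slope (Suc i) z\<bar> \<le> e + d" for z
  proof -
    have "m' i * T.slope (Suc i) z - m i * slope (Suc i) z = (m' i - m i) * slope (Suc i) z + m' i * (T.slope (Suc i) z - slope (Suc i) z)"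
      by (simp add: algebra_simps)
    moreover have "\<bar>(m' i - m i) * slope (Suc i) z\<bar> \<le> e * 1"
      unfolding abs_mult using e slope_le_1[OF i(4), of z] by (intro mult_mono) auto
    moreover have "\<bar>m' i * (T.slope (Suc i) z - slope (Suc i) z)\<bar> \<le> 1 * d"
      unfolding abs_mult using T.m[of i] IH[of z] by (intro mult_mono) auto
    ultimately show ?thesis
      by linarith
  qed
  have k: "\<bar>(m' i * T.f (Suc i) y - m i * f (Suc i) y) - (m' i * T.f (Suc i) x - m i * f (Suc i) x)\<bar> \<le> (e + d) * \<bar>y - x\<bar>" for x y
  proof -
    have "((\<lambda>y. m' i * T.f (Suc i) y - m i * f (Suc i) y) has_real_derivative m' i * T.slope (Suc i) z - m i * slope (Suc i) z) (at z)" for z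
      using i by (intro DERIV_diff DERIV_cmult near_DERIV T.near_DERIV) auto
    then have "norm ((\<lambda>y. m' i * T.f (Suc i) y - m i * f (Suc i) y) y - (\<lambda>y. m' i * T.f (Suc i) y - m i * f (Suc i) y) x) \<le> (e + d) * norm (y - x)"
      using kd by (intro field_differentiable_bound[of UNIV]) auto
    then show ?thesis
      by simp
  qed
  have bb: "bdd_borel (T.slope (Suc i))" "bdd_borel (slope (Suc i))"
    using i by (auto intro: bdd_borel_slope T.bdd_borel_slope)
  show ?case
  proof
    fix x
    have 1: "\<bar>T.L i (T.slope (Suc i)) x - T.L i (slope (Suc i)) x\<bar> \<le> d"
      using tilt_bound[OF T.adm[of i] bdd_borel_diff[OF bb], of d x] IH by (simp add: tilt_diff[OF T.adm bb])
    have 2: "\<bar>T.L i (slope (Suc i)) x - L i (slope (Suc i)) x\<bar> \<le> tilt_const_bound * (2 * (e + d) * v i)"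
      by (rule tilt_change_bound(1)[OF T.adm adm slope_lip[OF i(3,4)] k]) (use d\<epsilon> e eps in linarith)
    have 3: "d + tilt_const_bound * (2 * (e + d) * v i) \<le> near_const * \<epsilon> * \<tau> i"
    proof (cases "i < J")
      case True
      have "tilt_const_bound * (2 * (e + d) * v i) \<le> tilt_const_bound * (2 * (2 * \<epsilon>) * v i)"
        using d\<epsilon> True v[of i] tilt_const_bound_ge(4) by (intro mult_left_mono mult_right_mono) (auto simp: e_def)
      also have "\<dots> = (4 * tilt_const_bound) * (\<epsilon> * v i)"
        by simp
      also have "\<dots> \<le> near_const * (\<epsilon> * v i)"
        using near_const_bounds(2) tilt_const_bound_ge(4) eps v[of i] by (intro mult_right_mono) auto
      finally show ?thesis
        by (simp add: d_def tau_step[OF True] algebra_simps)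
    next
      case False
      then show ?thesis
        by (simp add: d_def e_def tau_top)
    qed
    show "\<bar>T.slope i x - slope i x\<bar> \<le> near_const * \<epsilon> * \<tau> i"
      unfolding slope_step[OF i(2)] T.slope_step[OF i(2)] using 1 2 3 by linarith
  qed
qed

text \<open>The local term of a discrete Duhamel formula: the parameter is changed at step
  \<open>i\<close> alone, after all later steps have been perturbed. The other part of the deviation
  is controlled by contraction or by Jensen.\<close>

definition rem :: "nat \<Rightarrow> real \<Rightarrow> real" where
  "rem i x = gauss_step (m' i) (v i) (T.f (Suc i)) x - gauss_step (m i) (v i) (T.f (Suc i)) x"

abbreviation "Q \<equiv> pert_const C"

lemma C0: "0 \<le> C"
  using C by (simp add: step_expansion_const_def)

lemma Q0: "0 \<le> Q"
  using C0 var_const_nonneg gibbs_mgf_pos[of 1] by (simp add: pert_const_def)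

text \<open>The derivative of a step in its parameter is half the variance, that is, half of
  \<open>v i\<close> times the squared slope. Passing from the perturbed slope at the next node to
  the unperturbed one at \<open>i\<close> costs \<open>\<epsilon>\<close> plus a multiple of
  \<open>h\<close>; the factor \<open>\<bar>m' i - m i\<bar> \<le> \<epsilon>\<close> makes this
  \<open>\<epsilon>^2\<close> plus a mesh error.\<close>

lemma rem_expansion:
  assumes i: "j \<le> i" "i < J"
  shows "\<bar>rem i x - (m' i - m i) / 2 * (v i * (slope i x)\<^sup>2)\<bar> \<le> v i * (\<epsilon>\<^sup>2 + Q * h)"
proof -
  have iN: "i < N" "j \<le> Suc i" "Suc i \<le> N"
    using i jJ by auto
  define d where "d = m' i - m i"
  have d: "\<bar>d\<bar> \<le> \<epsilon>"
    using pert[OF i] by (simp add: d_def)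
  have vh: "v i * sqrt (v i) \<le> v i * h"
    using h(2)[of i] v(1)[of i] by (rule mult_left_mono)
  define V where "V = gauss_var (v i) (T.f (Suc i)) x"
  have e: "\<bar>gauss_step \<mu> (v i) (T.f (Suc i)) x - gauss_step 0 (v i) (T.f (Suc i)) x - \<mu> / 2 * V\<bar> \<le> C * (v i * h)"
    if "0 \<le> \<mu>" "\<mu> \<le> 1" for \<mu>
  proof -
    have "\<bar>gauss_step \<mu> (v i) (T.f (Suc i)) x - gauss_step 0 (v i) (T.f (Suc i)) x - \<mu> / 2 * V\<bar> \<le> C * (v i * sqrt (v i))"
      using C that T.lip1_chain v[of i] unfolding step_expansion_const_def V_def by blast
    also have "\<dots> \<le> C * (v i * h)"
      using vh C0 by (rule mult_left_mono)
    finally show ?thesis .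
  qed
  have 1: "\<bar>rem i x - d / 2 * V\<bar> \<le> 2 * C * (v i * h)"
    using e[OF T.m(1,2)[of i]] e[OF m(1,2)[of i]] unfolding rem_def d_def diff_divide_distrib left_diff_distrib by linarith
  have "\<bar>V - v i * (T.slope (Suc i) x)\<^sup>2\<bar> \<le> var_const * (v i * sqrt (v i))"
    unfolding V_def
    by (rule gauss_var_expansion[OF T.lip1_chain T.near_DERIV(1)[OF iN(2,3)] T.slope_le_1[OF iN(3)] T_slope_lip[OF iN(2,3)] v])
  also have "\<dots> \<le> var_const * (v i * h)"
    using vh var_const_nonneg by (rule mult_left_mono)
  finally have 2: "\<bar>V - v i * (T.slope (Suc i) x)\<^sup>2\<bar> \<le> var_const * (v i * h)" .
  have 3: "\<bar>(T.slope (Suc i) x)\<^sup>2 - (slope i x)\<^sup>2\<bar> \<le> 2 * (\<epsilon> + 2 * h * gibbs_mgf 1)"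
  proof -
    have "\<epsilon> * (near_const * \<tau> (Suc i)) \<le> \<epsilon> * 1"
      using tau_le[OF iN(2)] eps by (intro mult_left_mono) auto
    then have "\<bar>T.slope (Suc i) x - slope (Suc i) x\<bar> \<le> \<epsilon>"
      using slope_diff[OF iN(2,3)] by (auto simp: mult_ac intro: order_trans)
    moreover have "\<bar>slope i x - slope (Suc i) x\<bar> \<le> 2 * sqrt (v i) * gibbs_mgf 1"
      unfolding slope_step[OF iN(1)] by (rule tilt_minus_self[OF adm slope_lip[OF iN(2,3)]])
    moreover have "2 * sqrt (v i) * gibbs_mgf 1 \<le> 2 * h * gibbs_mgf 1"
      using h(2)[of i] gibbs_mgf_pos[of 1] by (intro mult_right_mono) auto
    ultimately have a: "\<bar>T.slope (Suc i) x - slope i x\<bar> \<le> \<epsilon> + 2 * h * gibbs_mgf 1"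
      by linarith
    have b: "\<bar>T.slope (Suc i) x + slope i x\<bar> \<le> 2"
      using T.slope_le_1[OF iN(3), of x] slope_le_1[of i x] iN by linarith
    have "\<bar>(T.slope (Suc i) x)\<^sup>2 - (slope i x)\<^sup>2\<bar> = \<bar>T.slope (Suc i) x - slope i x\<bar> * \<bar>T.slope (Suc i) x + slope i x\<bar>"
      by (simp add: power2_eq_square square_diff_square_factored mult.commute flip: abs_mult)
    also have "\<dots> \<le> (\<epsilon> + 2 * h * gibbs_mgf 1) * 2"
      using a b by (intro mult_mono) (auto intro: order_trans[OF abs_ge_zero])
    finally show ?thesis
      by simp
  qed
  have "v i * \<bar>(T.slope (Suc i) x)\<^sup>2 - (slope i x)\<^sup>2\<bar> \<le> v i * (2 * (\<epsilon> + 2 * h * gibbs_mgf 1))"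
    using 3 v(1) by (rule mult_left_mono)
  then have 4: "\<bar>v i * (T.slope (Suc i) x)\<^sup>2 - v i * (slope i x)\<^sup>2\<bar> \<le> v i * (2 * (\<epsilon> + 2 * h * gibbs_mgf 1))"
    using v(1)[of i] by (simp add: abs_mult flip: right_diff_distrib)
  have "\<bar>V - v i * (slope i x)\<^sup>2\<bar> \<le> var_const * (v i * h) + v i * (2 * (\<epsilon> + 2 * h * gibbs_mgf 1))"
    using 2 4 by linarith
  then have "\<bar>d / 2\<bar> * \<bar>V - v i * (slope i x)\<^sup>2\<bar> \<le> (\<epsilon> / 2) * (var_const * (v i * h) + v i * (2 * (\<epsilon> + 2 * h * gibbs_mgf 1)))"
    using d eps by (intro mult_mono) auto
  also have "\<dots> = v i * (\<epsilon>\<^sup>2 + \<epsilon> * ((var_const / 2 + 2 * gibbs_mgf 1) * h))"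
    by (simp add: algebra_simps power2_eq_square)
  also have "\<dots> \<le> v i * (\<epsilon>\<^sup>2 + 1 * ((var_const + 2 * gibbs_mgf 1) * h))"
    using v(1)[of i] eps var_const_nonneg gibbs_mgf_pos[of 1] h0
    by (intro mult_left_mono add_left_mono mult_mono mult_right_mono) auto
  finally have 5: "\<bar>d / 2 * V - d / 2 * (v i * (slope i x)\<^sup>2)\<bar> \<le> v i * (\<epsilon>\<^sup>2 + (var_const + 2 * gibbs_mgf 1) * h)"
    by (simp only: abs_mult[symmetric] right_diff_distrib mult_1)
  have "\<bar>rem i x - d / 2 * (v i * (slope i x)\<^sup>2)\<bar> \<le> 2 * C * (v i * h) + v i * (\<epsilon>\<^sup>2 + (var_const + 2 * gibbs_mgf 1) * h)"
    using 1 5 by linarith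
  also have "\<dots> = v i * (\<epsilon>\<^sup>2 + Q * h)"
    by (simp add: pert_const_def algebra_simps)
  finally show ?thesis
    by (simp add: d_def)
qed

text \<open>\<open>v i * \<beta>\<close> bounds a local term. Since the window has clock length at
  most 1, \<open>\<beta>\<close> also bounds the whole deviation.\<close>

definition \<beta> :: real where "\<beta> = 2 * \<epsilon> + Q * h"

lemma beta0: "0 \<le> \<beta>"
  using eps Q0 h0 by (simp add: \<beta>_def)

lemma rem_bound:
  assumes i: "j \<le> i" "i < J"
  shows "\<bar>rem i x\<bar> \<le> v i * \<beta>"
proof -
  have iN: "i \<le> N"
    using i jJ by auto
  have "(slope i x)\<^sup>2 \<le> 1"
    using slope_le_1[OF iN, of x] by (simp add: abs_square_le_1)
  then have "\<bar>(m' i - m i) / 2 * (v i * (slope i x)\<^sup>2)\<bar> \<le> \<epsilon> * (v i * 1)"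
    unfolding abs_mult using pert[OF i] v(1)[of i] eps by (intro mult_mono) auto
  moreover have "v i * \<epsilon>\<^sup>2 \<le> v i * \<epsilon>"
    using eps v(1)[of i] by (intro mult_left_mono) (auto simp: power2_eq_square mult_left_le)
  moreover have "v i * (2 * \<epsilon>) = \<epsilon> * (v i * 1) + v i * \<epsilon>"
    by simp
  ultimately show ?thesis
    using rem_expansion[OF i, of x] unfolding \<beta>_def distrib_left by linarith
qed

definition dev :: "nat \<Rightarrow> real \<Rightarrow> real" where "dev i x = T.f i x - f i x"

lemma dev_split:
  "i < N \<Longrightarrow> dev i x = rem i x + (gauss_step (m i) (v i) (T.f (Suc i)) x - gauss_step (m i) (v i) (f (Suc i)) x)"
  by (simp add: dev_def rem_def chain_step)

lemma rem_zero: "i < j \<or> J \<le> i \<Longrightarrow> i < N \<Longrightarrow> rem i x = 0"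
  using unpert[of i] top[of i] T.top[of i] by (auto simp: rem_def)

lemma dev_le:
  assumes "i < N" "\<And>x. \<bar>dev (Suc i) x\<bar> \<le> b"
  shows "\<bar>dev i x\<bar> \<le> \<bar>rem i x\<bar> + b"
proof -
  have "\<bar>gauss_step (m i) (v i) (T.f (Suc i)) x - gauss_step (m i) (v i) (f (Suc i)) x\<bar> \<le> b"
    by (rule gauss_step_contraction[OF T.lip1_chain lip1_chain _ m(1)]) (use assms(2) in \<open>simp add: dev_def\<close>)
  then show ?thesis
    using dev_split[OF assms(1), of x] by linarith
qed

lemma dev_near: "i \<le> N \<Longrightarrow> j \<le> i \<Longrightarrow> \<bar>dev i x\<bar> \<le> \<beta> * \<tau> i"
proof (induction i arbitrary: x rule: inc_induct)
  case base
  then show ?case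
    using beta0 tau_nonneg by (simp add: dev_def chain_N)
next
  case (step i)
  have "\<bar>dev i x\<bar> \<le> \<bar>rem i x\<bar> + \<beta> * \<tau> (Suc i)"
    by (rule dev_le) (use step in auto)
  moreover have "\<bar>rem i x\<bar> + \<beta> * \<tau> (Suc i) \<le> \<beta> * \<tau> i"
  proof (cases "i < J")
    case True
    then show ?thesis
      using rem_bound[of i x] step tau_step[of i] by (simp add: algebra_simps)
  next
    case False
    then show ?thesis
      using rem_zero[of i x] step by (simp add: tau_top)
  qed
  ultimately show ?case
    by linarith
qed

lemma dev_bound: "i \<le> N \<Longrightarrow> \<bar>dev i x\<bar> \<le> \<beta>"
proof (cases "j \<le> i")
  case True
  assume "i \<le> N"
  have "\<tau> i \<le> 1"
    using tau_le[OF True] mult_right_mono[OF near_const_bounds(1) tau_nonneg[of i]] by linarith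
  then have "\<beta> * \<tau> i \<le> \<beta>"
    using beta0 by (simp add: mult_left_le)
  then show ?thesis
    using dev_near[OF \<open>i \<le> N\<close> True, of x] by linarith
next
  case False
  have "j \<le> N"
    using jJ by simp
  have "\<tau> j \<le> 1"
    using tau_le[of j] mult_right_mono[OF near_const_bounds(1) tau_nonneg[of j]] by simp
  then have bj: "\<bar>dev j x\<bar> \<le> \<beta>" for x
    using dev_near[OF \<open>j \<le> N\<close>, of x] mult_left_mono[OF _ beta0, of "\<tau> j" 1] by simp
  have "i \<le> j"
    using False by simp
  then show ?thesis
  proof (induction i arbitrary: x rule: inc_induct)
    case base
    then show ?case by (rule bj)
  next
    case (step i)
    have "\<bar>dev i x\<bar> \<le> \<bar>rem i x\<bar> + \<beta>"
      by (rule dev_le) (use step \<open>j \<le> N\<close> in auto)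
    then show ?case
      using rem_zero[of i x] step \<open>j \<le> N\<close> by simp
  qed
qed

text \<open>The exponential is the scale on which \<open>exp_gauss_step_diff_le\<close> is linear.
  Because \<open>dev \<le> gain\<close>, an upper bound for the average of \<open>gain\<close> is
  enough.\<close>

definition "gain i x = exp (dev i x) - 1"

lemma dev_measurable: "dev i \<in> borel_measurable borel"
  unfolding dev_def[abs_def] by (intro borel_measurable_diff lip1_measurable T.lip1_chain lip1_chain)

lemma bdd_borel_exp_dev: "i \<le> N \<Longrightarrow> bdd_borel (\<lambda>x. exp (dev i x))"
proof (rule bdd_borelI)
  show "(\<lambda>x. exp (dev i x)) \<in> borel_measurable borel"
    using dev_measurable by measurable
  show "\<bar>exp (dev i x)\<bar> \<le> exp \<beta>" if "i \<le> N" for x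
    using dev_bound[OF that, of x] by auto
qed

lemma bdd_borel_gain: "i \<le> N \<Longrightarrow> bdd_borel (gain i)"
  unfolding gain_def[abs_def] by (intro bdd_borel_diff bdd_borel_exp_dev bdd_borel_const)

lemma exp_dev_step:
  assumes "i < N"
  shows "exp (dev i x) \<le> exp (rem i x) * (1 + L i (gain (Suc i)) x)"
proof -
  have b: "\<bar>T.f (Suc i) y - f (Suc i) y\<bar> \<le> \<beta>" for y
    using dev_bound[of "Suc i" y] assms by (simp add: dev_def)
  have "exp (dev i x) = exp (rem i x) * exp (gauss_step (m i) (v i) (T.f (Suc i)) x - gauss_step (m i) (v i) (f (Suc i)) x)"
    using dev_split[OF assms] by (simp add: exp_add)
  also have "\<dots> \<le> exp (rem i x) * L i (\<lambda>y. exp (dev (Suc i) y)) x"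
    unfolding dev_def[of "Suc i"] by (intro mult_left_mono exp_gauss_step_diff_le[OF adm T.lip1_chain b]) auto
  also have "L i (\<lambda>y. exp (dev (Suc i) y)) x = 1 + L i (gain (Suc i)) x"
    using tilt_diff[OF adm bdd_borel_exp_dev bdd_borel_const, of "Suc i" i 1 x] assms
    by (simp add: gain_def[abs_def] tilt_const[OF adm])
  finally show ?thesis .
qed

text \<open>Below the window the local term is zero, so Jensen alone makes the gain a submartingale
  of the unperturbed chain. These steps add no error, however many there are.\<close>

lemma gain_step_far:
  assumes "i < j"
  shows "path_avg i (gain i) \<le> path_avg (Suc i) (gain (Suc i))"
proof -
  have "i < N"
    using assms jJ by simp
  then have "gain i x \<le> L i (gain (Suc i)) x" for x
    using exp_dev_step[of i x] rem_zero[of i x] assms by (simp add: gain_def)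
  then show ?thesis
    using \<open>i < N\<close> by (auto intro!: path_avg_mono bdd_borel_gain bdd_borel_tilt adm)
qed

text \<open>The term \<open>5 * \<beta>^2\<close> bounds \<open>r^2 + (r + r^2) * l\<close>, where
  \<open>\<bar>r\<bar> \<le> v i * \<beta>\<close> is the local term and
  \<open>\<bar>l\<bar> \<le> 2 * \<beta>\<close> the transported gain.\<close>

lemma gain_step_near:
  assumes i: "j \<le> i" "i < J" and \<beta>: "\<beta> \<le> 1"
  shows "path_avg i (gain i) \<le> path_avg (Suc i) (gain (Suc i))
    + (m' i - m i) / 2 * (v i * path_avg i (\<lambda>x. slope i x * slope i x)) + v i * (\<epsilon>\<^sup>2 + Q * h + 5 * \<beta>\<^sup>2)"
proof -
  have iN: "i < N" "i \<le> N" "Suc i \<le> N"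
    using i jJ by auto
  have pt: "gain i x \<le> (L i (gain (Suc i)) x + ((m' i - m i) / 2 * v i) * (slope i x * slope i x)) + v i * (\<epsilon>\<^sup>2 + Q * h + 5 * \<beta>\<^sup>2)" for x
  proof -
    define l where "l = L i (gain (Suc i)) x"
    define r where "r = rem i x"
    define \<rho> where "\<rho> = v i * \<beta>"
    have \<rho>: "0 \<le> \<rho>" "\<rho> \<le> \<beta>"
      using v[of i] beta0 by (auto simp: \<rho>_def mult_left_le_one_le)
    have r: "\<bar>r\<bar> \<le> \<rho>"
      unfolding r_def \<rho>_def by (rule rem_bound[OF i])
    have "\<bar>gain (Suc i) y\<bar> \<le> 2 * \<beta>" for y
    proof -
      have d: "\<bar>dev (Suc i) y\<bar> \<le> \<beta>"
        by (rule dev_bound[OF iN(3)])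
      have "\<beta>\<^sup>2 \<le> \<beta>"
        using \<beta> beta0 by (simp add: power2_eq_square mult_left_le)
      moreover have "exp \<beta> \<le> 1 + \<beta> + \<beta>\<^sup>2"
        using \<beta> beta0 by (intro exp_le_quadratic) auto
      moreover have "exp (dev (Suc i) y) \<le> exp \<beta>"
        using d by auto
      moreover have "1 + dev (Suc i) y \<le> exp (dev (Suc i) y)"
        by (rule exp_ge_add_one_self)
      ultimately show ?thesis
        using d unfolding gain_def by linarith
    qed
    then have l: "\<bar>l\<bar> \<le> 2 * \<beta>"
      unfolding l_def by (intro tilt_bound[OF adm bdd_borel_gain[OF iN(3)]])
    have "0 \<le> 1 + l"
      using exp_dev_step[OF iN(1), of x] by (simp add: l_def zero_less_mult_iff less_imp_le order_less_le_trans[OF exp_gt_zero])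
        (meson exp_gt_zero less_le_trans less_imp_le zero_less_mult_pos)
    have "exp (dev i x) \<le> exp r * (1 + l)"
      using exp_dev_step[OF iN(1), of x] by (simp add: l_def r_def)
    also have "\<dots> \<le> (1 + r + r\<^sup>2) * (1 + l)"
      using \<open>0 \<le> 1 + l\<close> r \<rho> \<beta> by (intro mult_right_mono exp_le_quadratic) auto
    also have "\<dots> = 1 + l + r + (r\<^sup>2 + (r + r\<^sup>2) * l)"
      by (simp add: algebra_simps)
    finally have 1: "gain i x \<le> l + r + (r\<^sup>2 + (r + r\<^sup>2) * l)"
      by (simp add: gain_def)
    have r2: "r\<^sup>2 \<le> \<rho> * \<beta>" "r\<^sup>2 \<le> \<rho>"
    proof -
      have "r\<^sup>2 \<le> \<rho>\<^sup>2"
        using power_mono[OF r, of 2] by simp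
      moreover have "\<rho>\<^sup>2 \<le> \<rho> * \<beta>"
        using \<rho> by (simp add: power2_eq_square mult_left_mono)
      moreover have "\<rho> * \<beta> \<le> \<rho>"
        using \<rho> \<beta> beta0 by (simp add: mult_left_le)
      ultimately show "r\<^sup>2 \<le> \<rho> * \<beta>" "r\<^sup>2 \<le> \<rho>"
        by linarith+
    qed
    have "\<bar>r + r\<^sup>2\<bar> \<le> 2 * \<rho>"
      using r r2 zero_le_power2[of r] by linarith
    then have "\<bar>(r + r\<^sup>2) * l\<bar> \<le> (2 * \<rho>) * (2 * \<beta>)"
      unfolding abs_mult using \<rho> by (intro mult_mono l) auto
    then have "r\<^sup>2 + (r + r\<^sup>2) * l \<le> \<rho> * \<beta> + (2 * \<rho>) * (2 * \<beta>)"
      using r2 by linarith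
    also have "\<dots> = v i * (5 * \<beta>\<^sup>2)"
      by (simp add: \<rho>_def power2_eq_square)
    finally have 2: "r\<^sup>2 + (r + r\<^sup>2) * l \<le> v i * (5 * \<beta>\<^sup>2)" .
    have 3: "r \<le> (m' i - m i) / 2 * (v i * (slope i x)\<^sup>2) + v i * (\<epsilon>\<^sup>2 + Q * h)"
      using rem_expansion[OF i, of x] unfolding r_def by linarith
    have "gain i x \<le> l + ((m' i - m i) / 2 * (v i * (slope i x)\<^sup>2) + v i * (\<epsilon>\<^sup>2 + Q * h)) + v i * (5 * \<beta>\<^sup>2)"
      using 1 2 3 by linarith
    then show ?thesis
      by (simp add: l_def power2_eq_square distrib_left mult.assoc)
  qed
  have bb: "bdd_borel (L i (gain (Suc i)))" "bdd_borel (\<lambda>x. ((m' i - m i) / 2 * v i) * (slope i x * slope i x))"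
    by (intro bdd_borel_tilt adm bdd_borel_gain bdd_borel_mult bdd_borel_const bdd_borel_slope iN)+
  note bb = bb bdd_borel_add[OF bb]
  have "path_avg i (gain i) \<le> path_avg i (\<lambda>x. (L i (gain (Suc i)) x + ((m' i - m i) / 2 * v i) * (slope i x * slope i x)) + v i * (\<epsilon>\<^sup>2 + Q * h + 5 * \<beta>\<^sup>2))"
    by (rule path_avg_mono[OF bdd_borel_gain[OF iN(2)] bdd_borel_add[OF bb(3) bdd_borel_const] pt])
  also have "\<dots> = (path_avg i (L i (gain (Suc i))) + ((m' i - m i) / 2 * v i) * path_avg i (\<lambda>x. slope i x * slope i x)) + v i * (\<epsilon>\<^sup>2 + Q * h + 5 * \<beta>\<^sup>2)"
    unfolding path_avg_add[OF bb(3) bdd_borel_const] path_avg_add[OF bb(1,2)] path_avg_cmult path_avg_const ..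
  finally show ?thesis
    by (simp add: mult.assoc)
qed

text \<open>Summing the window steps: each error is proportional to \<open>v i\<close> and the
  \<open>v i\<close> add up to at most 1, so the total error is quadratic in
  \<open>\<epsilon>\<close> up to terms that vanish with the mesh, independently of the number of
  steps.\<close>

theorem perturbation_bound:
  assumes \<beta>: "\<beta> \<le> 1"
  shows "T.f 0 0 - f 0 0 \<le> (\<Sum>i\<in>{j..<J}. (m' i - m i) / 2 * (v i * path_avg i (\<lambda>x. slope i x * slope i x))) + (\<epsilon>\<^sup>2 + Q * h + 5 * \<beta>\<^sup>2)"
proof -
  have JN: "J \<le> N" "j \<le> J"
    using jJ by auto
  define R where "R = \<epsilon>\<^sup>2 + Q * h + 5 * \<beta>\<^sup>2"
  have "0 \<le> R"
    using Q0 h0 by (simp add: R_def)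
  have "gain J = (\<lambda>_. 0)"
  proof
    show "gain J x = 0" for x
      using dev_near[OF JN, of x] by (simp add: gain_def tau_top)
  qed
  then have top0: "path_avg J (gain J) = 0"
    by (simp add: path_avg_const)
  have near_sum: "path_avg i (gain i) \<le> (\<Sum>k\<in>{i..<J}. (m' k - m k) / 2 * (v k * path_avg k (\<lambda>x. slope k x * slope k x))) + \<tau> i * R"
    if "i \<le> J" "j \<le> i" for i
    using that
  proof (induction i rule: inc_induct)
    case base
    then show ?case
      by (simp add: top0 tau_top)
  next
    case (step i)
    have "path_avg (Suc i) (gain (Suc i)) \<le> (\<Sum>k\<in>{Suc i..<J}. (m' k - m k) / 2 * (v k * path_avg k (\<lambda>x. slope k x * slope k x))) + \<tau> (Suc i) * R"
      using step by simp
    moreover have "\<tau> i * R = v i * R + \<tau> (Suc i) * R"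
      using tau_step[OF step.hyps(2)] by (simp add: distrib_right)
    ultimately show ?case
      unfolding sum.atLeast_Suc_lessThan[OF step.hyps(2)]
      using gain_step_near[OF step.prems step.hyps(2) \<beta>, folded R_def] by linarith
  qed
  have far: "path_avg i (gain i) \<le> path_avg j (gain j)" if "i \<le> j" for i
    using that
  proof (induction i rule: inc_induct)
    case (step i)
    then show ?case
      using gain_step_far[of i] by linarith
  qed simp
  have "T.f 0 0 - f 0 0 \<le> gain 0 0"
    using exp_ge_add_one_self[of "dev 0 0"] unfolding gain_def dev_def by linarith
  also have "\<dots> = path_avg 0 (gain 0)"
    by simp
  also have "\<dots> \<le> path_avg j (gain j)"
    by (rule far) simp
  also have "\<dots> \<le> (\<Sum>k\<in>{j..<J}. (m' k - m k) / 2 * (v k * path_avg k (\<lambda>x. slope k x * slope k x))) + \<tau> j * R"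
    by (rule near_sum) (use JN in auto)
  also have "\<tau> j * R \<le> R"
    using tau_le[of j] mult_right_mono[OF near_const_bounds(1) tau_nonneg[of j]] \<open>0 \<le> R\<close> by (simp add: mult_left_le_one_le tau_nonneg)
  finally show ?thesis
    by (simp add: R_def)
qed

end

section \<open>The second-order contradiction\<close>

definition power_sum :: "(nat \<Rightarrow> real) \<Rightarrow> real \<Rightarrow> real" where
  "power_sum c u = (\<Sum>n. c n * u ^ n)"

text \<open>Radius 2 makes 1 an interior point, so the two-sided \<open>deriv\<close> is meaningful
  there. Nonnegative coefficients make the sum and all its derivatives nondecreasing on
  \<open>{0..<2}\<close>.\<close>

definition entire2 :: "(nat \<Rightarrow> real) \<Rightarrow> bool" where
  "entire2 c \<longleftrightarrow> (\<forall>n. 0 \<le> c n) \<and> (\<forall>u. \<bar>u\<bar> < 2 \<longrightarrow> summable (\<lambda>n. c n * u ^ n))"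

lemma entire2_diffs: "entire2 c \<Longrightarrow> entire2 (diffs c)"
  unfolding entire2_def using termdiff_converges[of _ 2 c] by (auto simp: diffs_def)

lemma power_sum_DERIV:
  assumes "entire2 c" "\<bar>u\<bar> < 2"
  shows "(power_sum c has_real_derivative power_sum (diffs c) u) (at u)"
proof -
  define r where "r = (\<bar>u\<bar> + 2) / 2"
  have r: "\<bar>u\<bar> < r" "r < 2"
    using assms(2) by (auto simp: r_def)
  then have "summable (\<lambda>n. c n * r ^ n)"
    using assms(1) unfolding entire2_def by auto
  then show ?thesis
    unfolding power_sum_def[abs_def] using r by (intro termdiffs_strong[where K = r]) auto
qed

lemma power_sum_mono:
  assumes c: "entire2 c" and u: "0 \<le> u" "u \<le> w" "w < 2"
  shows "0 \<le> power_sum c u" "power_sum c u \<le> power_sum c w"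
proof -
  have s: "summable (\<lambda>n. c n * u ^ n)" "summable (\<lambda>n. c n * w ^ n)"
    using c u unfolding entire2_def by auto
  have c0: "0 \<le> c n" for n
    using c by (simp add: entire2_def)
  show "0 \<le> power_sum c u"
    unfolding power_sum_def by (intro suminf_nonneg s) (use c0 u in simp)
  show "power_sum c u \<le> power_sum c w"
    unfolding power_sum_def by (intro suminf_le s mult_left_mono power_mono) (use c0 u in auto)
qed

lemma mixture_facts:
  assumes "summable (\<lambda>p. 2 ^ (p + 2) * (\<beta> (p + 2))\<^sup>2)" and \<xi>: "\<xi> = mixture \<beta>"
  obtains c where "entire2 c" "c 0 = 2 * (\<beta> 2)\<^sup>2"
    "\<And>u. \<bar>u\<bar> < 2 \<Longrightarrow> (deriv \<xi> has_real_derivative (deriv ^^ 2) \<xi> u) (at u)"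
    "\<And>u. \<bar>u\<bar> < 2 \<Longrightarrow> (deriv ^^ 2) \<xi> u = power_sum c u"
    "\<And>u. \<bar>u\<bar> < 2 \<Longrightarrow> (deriv ^^ 3) \<xi> u = power_sum (diffs c) u"
proof -
  \<comment> \<open>Zero coefficients at 0 and 1 undo the reindexing in \<open>mixture\<close>, so
    that termwise differentiation of a full power series applies.\<close>
  define a where "a n = (if n < 2 then 0 else (\<beta> n)\<^sup>2)" for n
  have a2: "a (p + 2) = (\<beta> (p + 2))\<^sup>2" for p
    by (simp add: a_def)
  have sm: "summable (\<lambda>n. a n * u ^ n)" if u: "\<bar>u\<bar> < 2" for u :: real
  proof (rule summable_comparison_test')
    have "summable (\<lambda>p. a (p + 2) * 2 ^ (p + 2))"
      using assms(1) by (simp only: a2 mult.commute)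
    then show "summable (\<lambda>n. a n * 2 ^ n)"
      by (subst (asm) summable_iff_shift)
    show "norm (a n * u ^ n) \<le> a n * 2 ^ n" if "n \<ge> 0" for n
      using u by (auto simp: a_def abs_mult power_abs intro!: mult_left_mono power_mono)
  qed
  then have ea: "entire2 a"
    by (auto simp: entire2_def a_def)
  note e1 = entire2_diffs[OF ea]
  note e2 = entire2_diffs[OF e1]
  have eq: "\<xi> u = power_sum a u" if "\<bar>u\<bar> < 2" for u
  proof -
    have "power_sum a u = (\<Sum>p. a (p + 2) * u ^ (p + 2)) + (\<Sum>n<2. a n * u ^ n)"
      unfolding power_sum_def by (rule suminf_split_initial_segment[OF sm[OF that]])
    also have "(\<Sum>n<2. a n * u ^ n) = 0"
      by (simp add: a_def)
    finally show ?thesis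
      by (simp only: \<xi> mixture_def a2 add_0_right)
  qed
  have op: "open {-2<..<2::real}"
    by simp
  have d1: "deriv \<xi> u = power_sum (diffs a) u" if "\<bar>u\<bar> < 2" for u
  proof -
    have "(\<xi> has_real_derivative power_sum (diffs a) u) (at u)"
      by (rule has_field_derivative_transform_within_open[OF power_sum_DERIV[OF ea that] op])
        (use that eq in \<open>auto simp: abs_less_iff\<close>)
    then show ?thesis
      by (rule DERIV_imp_deriv)
  qed
  have D1: "(deriv \<xi> has_real_derivative power_sum (diffs (diffs a)) u) (at u)" if "\<bar>u\<bar> < 2" for u
    by (rule has_field_derivative_transform_within_open[OF power_sum_DERIV[OF e1 that] op])
      (use that d1 in \<open>auto simp: abs_less_iff\<close>)
  have d2: "(deriv ^^ 2) \<xi> u = power_sum (diffs (diffs a)) u" if "\<bar>u\<bar> < 2" for u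
    using DERIV_imp_deriv[OF D1[OF that]] by (simp add: numeral_2_eq_2)
  have D2: "((deriv ^^ 2) \<xi> has_real_derivative power_sum (diffs (diffs (diffs a))) u) (at u)" if "\<bar>u\<bar> < 2" for u
    by (rule has_field_derivative_transform_within_open[OF power_sum_DERIV[OF e2 that] op])
      (use that d2 in \<open>auto simp: abs_less_iff\<close>)
  have d3: "(deriv ^^ 3) \<xi> u = power_sum (diffs (diffs (diffs a))) u" if "\<bar>u\<bar> < 2" for u
    using DERIV_imp_deriv[OF D2[OF that]] by (simp add: numeral_3_eq_3 numeral_2_eq_2)
  show ?thesis
  proof (rule that[OF e2])
    show "diffs (diffs a) 0 = 2 * (\<beta> 2)\<^sup>2"
      by (simp add: diffs_def a_def numeral_2_eq_2)
  qed (use D1 d2 d3 in auto)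
qed

text \<open>The second-order expansion of the optimality function \<open>g\<close> at the left of \<open>q\<close>, given the limits
  \<open>A\<close>, \<open>B\<close>, \<open>C\<close> of the averages of \<open>tanh\<^sup>2\<close>, \<open>sech\<^sup>4\<close>, \<open>sech\<^sup>6\<close>. The case distinction at the end
  separates the strict case from \<open>X\<^sub>2(q) = 9/4\<close>, \<open>X\<^sub>3(q) = 0\<close>, where the limit law would have to sit on
  \<open>sech\<^sup>2 = 2/3\<close>; hypothesis \<open>P3\<close> says that the Gaussian noise prevents this.\<close>

lemma endgame:
  fixes A B C S q :: real and X1 X2 X3 \<eta> :: "real \<Rightarrow> real"
  defines "D \<equiv> 4 * B - 6 * C" and "T \<equiv> (\<lambda>x. X1 q - X1 x)"
  assumes q: "0 < q"
    and d1: "\<And>u. 0 \<le> u \<Longrightarrow> u \<le> q \<Longrightarrow> (X1 has_real_derivative X2 u) (at u)"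
    and d2: "\<And>u. 0 \<le> u \<Longrightarrow> u \<le> q \<Longrightarrow> (X2 has_real_derivative X3 u) (at u)"
    and X3: "\<And>u. 0 \<le> u \<Longrightarrow> u \<le> q \<Longrightarrow> X3 u \<le> X3 q" "0 \<le> X3 q"
    and X2: "1 < X2 q" "\<And>u. 0 \<le> u \<Longrightarrow> u \<le> q \<Longrightarrow> 0 < X2 u" and key: "X3 q / 6 + 2 / 3 * sqrt (X2 q) \<le> 1"
    and S: "0 < S" and \<eta>: "(\<eta> \<longlongrightarrow> 0) (at_left q)"
    and P1: "\<And>r. 0 \<le> r \<Longrightarrow> 3 * r * B \<le> 2 * C + r ^ 3"
    and P2: "0 \<le> C - 4 / 3 * B + 4 / 9 * (1 - A)"
    and P3: "eventually (\<lambda>x. 0 \<le> B - 4 / 3 * (1 - A) + 4 / 9 - T x * (D + 4 / 3 * B) + 3 * S * T x * (\<eta> x + T x)) (at_left q)"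
    and P4: "\<And>e. 0 < e \<Longrightarrow> \<not> eventually (\<lambda>x. A - B * T x + D * (T x)\<^sup>2 / 2 - x + S * (e + T x) * (T x)\<^sup>2 < 0) (at_left q)"
    and P5: "\<And>e. 0 < e \<Longrightarrow> \<not> eventually (\<lambda>x. 0 < A - B * T x + D * (T x)\<^sup>2 / 2 - x - S * (e + T x) * (T x)\<^sup>2) (at_left q)"
  shows False
proof -
  define w where "w = X2 q"
  have near: "eventually (\<lambda>x. 0 < x \<and> x < q) (at_left q)"
    using eventually_at_left_real[OF q] by eventually_elim auto
  have "isCont X1 q"
    using d1[of q] q DERIV_isCont by force
  then have X1l: "(X1 \<longlongrightarrow> X1 q) (at_left q)"
    by (simp add: isCont_def filterlim_at_split)
  have T0: "(T \<longlongrightarrow> 0) (at_left q)"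
    unfolding T_def using tendsto_diff[OF tendsto_const X1l, of "X1 q"] by simp
  have idl: "((\<lambda>x. x) \<longlongrightarrow> q) (at_left q)"
    by (rule tendsto_ident_at)
  have Tw: "((\<lambda>x. T x / (q - x)) \<longlongrightarrow> w) (at_left q)"
  proof -
    have "((\<lambda>x. (X1 x - X1 q) / (x - q)) \<longlongrightarrow> X2 q) (at q)"
      using d1[of q] q by (simp add: has_field_derivative_iff)
    then have "((\<lambda>x. (X1 x - X1 q) / (x - q)) \<longlongrightarrow> X2 q) (at_left q)"
      by (simp add: filterlim_at_split)
    moreover have "(\<lambda>x. (X1 x - X1 q) / (x - q)) = (\<lambda>x. T x / (q - x))"
    proof
      show "(X1 x - X1 q) / (x - q) = T x / (q - x)" for x
        using minus_divide_divide[of "X1 q - X1 x" "q - x"] by (simp add: T_def)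
    qed
    ultimately show ?thesis
      by (simp add: w_def)
  qed
  \<comment> \<open>\<open>\<sigma>\<close> is the sign with which the error term enters, so one
    limit serves both \<open>P4\<close> and \<open>P5\<close>.\<close>
  have g0: "((\<lambda>x. A - B * T x + D * (T x)\<^sup>2 / 2 - x + \<sigma> * (S * (e + T x) * (T x)\<^sup>2)) \<longlongrightarrow> A - B * 0 + D * 0\<^sup>2 / 2 - q + \<sigma> * (S * (e + 0) * 0\<^sup>2)) (at_left q)" for \<sigma> e
    by (intro tendsto_intros T0 idl) auto
  \<comment> \<open>Order 0: as \<open>x\<close> tends to \<open>q\<close> the expansion tends to
    \<open>A - q\<close>, and neither sign is allowed.\<close>
  have "\<not> A - q < 0"
  proof
    assume "A - q < 0"
    then have "eventually (\<lambda>x. A - B * T x + D * (T x)\<^sup>2 / 2 - x + 1 * (S * (1 + T x) * (T x)\<^sup>2) < 0) (at_left q)"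
      using g0[of 1 1] by (intro order_tendstoD(2)) auto
    then show False
      using P4[of 1] by simp
  qed
  moreover have "\<not> 0 < A - q"
  proof
    assume "0 < A - q"
    then have "eventually (\<lambda>x. 0 < A - B * T x + D * (T x)\<^sup>2 / 2 - x + (-1) * (S * (1 + T x) * (T x)\<^sup>2)) (at_left q)"
      using g0[of "-1" 1] by (intro order_tendstoD(1)) auto
    then show False
      using P5[of 1] by simp
  qed
  ultimately have Aq: "A = q"
    by simp
  have g1: "((\<lambda>x. 1 - B * (T x / (q - x)) + D * T x * (T x / (q - x)) / 2 + \<sigma> * (S * (e + T x) * (T x * (T x / (q - x)))))
      \<longlongrightarrow> 1 - B * w + D * 0 * w / 2 + \<sigma> * (S * (e + 0) * (0 * w))) (at_left q)" for \<sigma> e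
    by (intro tendsto_intros T0 Tw) auto
  have g1eq: "A - B * T x + D * (T x)\<^sup>2 / 2 - x + \<sigma> * (S * (e + T x) * (T x)\<^sup>2)
     = (q - x) * (1 - B * (T x / (q - x)) + D * T x * (T x / (q - x)) / 2 + \<sigma> * (S * (e + T x) * (T x * (T x / (q - x)))))"
    if "x < q" for x \<sigma> e
  proof -
    define p where "p = T x / (q - x)"
    have "T x = p * (q - x)"
      using that by (simp add: p_def)
    then show ?thesis
      unfolding p_def[symmetric] Aq by (simp only:) (simp add: algebra_simps power2_eq_square)
  qed
  \<comment> \<open>Order 1: after division by \<open>q - x\<close> the limit is
    \<open>1 - B * w\<close>, since \<open>T x / (q - x)\<close> tends to \<open>w\<close>. Again
    neither sign is allowed.\<close>
  have "\<not> 1 - B * w < 0"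
  proof
    assume "1 - B * w < 0"
    then have "eventually (\<lambda>x. 1 - B * (T x / (q - x)) + D * T x * (T x / (q - x)) / 2 + 1 * (S * (1 + T x) * (T x * (T x / (q - x)))) < 0) (at_left q)"
      using g1[of 1 1] by (intro order_tendstoD(2)) auto
    with near have "eventually (\<lambda>x. A - B * T x + D * (T x)\<^sup>2 / 2 - x + 1 * (S * (1 + T x) * (T x)\<^sup>2) < 0) (at_left q)"
      by eventually_elim (subst g1eq, auto intro: mult_pos_neg)
    then show False
      using P4[of 1] by simp
  qed
  moreover have "\<not> 0 < 1 - B * w"
  proof
    assume "0 < 1 - B * w"
    then have "eventually (\<lambda>x. 0 < 1 - B * (T x / (q - x)) + D * T x * (T x / (q - x)) / 2 + (-1) * (S * (1 + T x) * (T x * (T x / (q - x))))) (at_left q)"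
      using g1[of "-1" 1] by (intro order_tendstoD(1)) auto
    with near have "eventually (\<lambda>x. 0 < A - B * T x + D * (T x)\<^sup>2 / 2 - x + (-1) * (S * (1 + T x) * (T x)\<^sup>2)) (at_left q)"
      by eventually_elim (subst g1eq, auto intro: mult_pos_pos)
    then show False
      using P5[of 1] by simp
  qed
  ultimately have Bw: "B * w = 1"
    by simp
  have w1: "1 < w"
    using X2 by (simp add: w_def)
  have "B = 1 / w"
    using Bw w1 by (simp add: field_simps)
  moreover from this have "0 < B"
    using w1 by simp
  ultimately have B: "B = 1 / w" "0 < B"
    by simp_all
  \<comment> \<open>\<open>X3\<close> is largest at \<open>q\<close>, so Taylor's formula at
    \<open>q\<close> bounds \<open>T\<close> from below. Because \<open>T\<close> enters with the
    coefficient \<open>- B\<close>, this gives an upper bound for the expansion, as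
    \<open>P4\<close> requires.\<close>
  have Tlow: "w * (q - x) - X3 q * (q - x)\<^sup>2 / 2 \<le> T x" if x: "0 < x" "x < q" for x
  proof -
    define diff where "diff i = (if i = 0 then X1 else if i = 1 then X2 else X3)" for i :: nat
    have dd: "\<forall>m t. m < 2 \<and> 0 \<le> t \<and> t \<le> q \<longrightarrow> (diff m has_real_derivative diff (Suc m) t) (at t)"
      using d1 d2 by (auto simp: diff_def less_2_cases_iff)
    obtain t where t: "if x < q then x < t \<and> t < q else q < t \<and> t < x"
      and eq: "X1 x = (\<Sum>m<2. diff m q / fact m * (x - q) ^ m) + diff 2 t / fact 2 * (x - q)\<^sup>2"
      using Taylor[of 2 diff X1, OF _ _ dd, of q x] x q by (auto simp: diff_def)
    have "X1 x = X1 q + w * (x - q) + X3 t / 2 * (x - q)\<^sup>2"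
      using eq by (simp add: diff_def eval_nat_numeral w_def)
    moreover have "X3 t / 2 * (x - q)\<^sup>2 \<le> X3 q / 2 * (x - q)\<^sup>2"
      using X3(1)[of t] t x by (intro mult_right_mono) auto
    ultimately show ?thesis
      by (simp add: T_def power2_commute[of x q] algebra_simps)
  qed
  \<comment> \<open>Order 2: once the lower orders cancel, the coefficient of
    \<open>(q - x)^2\<close> is at most half of this quantity. If it were negative,
    \<open>P4\<close> would fail.\<close>
  have \<kappa>: "0 \<le> B * X3 q + D * w\<^sup>2"
  proof (rule ccontr)
    assume neg: "\<not> ?thesis"
    \<comment> \<open>With this \<open>e\<close> the error uses up only half of the negative
      coefficient.\<close>
    define e where "e = - (B * X3 q + D * w\<^sup>2) / (4 * S * w\<^sup>2)"
    have "0 < e"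
      using neg S w1 by (simp add: e_def divide_simps)
    have "S * e * w\<^sup>2 = - (B * X3 q + D * w\<^sup>2) / 4"
      using S w1 by (simp add: e_def)
    then have "B * X3 q / 2 + (D / 2 + S * (e + 0)) * w\<^sup>2 < 0"
      using neg by (simp add: algebra_simps)
    moreover have "((\<lambda>x. B * X3 q / 2 + (D / 2 + S * (e + T x)) * (T x / (q - x))\<^sup>2) \<longlongrightarrow> B * X3 q / 2 + (D / 2 + S * (e + 0)) * w\<^sup>2) (at_left q)"
      by (intro tendsto_intros T0 Tw)
    ultimately have "eventually (\<lambda>x. B * X3 q / 2 + (D / 2 + S * (e + T x)) * (T x / (q - x))\<^sup>2 < 0) (at_left q)"
      by (intro order_tendstoD(2))
    with near have "eventually (\<lambda>x. A - B * T x + D * (T x)\<^sup>2 / 2 - x + S * (e + T x) * (T x)\<^sup>2 < 0) (at_left q)"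
    proof eventually_elim
      case (elim x)
      have qx: "0 < (q - x)\<^sup>2"
        using elim by simp
      have "B * (w * (q - x) - X3 q * (q - x)\<^sup>2 / 2) \<le> B * T x"
        using Tlow[of x] elim B by (intro mult_left_mono) auto
      moreover have "B * (w * (q - x)) = q - x"
        using Bw by (simp flip: mult.assoc)
      ultimately have "A - B * T x - x \<le> B * X3 q / 2 * (q - x)\<^sup>2"
        unfolding Aq by (simp add: algebra_simps)
      moreover have "(T x)\<^sup>2 = (T x / (q - x))\<^sup>2 * (q - x)\<^sup>2"
        using elim by (simp add: power_divide)
      then have "D * (T x)\<^sup>2 / 2 + S * (e + T x) * (T x)\<^sup>2 = ((D / 2 + S * (e + T x)) * (T x / (q - x))\<^sup>2) * (q - x)\<^sup>2"
        by (simp only:) (simp add: algebra_simps)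
      ultimately have "A - B * T x + D * (T x)\<^sup>2 / 2 - x + S * (e + T x) * (T x)\<^sup>2
          \<le> (B * X3 q / 2 + (D / 2 + S * (e + T x)) * (T x / (q - x))\<^sup>2) * (q - x)\<^sup>2"
        unfolding distrib_right[of "B * X3 q / 2"] by linarith
      also have "\<dots> < 0"
        using elim qx by (intro mult_neg_pos) auto
      finally show ?case .
    qed
    then show False
      using P4[OF \<open>0 < e\<close>] by simp
  qed
  define y where "y = sqrt w"
  have y: "1 < y" "w = y\<^sup>2"
    using w1 by (auto simp: y_def)
  have By: "B = 1 / y\<^sup>2"
    using B y by simp
  \<comment> \<open>\<open>r = 1 / y\<close> is the choice with \<open>B = r^2\<close>: the
    inequality would be an equality if \<open>sech2\<close> were constantly
    \<open>r\<close>.\<close>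
  have "3 * (1 / y) * B \<le> 2 * C + (1 / y) ^ 3"
    using y by (intro P1) auto
  then have Cy: "1 \<le> C * y ^ 3"
    using y by (simp add: By field_simps eval_nat_numeral)
  have k2: "0 \<le> X3 q + 4 * y ^ 4 - 6 * (C * y ^ 6)"
  proof -
    have "0 \<le> y\<^sup>2 * (B * X3 q + D * w\<^sup>2)"
      using \<kappa> by simp
    also have "\<dots> = X3 q + 4 * y ^ 4 - 6 * (C * y ^ 6)"
      using y by (simp add: By D_def field_simps eval_nat_numeral)
    finally show ?thesis .
  qed
  have "y ^ 3 * 1 \<le> y ^ 3 * (C * y ^ 3)"
    using Cy y by (intro mult_left_mono) auto
  also have "\<dots> = C * y ^ 6"
    by (simp add: eval_nat_numeral)
  finally have k3: "y ^ 3 * (6 - 4 * y) \<le> X3 q"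
    using k2 by (simp add: algebra_simps eval_nat_numeral)
  have X3y: "X3 q \<le> 6 - 4 * y"
    using key by (simp add: y_def w_def)
  \<comment> \<open>\<open>X3 q\<close> lies between \<open>y ^ 3 * (6 - 4 * y)\<close> and
    \<open>6 - 4 * y\<close> with \<open>y ^ 3 > 1\<close>, so \<open>6 - 4 * y\<close> cannot be
    positive. As \<open>X3 q\<close> is nonnegative, only \<open>y = 3 / 2\<close> and
    \<open>X3 q = 0\<close> remain.\<close>
  have "6 - 4 * y \<le> 0"
  proof (rule ccontr)
    assume pos: "\<not> ?thesis"
    have "1 < y ^ 3"
      using y by (simp add: one_less_power)
    then have "1 * (6 - 4 * y) < y ^ 3 * (6 - 4 * y)"
      using pos by (intro mult_strict_right_mono) auto
    also have "\<dots> \<le> 6 - 4 * y"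
      by (rule order_trans[OF k3 X3y])
    finally show False
      by simp
  qed
  then have yv: "y = 3 / 2" and X30: "X3 q = 0"
    using X3(2) X3y by linarith+
  have Bv: "B = 4 / 9"
    by (simp add: By yv power2_eq_square)
  have Cv: "C \<le> 8 / 27"
    using k2 by (simp add: X30 yv eval_nat_numeral)
  \<comment> \<open>\<open>P2\<close> is the average of \<open>sech2 * (sech2 - 2 / 3)^2\<close>.
    With this bound and \<open>D1\<close>, the nonnegative average of
    \<open>(sech2 - 2 / 3)^2\<close> just below \<open>q\<close>, expanded in \<open>P3\<close>,
    would be at most \<open>- 16 / 27 * T x\<close> up to smaller terms.\<close>
  have A1: "2 / 3 \<le> 1 - A"
    using P2 Cv by (simp add: Bv field_simps)
  have D1: "16 / 27 \<le> D + 4 / 3 * B"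
    using Cv by (simp add: D_def Bv field_simps)
  have "((\<lambda>x. 3 * S * (\<eta> x + T x)) \<longlongrightarrow> 3 * S * (0 + 0)) (at_left q)"
    by (intro tendsto_intros \<eta> T0)
  then have "eventually (\<lambda>x. 3 * S * (\<eta> x + T x) < 16 / 27) (at_left q)"
    by (intro order_tendstoD(2)) auto
  moreover have "eventually (\<lambda>x. 0 < T x) (at_left q)"
    using near
  proof eventually_elim
    case (elim x)
    have "X1 x < X1 q"
    proof (rule DERIV_pos_imp_increasing[where f = X1 and a = x and b = q])
      fix u assume "x \<le> u" "u \<le> q"
      then show "\<exists>y. DERIV X1 u :> y \<and> 0 < y"
        using d1[of u] X2(2)[of u] elim by (intro exI[of _ "X2 u"]) auto
    qed (use elim in auto)
    then show ?case
      by (simp add: T_def)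
  qed
  ultimately have "eventually (\<lambda>x. False) (at_left q)"
    using P3
  proof eventually_elim
    case (elim x)
    define U where "U = T x * (D + 4 / 3 * B)"
    define W where "W = 3 * S * T x * (\<eta> x + T x)"
    define P where "P = B - 4 / 3 * (1 - A) + 4 / 9"
    have "W = T x * (3 * S * (\<eta> x + T x))"
      by (simp add: W_def)
    also have "\<dots> < T x * (16 / 27)"
      using elim by (intro mult_strict_left_mono) auto
    also have "\<dots> \<le> U"
      unfolding U_def using D1 elim by (intro mult_left_mono) auto
    finally have "W < U" .
    moreover have "P \<le> 0"
      using A1 by (simp add: P_def Bv field_simps)
    moreover have "0 \<le> P - U + W"
      using elim by (simp add: P_def U_def W_def)
    ultimately show ?case
      by linarith
  qed
  then show False
    by (simp add: trivial_limit_at_left_real)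
qed

section \<open>Passage to the limit\<close>

lemma chain_cong:
  assumes "\<And>i. i < N \<Longrightarrow> m i = m' i" "\<And>i. i < N \<Longrightarrow> v i = v' i"
  shows "chain m v N j = chain m' v' N j"
  unfolding chain_def by (intro foldr_cong) (use assms in auto)

text \<open>Bookkeeping for the passage from grid data \<open>a, b, d, \<tau>\<close> to limits
  \<open>A, B, D, T\<close>. In the application \<open>t\<close> is the clock length between
  \<open>q\<close> and the first node not below it.\<close>

lemma perturbed_quadratic:
  fixes G a b d A B D \<eta> T \<tau> t \<kappa> h S :: real
  assumes G: "\<bar>G - (a - b * \<tau> + d * \<tau>\<^sup>2 / 2)\<bar> \<le> S * (\<eta> + \<tau>) * \<tau>\<^sup>2 + S * h"
    and \<tau>: "0 \<le> T" "0 \<le> t" "\<tau> = T + t" "\<tau> \<le> 1" "t \<le> \<kappa>" and \<eta>: "0 \<le> \<eta>" "\<eta> \<le> 1"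
    and B: "\<bar>B\<bar> \<le> 1" and D: "\<bar>D\<bar> \<le> 10" and S: "0 \<le> S"
  shows "\<bar>G - (A - B * T + D * T\<^sup>2 / 2)\<bar> \<le> S * (\<eta> + T) * T\<^sup>2 + (\<bar>a - A\<bar> + \<bar>b - B\<bar> + \<bar>d - D\<bar> + (11 + 7 * S) * \<kappa> + S * h)"
proof -
  have \<tau>0: "0 \<le> \<tau>" "T \<le> 1"
    using \<tau> by auto
  have sq: "\<tau>\<^sup>2 - T\<^sup>2 = t * (\<tau> + T)"
    by (simp add: \<tau>(3) power2_eq_square algebra_simps)
  have sq2: "0 \<le> \<tau>\<^sup>2 - T\<^sup>2" "\<tau>\<^sup>2 - T\<^sup>2 \<le> 2 * t"
    unfolding sq using \<tau> \<tau>0 mult_left_mono[of "\<tau> + T" 2 t] by (simp_all add: mult.commute)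
  have "\<bar>(b - B) * \<tau>\<bar> \<le> \<bar>b - B\<bar>"
    unfolding abs_mult using \<tau> \<tau>0 by (simp add: mult_left_le)
  moreover have "\<bar>\<tau>\<^sup>2 / 2\<bar> \<le> 1"
    using \<tau> \<tau>0 power_le_one[of \<tau> 2] by simp
  then have "\<bar>(d - D) * (\<tau>\<^sup>2 / 2)\<bar> \<le> \<bar>d - D\<bar>"
    unfolding abs_mult by (rule mult_left_le) simp
  moreover have "\<bar>B * t\<bar> \<le> 1 * \<kappa>"
    unfolding abs_mult using B \<tau> by (intro mult_mono) auto
  moreover have "\<bar>D * ((\<tau>\<^sup>2 - T\<^sup>2) / 2)\<bar> \<le> 10 * \<kappa>"
    unfolding abs_mult using D sq2 \<tau> by (intro mult_mono) auto
  moreover have "(a - b * \<tau> + d * \<tau>\<^sup>2 / 2) - (A - B * T + D * T\<^sup>2 / 2)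
      = (a - A) - (b - B) * \<tau> + (d - D) * (\<tau>\<^sup>2 / 2) - B * t + D * ((\<tau>\<^sup>2 - T\<^sup>2) / 2)"
    unfolding \<tau>(3) by (simp add: algebra_simps add_divide_distrib diff_divide_distrib)
  ultimately have 1: "\<bar>(a - b * \<tau> + d * \<tau>\<^sup>2 / 2) - (A - B * T + D * T\<^sup>2 / 2)\<bar> \<le> \<bar>a - A\<bar> + \<bar>b - B\<bar> + \<bar>d - D\<bar> + 11 * \<kappa>"
    by linarith
  have "(\<eta> + \<tau>) * \<tau>\<^sup>2 = (\<eta> + T) * T\<^sup>2 + (t * \<tau>\<^sup>2 + (\<eta> + T) * (\<tau>\<^sup>2 - T\<^sup>2))"
    by (simp add: \<tau>(3) algebra_simps)
  also have "\<dots> \<le> (\<eta> + T) * T\<^sup>2 + (\<kappa> * 1 + 2 * (2 * \<kappa>))"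
    using \<tau> \<tau>0 \<eta> sq2 power_le_one[of \<tau> 2] by (intro add_left_mono add_mono mult_mono) auto
  also have "\<dots> \<le> (\<eta> + T) * T\<^sup>2 + 7 * \<kappa>"
    using \<tau> by simp
  finally have "S * ((\<eta> + \<tau>) * \<tau>\<^sup>2) \<le> S * ((\<eta> + T) * T\<^sup>2 + 7 * \<kappa>)"
    using S by (rule mult_left_mono)
  then have 2: "S * (\<eta> + \<tau>) * \<tau>\<^sup>2 \<le> S * (\<eta> + T) * T\<^sup>2 + 7 * S * \<kappa>"
    by (simp add: algebra_simps)
  have 3: "(11 + 7 * S) * \<kappa> = 11 * \<kappa> + 7 * S * \<kappa>"
    by (rule distrib_right)
  show ?thesis
    unfolding 3 using G 1 2 by linarith
qed

text \<open>The situation to be refuted: \<open>q\<close> is the first point where the distribution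
  function reaches 1, and \<open>Fq\<close> expresses that it carries no atom.\<close>

locale parisi_minimizer =
  fixes \<xi> :: "real \<Rightarrow> real" and \<mu> :: "real measure" and q K C1 C2 :: real
  assumes clk: "clock (deriv \<xi>) K"
    and D: "\<And>u. 0 \<le> u \<Longrightarrow> u \<le> 1 \<Longrightarrow> (deriv \<xi> has_real_derivative (deriv ^^ 2) \<xi> u) (at u)"
    and c: "\<And>u. 0 \<le> u \<Longrightarrow> u \<le> 1 \<Longrightarrow> isCont ((deriv ^^ 2) \<xi>) u" "\<And>u. 0 \<le> u \<Longrightarrow> u \<le> 1 \<Longrightarrow> 0 < (deriv ^^ 2) \<xi> u"
      "\<And>u. 0 \<le> u \<Longrightarrow> u \<le> 1 \<Longrightarrow> (deriv ^^ 2) \<xi> u \<le> K"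
    and min: "parisi_measure \<xi> \<mu>" and K: "0 < K"
    and q: "0 < q" "q \<le> 1" and F1: "measure \<mu> {0..q} = 1"
    and Flt: "\<And>u. 0 \<le> u \<Longrightarrow> u < q \<Longrightarrow> measure \<mu> {0..u} < 1"
    and Fq: "((\<lambda>u. measure \<mu> {0..u}) \<longlongrightarrow> 1) (at_left q)"
    and C1: "sech_expansion_const C1" and C2: "step_expansion_const C2"
begin

abbreviation "X \<equiv> deriv \<xi>"
definition "F u = measure \<mu> {0..u}"
definition ms :: "nat \<Rightarrow> nat \<Rightarrow> real" where "ms N i = F (real i / N)"
text \<open>The value 0 from \<open>N\<close> on gives the bounds that \<open>gibbs_chain\<close>
  demands for every index.\<close>

definition vs :: "nat \<Rightarrow> nat \<Rightarrow> real" where "vs N i = (if i < N then X ((real i + 1) / N) - X (real i / N) else 0)"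
text \<open>The first node not below \<open>q\<close>; from it on the parameters are exactly
  1.\<close>

definition Jq :: "nat \<Rightarrow> nat" where "Jq N = nat \<lceil>real N * q\<rceil>"
definition hs :: "nat \<Rightarrow> real" where "hs N = sqrt (K / N)"
definition "T x = X q - X x"
definition S1 :: real where "S1 = 40 + 14 * step_const C1"

text \<open>\<open>Gm\<close> and \<open>Av\<close> name the averages of the chain with mesh
  \<open>1 / N\<close> outside the chain locales, where the left end of the window is a parameter;
  here that end varies.\<close>

definition Gm :: "nat \<Rightarrow> nat \<Rightarrow> real" where
  "Gm N i = gibbs_chain.path_avg (ms N) (vs N) N i (\<lambda>x. gibbs_chain.slope (ms N) (vs N) N i x * gibbs_chain.slope (ms N) (vs N) N i x)"
definition Av :: "nat \<Rightarrow> nat \<Rightarrow> nat \<Rightarrow> real" where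
  "Av k N i = gibbs_chain.path_avg (ms N) (vs N) N i (\<lambda>x. sech2 x ^ k)"

lemma mu: "\<mu> \<in> prob_measures01"
  using min by (auto simp: parisi_measure_def is_arg_min_def)

lemma F_mono: "0 \<le> a \<Longrightarrow> a \<le> b \<Longrightarrow> b \<le> 1 \<Longrightarrow> F a \<le> F b"
  unfolding F_def by (rule cdf01_mono[OF mu])

lemma F_bounds: "0 \<le> F u" "F u \<le> 1"
  unfolding F_def using cdf01_le_1[OF mu] by auto

lemma F_top: "q \<le> u \<Longrightarrow> u \<le> 1 \<Longrightarrow> F u = 1"
  using F_mono[of q u] F_bounds(2)[of u] q F1 by (simp add: F_def)

lemma X_diff: "0 \<le> a \<Longrightarrow> a \<le> b \<Longrightarrow> b \<le> 1 \<Longrightarrow> 0 \<le> X b - X a" "0 \<le> a \<Longrightarrow> a \<le> b \<Longrightarrow> b \<le> 1 \<Longrightarrow> X b - X a \<le> K * (b - a)"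
  by (rule clockD[OF clk], assumption+)+

lemma Jq_facts:
  assumes N: "0 < N"
  shows "Jq N \<le> N" "q \<le> real (Jq N) / N" "real (Jq N) / N \<le> q + 1 / N" "i < Jq N \<longleftrightarrow> real i / N < q" "real (Jq N) / N \<le> 1"
proof -
  have "0 \<le> real N * q"
    using q N by simp
  then have "0 \<le> \<lceil>real N * q\<rceil>"
    by linarith
  then have r: "real (Jq N) = of_int \<lceil>real N * q\<rceil>"
    by (simp add: Jq_def)
  have le: "real N * q \<le> real N"
    using q by (simp add: mult_left_le)
  then show JN: "Jq N \<le> N"
    by (simp add: Jq_def nat_ceiling_le_eq)
  then show "real (Jq N) / N \<le> 1"
    using N by (simp add: divide_simps)
  have b: "real N * q \<le> real (Jq N)" "real (Jq N) \<le> real N * q + 1"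
    unfolding r by linarith+
  show "q \<le> real (Jq N) / N" "real (Jq N) / N \<le> q + 1 / N"
    using b N by (simp_all add: field_simps)
  have "i < Jq N \<longleftrightarrow> real i < real N * q"
    by (simp add: Jq_def zless_nat_eq_int_zless less_ceiling_iff)
  then show "i < Jq N \<longleftrightarrow> real i / N < q"
    using N by (simp add: field_simps)
qed

lemma node_bounds:
  fixes N i :: nat
  shows "0 < N \<Longrightarrow> i < N \<Longrightarrow> 0 \<le> real i / N \<and> real i / N \<le> (real i + 1) / N \<and> (real i + 1) / N \<le> 1 \<and> (real i + 1) / N - real i / N = 1 / N"
  by (auto simp: divide_simps)

lemma vs_bounds:
  assumes "0 < N"
  shows "0 \<le> vs N i" "vs N i \<le> K / N" "sqrt (vs N i) \<le> hs N"
proof -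
  show "0 \<le> vs N i" "vs N i \<le> K / N"
    using node_bounds[OF assms, of i] X_diff[of "real i / N" "(real i + 1) / N"] K by (auto simp: vs_def)
  then show "sqrt (vs N i) \<le> hs N"
    by (simp add: hs_def)
qed

lemma vs_sum:
  assumes "i \<le> k" "k \<le> N"
  shows "(\<Sum>l\<in>{i..<k}. vs N l) = X (real k / N) - X (real i / N)"
proof -
  have "(\<Sum>l\<in>{i..<k}. vs N l) = (\<Sum>l\<in>{i..<k}. X (real (Suc l) / N) - X (real l / N))"
    using assms by (intro sum.cong) (auto simp: vs_def add.commute)
  also have "\<dots> = X (real k / N) - X (real i / N)"
    using assms(1) by (rule sum_Suc_diff')
  finally show ?thesis .
qed

text \<open>Stated for general parameters \<open>m'\<close>, so that it serves the grid values of
  \<open>F\<close> and their perturbations alike.\<close>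

lemma near_top_inst:
  assumes N: "0 < N" "K / N \<le> 1" and i: "i \<le> Jq N" "1 / 2 \<le> F (real i / N)" "near_const * (X (real (Jq N) / N) - X (real i / N)) \<le> 1"
    and m': "\<And>k. 0 \<le> m' k" "\<And>k. m' k \<le> 1" "\<And>k. Jq N \<le> k \<Longrightarrow> k < N \<Longrightarrow> m' k = 1" "\<And>k. i \<le> k \<Longrightarrow> k < Jq N \<Longrightarrow> F (real i / N) \<le> m' k"
  shows "near_top m' (vs N) N i (Jq N) (1 - F (real i / N))"
proof (intro near_top.intro gibbs_chain.intro near_top_axioms.intro)
  show "vs N k \<le> 1" for k
    using vs_bounds(2)[OF N(1), of k] N(2) by linarith
  show "near_const * (\<Sum>l = i..<Jq N. vs N l) \<le> 1"
    using vs_sum[OF i(1) Jq_facts(1)[OF N(1)]] i(3) by simp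
qed (use m' vs_bounds(1)[OF N(1)] Jq_facts(1)[OF N(1)] i F_bounds in auto)

lemma ms_inst:
  assumes N: "0 < N"
  shows "0 \<le> ms N k" "ms N k \<le> 1" "Jq N \<le> k \<Longrightarrow> k < N \<Longrightarrow> ms N k = 1"
    "i \<le> k \<Longrightarrow> k < Jq N \<Longrightarrow> F (real i / N) \<le> ms N k" "ms N N = 1"
proof -
  show "0 \<le> ms N k" "ms N k \<le> 1"
    using F_bounds by (auto simp: ms_def)
  show "ms N k = 1" if "Jq N \<le> k" "k < N"
    unfolding ms_def
  proof (rule F_top)
    show "q \<le> real k / N"
      using Jq_facts(4)[OF N, of k] that by simp
  qed (use that N in \<open>auto simp: divide_simps\<close>)
  show "F (real i / N) \<le> ms N k" if "i \<le> k" "k < Jq N"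
    unfolding ms_def by (rule F_mono) (use that Jq_facts(1)[OF N] N in \<open>auto simp: divide_simps\<close>)
  show "ms N N = 1"
    using F_top[of 1] q N by (simp add: ms_def)
qed

lemma near_inst:
  assumes N: "0 < N" "K / N \<le> 1" and i: "i \<le> Jq N" "1 / 2 \<le> F (real i / N)" "near_const * (X (real (Jq N) / N) - X (real i / N)) \<le> 1"
  shows "near_expansion (ms N) (vs N) N i (Jq N) (1 - F (real i / N)) C1 (hs N)"
proof (intro near_expansion.intro near_expansion_axioms.intro near_top_inst N i C1)
  show "hs N \<le> 1"
    using N(2) by (simp add: hs_def)
qed (use ms_inst[OF N(1)] vs_bounds[OF N(1)] in auto)

lemma S1_bounds: "0 < S1" "2 * step_const C1 \<le> S1" "2 * step_const C1 + 5 \<le> S1" "step_const C1 \<le> S1" "10 + 2 * step_const C1 \<le> S1"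
proof -
  have "0 \<le> tilt_const_bound * near_const"
    using tilt_const_bound_ge(4) near_const_bounds(1) by simp
  then have "0 \<le> step_const C1"
    using C1 tilt_const_bound_ge(4) by (simp add: step_const_def sech_expansion_const_def)
  then show "0 < S1" "2 * step_const C1 \<le> S1" "2 * step_const C1 + 5 \<le> S1" "step_const C1 \<le> S1" "10 + 2 * step_const C1 \<le> S1"
    by (auto simp: S1_def)
qed

text \<open>The second claim is the nonnegative average of \<open>(sech2 - 2 / 3)^2\<close> at node
  \<open>i\<close>, expanded from the top; in the limit it becomes hypothesis \<open>P3\<close> of
  \<open>endgame\<close>.\<close>

lemma expansion_N:
  assumes N: "0 < N" "K / N \<le> 1" and i: "i \<le> Jq N" "1 / 2 \<le> F (real i / N)" "near_const * (X (real (Jq N) / N) - X (real i / N)) \<le> 1"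
  defines "\<tau> \<equiv> X (real (Jq N) / N) - X (real i / N)" and "\<eta> \<equiv> 1 - F (real i / N)" and "J \<equiv> Jq N"
  shows "\<bar>Gm N i - (Gm N J - Av 2 N J * \<tau> + (4 * Av 2 N J - 6 * Av 3 N J) * \<tau>\<^sup>2 / 2)\<bar> \<le> S1 * (\<eta> + \<tau>) * \<tau>\<^sup>2 + S1 * hs N"
    and "0 \<le> Av 2 N J - 4 / 3 * (1 - Gm N J) + 4 / 9 - \<tau> * ((4 * Av 2 N J - 6 * Av 3 N J) + 4 / 3 * Av 2 N J) + 3 * S1 * \<tau> * ((\<eta> + hs N) + \<tau>)"
    and "0 \<le> \<tau>" "\<tau> \<le> 1"
proof -
  interpret E: near_expansion "ms N" "vs N" N i "Jq N" "1 - F (real i / N)" C1 "hs N"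
    by (rule near_inst[OF N i])
  have \<tau>: "E.\<tau> i = \<tau>"
    unfolding E.\<tau>_def \<tau>_def by (rule vs_sum[OF i(1) Jq_facts(1)[OF N(1)]])
  have g: "E.\<Gamma> k = Gm N k" for k
    by (simp add: E.\<Gamma>_def Gm_def)
  have a: "E.avg1 k = Av 1 N k" "E.avg2 k = Av 2 N k" "E.avg3 k = Av 3 N k" for k
    by (simp_all add: E.avg1_def E.avg2_def E.avg3_def Av_def)
  show t: "0 \<le> \<tau>" "\<tau> \<le> 1"
    using E.tau_nonneg[of i] E.tau_le_1[of i] \<tau> by auto
  have \<eta>: "0 \<le> \<eta>"
    using F_bounds by (simp add: \<eta>_def)
  have h: "0 \<le> hs N"
    by (rule E.h0)
  have "\<tau> * (2 * step_const C1 * \<eta> * \<tau> + S1 * \<tau>\<^sup>2 + (2 * step_const C1 + 5) * hs N)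
      = (2 * step_const C1) * (\<eta> * \<tau>\<^sup>2) + S1 * (\<tau> * \<tau>\<^sup>2) + (2 * step_const C1 + 5) * (\<tau> * hs N)"
    by (simp add: power2_eq_square algebra_simps)
  also have "\<dots> \<le> S1 * (\<eta> * \<tau>\<^sup>2) + S1 * (\<tau> * \<tau>\<^sup>2) + S1 * (1 * hs N)"
    using S1_bounds t \<eta> h by (intro add_mono mult_mono mult_right_mono) auto
  also have "\<dots> = S1 * (\<eta> + \<tau>) * \<tau>\<^sup>2 + S1 * hs N"
    by (simp add: algebra_simps)
  finally have 1: "\<tau> * (2 * step_const C1 * \<eta> * \<tau> + S1 * \<tau>\<^sup>2 + (2 * step_const C1 + 5) * hs N) \<le> S1 * (\<eta> + \<tau>) * \<tau>\<^sup>2 + S1 * hs N" .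
  show "\<bar>Gm N i - (Gm N J - Av 2 N J * \<tau> + (4 * Av 2 N J - 6 * Av 3 N J) * \<tau>\<^sup>2 / 2)\<bar> \<le> S1 * (\<eta> + \<tau>) * \<tau>\<^sup>2 + S1 * hs N"
    using E.Gamma_expansion[unfolded \<tau> g a] 1 unfolding J_def S1_def \<eta>_def by linarith
  have e2: "\<bar>Av 2 N i - (Av 2 N J - \<tau> * (4 * Av 2 N J - 6 * Av 3 N J))\<bar> \<le> \<tau> * (step_const C1 * (\<eta> + hs N) + \<tau> * S1)"
    using E.avg2_expansion[of i, unfolded \<tau> g a] i(1) unfolding J_def S1_def \<eta>_def by simp
  also have "\<dots> \<le> \<tau> * (S1 * (\<eta> + hs N) + \<tau> * S1)"
    using S1_bounds t \<eta> h by (intro mult_left_mono add_mono mult_right_mono) auto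
  finally have e2: "\<bar>Av 2 N i - (Av 2 N J - \<tau> * (4 * Av 2 N J - 6 * Av 3 N J))\<bar> \<le> \<tau> * S1 * ((\<eta> + hs N) + \<tau>)"
    by (simp add: algebra_simps)
  have e1: "\<bar>Av 1 N i - (1 - Gm N J + \<tau> * Av 2 N J)\<bar> \<le> \<tau> * (step_const C1 * (\<eta> + hs N) + \<tau> * (10 + 2 * step_const C1))"
    using E.avg1_expansion[unfolded \<tau> g a] unfolding J_def \<eta>_def by simp
  also have "\<dots> \<le> \<tau> * (S1 * (\<eta> + hs N) + \<tau> * S1)"
    using S1_bounds t \<eta> h by (intro mult_left_mono add_mono mult_right_mono) auto
  finally have e1: "\<bar>Av 1 N i - (1 - Gm N J + \<tau> * Av 2 N J)\<bar> \<le> \<tau> * S1 * ((\<eta> + hs N) + \<tau>)"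
    by (simp add: algebra_simps)
  have "0 \<le> E.path_avg i (\<lambda>x. (sech2 x ^ 2 - 4 / 3 * sech2 x ^ 1) + 4 / 9)"
  proof (rule E.path_avg_ge)
    show "bdd_borel (\<lambda>x. (sech2 x ^ 2 - 4 / 3 * sech2 x ^ 1) + 4 / 9)"
      by (intro bdd_borel_add bdd_borel_diff bdd_borel_mult bdd_borel_const E.bdd_sech2_power)
    have "0 \<le> (sech2 x - 2 / 3)\<^sup>2" for x
      by simp
    then show "0 \<le> (sech2 x ^ 2 - 4 / 3 * sech2 x ^ 1) + 4 / 9" for x
      by (simp add: power2_diff power2_eq_square algebra_simps)
  qed
  also have "\<dots> = Av 2 N i - 4 / 3 * Av 1 N i + 4 / 9"
    unfolding Av_def
    by (subst E.path_avg_add E.path_avg_diff, (intro bdd_borel_diff bdd_borel_mult bdd_borel_const E.bdd_sech2_power)+)+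
      (simp only: E.path_avg_cmult E.path_avg_const)
  finally have pos: "0 \<le> Av 2 N i - 4 / 3 * Av 1 N i + 4 / 9" .
  define R where "R = \<tau> * S1 * ((\<eta> + hs N) + \<tau>)"
  define U where "U = \<tau> * (4 * Av 2 N J - 6 * Av 3 N J)"
  define W where "W = \<tau> * Av 2 N J"
  have "0 \<le> R"
    using t \<eta> h S1_bounds by (simp add: R_def)
  have "Av 2 N i \<le> Av 2 N J - U + R" "1 - Gm N J + W - R \<le> Av 1 N i"
    using e1 e2 unfolding R_def U_def W_def by linarith+
  then have "0 \<le> Av 2 N J - 4 / 3 * (1 - Gm N J) + 4 / 9 - (U + 4 / 3 * W) + 3 * R"
    using pos \<open>0 \<le> R\<close> by argo
  moreover have "\<tau> * ((4 * Av 2 N J - 6 * Av 3 N J) + 4 / 3 * Av 2 N J) = U + 4 / 3 * W"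
    unfolding U_def W_def by (simp only: distrib_left mult.left_commute)
  ultimately show "0 \<le> Av 2 N J - 4 / 3 * (1 - Gm N J) + 4 / 9 - \<tau> * ((4 * Av 2 N J - 6 * Av 3 N J) + 4 / 3 * Av 2 N J) + 3 * S1 * \<tau> * ((\<eta> + hs N) + \<tau>)"
    by (simp add: R_def mult_ac)
qed

text \<open>The last two claims average the nonnegative polynomials
  \<open>(y - r)^2 * (2 * y + r)\<close> and \<open>y * (y - 2 / 3)^2\<close> at
  \<open>y = sech2 x\<close>; they become \<open>P1\<close> and \<open>P2\<close>.\<close>

lemma top_facts:
  assumes N: "0 < N" "K / N \<le> 1"
  defines "J \<equiv> Jq N"
  shows "0 \<le> Gm N J" "Gm N J \<le> 1" "0 \<le> Av 2 N J" "Av 2 N J \<le> 1" "0 \<le> Av 3 N J" "Av 3 N J \<le> 1"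
    and "0 \<le> r \<Longrightarrow> 3 * r * Av 2 N J \<le> 2 * Av 3 N J + r ^ 3"
    and "0 \<le> Av 3 N J - 4 / 3 * Av 2 N J + 4 / 9 * (1 - Gm N J)"
proof -
  have FJ: "F (real (Jq N) / N) = 1"
    using Jq_facts[OF N(1)] by (intro F_top) auto
  interpret E: near_expansion "ms N" "vs N" N "Jq N" "Jq N" "1 - F (real (Jq N) / N)" C1 "hs N"
    by (rule near_inst[OF N]) (use FJ in auto)
  have g: "E.\<Gamma> k = Gm N k" for k
    by (simp add: E.\<Gamma>_def Gm_def)
  have a: "E.avg1 k = Av 1 N k" "E.avg2 k = Av 2 N k" "E.avg3 k = Av 3 N k" for k
    by (simp_all add: E.avg1_def E.avg2_def E.avg3_def Av_def)
  show "0 \<le> Av 2 N J" "Av 2 N J \<le> 1" "0 \<le> Av 3 N J" "Av 3 N J \<le> 1"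
    using E.avg_bounds[of J] by (auto simp: a)
  have b: "0 \<le> Av 1 N J" "Av 1 N J \<le> 1"
    unfolding Av_def using sech2_bounds
    by (auto intro!: E.path_avg_ge E.path_avg_le E.bdd_sech2_power bdd_borel_sech2 simp: less_imp_le)
  have A1: "Av 1 N J = 1 - Gm N J"
    using E.avg1_J by (simp add: a g J_def)
  show "0 \<le> Gm N J" "Gm N J \<le> 1"
    using A1 b by auto
  show "3 * r * Av 2 N J \<le> 2 * Av 3 N J + r ^ 3" if r: "0 \<le> r"
  proof -
    have "0 \<le> E.path_avg J (\<lambda>x. (2 * sech2 x ^ 3 - 3 * r * sech2 x ^ 2) + r ^ 3)"
    proof (rule E.path_avg_ge)
      show "bdd_borel (\<lambda>x. (2 * sech2 x ^ 3 - 3 * r * sech2 x ^ 2) + r ^ 3)"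
        by (intro bdd_borel_add bdd_borel_diff bdd_borel_mult bdd_borel_const E.bdd_sech2_power)
      fix x
      have "0 \<le> (sech2 x - r)\<^sup>2 * (2 * sech2 x + r)"
        using r sech2_bounds[of x] by simp
      then show "0 \<le> (2 * sech2 x ^ 3 - 3 * r * sech2 x ^ 2) + r ^ 3"
        by (simp add: power2_eq_square power3_eq_cube algebra_simps)
    qed
    also have "\<dots> = 2 * Av 3 N J - 3 * r * Av 2 N J + r ^ 3"
      unfolding Av_def
      by (subst E.path_avg_add E.path_avg_diff, (intro bdd_borel_diff bdd_borel_mult bdd_borel_const E.bdd_sech2_power)+)+
        (simp add: E.path_avg_cmult E.path_avg_const)
    finally show ?thesis
      by simp
  qed
  have "0 \<le> E.path_avg J (\<lambda>x. (sech2 x ^ 3 - 4 / 3 * sech2 x ^ 2) + 4 / 9 * sech2 x ^ 1)"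
  proof (rule E.path_avg_ge)
    show "bdd_borel (\<lambda>x. (sech2 x ^ 3 - 4 / 3 * sech2 x ^ 2) + 4 / 9 * sech2 x ^ 1)"
      by (intro bdd_borel_add bdd_borel_diff bdd_borel_mult bdd_borel_const E.bdd_sech2_power)
    fix x
    have "0 \<le> sech2 x * (sech2 x - 2 / 3)\<^sup>2"
      using sech2_bounds[of x] by simp
    then show "0 \<le> (sech2 x ^ 3 - 4 / 3 * sech2 x ^ 2) + 4 / 9 * sech2 x ^ 1"
      by (simp add: power2_eq_square power3_eq_cube algebra_simps)
  qed
  also have "\<dots> = Av 3 N J - 4 / 3 * Av 2 N J + 4 / 9 * Av 1 N J"
    unfolding Av_def
    by (subst E.path_avg_add E.path_avg_diff, (intro bdd_borel_diff bdd_borel_mult bdd_borel_const E.bdd_sech2_power)+)+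
      (simp only: E.path_avg_cmult)
  finally show "0 \<le> Av 3 N J - 4 / 3 * Av 2 N J + 4 / 9 * (1 - Gm N J)"
    by (simp only: A1)
qed

abbreviation "Q \<equiv> pert_const C2"
text \<open>All errors of the variation, at most \<open>(44 + Q + 10 * Q^2) * h\<close>, divided by
  \<open>\<epsilon> / 2\<close> with \<open>\<epsilon> = sqrt h\<close>; here
  \<open>44 = 1 + 5 * 8 + 3\<close>.\<close>

definition "var_err N = 2 * (44 + Q + 10 * Q\<^sup>2) * sqrt (hs N)"

text \<open>First-order optimality in the direction \<open>\<delta>\<close>:
  \<open>parisi_grid_variation\<close> bounds the perturbed value from below and
  \<open>perturbation_bound\<close> from above. The conditions are imposed for every
  \<open>e\<close> in the unit interval because the actual size of the perturbation depends on
  \<open>N\<close>.\<close>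

lemma variation_N:
  assumes N: "0 < N" "K / N \<le> 1" "2 * sqrt (hs N) + Q * hs N \<le> 1"
    and j: "j \<le> Jq N" "1 / 2 \<le> F (real j / N)" "near_const * (X (real (Jq N) / N) - X (real j / N)) \<le> 1"
    and \<delta>: "\<And>i. j \<le> i \<Longrightarrow> i < Jq N \<Longrightarrow> \<bar>\<delta> i\<bar> \<le> 1"
    and mono: "\<And>e i k. 0 \<le> e \<Longrightarrow> e \<le> 1 \<Longrightarrow> j \<le> i \<Longrightarrow> i \<le> k \<Longrightarrow> k < Jq N \<Longrightarrow> ms N i + e * \<delta> i \<le> ms N k + e * \<delta> k"
    and range: "\<And>e i. 0 \<le> e \<Longrightarrow> e \<le> 1 \<Longrightarrow> j \<le> i \<Longrightarrow> i < Jq N \<Longrightarrow> ms N j \<le> ms N i + e * \<delta> i \<and> ms N i + e * \<delta> i \<le> 1"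
  shows "- var_err N \<le> (\<Sum>i\<in>{j..<Jq N}. \<delta> i * (vs N i * (Gm N i - real i / N)))"
proof -
  define J where "J = Jq N"
  have JN: "J \<le> N"
    using Jq_facts(1)[OF N(1)] by (simp add: J_def)
  define h where "h = hs N"
  have h0: "0 < h" "h \<le> 1" "h * h = K / N"
    using K N by (auto simp: h_def hs_def)
  \<comment> \<open>The gain is linear in \<open>\<epsilon>\<close>, the errors are of order
    \<open>\<epsilon>^2 + h\<close>. This choice balances them and leaves an error of order
    \<open>sqrt h\<close> after division by \<open>\<epsilon>\<close>.\<close>
  define \<epsilon> where "\<epsilon> = sqrt h"
  have \<epsilon>: "0 < \<epsilon>" "\<epsilon> \<le> 1" "\<epsilon>\<^sup>2 = h"
    using h0 by (auto simp: \<epsilon>_def)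
  define m' where "m' i = (if j \<le> i \<and> i < J then ms N i + \<epsilon> * \<delta> i else ms N i)" for i
  have m'1: "m' i \<le> 1" for i
    using range[of \<epsilon> i] \<epsilon> ms_inst(2)[OF N(1), of i] by (auto simp: m'_def J_def)
  have m'0: "0 \<le> m' i" for i
    using range[of \<epsilon> i] \<epsilon> ms_inst(1)[OF N(1)] by (auto simp: m'_def J_def intro: order_trans)
  have m'top: "m' i = 1" if "J \<le> i" "i \<le> N" for i
    using that ms_inst(3)[OF N(1), of i] ms_inst(5)[OF N(1)] by (cases "i = N") (auto simp: m'_def J_def)
  have m'near: "F (real j / N) \<le> m' i" if "j \<le> i" "i < J" for i
    using range[of \<epsilon> i] \<epsilon> that by (auto simp: m'_def J_def ms_def)
  have msmono: "ms N i \<le> ms N k" if "i \<le> k" "k \<le> N" for i k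
    unfolding ms_def by (rule F_mono) (use that N in \<open>auto simp: divide_simps\<close>)
  have m'mono: "m' i \<le> m' k" if ik: "i \<le> k" "k \<le> N" for i k
  proof (cases "J \<le> k")
    case True
    then show ?thesis
      using m'top[of k] m'1[of i] ik by simp
  next
    case kJ: False
    show ?thesis
    proof (cases "j \<le> i")
      case True
      then show ?thesis
        using mono[of \<epsilon> i k] \<epsilon> ik kJ by (auto simp: m'_def J_def)
    next
      case iF: False
      then have mi: "m' i = ms N i"
        by (simp add: m'_def)
      show ?thesis
      proof (cases "j \<le> k")
        case True
        have "ms N i \<le> ms N j"
          using iF j(1) Jq_facts(1)[OF N(1)] by (intro msmono) auto
        then show ?thesis
          using m'near[OF True] kJ mi by (simp add: ms_def)
      next
        case False
        then have "m' k = ms N k"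
          by (simp add: m'_def)
        then show ?thesis
          using msmono[OF ik] mi by simp
      qed
    qed
  qed
  have nt: "near_top (ms N) (vs N) N j J (1 - F (real j / N))"
    unfolding J_def by (rule near_top_inst[OF N(1,2) j ms_inst(1-4)[OF N(1)]])
  have nt': "near_top m' (vs N) N j J (1 - F (real j / N))"
    unfolding J_def by (rule near_top_inst[OF N(1,2) j m'0 m'1]) (use m'top m'near in \<open>auto simp: J_def\<close>)
  interpret P: perturbed_chain "ms N" m' "vs N" N j J "1 - F (real j / N)" \<epsilon> h C2
  proof (intro perturbed_chain.intro perturbed_chain_axioms.intro nt nt' C2)
    show "\<bar>m' i - ms N i\<bar> \<le> \<epsilon>" if "j \<le> i" "i < J" for i
      using \<delta>[of i] that \<epsilon> mult_left_mono[of "\<bar>\<delta> i\<bar>" 1 \<epsilon>] by (simp add: m'_def J_def abs_mult)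
    show "sqrt (vs N i) \<le> h" for i
      using vs_bounds(3)[OF N(1)] by (simp add: h_def)
  qed (use \<epsilon> h0 in \<open>auto simp: m'_def\<close>)
  define \<beta> where "\<beta> = P.\<beta>"
  have \<beta>: "\<beta> = 2 * \<epsilon> + Q * h"
    by (simp add: \<beta>_def P.\<beta>_def)
  have "P.\<beta> \<le> 1"
    using N(3) \<beta> by (simp add: \<beta>_def \<epsilon>_def h_def)
  from P.perturbation_bound[OF this]
  have up: "chain m' (vs N) N 0 0 - chain (ms N) (vs N) N 0 0 \<le> (\<Sum>i\<in>{j..<J}. (m' i - ms N i) / 2 * (vs N i * Gm N i)) + (\<epsilon>\<^sup>2 + Q * h + 5 * \<beta>\<^sup>2)"
    by (simp add: Gm_def \<beta>_def)
  have cg: "chain M (\<lambda>j. X ((real j + 1) / N) - X (real j / N)) N 0 0 = chain M (vs N) N 0 0" for M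
    by (rule fun_cong[OF chain_cong]) (simp_all add: vs_def)
  have "chain (ms N) (vs N) N 0 0 + (\<Sum>i<N. (m' i - ms N i) * (real i / N) * (X ((real i + 1) / N) - X (real i / N))) / 2 - 3 * (K / N) \<le> chain m' (vs N) N 0 0"
    using parisi_grid_variation[of \<xi> K \<mu> N m', OF clk D c(1) less_imp_le[OF c(2)] c(3) min N(1) m'0 m'mono m'top] JN cg
    by (simp add: ms_def[abs_def] F_def)
  also have "(\<Sum>i<N. (m' i - ms N i) * (real i / N) * (X ((real i + 1) / N) - X (real i / N))) = (\<Sum>i\<in>{j..<J}. (m' i - ms N i) * (real i / N) * vs N i)"
    using JN by (intro sum.mono_neutral_cong_right) (auto simp: m'_def vs_def)
  finally have low: "chain (ms N) (vs N) N 0 0 + (\<Sum>i\<in>{j..<J}. (m' i - ms N i) * (real i / N) * vs N i) / 2 - 3 * (K / N) \<le> chain m' (vs N) N 0 0" .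
  define Z where "Z = (\<Sum>i\<in>{j..<J}. \<delta> i * (vs N i * (Gm N i - real i / N)))"
  have "(\<Sum>i\<in>{j..<J}. (m' i - ms N i) / 2 * (vs N i * Gm N i)) - (\<Sum>i\<in>{j..<J}. (m' i - ms N i) * (real i / N) * vs N i) / 2
      = (\<Sum>i\<in>{j..<J}. \<epsilon> / 2 * (\<delta> i * (vs N i * (Gm N i - real i / N))))"
    unfolding sum_divide_distrib sum_subtractf[symmetric]
    by (intro sum.cong) (auto simp: m'_def diff_divide_distrib right_diff_distrib mult_ac)
  also have "\<dots> = \<epsilon> / 2 * Z"
    by (simp add: Z_def sum_distrib_left)
  finally have "0 \<le> \<epsilon> / 2 * Z + (\<epsilon>\<^sup>2 + Q * h + 5 * \<beta>\<^sup>2) + 3 * (h * h)"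
    using up low h0(3) by linarith
  moreover have "\<beta>\<^sup>2 \<le> 8 * h + 2 * Q\<^sup>2 * h"
  proof -
    have "0 \<le> (2 * \<epsilon> - Q * h)\<^sup>2"
      by simp
    then have "\<beta>\<^sup>2 \<le> 8 * \<epsilon>\<^sup>2 + 2 * Q\<^sup>2 * (h * h)"
      unfolding \<beta> by (simp add: power2_eq_square algebra_simps)
    also have "2 * Q\<^sup>2 * (h * h) \<le> 2 * Q\<^sup>2 * (h * 1)"
      using h0 by (intro mult_left_mono) auto
    finally show ?thesis
      by (simp add: \<epsilon>)
  qed
  moreover have "h * h \<le> h"
    using mult_left_mono[of h 1 h] h0(1,2) by simp
  ultimately have "0 \<le> \<epsilon> / 2 * Z + (h + Q * h + 5 * (8 * h + 2 * Q\<^sup>2 * h)) + 3 * h"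
  proof -
    have lin: "0 \<le> z + (p + w + 5 * b) + 3 * k \<Longrightarrow> b \<le> d \<Longrightarrow> k \<le> p \<Longrightarrow> 0 \<le> z + (p + w + 5 * d) + 3 * p" for z p w b k d :: real
      by linarith
    assume "0 \<le> \<epsilon> / 2 * Z + (\<epsilon>\<^sup>2 + Q * h + 5 * \<beta>\<^sup>2) + 3 * (h * h)" "\<beta>\<^sup>2 \<le> 8 * h + 2 * Q\<^sup>2 * h" "h * h \<le> h"
    then show "0 \<le> \<epsilon> / 2 * Z + (h + Q * h + 5 * (8 * h + 2 * Q\<^sup>2 * h)) + 3 * h"
      unfolding \<epsilon>(3) by (rule lin)
  qed
  also have "\<dots> = \<epsilon> / 2 * (Z + 2 * (44 + Q + 10 * Q\<^sup>2) * \<epsilon>)"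
    by (simp add: algebra_simps flip: \<epsilon>(3)) (simp add: power2_eq_square)
  finally have "0 \<le> Z + 2 * (44 + Q + 10 * Q\<^sup>2) * \<epsilon>"
    using \<epsilon>(1) by (simp add: zero_le_mult_iff)
  then show ?thesis
    by (simp add: Z_def J_def var_err_def \<epsilon>_def h_def)
qed

lemma lims: "(\<lambda>N. K / real N) \<longlonglongrightarrow> 0" "hs \<longlonglongrightarrow> 0" "var_err \<longlonglongrightarrow> 0"
proof -
  show k: "(\<lambda>N. K / real N) \<longlonglongrightarrow> 0"
    by (rule lim_const_over_n)
  from tendsto_real_sqrt[OF this] show h: "hs \<longlonglongrightarrow> 0"
    by (simp add: hs_def[abs_def])
  from tendsto_mult[OF tendsto_const tendsto_real_sqrt[OF this], of "2 * (44 + Q + 10 * Q\<^sup>2)"]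
  show "var_err \<longlonglongrightarrow> 0"
    by (simp add: var_err_def[abs_def])
qed

lemma X_isCont: "0 \<le> u \<Longrightarrow> u \<le> 1 \<Longrightarrow> isCont X u"
  using D DERIV_isCont by blast

lemma T_bounds: "0 \<le> x \<Longrightarrow> x \<le> q \<Longrightarrow> 0 \<le> T x"
  using X_diff(1)[of x q] q by (simp add: T_def)

text \<open>The error delivered by \<open>perturbed_quadratic\<close> with
  \<open>\<kappa> = K / N\<close>. It is uniform over the window and tends to 0 along the
  subsequence chosen later.\<close>

definition gap :: "real \<Rightarrow> real \<Rightarrow> real \<Rightarrow> nat \<Rightarrow> real" where
  "gap A B D' N = \<bar>Gm N (Jq N) - A\<bar> + \<bar>Av 2 N (Jq N) - B\<bar> + \<bar>(4 * Av 2 N (Jq N) - 6 * Av 3 N (Jq N)) - D'\<bar>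
    + (11 + 7 * S1) * (K / N) + S1 * hs N"

lemma top_gap:
  assumes "0 < N"
  shows "0 \<le> X (real (Jq N) / N) - X q" "X (real (Jq N) / N) - X q \<le> K / N"
proof -
  show "0 \<le> X (real (Jq N) / N) - X q"
    using Jq_facts[OF assms] q by (intro X_diff) auto
  have "X (real (Jq N) / N) - X q \<le> K * (real (Jq N) / N - q)"
    using Jq_facts[OF assms] q by (intro X_diff) auto
  also have "\<dots> \<le> K * (1 / N)"
    using Jq_facts(3)[OF assms] K by (intro mult_left_mono) auto
  finally show "X (real (Jq N) / N) - X q \<le> K / N"
    by simp
qed

lemma approx_N:
  assumes N: "0 < N" "K / N \<le> 1" and i: "i < Jq N" "1 / 2 \<le> F (real i / N)" "near_const * (X (real (Jq N) / N) - X (real i / N)) \<le> 1"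
    and B: "\<bar>B\<bar> \<le> 1" and D': "\<bar>D'\<bar> \<le> 10"
  defines "x \<equiv> real i / N"
  shows "\<bar>Gm N i - (A - B * T x + D' * (T x)\<^sup>2 / 2)\<bar> \<le> S1 * ((1 - F x) + T x) * (T x)\<^sup>2 + gap A B D' N"
proof -
  note i' = less_imp_le[OF i(1)] i(2,3)
  have x: "0 \<le> x" "x < q"
    using Jq_facts(4)[OF N(1)] i(1) by (auto simp: x_def)
  show ?thesis
    unfolding gap_def x_def
  proof (rule perturbed_quadratic[OF expansion_N(1)[OF N i'], where t = "X (real (Jq N) / N) - X q"])
    show "X (real (Jq N) / N) - X (real i / N) \<le> 1"
      by (rule expansion_N(4)[OF N i'])
    show "0 \<le> T (real i / N)"
      using T_bounds x by (simp add: x_def)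
  qed (use top_gap[OF N(1)] F_bounds B D' S1_bounds(1) in \<open>auto simp: T_def\<close>)
qed

lemma ceiling_node:
  fixes N :: nat and x :: real
  assumes "0 < N" "0 \<le> x"
  shows "x \<le> real (nat \<lceil>N * x\<rceil>) / N" "real (nat \<lceil>N * x\<rceil>) / N \<le> x + 1 / N"
proof -
  have "0 \<le> real N * x"
    using assms by simp
  then have "real N * x \<le> real (nat \<lceil>N * x\<rceil>)" "real (nat \<lceil>N * x\<rceil>) \<le> real N * x + 1"
    by linarith+
  then show "x \<le> real (nat \<lceil>N * x\<rceil>) / N" "real (nat \<lceil>N * x\<rceil>) / N \<le> x + 1 / N"
    using assms by (simp_all add: field_simps)
qed

lemma T_tendsto: "(T \<longlongrightarrow> 0) (at_left q)"
proof -
  have "isCont X q"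
    using X_isCont q by simp
  then have "(X \<longlongrightarrow> X q) (at_left q)"
    by (simp add: isCont_def filterlim_at_split)
  from tendsto_diff[OF tendsto_const this, of "X q"] show ?thesis
    by (simp add: T_def[abs_def])
qed

lemma F_tendsto: "(F \<longlongrightarrow> 1) (at_left q)"
  using Fq by (simp add: F_def[abs_def])

end

locale parisi_limit = parisi_minimizer +
  fixes r :: "nat \<Rightarrow> nat" and A B C3 :: real
  assumes r: "strict_mono r"
    and lA: "(\<lambda>n. Gm (r n) (Jq (r n))) \<longlonglongrightarrow> A"
    and lB: "(\<lambda>n. Av 2 (r n) (Jq (r n))) \<longlonglongrightarrow> B"
    and lC: "(\<lambda>n. Av 3 (r n) (Jq (r n))) \<longlonglongrightarrow> C3"
    and unit: "B \<in> {0..1}" "C3 \<in> {0..1}"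
begin

definition "D' = 4 * B - 6 * C3"

lemma BD': "\<bar>B\<bar> \<le> 1" "\<bar>D'\<bar> \<le> 10"
  using unit by (auto simp: D'_def)

lemma r_limit: "f \<longlonglongrightarrow> l \<Longrightarrow> (\<lambda>n. f (r n)) \<longlonglongrightarrow> l"
  using LIMSEQ_subseq_LIMSEQ[OF _ r] by (simp add: o_def)

lemma r_eventually: "eventually P sequentially \<Longrightarrow> eventually (\<lambda>n. P (r n)) sequentially"
  using eventually_subseq[OF r] .

lemma gap_tendsto: "(\<lambda>n. gap A B D' (r n)) \<longlonglongrightarrow> 0"
proof -
  have "(\<lambda>n. \<bar>Gm (r n) (Jq (r n)) - A\<bar> + \<bar>Av 2 (r n) (Jq (r n)) - B\<bar>
      + \<bar>(4 * Av 2 (r n) (Jq (r n)) - 6 * Av 3 (r n) (Jq (r n))) - D'\<bar> + (11 + 7 * S1) * (K / r n) + S1 * hs (r n))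
    \<longlonglongrightarrow> \<bar>A - A\<bar> + \<bar>B - B\<bar> + \<bar>(4 * B - 6 * C3) - D'\<bar> + (11 + 7 * S1) * 0 + S1 * 0"
    by (intro tendsto_intros lA lB lC r_limit[OF lims(1)] r_limit[OF lims(2)])
  then show ?thesis
    by (simp add: gap_def[abs_def] D'_def)
qed

lemma gap_nonneg: "0 < N \<Longrightarrow> 0 \<le> gap A B D' N"
  using S1_bounds(1) K by (simp add: gap_def hs_def)

text \<open>The third condition is \<open>\<beta> \<le> 1\<close> for the perturbation used in
  \<open>variation_N\<close>. The fourth reserves half of the admissible clock length for the excess
  between \<open>q\<close> and the node \<open>Jq N\<close>.\<close>

definition good :: "nat \<Rightarrow> bool" where
  "good N \<longleftrightarrow> 0 < N \<and> K / N \<le> 1 \<and> 2 * sqrt (hs N) + Q * hs N \<le> 1 \<and> near_const * (K / N) \<le> 1 / 2"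

lemma eventually_good: "eventually good sequentially"
proof -
  have "(\<lambda>N. 2 * sqrt (hs N) + Q * hs N) \<longlonglongrightarrow> 2 * sqrt 0 + Q * 0"
    by (intro tendsto_intros lims)
  then have 1: "eventually (\<lambda>N. 2 * sqrt (hs N) + Q * hs N < 1) sequentially"
    by (rule order_tendstoD(2)) simp
  have "(\<lambda>N. near_const * (K / real N)) \<longlonglongrightarrow> near_const * 0"
    by (intro tendsto_intros lims)
  then have 2: "eventually (\<lambda>N. near_const * (K / real N) < 1 / 2) sequentially"
    by (rule order_tendstoD(2)) simp
  have 3: "eventually (\<lambda>N. K / real N < 1) sequentially"
    by (rule order_tendstoD(2)[OF lims(1)]) simp
  show ?thesis
    using 1 2 3 eventually_gt_at_top[of 0] by eventually_elim (simp add: good_def)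
qed

lemma eventually_inverse_le: "0 < (e::real) \<Longrightarrow> eventually (\<lambda>N. t / real N \<le> e) sequentially"
  using order_tendstoD(2)[OF lim_const_over_n[of t], of e] by (auto elim: eventually_mono)

lemma good_near:
  assumes N: "good N" and i: "real i / N < q" "1 / 2 \<le> F (real i / N)" "near_const * T (real i / N) \<le> 1 / 2"
  shows "0 < N" "K / N \<le> 1" "i < Jq N" "near_const * (X (real (Jq N) / N) - X (real i / N)) \<le> 1"
proof -
  show N0: "0 < N" "K / N \<le> 1"
    using N by (auto simp: good_def)
  show "i < Jq N"
    using Jq_facts(4)[OF N0(1)] i(1) by simp
  have "X (real (Jq N) / N) - X (real i / N) \<le> T (real i / N) + K / N"
    using top_gap(2)[OF N0(1)] by (simp add: T_def)
  then have "near_const * (X (real (Jq N) / N) - X (real i / N)) \<le> near_const * (T (real i / N) + K / N)"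
    using near_const_bounds(1) by (intro mult_left_mono) auto
  also have "\<dots> = near_const * T (real i / N) + near_const * (K / N)"
    by (rule distrib_left)
  also have "\<dots> \<le> 1 / 2 + 1 / 2"
    using N i(3) by (intro add_mono) (auto simp: good_def)
  finally show "near_const * (X (real (Jq N) / N) - X (real i / N)) \<le> 1"
    by simp
qed

lemma eventually_near:
  assumes "0 < e"
  shows "eventually (\<lambda>x. 0 < x \<and> x < q \<and> 1 / 2 \<le> F x \<and> 1 - F x \<le> e \<and> near_const * T x \<le> 1 / 2) (at_left q)"
proof -
  have "((\<lambda>x. near_const * T x) \<longlongrightarrow> near_const * 0) (at_left q)"
    by (intro tendsto_intros T_tendsto)
  then have "eventually (\<lambda>x. near_const * T x < 1 / 2) (at_left q)"
    by (rule order_tendstoD(2)) simp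
  moreover have "eventually (\<lambda>x. max (1 / 2) (1 - e) < F x) (at_left q)"
    by (rule order_tendstoD(1)[OF F_tendsto]) (use assms in auto)
  ultimately show ?thesis
    using eventually_at_left_real[OF q(1)] by eventually_elim auto
qed

text \<open>If \<open>\<Gamma>(u) - u\<close> kept one sign just below \<open>q\<close>, moving the
  parameters in the profitable direction would lower the functional: towards 1 for
  \<open>s = 1\<close>, down to the value at the left end of the window for \<open>s = - 1\<close>.
  Both moves are nontrivial because \<open>F\<close> stays below 1 before \<open>q\<close> and yet
  tends to 1.\<close>

lemma sign_contradiction:
  fixes s e :: real
  assumes s: "s = 1 \<or> s = - 1" and e: "0 < e"
    and ev: "eventually (\<lambda>x. s * (A - B * T x + D' * (T x)\<^sup>2 / 2 - x) + S1 * (e + T x) * (T x)\<^sup>2 < 0) (at_left q)"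
  shows False
proof -
  define H where "H x = s * (A - B * T x + D' * (T x)\<^sup>2 / 2 - x) + S1 * (e + T x) * (T x)\<^sup>2" for x
  have "eventually (\<lambda>x. H x < 0 \<and> 0 < x \<and> x < q \<and> 1 / 2 \<le> F x \<and> 1 - F x \<le> e \<and> near_const * T x \<le> 1 / 2) (at_left q)"
    using ev eventually_near[OF e] unfolding H_def by eventually_elim auto
  then obtain b where b: "b < q" and P: "\<And>x. b < x \<Longrightarrow> x < q \<Longrightarrow> H x < 0 \<and> 0 < x \<and> 1 / 2 \<le> F x \<and> 1 - F x \<le> e \<and> near_const * T x \<le> 1 / 2"
    using eventually_at_left[OF q(1)] by (metis (mono_tags, lifting))
  \<comment> \<open>Four points \<open>a < a' < a1 < b1\<close> below \<open>q\<close>: the window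
    will start at a node in \<open>{a..a'}\<close>, and on \<open>{a1..b1}\<close> the perturbation
    will have size at least \<open>d\<close>.\<close>
  define a where "a = (max b 0 + q) / 2"
  have a: "b < a" "0 < a" "a < q"
    using b q by (auto simp: a_def max_def)
  define a' where "a' = (a + q) / 2"
  have a': "a < a'" "a' < q"
    using a by (auto simp: a'_def)
  have "F a' < 1"
    unfolding F_def using Flt a a' by auto
  then have "eventually (\<lambda>x. F a' < F x) (at_left q)"
    by (rule order_tendstoD(1)[OF F_tendsto])
  then have "eventually (\<lambda>x. F a' < F x \<and> a' < x \<and> x < q) (at_left q)"
    using eventually_at_left_real[OF a'(2)] by eventually_elim auto
  then obtain a1 where a1: "F a' < F a1" "a' < a1" "a1 < q"
    using eventually_happens[OF \<open>eventually (\<lambda>x. F a' < F x \<and> a' < x \<and> x < q) (at_left q)\<close>] trivial_limit_at_left_real by blast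
  define b1 where "b1 = (a1 + q) / 2"
  have b1: "a1 < b1" "b1 < q"
    using a1 by (auto simp: b1_def)
  have "F b1 < 1"
    unfolding F_def using Flt a a' a1 b1 by auto
  \<comment> \<open>\<open>1 - F b1\<close> is the room for increasing the parameters on
    \<open>{a1..b1}\<close>, \<open>F a1 - F a'\<close> the room for decreasing them.\<close>
  define d where "d = min (1 - F b1) (F a1 - F a')"
  have d: "0 < d" "d \<le> 1 - F b1" "d \<le> F a1 - F a'"
    using a1 \<open>F b1 < 1\<close> by (auto simp: d_def)
  have "continuous_on {a1..b1} H"
    unfolding H_def T_def
    by (intro continuous_intros continuous_at_imp_continuous_on ballI X_isCont) (use a a' a1 b1 q in auto)
  then obtain x0 where x0: "x0 \<in> {a1..b1}" "\<And>x. x \<in> {a1..b1} \<Longrightarrow> H x \<le> H x0"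
    using continuous_attains_sup[of "{a1..b1}" H] b1 by fastforce
  define c0 where "c0 = - H x0"
  have c0: "0 < c0"
    using P[of x0] x0 a a' a1 b1 by (auto simp: c0_def)
  have "X a1 < X b1"
  proof (rule DERIV_pos_imp_increasing[OF b1(1)])
    fix x assume x: "a1 \<le> x" "x \<le> b1"
    then have x01: "0 \<le> x" "x \<le> 1"
      using a a' a1 b1 q by auto
    then show "\<exists>y. (X has_real_derivative y) (at x) \<and> 0 < y"
      using D c(2) by blast
  qed
  have claim: "- var_err N \<le> - (c0 * d * (X b1 - X a1 - 2 * (K / N))) + gap A B D' N"
    if N: "good N" and N1: "1 / real N \<le> (q - a) / 2" and N2: "2 / real N \<le> b1 - a1" for N
  proof -
    define J where "J = Jq N"
    define G where "G = gap A B D' N"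
    have N0: "0 < N" "K / N \<le> 1" and N0': "2 * sqrt (hs N) + Q * hs N \<le> 1"
      using N by (auto simp: good_def)
    have G: "0 \<le> G"
      using gap_nonneg[OF N0(1)] by (simp add: G_def)
    define j where "j = nat \<lceil>N * a\<rceil>"
    have j: "a \<le> real j / N" "real j / N \<le> a'"
      using ceiling_node[OF N0(1), of a] a N1 by (auto simp: j_def a'_def field_simps)
    have jP: "1 / 2 \<le> F (real j / N)" "near_const * T (real j / N) \<le> 1 / 2" "real j / N < q"
      using P[of "real j / N"] j a a' by auto
    note jn = good_near[OF N jP(3,1,2)]
    have node: "a \<le> real i / N \<and> real i / N < q" if "j \<le> i" "i < J" for i
      using that j(1) Jq_facts(4)[OF N0(1), of i] divide_right_mono[of "real j" "real i" "real N"] by (auto simp: J_def)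
    define \<delta>' where "\<delta>' i = (if s = 1 then 1 - ms N i else ms N i - ms N j)" for i
    have msmono: "ms N i \<le> ms N k" if "i \<le> k" "k < J" for i k
      unfolding ms_def by (rule F_mono) (use that Jq_facts(1)[OF N0(1)] N0(1) in \<open>auto simp: J_def divide_simps\<close>)
    have \<delta>': "0 \<le> \<delta>' i" "\<delta>' i \<le> 1" if "j \<le> i" "i < J" for i
      using msmono[of j i] that ms_inst(1,2)[OF N0(1)] by (auto simp: \<delta>'_def intro: add_increasing2 diff_left_mono)
        (smt (verit) ms_inst(1,2)[OF N0(1)])+
    have \<delta>'d: "d \<le> \<delta>' i" if i: "j \<le> i" "i < J" "a1 \<le> real i / N" "real i / N \<le> b1" for i
    proof -
      have "F (real i / N) \<le> F b1" "F a1 \<le> F (real i / N)" "F (real j / N) \<le> F a'"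
        using i j a a' a1 b1 q by (auto intro!: F_mono)
      then show ?thesis
        using d by (auto simp: \<delta>'_def ms_def)
    qed
    define \<delta> where "\<delta> i = s * \<delta>' i" for i
    \<comment> \<open>A convex combination with a constant sequence, from which monotonicity and
      range can be read off.\<close>
    have form: "ms N i + t * \<delta> i = (1 - t) * ms N i + t * (if s = 1 then 1 else ms N j)" for t i
      using s by (auto simp: \<delta>_def \<delta>'_def algebra_simps)
    have "- var_err N \<le> (\<Sum>i\<in>{j..<Jq N}. \<delta> i * (vs N i * (Gm N i - real i / N)))"
    proof (rule variation_N[OF N0 N0'])
      show "j \<le> Jq N"
        using jn(3) by simp
      show "\<bar>\<delta> i\<bar> \<le> 1" if "j \<le> i" "i < Jq N" for i
        using \<delta>'[of i] that s by (auto simp: \<delta>_def J_def)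
      show "ms N i + t * \<delta> i \<le> ms N k + t * \<delta> k" if "0 \<le> t" "t \<le> 1" "j \<le> i" "i \<le> k" "k < Jq N" for t i k
        unfolding form using that msmono[of i k] by (intro add_right_mono mult_left_mono) (auto simp: J_def)
      show "ms N j \<le> ms N i + t * \<delta> i \<and> ms N i + t * \<delta> i \<le> 1" if t: "0 \<le> t" "t \<le> 1" and i: "j \<le> i" "i < Jq N" for t i
      proof
        have mj: "ms N j \<le> ms N i" "ms N j \<le> 1" "ms N i \<le> 1"
          using msmono[of j i] i ms_inst(2)[OF N0(1)] by (auto simp: J_def)
        have "(1 - t) * ms N j + t * ms N j \<le> (1 - t) * ms N i + t * (if s = 1 then 1 else ms N j)"
          using t mj by (intro add_mono mult_left_mono) auto
        then show "ms N j \<le> ms N i + t * \<delta> i"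
          unfolding form by (simp add: left_diff_distrib)
        have "(1 - t) * ms N i + t * (if s = 1 then 1 else ms N j) \<le> (1 - t) * 1 + t * 1"
          using t mj by (intro add_mono mult_left_mono) auto
        then show "ms N i + t * \<delta> i \<le> 1"
          unfolding form by simp
      qed
    qed (use jP(1) jn(4) in auto)
    also have "\<dots> \<le> (\<Sum>i\<in>{j..<J}. vs N i * G - c0 * d * (if a1 \<le> real i / N \<and> real i / N \<le> b1 then vs N i else 0))"
      unfolding J_def
    proof (rule sum_mono)
      fix i assume "i \<in> {j..<Jq N}"
      then have i: "j \<le> i" "i < J"
        by (auto simp: J_def)
      define x where "x = real i / N"
      have x: "a \<le> x" "x < q"
        using node[OF i] by (auto simp: x_def)
      have Px: "H x < 0" "1 / 2 \<le> F x" "1 - F x \<le> e" "near_const * T x \<le> 1 / 2" "0 < x"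
        using P[of x] x a by auto
      note near = good_near[OF N, of i, folded x_def, OF x(2) Px(2,4)]
      have "\<bar>Gm N i - (A - B * T x + D' * (T x)\<^sup>2 / 2)\<bar> \<le> S1 * ((1 - F x) + T x) * (T x)\<^sup>2 + G"
        using approx_N[OF N0 near(3) _ _ BD', of A] near(4) Px(2) by (simp add: x_def G_def)
      also have "S1 * ((1 - F x) + T x) * (T x)\<^sup>2 \<le> S1 * (e + T x) * (T x)\<^sup>2"
        using Px S1_bounds(1) by (intro mult_right_mono mult_left_mono) auto
      finally have sg: "s * (Gm N i - x) \<le> H x + G"
        using s unfolding H_def by (auto simp: abs_le_iff)
      have v: "0 \<le> vs N i"
        by (rule vs_bounds(1)[OF N0(1)])
      have "\<delta> i * (vs N i * (Gm N i - real i / N)) = \<delta>' i * vs N i * (s * (Gm N i - x))"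
        by (simp add: \<delta>_def x_def mult_ac)
      also have "\<dots> \<le> \<delta>' i * vs N i * (H x + G)"
        using sg v \<delta>'[OF i] by (intro mult_left_mono) auto
      also have "\<dots> = \<delta>' i * vs N i * G + \<delta>' i * vs N i * H x"
        by (simp add: algebra_simps)
      also have "\<dots> \<le> vs N i * G - c0 * d * (if a1 \<le> x \<and> x \<le> b1 then vs N i else 0)"
      proof -
        have 1: "\<delta>' i * vs N i * G \<le> 1 * vs N i * G"
          using v \<delta>'[OF i] G by (intro mult_right_mono) auto
        have 2: "\<delta>' i * vs N i * H x \<le> - (c0 * d * (if a1 \<le> x \<and> x \<le> b1 then vs N i else 0))"
        proof (cases "a1 \<le> x \<and> x \<le> b1")
          case True
          have "d * vs N i * c0 \<le> \<delta>' i * vs N i * (- H x)"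
            using True v \<delta>'[OF i] \<delta>'d[OF i] x0(2)[of x] d c0 by (intro mult_mono) (auto simp: x_def c0_def)
          then show ?thesis
            using True by (simp add: mult_ac)
        next
          case False
          have "\<delta>' i * vs N i * H x \<le> 0"
            using v \<delta>'[OF i] Px(1) by (simp add: mult_nonneg_nonpos)
          then show ?thesis
            unfolding if_not_P[OF False] by simp
        qed
        show ?thesis
          using 1 2 by simp
      qed
      finally show "\<delta> i * (vs N i * (Gm N i - real i / N)) \<le> vs N i * G - c0 * d * (if a1 \<le> real i / N \<and> real i / N \<le> b1 then vs N i else 0)"
        by (simp add: x_def)
    qed
    also have "\<dots> = (\<Sum>i\<in>{j..<J}. vs N i) * G - c0 * d * (\<Sum>i\<in>{j..<J}. if a1 \<le> real i / N \<and> real i / N \<le> b1 then vs N i else 0)"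
      by (simp add: sum_subtractf sum_distrib_left sum_distrib_right)
    also have "\<dots> \<le> 1 * G - c0 * d * (X b1 - X a1 - 2 * (K / N))"
    proof -
      have "(\<Sum>i\<in>{j..<J}. vs N i) \<le> 1"
        using vs_sum[of j J N] Jq_facts(1)[OF N0(1)] jn(3) expansion_N(4)[OF N0, of j] jP(1) jn(4) by (simp add: J_def)
      then have 1: "(\<Sum>i\<in>{j..<J}. vs N i) * G \<le> 1 * G"
        using G by (rule mult_right_mono)
      \<comment> \<open>The first and the last node in \<open>{a1..b1}\<close>; at each end at most
        \<open>K / N\<close> of the clock increment is lost.\<close>
      define p k where "p = nat \<lceil>N * a1\<rceil>" and "k = nat \<lfloor>N * b1\<rfloor>"
      have p: "a1 \<le> real p / N" "real p / N \<le> a1 + 1 / N"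
        using ceiling_node[OF N0(1), of a1] a a' a1 by (auto simp: p_def)
      have "0 \<le> real N * b1"
        using a a' a1 b1 by simp
      then have "real k \<le> real N * b1" "real N * b1 - 1 \<le> real k"
        unfolding k_def by linarith+
      then have "real k / N \<le> b1" "b1 \<le> (real k + 1) / N"
        using N0(1) by (simp_all add: pos_divide_le_eq pos_le_divide_eq mult.commute)
      then have k: "real k / N \<le> b1" "b1 - 1 / N \<le> real k / N"
        by (simp_all add: add_divide_distrib)
      have "real p / N \<le> real k / N"
        using p(2) k(2) N2 by (simp add: field_simps)
      then have pk: "p \<le> k"
        using N0(1) by (simp add: divide_le_cancel)
      have jp: "j \<le> p"
        using p(1) j(2) a1(2) N0(1) by (smt (verit) divide_right_mono of_nat_le_iff of_nat_0_le_iff of_nat_0_less_iff divide_le_cancel)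
      have kJ: "k < J"
        using Jq_facts(4)[OF N0(1), of k] k(1) b1(2) by (simp add: J_def)
      have "X (real p / N) - X a1 \<le> K * (real p / N - a1)" "X b1 - X (real k / N) \<le> K * (b1 - real k / N)"
        using p k a a' a1 b1 q \<open>real p / N \<le> real k / N\<close> by (intro X_diff(2); simp)+
      moreover have "K * (real p / N - a1) \<le> K * (1 / N)" "K * (b1 - real k / N) \<le> K * (1 / N)"
        using p k K by (intro mult_left_mono; simp)+
      ultimately have "X b1 - X a1 - 2 * (K / N) \<le> X (real k / N) - X (real p / N)"
        by simp
      also have "\<dots> = (\<Sum>i\<in>{p..<k}. vs N i)"
        using vs_sum[OF pk] kJ Jq_facts(1)[OF N0(1)] by (simp add: J_def)
      also have "\<dots> = (\<Sum>i\<in>{p..<k}. if a1 \<le> real i / N \<and> real i / N \<le> b1 then vs N i else 0)"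
      proof (rule sum.cong)
        fix i assume "i \<in> {p..<k}"
        then have "real p / N \<le> real i / N" "real i / N \<le> real k / N"
          using N0(1) by (auto simp: divide_le_cancel)
        then show "vs N i = (if a1 \<le> real i / N \<and> real i / N \<le> b1 then vs N i else 0)"
          using p(1) k(1) by simp
      qed simp
      also have "\<dots> \<le> (\<Sum>i\<in>{j..<J}. if a1 \<le> real i / N \<and> real i / N \<le> b1 then vs N i else 0)"
        using jp kJ vs_bounds(1)[OF N0(1)] by (intro sum_mono2) auto
      finally have "c0 * d * (X b1 - X a1 - 2 * (K / N)) \<le> c0 * d * (\<Sum>i\<in>{j..<J}. if a1 \<le> real i / N \<and> real i / N \<le> b1 then vs N i else 0)"
        using c0 d by (intro mult_left_mono) auto
      then show ?thesis
        using 1 by linarith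
    qed
    finally show ?thesis
      by (simp add: G_def)
  qed
  have "eventually (\<lambda>N. - var_err N \<le> - (c0 * d * (X b1 - X a1 - 2 * (K / N))) + gap A B D' N) sequentially"
  proof -
    have h: "0 < (q - a) / 2" "0 < b1 - a1"
      using a b1 by auto
    show ?thesis
      using eventually_good eventually_inverse_le[OF h(1), of 1] eventually_inverse_le[OF h(2), of 2]
      by eventually_elim (rule claim)
  qed
  from r_eventually[OF this]
  have ev1: "eventually (\<lambda>n. 0 \<le> var_err (r n) - c0 * d * (X b1 - X a1 - 2 * (K / r n)) + gap A B D' (r n)) sequentially"
    by eventually_elim simp
  have "(\<lambda>n. var_err (r n) - c0 * d * (X b1 - X a1 - 2 * (K / r n)) + gap A B D' (r n)) \<longlonglongrightarrow> 0 - c0 * d * (X b1 - X a1 - 2 * 0) + 0"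
    by (intro tendsto_intros gap_tendsto r_limit[OF lims(1)] r_limit[OF lims(3)])
  from tendsto_lowerbound[OF this ev1] have "c0 * d * (X b1 - X a1) \<le> 0"
    by simp
  moreover have "0 < c0 * d * (X b1 - X a1)"
    using c0 d \<open>X a1 < X b1\<close> by simp
  ultimately show False
    by simp
qed

text \<open>For fixed \<open>x\<close>, use the first node at or above \<open>x\<close> on every
  grid. It converges to \<open>x\<close>, and since it lies to the right, \<open>1 - F x\<close>
  bounds the parameter deficit there for all \<open>N\<close>.\<close>

lemma avg2_limit:
  "eventually (\<lambda>x. 0 \<le> B - 4 / 3 * (1 - A) + 4 / 9 - T x * (D' + 4 / 3 * B) + 3 * S1 * T x * ((1 - F x) + T x)) (at_left q)"
  using eventually_near[OF zero_less_one]
proof eventually_elim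
  fix x assume x: "0 < x \<and> x < q \<and> 1 / 2 \<le> F x \<and> 1 - F x \<le> 1 \<and> near_const * T x \<le> 1 / 2"
  define \<tau> where "\<tau> N = X (real (Jq N) / N) - X (real (nat \<lceil>N * x\<rceil>) / N)" for N :: nat
  define a where "a N = Gm N (Jq N)" for N
  define b where "b N = Av 2 N (Jq N)" for N
  define c3 where "c3 N = Av 3 N (Jq N)" for N
  have node: "x \<le> real (nat \<lceil>N * x\<rceil>) / N" "real (nat \<lceil>N * x\<rceil>) / N \<le> x + 1 / N" if "0 < N" for N :: nat
    using ceiling_node[OF that, of x] x by auto
  have h: "0 < (q - x) / 2"
    using x by simp
  have near: "eventually (\<lambda>N. good N \<and> real (nat \<lceil>N * x\<rceil>) / N < q) sequentially"
    using eventually_good eventually_inverse_le[OF h, of 1]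
  proof eventually_elim
    case (elim N)
    then have "real (nat \<lceil>N * x\<rceil>) / N \<le> x + (q - x) / 2"
      using order_trans[OF node(2)[of N] add_left_mono] by (simp add: good_def)
    also have "\<dots> < q"
      using x by (simp add: field_simps)
    finally show ?case
      using elim by simp
  qed
  have ev: "eventually (\<lambda>N. \<bar>\<tau> N - T x\<bar> \<le> K / N \<and> 0 \<le> b N - 4 / 3 * (1 - a N) + 4 / 9 - \<tau> N * ((4 * b N - 6 * c3 N) + 4 / 3 * b N) + 3 * S1 * \<tau> N * (((1 - F x) + hs N) + \<tau> N)) sequentially"
    using near
  proof eventually_elim
    case (elim N)
    define y where "y = real (nat \<lceil>N * x\<rceil>) / N"
    have N: "0 < N"
      using elim by (simp add: good_def)
    have y: "x \<le> y" "y \<le> x + 1 / N" "y < q"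
      using node[OF N] elim by (auto simp: y_def)
    have Xy: "0 \<le> X y - X x" "X y - X x \<le> K * (y - x)"
      using X_diff[of x y] x y q by auto
    have "K * (y - x) \<le> K * (1 / N)"
      using K y by (intro mult_left_mono) auto
    with Xy top_gap[OF N] have 1: "\<bar>\<tau> N - T x\<bar> \<le> K / N"
      by (simp add: \<tau>_def T_def flip: y_def)
    have Fy: "F x \<le> F y"
      using x y q by (intro F_mono) auto
    have "T y \<le> T x"
      using Xy by (simp add: T_def)
    then have "near_const * T y \<le> near_const * T x"
      using near_const_bounds(1) by (intro mult_left_mono) auto
    then have g: "1 / 2 \<le> F y" "near_const * T y \<le> 1 / 2"
      using Fy x by auto
    have gn: "0 < N" "K / N \<le> 1" "nat \<lceil>N * x\<rceil> < Jq N" "near_const * (X (real (Jq N) / N) - X y) \<le> 1"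
      using good_near[of N "nat \<lceil>N * x\<rceil>"] elim y g by (auto simp flip: y_def)
    have e: "0 \<le> b N - 4 / 3 * (1 - a N) + 4 / 9 - \<tau> N * ((4 * b N - 6 * c3 N) + 4 / 3 * b N) + 3 * S1 * \<tau> N * (((1 - F y) + hs N) + \<tau> N)"
      and t: "0 \<le> \<tau> N"
      using expansion_N(2,3)[OF gn(1,2) less_imp_le[OF gn(3)]] gn(4) g(1) by (simp_all add: a_def b_def c3_def \<tau>_def flip: y_def)
    have "3 * S1 * \<tau> N * (((1 - F y) + hs N) + \<tau> N) \<le> 3 * S1 * \<tau> N * (((1 - F x) + hs N) + \<tau> N)"
      using Fy t S1_bounds(1) by (intro mult_left_mono) auto
    with e 1 show ?case
      by linarith
  qed
  have "(\<lambda>N. \<tau> N - T x) \<longlonglongrightarrow> 0"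
    by (rule Lim_null_comparison[OF _ lims(1)]) (use ev in \<open>auto elim: eventually_mono\<close>)
  then have \<tau>: "\<tau> \<longlonglongrightarrow> T x"
    by (rule LIM_zero_cancel)
  have "(\<lambda>n. b (r n) - 4 / 3 * (1 - a (r n)) + 4 / 9 - \<tau> (r n) * ((4 * b (r n) - 6 * c3 (r n)) + 4 / 3 * b (r n))
      + 3 * S1 * \<tau> (r n) * (((1 - F x) + hs (r n)) + \<tau> (r n)))
    \<longlonglongrightarrow> B - 4 / 3 * (1 - A) + 4 / 9 - T x * ((4 * B - 6 * C3) + 4 / 3 * B) + 3 * S1 * T x * (((1 - F x) + 0) + T x)"
    using lA lB lC unfolding a_def[symmetric] b_def[symmetric] c3_def[symmetric]
    by (intro tendsto_intros r_limit[OF \<tau>] r_limit[OF lims(2)])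
  from tendsto_lowerbound[OF this, of 0] r_eventually[OF ev]
  show "0 \<le> B - 4 / 3 * (1 - A) + 4 / 9 - T x * (D' + 4 / 3 * B) + 3 * S1 * T x * ((1 - F x) + T x)"
    by (simp add: D'_def eventually_conj_iff)
qed

lemma contradiction:
  assumes d2: "\<And>u. 0 \<le> u \<Longrightarrow> u \<le> 1 \<Longrightarrow> ((deriv ^^ 2) \<xi> has_real_derivative X3 u) (at u)"
    and X3: "\<And>u. 0 \<le> u \<Longrightarrow> u \<le> q \<Longrightarrow> X3 u \<le> X3 q" "0 \<le> X3 q"
    and X2: "1 < (deriv ^^ 2) \<xi> q" and key: "X3 q / 6 + 2 / 3 * sqrt ((deriv ^^ 2) \<xi> q) \<le> 1"
  shows False
proof -
  have top: "eventually (\<lambda>N. 0 < N \<and> K / real N \<le> 1) sequentially"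
    using eventually_good by eventually_elim (simp add: good_def)
  note top = r_eventually[OF top]
  show False
  proof (rule endgame[where A = A and B = B and C = C3 and S = S1 and q = q and ?X1.0 = X and ?X2.0 = "(deriv ^^ 2) \<xi>" and ?X3.0 = X3 and \<eta> = "\<lambda>x. 1 - F x", folded T_def D'_def])
    show "((\<lambda>x. 1 - F x) \<longlongrightarrow> 0) (at_left q)"
      using tendsto_diff[OF tendsto_const F_tendsto, of 1] by simp
    show "3 * t * B \<le> 2 * C3 + t ^ 3" if "0 \<le> t" for t
    proof (rule tendsto_le[OF _ _ _ eventually_mono[OF top]])
      show "(\<lambda>n. 3 * t * Av 2 (r n) (Jq (r n))) \<longlonglongrightarrow> 3 * t * B" "(\<lambda>n. 2 * Av 3 (r n) (Jq (r n)) + t ^ 3) \<longlonglongrightarrow> 2 * C3 + t ^ 3"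
        by (intro tendsto_intros lB lC)+
      show "3 * t * Av 2 (r n) (Jq (r n)) \<le> 2 * Av 3 (r n) (Jq (r n)) + t ^ 3" if "0 < r n \<and> K / real (r n) \<le> 1" for n
        using top_facts(7)[of "r n" t] that \<open>0 \<le> t\<close> by auto
    qed simp
    have "(\<lambda>n. Av 3 (r n) (Jq (r n)) - 4 / 3 * Av 2 (r n) (Jq (r n)) + 4 / 9 * (1 - Gm (r n) (Jq (r n)))) \<longlonglongrightarrow> C3 - 4 / 3 * B + 4 / 9 * (1 - A)"
      by (intro tendsto_intros lA lB lC)
    then show "0 \<le> C3 - 4 / 3 * B + 4 / 9 * (1 - A)"
      by (rule tendsto_lowerbound[OF _ eventually_mono[OF top top_facts(8)]]) auto
    show "\<not> eventually (\<lambda>x. A - B * T x + D' * (T x)\<^sup>2 / 2 - x + S1 * (e + T x) * (T x)\<^sup>2 < 0) (at_left q)" if "0 < e" for e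
      using sign_contradiction[of 1 e] that by auto
    show "\<not> eventually (\<lambda>x. 0 < A - B * T x + D' * (T x)\<^sup>2 / 2 - x - S1 * (e + T x) * (T x)\<^sup>2) (at_left q)" if "0 < e" for e
    proof
      assume "eventually (\<lambda>x. 0 < A - B * T x + D' * (T x)\<^sup>2 / 2 - x - S1 * (e + T x) * (T x)\<^sup>2) (at_left q)"
      then have "eventually (\<lambda>x. - 1 * (A - B * T x + D' * (T x)\<^sup>2 / 2 - x) + S1 * (e + T x) * (T x)\<^sup>2 < 0) (at_left q)"
        by eventually_elim simp
      then show False
        using sign_contradiction[of "- 1" e] that by blast
    qed
  qed (use q D c(2) d2 X3 X2 key S1_bounds(1) avg2_limit in auto)
qed

end

lemma (in parisi_minimizer) obtain_limit:
  obtains r A B C3 where "parisi_limit \<xi> \<mu> q K C1 C2 r A B C3"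
proof -
  \<comment> \<open>The shift ensures \<open>K / N \<le> 1\<close>, under which
    \<open>top_facts\<close> puts the three averages into the compact unit cube.\<close>
  define n0 where "n0 = nat \<lceil>K\<rceil> + 1"
  define f where "f n = (Gm (n + n0) (Jq (n + n0)), Av 2 (n + n0) (Jq (n + n0)), Av 3 (n + n0) (Jq (n + n0)))" for n
  have "compact ({0..1} \<times> {0..1} \<times> {0..1} :: (real \<times> real \<times> real) set)"
    by (intro compact_Times compact_Icc)
  moreover have "f n \<in> {0..1} \<times> {0..1} \<times> {0..1}" for n
  proof -
    have "K \<le> real n0"
      using real_nat_ceiling_ge[of K] by (simp add: n0_def)
    then have "0 < n + n0" "K / real (n + n0) \<le> 1"
      by (auto simp: n0_def divide_simps)
    from top_facts[OF this] show ?thesis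
      by (simp add: f_def)
  qed
  ultimately obtain l \<rho> where l: "l \<in> {0..1} \<times> {0..1} \<times> {0..1}" and \<rho>: "strict_mono \<rho>" and lim: "(f \<circ> \<rho>) \<longlonglongrightarrow> l"
    unfolding compact_def by metis
  obtain A B C3 where ABC: "l = (A, B, C3)"
    by (cases l) auto
  have "parisi_limit \<xi> \<mu> q K C1 C2 (\<lambda>n. \<rho> n + n0) A B C3"
  proof (intro parisi_limit.intro parisi_limit_axioms.intro parisi_minimizer_axioms)
    show "strict_mono (\<lambda>n. \<rho> n + n0)"
      using \<rho> by (simp add: strict_mono_def)
    show "(\<lambda>n. Gm (\<rho> n + n0) (Jq (\<rho> n + n0))) \<longlonglongrightarrow> A"
      using tendsto_fst[OF lim] by (simp add: ABC f_def o_def)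
    show "(\<lambda>n. Av 2 (\<rho> n + n0) (Jq (\<rho> n + n0))) \<longlonglongrightarrow> B"
      using tendsto_fst[OF tendsto_snd[OF lim]] by (simp add: ABC f_def o_def)
    show "(\<lambda>n. Av 3 (\<rho> n + n0) (Jq (\<rho> n + n0))) \<longlonglongrightarrow> C3"
      using tendsto_snd[OF tendsto_snd[OF lim]] by (simp add: ABC f_def o_def)
  qed (use l ABC in auto)
  then show thesis
    by (rule that)
qed

section \<open>The top of the support\<close>

text \<open>\<open>q\<close> is the infimum of the points where the distribution function equals 1.
  Continuity from above gives the value 1 at \<open>q\<close>, and the smaller values before
  \<open>q\<close> put \<open>q\<close> into the support, so the \<open>GREATEST\<close> in the
  theorem is attained.\<close>

lemma support_max:
  assumes \<mu>: "\<mu> \<in> prob_measures01"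
  obtains q where "0 \<le> q" "q \<le> 1" "measure \<mu> {0..q} = 1" "\<And>u. 0 \<le> u \<Longrightarrow> u < q \<Longrightarrow> measure \<mu> {0..u} < 1"
    "q \<in> measure_support \<mu>" "\<And>x. x \<in> measure_support \<mu> \<Longrightarrow> x \<le> q"
proof -
  interpret prob_space \<mu>
    by (rule prob_measures01D[OF \<mu>])
  note sp = prob_measures01D(2,3)[OF \<mu>]
  define G where "G = {u. 0 \<le> u \<and> u \<le> 1 \<and> measure \<mu> {0..u} = 1}"
  have "1 \<in> G"
    using cdf01_1[OF \<mu>] by (simp add: G_def)
  then have ne: "G \<noteq> {}" and bb: "bdd_below G"
    by (auto simp: G_def intro: bdd_belowI[of _ 0])
  define q where "q = Inf G"
  have q: "0 \<le> q" "q \<le> 1"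
    using cInf_greatest[OF ne, of 0] cInf_lower[OF \<open>1 \<in> G\<close> bb] by (auto simp: q_def G_def)
  have lt: "measure \<mu> {0..u} < 1" if "0 \<le> u" "u < q" for u
  proof -
    have "u \<notin> G"
      using cInf_lower[OF _ bb, of u] that by (auto simp: q_def)
    then show ?thesis
      using that q prob_le_1[of "{0..u}"] by (auto simp: G_def less_le)
  qed
  define S where "S n = {0..min 1 (q + 1 / real (Suc n))}" for n
  have S1: "measure \<mu> (S n) = 1" for n
  proof -
    obtain u where u: "u \<in> G" "u < q + 1 / real (Suc n)"
      using cInf_lessD[OF ne, of "q + 1 / real (Suc n)"] by (auto simp: q_def)
    have "measure \<mu> {0..u} \<le> measure \<mu> (S n)"
      unfolding S_def using u q by (intro cdf01_mono[OF \<mu>]) (auto simp: G_def)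
    then show ?thesis
      using u by (intro antisym prob_le_1) (auto simp: G_def)
  qed
  have "(\<lambda>n. measure \<mu> (S n)) \<longlonglongrightarrow> measure \<mu> (\<Inter>n. S n)"
  proof (rule finite_Lim_measure_decseq)
    show "range S \<subseteq> events"
      by (auto simp: S_def sp)
    show "decseq S"
    proof (rule antimonoI)
      fix m n :: nat assume "m \<le> n"
      then have "1 / real (Suc n) \<le> 1 / real (Suc m)"
        by (simp add: divide_simps)
      then show "S n \<subseteq> S m"
        by (auto simp: S_def)
    qed
  qed
  moreover have "(\<Inter>n. S n) = {0..q}"
  proof (intro equalityI subsetI)
    fix x assume "x \<in> (\<Inter>n. S n)"
    then have x: "0 \<le> x" "\<And>n. x \<le> q + 1 / real (Suc n)"
      by (auto simp: S_def)
    have "x \<le> q"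
    proof (rule ccontr)
      assume "\<not> x \<le> q"
      then obtain n where "1 / real (Suc n) < x - q"
        using nat_approx_posE[of "x - q"] by auto
      then show False
        using x(2)[of n] by simp
    qed
    then show "x \<in> {0..q}"
      using x by simp
  qed (use q in \<open>auto simp: S_def intro: order_trans\<close>)
  ultimately have one: "measure \<mu> {0..q} = 1"
    by (simp add: S1 LIMSEQ_const_iff)
  have "q \<in> measure_support \<mu>"
    unfolding measure_support_def
  proof (intro CollectI conjI allI impI)
    show "q \<in> space \<mu>"
      using q sp by simp
    fix U assume U: "open U \<and> q \<in> U"
    then obtain e where e: "0 < e" "ball q e \<subseteq> U"
      by (meson open_contains_ball)
    have ev: "U \<inter> space \<mu> \<in> events"
      using U by (auto simp: sp)
    show "0 < measure \<mu> (U \<inter> space \<mu>)"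
    proof (cases "q = 0")
      case True
      then have "{0..q} \<subseteq> U \<inter> space \<mu>"
        using U sp by auto
      from finite_measure_mono[OF this ev] one show ?thesis
        by simp
    next
      case False
      define u where "u = max 0 (q - e / 2)"
      have u: "0 \<le> u" "u < q" "q - e < u"
        using False q e by (auto simp: u_def)
      have "{u<..q} \<subseteq> U \<inter> space \<mu>"
        using e u q sp by (auto simp: subset_iff dist_real_def)
      from finite_measure_mono[OF this ev] show ?thesis
        using cdf01_diff[OF \<mu> u(1) less_imp_le[OF u(2)] q(2)] one lt[OF u(1,2)] by simp
    qed
  qed
  moreover have "x \<le> q" if x: "x \<in> measure_support \<mu>" for x
  proof (rule ccontr)
    assume "\<not> x \<le> q"
    then have "0 < measure \<mu> ({q<..} \<inter> space \<mu>)"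
      using x by (auto simp: measure_support_def)
    moreover have "{q<..} \<inter> space \<mu> = {q<..1}"
      using q sp by auto
    ultimately show False
      using cdf01_diff[OF \<mu> q(1,2)] cdf01_1[OF \<mu>] one by simp
  qed
  ultimately show thesis
    using that q one lt by blast
qed

lemma cdf01_left_limit:
  assumes \<mu>: "\<mu> \<in> prob_measures01" and q: "0 < q" "q \<le> 1" and one: "measure \<mu> {0..q} = 1" and null: "measure \<mu> {q} = 0"
  shows "((\<lambda>u. measure \<mu> {0..u}) \<longlongrightarrow> 1) (at_left q)"
proof -
  interpret prob_space \<mu>
    by (rule prob_measures01D[OF \<mu>])
  note sp = prob_measures01D(2,3)[OF \<mu>]
  \<comment> \<open>The factor \<open>1 - 1 / real (Suc n)\<close> keeps the right end nonnegative
    and strictly below \<open>q\<close> for every \<open>n\<close>.\<close>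
  define S where "S n = {0..q * (1 - 1 / real (Suc n))}" for n
  have le: "0 \<le> q * (1 - 1 / real (Suc n))" "q * (1 - 1 / real (Suc n)) < q" for n
    using q by (simp_all add: mult_less_cancel_left2)
  have "(\<lambda>n. measure \<mu> (S n)) \<longlonglongrightarrow> measure \<mu> (\<Union>n. S n)"
  proof (rule finite_Lim_measure_incseq)
    show "range S \<subseteq> events"
    proof
      fix A assume "A \<in> range S"
      then obtain n where "A = S n"
        by auto
      moreover define x where "x = q * (1 - 1 / real (Suc n))"
      moreover have "0 \<le> x" "x \<le> 1"
        using le[of n] q(2) unfolding x_def by linarith+
      ultimately show "A \<in> events"
        by (auto simp: S_def sp)
    qed
    show "incseq S"
    proof (rule monoI)
      fix m n :: nat assume "m \<le> n"
      then have "1 / real (Suc n) \<le> 1 / real (Suc m)"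
        by (simp add: divide_simps)
      then have "q * (1 - 1 / real (Suc m)) \<le> q * (1 - 1 / real (Suc n))"
        using q by (intro mult_left_mono) auto
      then show "S m \<subseteq> S n"
        by (auto simp: S_def)
    qed
  qed
  moreover have "(\<Union>n. S n) = {0..<q}"
  proof (intro equalityI subsetI)
    fix x assume x: "x \<in> {0..<q}"
    then obtain n where "1 / real (Suc n) < 1 - x / q"
      using nat_approx_posE[of "1 - x / q"] q by auto
    then have "q * (x / q) \<le> q * (1 - 1 / real (Suc n))"
      using q by (intro mult_left_mono) auto
    then show "x \<in> (\<Union>n. S n)"
      using x q by (auto simp: S_def intro!: exI[of _ n])
  qed (use le in \<open>auto simp: S_def intro: le_less_trans\<close>)
  moreover have "measure \<mu> {0..<q} = 1"
  proof -
    have "{0..q} = {0..<q} \<union> {q}"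
      using q by auto
    moreover have "measure \<mu> ({0..<q} \<union> {q}) = measure \<mu> {0..<q} + measure \<mu> {q}"
      by (rule finite_measure_Union) (use q in \<open>auto simp: sp\<close>)
    ultimately show ?thesis
      using one null by simp
  qed
  ultimately have lim: "(\<lambda>n. measure \<mu> (S n)) \<longlonglongrightarrow> 1"
    by simp
  show ?thesis
  proof (rule order_tendstoI)
    fix a :: real assume "a < 1"
    then obtain n where n: "a < measure \<mu> (S n)"
      using eventually_happens[OF order_tendstoD(1)[OF lim]] by auto
    show "eventually (\<lambda>u. a < measure \<mu> {0..u}) (at_left q)"
      using eventually_at_left_real[OF le(2)[of n]]
    proof eventually_elim
      case (elim u)
      then have "measure \<mu> (S n) \<le> measure \<mu> {0..u}"
        unfolding S_def using le[of n] q by (intro cdf01_mono[OF \<mu>]) auto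
      then show ?case
        using n by simp
    qed
  next
    fix a :: real assume "1 < a"
    then show "eventually (\<lambda>u. measure \<mu> {0..u} < a) (at_left q)"
      by (intro always_eventually allI le_less_trans[OF cdf01_le_1[OF \<mu>]])
  qed
qed

theorem theorem4:
  fixes \<beta> :: "nat \<Rightarrow> real" and \<xi> :: "real \<Rightarrow> real" and \<mu>\<^sub>P :: "real measure" and q\<^sub>M :: real
  assumes "summable (\<lambda>p. 2 ^ (p + 2) * (\<beta> (p + 2))\<^sup>2)"
    and "\<xi> = mixture \<beta>"
    and "1 / sqrt 2 < \<beta> 2" and "\<beta> 2 \<le> 3 / (2 * sqrt 2)"
    and "(deriv ^^ 3) \<xi> 1 / 6 + 2 / 3 * sqrt ((deriv ^^ 2) \<xi> 1) \<le> 1"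
    and "parisi_measure \<xi> \<mu>\<^sub>P"
    and "q\<^sub>M = (GREATEST q. q \<in> measure_support \<mu>\<^sub>P)"
  shows "measure \<mu>\<^sub>P {q\<^sub>M} > 0"
proof (rule ccontr)
  assume "\<not> measure \<mu>\<^sub>P {q\<^sub>M} > 0"
  then have null: "measure \<mu>\<^sub>P {q\<^sub>M} = 0"
    using measure_nonneg[of \<mu>\<^sub>P "{q\<^sub>M}"] by linarith
  have \<mu>: "\<mu>\<^sub>P \<in> prob_measures01"
    using assms(6) by (simp add: parisi_measure_def is_arg_min_def)
  obtain q where q: "0 \<le> q" "q \<le> 1" "measure \<mu>\<^sub>P {0..q} = 1" and lt: "\<And>u. 0 \<le> u \<Longrightarrow> u < q \<Longrightarrow> measure \<mu>\<^sub>P {0..u} < 1"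
    and supp: "q \<in> measure_support \<mu>\<^sub>P" "\<And>x. x \<in> measure_support \<mu>\<^sub>P \<Longrightarrow> x \<le> q"
    using support_max[OF \<mu>] by metis
  have qM: "q\<^sub>M = q"
    unfolding assms(7) using supp by (rule Greatest_equality)
  \<comment> \<open>For \<open>q = 0\<close> the null set \<open>{q}\<close> would be
    \<open>{0..q}\<close>, which has mass 1.\<close>
  have q0: "0 < q"
    using null q unfolding qM by (cases "q = 0") auto
  obtain c where c: "entire2 c" "c 0 = 2 * (\<beta> 2)\<^sup>2"
    and d1: "\<And>u. \<bar>u\<bar> < 2 \<Longrightarrow> (deriv \<xi> has_real_derivative (deriv ^^ 2) \<xi> u) (at u)"
    and e2: "\<And>u. \<bar>u\<bar> < 2 \<Longrightarrow> (deriv ^^ 2) \<xi> u = power_sum c u"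
    and e3: "\<And>u. \<bar>u\<bar> < 2 \<Longrightarrow> (deriv ^^ 3) \<xi> u = power_sum (diffs c) u"
    using mixture_facts[OF assms(1,2)] by metis
  have d2: "((deriv ^^ 2) \<xi> has_real_derivative (deriv ^^ 3) \<xi> u) (at u)" if "\<bar>u\<bar> < 2" for u
  proof (rule DERIV_cong_ev[OF refl _ refl, THEN iffD2])
    show "(power_sum c has_real_derivative (deriv ^^ 3) \<xi> u) (at u)"
      using power_sum_DERIV[OF c(1) that] e3[OF that] by simp
    have "eventually (\<lambda>w. w \<in> {-2<..<2}) (nhds u)"
      using that by (intro eventually_nhds_in_open) auto
    then show "eventually (\<lambda>w. (deriv ^^ 2) \<xi> w = power_sum c w) (nhds u)"
      by eventually_elim (auto intro: e2)
  qed
  \<comment> \<open>The lower bound on \<open>\<beta> 2\<close> enters as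
    \<open>\<xi>''(0) > 1\<close>; monotonicity extends this to the whole unit interval.\<close>
  have "power_sum c 0 = 2 * (\<beta> 2)\<^sup>2"
    by (simp add: power_sum_def c(2))
  moreover have "(1 / sqrt 2)\<^sup>2 < (\<beta> 2)\<^sup>2"
    using assms(3) by (intro power_strict_mono) auto
  ultimately have c0: "1 < power_sum c 0"
    by (simp add: power_divide)
  have X2: "1 < (deriv ^^ 2) \<xi> u" if "0 \<le> u" "u \<le> 1" for u
    using power_sum_mono(2)[OF c(1), of 0 u] that c0 e2[of u] by auto
  have mono2: "(deriv ^^ 2) \<xi> u \<le> (deriv ^^ 2) \<xi> w" and mono3: "(deriv ^^ 3) \<xi> u \<le> (deriv ^^ 3) \<xi> w" and nonneg3: "0 \<le> (deriv ^^ 3) \<xi> u"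
    if "0 \<le> u" "u \<le> w" "w \<le> 1" for u w
    using power_sum_mono[OF c(1), of u w] power_sum_mono[OF entire2_diffs[OF c(1)], of u w] that e2[of u] e2[of w] e3[of u] e3[of w] by auto
  define K where "K = (deriv ^^ 2) \<xi> 1"
  have K: "0 < K"
    using X2[of 1] by (simp add: K_def)
  have clk: "clock (deriv \<xi>) K"
    unfolding clock_def
  proof (intro allI impI)
    fix a b :: real assume ab: "0 \<le> a" "a \<le> b" "b \<le> 1"
    show "0 \<le> deriv \<xi> b - deriv \<xi> a \<and> deriv \<xi> b - deriv \<xi> a \<le> K * (b - a)"
    proof (cases "a = b")
      case False
      then obtain z where z: "a < z" "z < b" "deriv \<xi> b - deriv \<xi> a = (b - a) * (deriv ^^ 2) \<xi> z"
        using MVT2[of a b "deriv \<xi>" "(deriv ^^ 2) \<xi>"] d1 ab by force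
      have "1 < (deriv ^^ 2) \<xi> z" "(deriv ^^ 2) \<xi> z \<le> K"
        using X2[of z] mono2[of z 1] z ab by (auto simp: K_def)
      then show ?thesis
        unfolding z(3) using ab mult_left_mono[of "(deriv ^^ 2) \<xi> z" K "b - a"] by (auto simp: mult.commute)
    qed simp
  qed
  obtain C1 C2 where C: "sech_expansion_const C1" "step_expansion_const C2"
    using exists_sech_expansion_const exists_step_expansion_const by auto
  interpret parisi_minimizer \<xi> \<mu>\<^sub>P q K C1 C2
  proof
    show "isCont ((deriv ^^ 2) \<xi>) u" if "0 \<le> u" "u \<le> 1" for u
      using d2[of u] that by (intro DERIV_isCont) auto
    show "0 < (deriv ^^ 2) \<xi> u" if "0 \<le> u" "u \<le> 1" for u
      using X2[OF that] by simp
    show "((\<lambda>u. measure \<mu>\<^sub>P {0..u}) \<longlongrightarrow> 1) (at_left q)"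
      using cdf01_left_limit[OF \<mu> q0 q(2,3)] null unfolding qM by simp
  qed (use clk d1 mono2 K q q0 lt C assms(6) in \<open>auto simp: K_def\<close>)
  obtain r A B C3 where "parisi_limit \<xi> \<mu>\<^sub>P q K C1 C2 r A B C3"
    by (rule obtain_limit)
  then show False
  proof (rule parisi_limit.contradiction)
    \<comment> \<open>Both terms are nondecreasing in the point, so the hypothesis at 1 passes down
      to \<open>q\<close>, where \<open>endgame\<close> uses it.\<close>
    have "(deriv ^^ 3) \<xi> q / 6 + 2 / 3 * sqrt ((deriv ^^ 2) \<xi> q) \<le> (deriv ^^ 3) \<xi> 1 / 6 + 2 / 3 * sqrt ((deriv ^^ 2) \<xi> 1)"
      using mono2[of q 1] mono3[of q 1] q by (intro add_mono divide_right_mono mult_left_mono real_sqrt_le_mono) auto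
    then show "(deriv ^^ 3) \<xi> q / 6 + 2 / 3 * sqrt ((deriv ^^ 2) \<xi> q) \<le> 1"
      using assms(5) by linarith
  qed (use q d2 mono3 nonneg3[of q q] X2 in auto)
qed

end
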